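(* Let $(\mathbf d_n)_{n\in\mathbb N}$ be a sequence of bi-degree sequences $\mathbf d_n=((d_1^-,d_1^+),\dots,(d_n^-,d_n^+))$ for which there exist constants $\eta,C>0$ and $K\ge 2$ such that for all $n$: (i) $\min_{v\in[n]}d_v^+\ge 2$; (ii) $\max_{v\in[n]}d_v^+\le K$; (iii) $\sum_{v\in[n]}(d_v^-)^{2+\eta}\le Cn$. Let $P$ be the transition matrix of the simple random walk on the directed configuration model $G_n$ with bi-degree sequence $\mathbf d_n$, let $\pi$ be its stationary distribution, and let $T_{\rm ent}=\frac{\log n}{\mathrm H}$ with $\mathrm H=\sum_{v\in[n]}\frac{d_v^-}{m}\log d_v^+$. Then for every constant $\rho\ge 0$ with $\rho\ne 1$, $$\max_{x\in[n]}\Big|\,\|P^{\rho T_{\rm ent}}(x,\cdot)-\pi\|_{\rm TV}-\mathbf 1(\rho<1)\Big|\longrightarrow 0\quad\text{in probability as }n\to\infty.$$ In particular, for every $\varepsilon\in(0,1)$, with high probability $T_{\rm mix}(\varepsilon)=(1+o(1))T_{\rm ent}$, i.e. $T_{\rm mix}(\varepsilon)/T_{\rm ent}\to1$ in probability.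
   Context: Directed configuration model: given a bi-degree sequence of nonnegative integers with $m:=\sum_{v\in[n]}d_v^+=\sum_{v\in[n]}d_v^-$, attach $d_v^-$ heads and $d_v^+$ tails to each vertex $v\in[n]=\{1,\dots,n\}$, match the $m$ tails to the $m$ heads by a uniformly random bijection, and add a directed edge $(u,v)$ for each tail of $u$ matched to a head of $v$. The result is the random directed multigraph $G=G_n$. The simple random walk on $G$ has transition matrix $P(y,x)=m(y,x)/d_y^+$, where $m(y,x)$ is the multiplicity of the directed edge $(y,x)$. "With high probability" means with probability tending to $1$ as $n\to\infty$. Under the stated assumptions, with high probability $P$ has a unique stationary distribution, denoted $\pi$ (on the complementary event, of probability $o(1)$, $\pi$ is any stationary distribution). Non-integer times are rounded down: $P^t:=P^{\lfloor t\rfloor}$. Total variation: $\|\mu-\nu\|_{\rm TV}=\max_{A\subset[n]}|\mu(A)-\nu(A)|$. Mixing time: $T_{\rm mix}(\varepsilon)=\inf\{t\in\mathbb N:\max_{v\in[n]}\|P^t(v,\cdot)-\pi\|_{\rm TV}<\varepsilon\}$. *)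

theory Defs
  imports
    "HOL-Probability.Probability"
    "Graph_Theory.Digraph"
begin

section \<open>The directed configuration model\<close>

text \<open>The tails attached to \<open>v\<close> are the pairs \<open>(v, i)\<close> with \<open>i < d v\<close>, for \<open>d\<close> the out-degrees;
  likewise for the heads, with \<open>d\<close> the in-degrees.\<close>

definition half_edges :: "nat \<Rightarrow> (nat \<Rightarrow> nat) \<Rightarrow> (nat \<times> nat) set" where
  "half_edges n d = (SIGMA v:{1..n}. {..<d v})"

text \<open>Extensionality makes each bijection from tails to heads appear exactly once.\<close>

definition matchings ::
  "nat \<Rightarrow> (nat \<Rightarrow> nat) \<Rightarrow> (nat \<Rightarrow> nat) \<Rightarrow> (nat \<times> nat \<Rightarrow> nat \<times> nat) set" where
  "matchings n din dout =
     {\<sigma> \<in> extensional (half_edges n dout).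
        bij_betw \<sigma> (half_edges n dout) (half_edges n din)}"

text \<open>The arcs of the multigraph are labelled by the tails.\<close>

definition matching_graph ::
  "nat \<Rightarrow> (nat \<Rightarrow> nat) \<Rightarrow> (nat \<times> nat \<Rightarrow> nat \<times> nat) \<Rightarrow> (nat, nat \<times> nat) pre_digraph" where
  "matching_graph n dout \<sigma> =
     \<lparr>verts = {1..n}, arcs = half_edges n dout, tail = fst, head = (\<lambda>e. fst (\<sigma> e))\<rparr>"

definition config_model ::
  "nat \<Rightarrow> (nat \<Rightarrow> nat) \<Rightarrow> (nat \<Rightarrow> nat) \<Rightarrow> (nat, nat \<times> nat) pre_digraph pmf" where
  "config_model n din dout = map_pmf (matching_graph n dout) (pmf_of_set (matchings n din dout))"

section \<open>Simple random walk on a directed multigraph\<close>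

definition multiplicity_arc :: "('a, 'b) pre_digraph \<Rightarrow> 'a \<Rightarrow> 'a \<Rightarrow> nat" where
  "multiplicity_arc G y x = card {e \<in> arcs G. tail G e = y \<and> head G e = x}"

definition srw :: "('a, 'b) pre_digraph \<Rightarrow> 'a \<Rightarrow> 'a \<Rightarrow> real" where
  "srw G y x = real (multiplicity_arc G y x) / real (out_degree G y)"

text \<open>In the configuration model the out-degree of the multigraph is the prescribed one.\<close>

lemma out_degree_matching_graph:
  assumes "v \<in> {1..n}"
  shows "out_degree (matching_graph n dout \<sigma>) v = dout v"
proof -
  have "out_arcs (matching_graph n dout \<sigma>) v = {v} \<times> {..<dout v}"
    using assms by (auto simp: out_arcs_def matching_graph_def half_edges_def)
  then show ?thesis
    by (simp add: out_degree_def card_cartesian_product)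
qed

primrec srw_pow :: "('a, 'b) pre_digraph \<Rightarrow> nat \<Rightarrow> 'a \<Rightarrow> 'a \<Rightarrow> real" where
  "srw_pow G 0 x y = of_bool (x = y)"
| "srw_pow G (Suc t) x y = (\<Sum>z\<in>verts G. srw_pow G t x z * srw G z y)"

definition stationary :: "('a, 'b) pre_digraph \<Rightarrow> ('a \<Rightarrow> real) \<Rightarrow> bool" where
  "stationary G \<mu> \<longleftrightarrow>
     (\<forall>x\<in>verts G. \<mu> x \<ge> 0) \<and> (\<Sum>x\<in>verts G. \<mu> x) = 1 \<and>
     (\<forall>x\<in>verts G. (\<Sum>y\<in>verts G. \<mu> y * srw G y x) = \<mu> x)"

definition tv_dist :: "'a set \<Rightarrow> ('a \<Rightarrow> real) \<Rightarrow> ('a \<Rightarrow> real) \<Rightarrow> real" where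
  "tv_dist V \<mu> \<nu> = Max ((\<lambda>A. \<bar>sum \<mu> A - sum \<nu> A\<bar>) ` Pow V)"

text \<open>The infimum is taken in \<^typ>\<open>enat\<close>, so that it is \<open>\<infinity>\<close> when the walk never gets
  \<open>\<epsilon>\<close>-close to \<open>\<mu>\<close>, for instance when it is irreducible and periodic.\<close>

definition mixing_time :: "('a, 'b) pre_digraph \<Rightarrow> ('a \<Rightarrow> real) \<Rightarrow> real \<Rightarrow> enat" where
  "mixing_time G \<mu> \<epsilon> =
     Inf (enat ` {t. Max ((\<lambda>v. tv_dist (verts G) (srw_pow G t v) \<mu>) ` verts G) < \<epsilon>})"

definition entropy_rate :: "nat \<Rightarrow> (nat \<Rightarrow> nat) \<Rightarrow> (nat \<Rightarrow> nat) \<Rightarrow> real" where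
  "entropy_rate n din dout =
     (\<Sum>v=1..n. real (din v) / real (\<Sum>u=1..n. din u) * ln (real (dout v)))"

definition entropic_time :: "nat \<Rightarrow> (nat \<Rightarrow> nat) \<Rightarrow> (nat \<Rightarrow> nat) \<Rightarrow> real" where
  "entropic_time n din dout = ln (real n) / entropy_rate n din dout"

text \<open>Convergence in probability to a real constant of random variables that live on different
  probability spaces and may take infinite values.\<close>

definition tendsto_in_prob ::
  "(nat \<Rightarrow> 'a pmf) \<Rightarrow> (nat \<Rightarrow> 'a \<Rightarrow> ereal) \<Rightarrow> real \<Rightarrow> bool" where
  "tendsto_in_prob p X c \<longleftrightarrow>
     (\<forall>\<delta>>0. (\<lambda>n. measure_pmf.prob (p n) {\<omega>. \<bar>X n \<omega> - ereal c\<bar> > ereal \<delta>}) \<longlonglongrightarrow> 0)"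

end

theory Submission
  imports Defs "HOL-Real_Asymp.Real_Asymp"
begin

text \<open>
  Reveal the matching step by step. Starting from a vertex \<open>z\<close> whose neighbourhood of radius
  \<open>s \<approx> 3 log log n\<close> is a tree, repeatedly reveal tails that the walk reaches within
  \<open>t\<^sub>0 \<approx> (1 - 2\<delta>) log n / H\<close> steps along a path of probability at least \<open>\<theta> = n\<^sup>-\<^sup>1\<^sup>+\<^sup>\<delta>\<close>. At most
  \<open>t\<^sub>0 / \<theta> = o(n)\<close> tails are revealed, and the in-degree-biased vertices met along a path make the
  logarithm of its probability drift at speed \<open>H\<close>; an exponential supermartingale built from the
  quenched second moment of the deviation shows that, with probability \<open>1 - o(1/n)\<close>, almost all of
  the mass of the walk ends at depth \<open>t\<^sub>0\<close> on unrevealed tails of weight at most \<open>n\<^sup>-\<^sup>1\<^sup>+\<^sup>3\<^sup>\<delta>\<close>. At time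
  \<open>t\<^sub>0\<close> the walk is thus on few vertices, which gives the lower bound on the distance. The matching
  of these tails is still random, and their masses are so small that, by concentration, the law of
  the walk after \<open>h \<approx> 4\<delta> log n\<close> further steps agrees in total variation with that of a walk started
  uniformly on the fixed set of vertices \<open>{1..b}\<close>, \<open>b \<approx> n\<^sup>1\<^sup>-\<^sup>\<delta>\<^sup>/\<^sup>8\<close>. This reference law does not depend on \<open>z\<close>,
  so it is close to \<open>\<pi>\<close>. From an arbitrary starting point the walk is at a tree-like vertex after
  \<open>s\<close> steps except with probability \<open>2\<^sup>-\<^sup>s\<close>, since with high probability no vertex has two children
  that are not tree-like.
\<close>

section \<open>Uniform matchings conditioned on a partial matching\<close>

text \<open>The precision o(1/n) is dictated by the union bound over the starting vertices
  \<open>z\<close>, and a start next to a short cycle cannot be excluded at that precision. Hence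
  the tree-like ball: it caps every later weight at (log n)^-3, so that one reveal hardly moves the
  potential and the failure probability drops to exp(- c (log n)^(3/2)). The remaining starts are
  saved by the two-collision estimate for siblings, about n^(2a - 2) with a = 1 / (2 + \<eta>);
  summed over n vertices it tends to 0 because 2a < 1, which is where more than two moments of the
  in-degrees enter.

  \<pi> depends on the whole matching and cannot be handled during an exploration. The reference law
  can, but its good properties hold only with probability 1 - o(1); they are therefore carried along
  as an event on the final matching and never conditioned on.

  In the last comparison the squared error is about n times the largest tail mass n^(-1 + 3\<delta>)
  times the largest transition probability 2^-h of the walk on trees. The length h is chosen to make
  2^-h at most n^(-4\<delta>), which leaves n^(-\<delta>).\<close>

locale matching_space =
  fixes T :: "'a set" and H :: "'b set"
  assumes finT: "finite T" and finH: "finite H" and card_eq: "card T = card H"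
begin

definition ext :: "('a \<rightharpoonup> 'b) \<Rightarrow> ('a \<Rightarrow> 'b) set" where
  "ext \<rho> = {\<sigma> \<in> extensional T. bij_betw \<sigma> T H \<and> (\<forall>e\<in>dom \<rho>. \<rho> e = Some (\<sigma> e))}"

definition pm :: "('a \<rightharpoonup> 'b) \<Rightarrow> bool" where
  "pm \<rho> \<longleftrightarrow> dom \<rho> \<subseteq> T \<and> ran \<rho> \<subseteq> H \<and> inj_on \<rho> (dom \<rho>)"

text \<open>Conditional expectation of a uniform matching given the revealed pairs \<open>\<rho>\<close>; meaningful only if
  \<open>pm \<rho>\<close>, as it is 0 when nothing extends \<open>\<rho>\<close>.\<close>

definition cexp :: "('a \<rightharpoonup> 'b) \<Rightarrow> (('a \<Rightarrow> 'b) \<Rightarrow> real) \<Rightarrow> real" where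
  "cexp \<rho> f = (\<Sum>\<sigma>\<in>ext \<rho>. f \<sigma>) / card (ext \<rho>)"

lemma finite_ext: "finite (ext \<rho>)"
proof (rule finite_subset)
  show "ext \<rho> \<subseteq> T \<rightarrow>\<^sub>E H"
    by (auto simp: ext_def PiE_def bij_betw_def)
  show "finite (T \<rightarrow>\<^sub>E H)"
    using finT finH by (simp add: finite_PiE)
qed

lemma ext_antimono: "\<rho> \<subseteq>\<^sub>m \<rho>' \<Longrightarrow> ext \<rho>' \<subseteq> ext \<rho>"
  unfolding ext_def map_le_def by (auto simp: dom_def)

lemma ext_D: "\<sigma> \<in> ext \<rho> \<Longrightarrow> \<rho> e = Some x \<Longrightarrow> \<sigma> e = x"
  unfolding ext_def by force

lemma pm_empty: "pm Map.empty"
  by (simp add: pm_def)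

lemma pm_finite: "pm \<rho> \<Longrightarrow> finite (dom \<rho>)"
  using finT finite_subset unfolding pm_def by blast

lemma pm_upd: "pm \<rho> \<Longrightarrow> e \<in> T - dom \<rho> \<Longrightarrow> x \<in> H - ran \<rho> \<Longrightarrow> pm (\<rho>(e \<mapsto> x))"
  unfolding pm_def inj_on_def ran_def by (auto simp: dom_def split: if_splits)

lemma card_ran: "pm \<rho> \<Longrightarrow> card (ran \<rho>) = card (dom \<rho>)"
proof -
  assume p: "pm \<rho>"
  have "inj_on (\<lambda>e. the (\<rho> e)) (dom \<rho>)"
  proof (rule inj_onI)
    fix a b assume a: "a \<in> dom \<rho>" "b \<in> dom \<rho>" "the (\<rho> a) = the (\<rho> b)"
    then have "\<rho> a = \<rho> b" by (metis domIff option.expand)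
    then show "a = b" using a p by (auto simp: pm_def inj_on_def)
  qed
  moreover have "(\<lambda>e. the (\<rho> e)) ` dom \<rho> = ran \<rho>" by (force simp: ran_def image_def dom_def)
  ultimately have "bij_betw (\<lambda>e. the (\<rho> e)) (dom \<rho>) (ran \<rho>)" by (simp add: bij_betw_def)
  then show ?thesis by (simp add: bij_betw_same_card)
qed

lemma card_rem: "pm \<rho> \<Longrightarrow> card (H - ran \<rho>) = card (T - dom \<rho>)"
  using card_ran[of \<rho>] finT finH card_eq pm_finite[of \<rho>] finite_subset[of "ran \<rho>" H]
  by (simp add: card_Diff_subset pm_def)

lemma card_rem_upd:
  "pm \<rho> \<Longrightarrow> e \<in> T - dom \<rho> \<Longrightarrow> card (T - dom (\<rho>(e \<mapsto> x))) = card (T - dom \<rho>) - 1"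
proof -
  assume "e \<in> T - dom \<rho>"
  moreover have "T - dom (\<rho>(e \<mapsto> x)) = (T - dom \<rho>) - {e}" by auto
  ultimately show ?thesis using finT by simp
qed

lemma ext_step:
  assumes "pm \<rho>" "e \<in> T - dom \<rho>"
  shows "ext \<rho> = (\<Union>x\<in>H - ran \<rho>. ext (\<rho>(e \<mapsto> x)))"
proof (intro set_eqI iffI)
  fix \<sigma> assume s: "\<sigma> \<in> ext \<rho>"
  have b: "bij_betw \<sigma> T H" using s by (simp add: ext_def)
  have "\<sigma> e \<in> H" using b assms by (auto simp: bij_betw_def)
  moreover have "\<sigma> e \<notin> ran \<rho>"
  proof
    assume "\<sigma> e \<in> ran \<rho>"
    then obtain a where a: "\<rho> a = Some (\<sigma> e)" by (auto simp: ran_def)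
    then have "\<sigma> a = \<sigma> e" using s ext_D by fastforce
    moreover have "a \<in> T" using a assms(1) by (auto simp: pm_def)
    ultimately have "a = e" using b assms by (auto simp: bij_betw_def inj_on_def)
    then show False using a assms by auto
  qed
  moreover have "\<sigma> \<in> ext (\<rho>(e \<mapsto> \<sigma> e))" using s by (auto simp: ext_def)
  ultimately show "\<sigma> \<in> (\<Union>x\<in>H - ran \<rho>. ext (\<rho>(e \<mapsto> x)))" by blast
next
  fix \<sigma> assume "\<sigma> \<in> (\<Union>x\<in>H - ran \<rho>. ext (\<rho>(e \<mapsto> x)))"
  then obtain x where "\<sigma> \<in> ext (\<rho>(e \<mapsto> x))" by auto
  moreover have "\<rho> \<subseteq>\<^sub>m \<rho>(e \<mapsto> x)" using assms by (auto simp: map_le_def)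
  ultimately show "\<sigma> \<in> ext \<rho>" using ext_antimono by blast
qed

lemma ext_step_disj:
  "x \<noteq> x' \<Longrightarrow> ext (\<rho>(e \<mapsto> x)) \<inter> ext (\<rho>(e \<mapsto> x')) = {}"
proof -
  assume "x \<noteq> x'"
  moreover have "\<sigma> e = x" if "\<sigma> \<in> ext (\<rho>(e \<mapsto> x))" for \<sigma> x
    using that ext_D by fastforce
  ultimately show ?thesis by blast
qed

lemma sum_ext_step:
  assumes "pm \<rho>" "e \<in> T - dom \<rho>"
  shows "(\<Sum>\<sigma>\<in>ext \<rho>. g \<sigma>) = (\<Sum>x\<in>H - ran \<rho>. \<Sum>\<sigma>\<in>ext (\<rho>(e \<mapsto> x)). g \<sigma>)"
  unfolding ext_step[OF assms]
  by (rule sum.UNION_disjoint) (use finH finite_ext ext_step_disj in auto)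

text \<open>The number of extensions depends only on how many tails are unrevealed. Hence the next
  tail is matched to each free head with equal probability, and \<open>cexp_step\<close> is a plain
  average.\<close>

lemma card_ext: "pm \<rho> \<Longrightarrow> card (ext \<rho>) = fact (card (T - dom \<rho>))"
proof (induction "card (T - dom \<rho>)" arbitrary: \<rho>)
  case 0
  then have d: "dom \<rho> = T" using finT by (auto simp: pm_def)
  have "H - ran \<rho> = {}" using card_rem[OF 0(2)] 0(1) finH by simp
  then have r: "ran \<rho> = H" using 0(2) by (auto simp: pm_def)
  have "ext \<rho> = {\<lambda>e\<in>T. the (\<rho> e)}"
  proof (intro set_eqI iffI)
    fix \<sigma> assume "\<sigma> \<in> ext \<rho>"
    then have "\<sigma> = (\<lambda>e\<in>T. the (\<rho> e))" using d
      by (auto simp: ext_def extensional_def fun_eq_iff restrict_def)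
    then show "\<sigma> \<in> {\<lambda>e\<in>T. the (\<rho> e)}" by simp
  next
    fix \<sigma> assume "\<sigma> \<in> {\<lambda>e\<in>T. the (\<rho> e)}"
    then have s: "\<sigma> = (\<lambda>e\<in>T. the (\<rho> e))" by simp
    have "inj_on \<sigma> T" unfolding s
    proof (rule inj_onI)
      fix x y assume xy: "x \<in> T" "y \<in> T" "(\<lambda>e\<in>T. the (\<rho> e)) x = (\<lambda>e\<in>T. the (\<rho> e)) y"
      then have "\<rho> x = \<rho> y" using d by (metis domIff option.expand restrict_apply')
      then show "x = y" using xy d 0(2) by (auto simp: pm_def inj_on_def)
    qed
    moreover have "\<sigma> ` T = H"
    proof -
      have "\<sigma> ` T = (\<lambda>e. the (\<rho> e)) ` dom \<rho>" by (auto simp: s d)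
      also have "\<dots> = ran \<rho>" by (force simp: ran_def image_def dom_def)
      finally show ?thesis using r by simp
    qed
    ultimately have "bij_betw \<sigma> T H" by (simp add: bij_betw_def)
    moreover have "\<rho> e = Some (\<sigma> e)" if "e \<in> dom \<rho>" for e
      using that d by (auto simp: s)
    ultimately show "\<sigma> \<in> ext \<rho>" by (simp add: ext_def s)
  qed
  then show ?case using 0 by simp
next
  case (Suc k)
  then obtain e where e: "e \<in> T - dom \<rho>" by (metis card_eq_0_iff ex_in_conv nat.distinct(1))
  have c: "card (ext (\<rho>(e \<mapsto> x))) = fact k" if x: "x \<in> H - ran \<rho>" for x
  proof -
    have k: "k = card (T - dom (\<rho>(e \<mapsto> x)))" using card_rem_upd[OF Suc(3) e] Suc(2) by simp
    show ?thesis using Suc(1)[OF k pm_upd[OF Suc(3) e x]] k by simp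
  qed
  have "card (ext \<rho>) = (\<Sum>x\<in>H - ran \<rho>. card (ext (\<rho>(e \<mapsto> x))))"
    using sum_ext_step[OF Suc(3) e, of "\<lambda>_. 1::nat"] by simp
  also have "\<dots> = card (T - dom \<rho>) * fact k"
    using c card_rem[OF Suc(3)] by simp
  finally show ?case using Suc(2)[symmetric] by simp
qed

lemma ext_nonempty: "pm \<rho> \<Longrightarrow> ext \<rho> \<noteq> {}"
  using card_ext[of \<rho>] by (metis card.empty fact_nonzero)

lemma cexp_step:
  assumes "pm \<rho>" "e \<in> T - dom \<rho>"
  shows "cexp \<rho> f = (\<Sum>x\<in>H - ran \<rho>. cexp (\<rho>(e \<mapsto> x)) f) / card (T - dom \<rho>)"
proof -
  define N where "N = card (T - dom \<rho>)"
  have N: "N > 0" using assms finT unfolding N_def by (simp add: card_gt_0_iff) blast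
  have c: "card (ext (\<rho>(e \<mapsto> x))) = fact (N - 1)" if x: "x \<in> H - ran \<rho>" for x
    using card_ext[OF pm_upd[OF assms x]] card_rem_upd[OF assms] unfolding N_def by simp
  have "cexp \<rho> f = (\<Sum>x\<in>H - ran \<rho>. \<Sum>\<sigma>\<in>ext (\<rho>(e \<mapsto> x)). f \<sigma>) / fact N"
    unfolding cexp_def sum_ext_step[OF assms] card_ext[OF assms(1)] N_def by simp
  also have "\<dots> = (\<Sum>x\<in>H - ran \<rho>. cexp (\<rho>(e \<mapsto> x)) f * fact (N - 1)) / fact N"
    by (intro arg_cong2[where f="(/)"] sum.cong refl) (simp add: cexp_def c)
  also have "\<dots> = (\<Sum>x\<in>H - ran \<rho>. cexp (\<rho>(e \<mapsto> x)) f) * fact (N - 1) / fact N"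
    by (simp add: sum_distrib_right)
  also have "(fact N :: real) = N * fact (N - 1)" using N by (simp add: fact_reduce)
  finally show ?thesis using N unfolding N_def by (simp del: fun_upd_apply)
qed

lemma cexp_mono: "(\<And>\<sigma>. \<sigma> \<in> ext \<rho> \<Longrightarrow> f \<sigma> \<le> g \<sigma>) \<Longrightarrow> cexp \<rho> f \<le> cexp \<rho> g"
  unfolding cexp_def by (intro divide_right_mono sum_mono) auto

lemma cexp_cong: "(\<And>\<sigma>. \<sigma> \<in> ext \<rho> \<Longrightarrow> f \<sigma> = g \<sigma>) \<Longrightarrow> cexp \<rho> f = cexp \<rho> g"
  unfolding cexp_def by (metis (mono_tags, lifting) sum.cong)

lemma cexp_const: "pm \<rho> \<Longrightarrow> cexp \<rho> (\<lambda>_. c) = c"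
  using ext_nonempty[of \<rho>] finite_ext[of \<rho>] unfolding cexp_def by simp

lemma cexp_le_const: "pm \<rho> \<Longrightarrow> (\<And>\<sigma>. \<sigma> \<in> ext \<rho> \<Longrightarrow> f \<sigma> \<le> c) \<Longrightarrow> cexp \<rho> f \<le> c"
  using cexp_mono[of \<rho> f "\<lambda>_. c"] cexp_const[of \<rho> c] by simp

lemma cexp_add: "cexp \<rho> (\<lambda>\<sigma>. f \<sigma> + g \<sigma>) = cexp \<rho> f + cexp \<rho> g"
  unfolding cexp_def by (simp add: sum.distrib add_divide_distrib)

lemma cexp_cmult: "cexp \<rho> (\<lambda>\<sigma>. c * f \<sigma>) = c * cexp \<rho> f"
  unfolding cexp_def by (simp add: sum_distrib_left)

lemma cexp_sum: "cexp \<rho> (\<lambda>\<sigma>. \<Sum>i\<in>I. f i \<sigma>) = (\<Sum>i\<in>I. cexp \<rho> (f i))"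
  unfolding cexp_def by (subst sum.swap) (simp add: sum_divide_distrib)

text \<open>The form in which conditional expectations are used: the probabilistic inductions below
  reveal one tail and average a bound \<open>\<phi>\<close> over the free heads.\<close>

lemma cexp_le_step:
  fixes c :: real
  assumes "pm \<rho>" "e \<in> T - dom \<rho>"
    and "\<And>x. x \<in> H - ran \<rho> \<Longrightarrow> cexp (\<rho>(e \<mapsto> x)) f \<le> \<phi> x"
    and "(\<Sum>x\<in>H - ran \<rho>. \<phi> x) \<le> c * card (T - dom \<rho>)"
  shows "cexp \<rho> f \<le> c"
proof -
  have N: "card (T - dom \<rho>) > 0" using assms finT by (simp add: card_gt_0_iff) blast
  have "cexp \<rho> f \<le> (\<Sum>x\<in>H - ran \<rho>. \<phi> x) / card (T - dom \<rho>)"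
    unfolding cexp_step[OF assms(1,2)] by (intro divide_right_mono sum_mono assms) auto
  also have "\<dots> \<le> c" using assms(4) N by (simp add: divide_le_eq)
  finally show ?thesis .
qed

text \<open>The tower property. The final comparison uses it to reveal everything but the boundary
  tails at once.\<close>

lemma cexp_reveal_le:
  assumes "pm \<rho>" "D \<subseteq> T"
    and "\<And>\<rho>'. pm \<rho>' \<Longrightarrow> \<rho> \<subseteq>\<^sub>m \<rho>' \<Longrightarrow> dom \<rho>' = dom \<rho> \<union> D \<Longrightarrow> cexp \<rho>' f \<le> c"
  shows "cexp \<rho> f \<le> c"
  using assms
proof (induction "card (D - dom \<rho>)" arbitrary: \<rho>)
  case 0
  then have "D \<subseteq> dom \<rho>" using finite_subset[OF 0(3) finT] by simp
  then show ?case using 0 by (simp add: sup.absorb1)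
next
  case (Suc k)
  note IH = Suc(1) and k = Suc(2) and pm = Suc(3) and D = Suc(4) and hyp = Suc(5)
  obtain e where e: "e \<in> D - dom \<rho>" using k by (metis card_eq_0_iff ex_in_conv nat.distinct(1))
  have e': "e \<in> T - dom \<rho>" using e D by blast
  have dom_eq: "D - dom (\<rho>(e \<mapsto> x)) = (D - dom \<rho>) - {e}" for x by auto
  have "cexp (\<rho>(e \<mapsto> x)) f \<le> c" if x: "x \<in> H - ran \<rho>" for x
  proof (rule IH[OF _ pm_upd[OF pm e' x] D])
    show "k = card (D - dom (\<rho>(e \<mapsto> x)))"
      unfolding dom_eq using e k by (simp add: card_Diff_singleton flip: k)
    fix \<rho>' assume r: "pm \<rho>'" "\<rho>(e \<mapsto> x) \<subseteq>\<^sub>m \<rho>'" "dom \<rho>' = dom (\<rho>(e \<mapsto> x)) \<union> D"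
    have "\<rho> \<subseteq>\<^sub>m \<rho>(e \<mapsto> x)" using e by (auto simp: map_le_def)
    then show "cexp \<rho>' f \<le> c" using r e by (intro hyp) (auto intro: map_le_trans)
  qed
  then show ?case
    using cexp_le_step[OF pm e', of f "\<lambda>_. c" c] card_rem[OF pm] by (simp del: fun_upd_apply)
qed

end

section \<open>Concentration for uniform matchings\<close>

lemma exp_le_quadratic:
  fixes x :: real
  assumes "x \<le> 1"
  shows "exp x \<le> 1 + x + x\<^sup>2"
proof (cases "x \<ge> 0")
  case True
  then show ?thesis using exp_bound[of x] assms by simp
next
  case False
  define u where "u = - x"
  have u: "u > 0" using False by (simp add: u_def)
  have "1 + u + u\<^sup>2 / 2 \<le> exp u" using u by (intro exp_lower_Taylor_quadratic) simp
  moreover have pos: "1 + u + u\<^sup>2 / 2 > 0" using u by (simp add: add_pos_nonneg)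
  ultimately have "exp x \<le> 1 / (1 + u + u\<^sup>2 / 2)"
    unfolding u_def exp_minus by (simp add: divide_simps exp_minus mult.commute)
  also have "\<dots> \<le> 1 - u + u\<^sup>2"
  proof -
    have "(1 - u + u\<^sup>2) * (1 + u + u\<^sup>2 / 2) = 1 + (u\<^sup>2 + u ^ 3 + u ^ 4) / 2"
      by (simp add: field_simps power2_eq_square power3_eq_cube power4_eq_xxxx)
    also have "\<dots> \<ge> 1" using u by simp
    finally show ?thesis using pos by (simp add: divide_le_eq)
  qed
  finally show ?thesis by (simp add: u_def)
qed

text \<open>In the average of a centred variable the linear term cancels, which leaves a Gaussian
  factor with no restriction on the size of \<open>x\<close>.\<close>

lemma exp_le_add_exp_square: "exp x \<le> x + exp (x\<^sup>2)" for x :: real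
proof (cases "x \<le> 1")
  case True
  have "1 + x\<^sup>2 \<le> exp (x\<^sup>2)" by simp
  then show ?thesis using exp_le_quadratic[OF True] by linarith
next
  case False
  then have "x \<le> x\<^sup>2" by (simp add: power2_eq_square)
  then have "exp x \<le> exp (x\<^sup>2)" by simp
  then show ?thesis using False by linarith
qed

lemma average_exp_centered_le:
  fixes a :: "'a \<Rightarrow> real"
  assumes "finite X" "X \<noteq> {}" and "\<And>x y. x \<in> X \<Longrightarrow> y \<in> X \<Longrightarrow> \<bar>a x - a y\<bar> \<le> c"
  shows "(\<Sum>x\<in>X. exp (l * (a x - (\<Sum>y\<in>X. a y) / card X))) \<le> exp (l\<^sup>2 * c\<^sup>2) * card X"
proof -
  define m where "m = (\<Sum>y\<in>X. a y) / card X"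
  have N: "real (card X) > 0" using assms by (simp add: card_gt_0_iff)
  have dev: "\<bar>a x - m\<bar> \<le> c" if "x \<in> X" for x
  proof -
    have "card X * (a x - m) = (\<Sum>y\<in>X. a x - a y)"
      using N by (simp add: m_def sum_subtractf right_diff_distrib)
    then have "card X * \<bar>a x - m\<bar> = \<bar>\<Sum>y\<in>X. a x - a y\<bar>"
      by (metis N abs_mult abs_of_pos)
    also have "\<dots> \<le> (\<Sum>y\<in>X. c)"
      by (rule order_trans[OF sum_abs]) (intro sum_mono assms that)
    finally show ?thesis using N by simp
  qed
  have "exp (l * (a x - m)) \<le> l * (a x - m) + exp (l\<^sup>2 * c\<^sup>2)" if "x \<in> X" for x
  proof -
    have "(a x - m)\<^sup>2 \<le> c\<^sup>2" using dev[OF that] by (simp add: abs_le_square_iff[symmetric])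
    then have "(l * (a x - m))\<^sup>2 \<le> l\<^sup>2 * c\<^sup>2" by (simp add: power_mult_distrib mult_left_mono)
    then show ?thesis using exp_le_add_exp_square[of "l * (a x - m)"]
      by (smt (verit) exp_le_cancel_iff)
  qed
  then have "(\<Sum>x\<in>X. exp (l * (a x - m))) \<le> (\<Sum>x\<in>X. l * (a x - m) + exp (l\<^sup>2 * c\<^sup>2))"
    by (rule sum_mono)
  also have "\<dots> = l * (\<Sum>x\<in>X. a x - m) + exp (l\<^sup>2 * c\<^sup>2) * card X"
    by (simp add: sum.distrib sum_distrib_left)
  also have "(\<Sum>x\<in>X. a x - m) = 0" using N by (simp add: sum_subtractf m_def)
  finally show ?thesis by (simp add: m_def)
qed

section \<open>Concentration by switching two heads\<close>

context matching_space
begin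

text \<open>Switching: the transposition of two free heads maps the matchings that send
  \<open>e\<close> to \<open>x\<close> bijectively onto those that send \<open>e\<close> to
  \<open>x'\<close>. The conditional laws after two outcomes of one tail are thus coupled so that
  they differ in two tails only.\<close>

definition swap_heads :: "'b \<Rightarrow> 'b \<Rightarrow> ('a \<Rightarrow> 'b) \<Rightarrow> 'a \<Rightarrow> 'b" where
  "swap_heads x x' \<sigma> = (\<lambda>e\<in>T. Transposition.transpose x x' (\<sigma> e))"

lemma ext_inj: "\<sigma> \<in> ext \<rho> \<Longrightarrow> inj_on \<sigma> T"
  by (auto simp: ext_def bij_betw_def)

lemma swap_heads_ext:
  assumes "pm \<rho>" "e \<in> T - dom \<rho>" "x \<in> H - ran \<rho>" "x' \<in> H - ran \<rho>" "\<sigma> \<in> ext (\<rho>(e \<mapsto> x))"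
  shows "swap_heads x x' \<sigma> \<in> ext (\<rho>(e \<mapsto> x'))"
proof -
  have b: "bij_betw \<sigma> T H" using assms(5) by (simp add: ext_def)
  have "bij_betw (Transposition.transpose x x' \<circ> \<sigma>) T H"
  proof (rule bij_betw_trans[OF b])
    show "bij_betw (Transposition.transpose x x') H H"
      using assms(3,4) by (intro bij_betw_byWitness[where f'="Transposition.transpose x x'"])
        (auto simp: Transposition.transpose_def)
  qed
  then have "bij_betw (swap_heads x x' \<sigma>) T H"
    unfolding swap_heads_def by (subst bij_betw_cong[of _ _ "Transposition.transpose x x' \<circ> \<sigma>"]) auto
  moreover have "(\<rho>(e \<mapsto> x')) a = Some (swap_heads x x' \<sigma> a)" if a: "a \<in> dom (\<rho>(e \<mapsto> x'))" for a
  proof (cases "a = e")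
    case True
    have "\<sigma> e = x" using assms(5) ext_D by fastforce
    then show ?thesis using True assms(2) by (simp add: swap_heads_def Transposition.transpose_def)
  next
    case False
    then obtain y where y: "\<rho> a = Some y" using a by auto
    then have "\<sigma> a = y" using assms(5) False ext_D[of \<sigma> "\<rho>(e \<mapsto> x)" a y] by simp
    moreover have "y \<noteq> x" "y \<noteq> x'" using y assms(3,4) by (auto simp: ran_def)
    moreover have "a \<in> T" using y assms(1) by (auto simp: pm_def)
    ultimately show ?thesis using False y by (simp add: swap_heads_def Transposition.transpose_def)
  qed
  ultimately show ?thesis by (simp add: ext_def swap_heads_def)
qed

lemma swap_heads_twice:
  "\<sigma> \<in> extensional T \<Longrightarrow> swap_heads x' x (swap_heads x x' \<sigma>) = \<sigma>"
  by (auto simp: swap_heads_def fun_eq_iff Transposition.transpose_def extensional_def)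

lemma cexp_swap_diff:
  assumes "pm \<rho>" "e \<in> T - dom \<rho>" "x \<in> H - ran \<rho>" "x' \<in> H - ran \<rho>"
    and "\<And>\<sigma>. \<sigma> \<in> ext \<rho> \<Longrightarrow> \<bar>g (swap_heads x x' \<sigma>) - g \<sigma>\<bar> \<le> c"
  shows "\<bar>cexp (\<rho>(e \<mapsto> x)) g - cexp (\<rho>(e \<mapsto> x')) g\<bar> \<le> c"
proof -
  let ?A = "ext (\<rho>(e \<mapsto> x))" and ?B = "ext (\<rho>(e \<mapsto> x'))"
  have ext0: "\<sigma> \<in> extensional T" if "\<sigma> \<in> ext \<rho>'" for \<sigma> \<rho>'
    using that by (simp add: ext_def)
  have bij: "bij_betw (swap_heads x x') ?A ?B"
    by (rule bij_betw_byWitness[where f'="swap_heads x' x"])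
      (use swap_heads_ext[OF assms(1-4)] swap_heads_ext[OF assms(1,2,4,3)] swap_heads_twice ext0
       in blast)+
  have sub: "?A \<subseteq> ext \<rho>"
    using assms(2) by (intro ext_antimono) (auto simp: map_le_def)
  have c: "card ?A = card ?B" using bij by (rule bij_betw_same_card)
  have ne: "card ?A > 0" using ext_nonempty[OF pm_upd[OF assms(1-3)]] finite_ext by (simp add: card_gt_0_iff)
  have "cexp (\<rho>(e \<mapsto> x')) g = (\<Sum>\<sigma>\<in>?A. g (swap_heads x x' \<sigma>)) / card ?A"
    unfolding cexp_def c sum.reindex_bij_betw[OF bij] ..
  then have "cexp (\<rho>(e \<mapsto> x')) g - cexp (\<rho>(e \<mapsto> x)) g = (\<Sum>\<sigma>\<in>?A. g (swap_heads x x' \<sigma>) - g \<sigma>) / card ?A"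
    unfolding cexp_def by (simp add: sum_subtractf diff_divide_distrib)
  moreover have "\<bar>\<Sum>\<sigma>\<in>?A. g (swap_heads x x' \<sigma>) - g \<sigma>\<bar> \<le> (\<Sum>\<sigma>\<in>?A. c)"
    using sub by (intro order_trans[OF sum_abs] sum_mono assms(5)) auto
  ultimately have "\<bar>cexp (\<rho>(e \<mapsto> x')) g - cexp (\<rho>(e \<mapsto> x)) g\<bar> \<le> c"
    using ne by (simp add: divide_le_eq mult.commute)
  then show ?thesis by linarith
qed

text \<open>The Azuma-Hoeffding argument for the Doob martingale that reveals the tails one at a
  time. By switching, two outcomes of one tail change the conditional mean by at most
  \<open>c\<close>, so each tail contributes a factor
  \<open>exp (l\<^sup>2 * c\<^sup>2)\<close>.\<close>

lemma cexp_exp_deviation_le: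
  assumes "pm \<rho>"
    and "\<And>\<sigma> x x'. \<sigma> \<in> ext \<rho> \<Longrightarrow> x \<in> H - ran \<rho> \<Longrightarrow> x' \<in> H - ran \<rho> \<Longrightarrow>
           \<bar>g (swap_heads x x' \<sigma>) - g \<sigma>\<bar> \<le> c"
  shows "cexp \<rho> (\<lambda>\<sigma>. exp (l * (g \<sigma> - cexp \<rho> g))) \<le> exp (l\<^sup>2 * c\<^sup>2 * card (T - dom \<rho>))"
  using assms
proof (induction "card (T - dom \<rho>)" arbitrary: \<rho>)
  case 0
  have "card (ext \<rho>) = 1" using card_ext[OF 0(2)] 0(1) by simp
  then obtain \<tau> where "ext \<rho> = {\<tau>}" by (metis card_1_singletonE)
  then show ?case by (simp add: cexp_def)
next
  case (Suc k)
  note IH = Suc(1) and k = Suc(2) and pm = Suc(3) and D = Suc(4)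
  obtain e where e: "e \<in> T - dom \<rho>" using k by (metis card_eq_0_iff ex_in_conv nat.distinct(1))
  let ?N = "real (card (T - dom \<rho>))"
  let ?X = "H - ran \<rho>"
  define a where "a = (\<lambda>x. cexp (\<rho>(e \<mapsto> x)) g)"
  have cX: "card ?X = card (T - dom \<rho>)" by (rule card_rem[OF pm])
  have Xne: "?X \<noteq> {}" using cX k by (metis card.empty nat.distinct(1))
  have mean: "cexp \<rho> g = (\<Sum>x\<in>?X. a x) / card ?X"
    unfolding cexp_step[OF pm e] a_def cX ..
  have sub: "ext (\<rho>(e \<mapsto> x)) \<subseteq> ext \<rho>" for x
    using e by (intro ext_antimono) (auto simp: map_le_def)
  have ran: "ran (\<rho>(e \<mapsto> x)) = insert x (ran \<rho>)" for x
    using e by (intro ran_map_upd) (auto simp: domIff)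
  have IHx: "cexp (\<rho>(e \<mapsto> x)) (\<lambda>\<sigma>. exp (l * (g \<sigma> - cexp \<rho> g)))
      \<le> exp (l * (a x - cexp \<rho> g)) * exp (l\<^sup>2 * c\<^sup>2 * k)" if x: "x \<in> ?X" for x
  proof -
    have ck: "k = card (T - dom (\<rho>(e \<mapsto> x)))" using card_rem_upd[OF pm e] k by simp
    have "cexp (\<rho>(e \<mapsto> x)) (\<lambda>\<sigma>. exp (l * (g \<sigma> - a x))) \<le> exp (l\<^sup>2 * c\<^sup>2 * k)"
      unfolding a_def using IH[OF ck pm_upd[OF pm e x]] D sub ran ck by (metis DiffE DiffI insert_iff subsetD)
    moreover have "exp (l * (g \<sigma> - cexp \<rho> g)) = exp (l * (a x - cexp \<rho> g)) * exp (l * (g \<sigma> - a x))" for \<sigma>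
      by (simp add: exp_add[symmetric] algebra_simps)
    ultimately show ?thesis by (simp add: cexp_cmult)
  qed
  show ?case
  proof (rule cexp_le_step[OF pm e IHx])
    have "(\<Sum>x\<in>?X. exp (l * (a x - cexp \<rho> g)) * exp (l\<^sup>2 * c\<^sup>2 * k))
       = (\<Sum>x\<in>?X. exp (l * (a x - cexp \<rho> g))) * exp (l\<^sup>2 * c\<^sup>2 * k)"
      by (simp add: sum_distrib_right)
    also have "\<dots> \<le> (exp (l\<^sup>2 * c\<^sup>2) * card ?X) * exp (l\<^sup>2 * c\<^sup>2 * k)"
      unfolding mean
    proof (intro mult_right_mono average_exp_centered_le)
      fix x y assume "x \<in> ?X" "y \<in> ?X"
      then show "\<bar>a x - a y\<bar> \<le> c" unfolding a_def by (intro cexp_swap_diff[OF pm e] D)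
    qed (use finH Xne in auto)
    also have "\<dots> = exp (l\<^sup>2 * c\<^sup>2 * card (T - dom \<rho>)) * card (T - dom \<rho>)"
      unfolding cX k[symmetric] by (simp add: exp_add[symmetric] algebra_simps)
    finally show "(\<Sum>x\<in>?X. exp (l * (a x - cexp \<rho> g)) * exp (l\<^sup>2 * c\<^sup>2 * k))
      \<le> exp (l\<^sup>2 * c\<^sup>2 * card (T - dom \<rho>)) * card (T - dom \<rho>)" .
  qed
qed

lemma cexp_tail_le:
  assumes "pm \<rho>" and c: "c > 0" and \<epsilon>: "\<epsilon> > 0"
    and "\<And>\<sigma> x x'. \<sigma> \<in> ext \<rho> \<Longrightarrow> x \<in> H - ran \<rho> \<Longrightarrow> x' \<in> H - ran \<rho> \<Longrightarrow>
           \<bar>g (swap_heads x x' \<sigma>) - g \<sigma>\<bar> \<le> c"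
    and N: "real (card (T - dom \<rho>)) \<le> N" "N > 0"
  shows "cexp \<rho> (\<lambda>\<sigma>. of_bool (g \<sigma> > cexp \<rho> g + \<epsilon>)) \<le> exp (- \<epsilon>\<^sup>2 / (4 * c\<^sup>2 * N))"
proof -
  \<comment> \<open>The minimiser of \<open>- l * \<epsilon> + l\<^sup>2 * c\<^sup>2 * N\<close>, as
    in the Chernoff bound.\<close>
  define l where "l = \<epsilon> / (2 * c\<^sup>2 * N)"
  have l: "l > 0" using c \<epsilon> N by (simp add: l_def)
  have "cexp \<rho> (\<lambda>\<sigma>. of_bool (g \<sigma> > cexp \<rho> g + \<epsilon>))
     \<le> cexp \<rho> (\<lambda>\<sigma>. exp (- l * \<epsilon>) * exp (l * (g \<sigma> - cexp \<rho> g)))"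
  proof (rule cexp_mono)
    fix \<sigma>
    have "1 \<le> exp (- l * \<epsilon>) * exp (l * (g \<sigma> - cexp \<rho> g))" if "g \<sigma> > cexp \<rho> g + \<epsilon>"
    proof -
      have "0 \<le> l * (g \<sigma> - cexp \<rho> g - \<epsilon>)" using that l by simp
      then show ?thesis by (simp add: exp_add[symmetric] algebra_simps)
    qed
    then show "of_bool (g \<sigma> > cexp \<rho> g + \<epsilon>) \<le> exp (- l * \<epsilon>) * exp (l * (g \<sigma> - cexp \<rho> g))" by simp
  qed
  also have "\<dots> \<le> exp (- l * \<epsilon>) * exp (l\<^sup>2 * c\<^sup>2 * card (T - dom \<rho>))"
    unfolding cexp_cmult by (intro mult_left_mono cexp_exp_deviation_le assms) auto
  also have "\<dots> \<le> exp (- l * \<epsilon>) * exp (l\<^sup>2 * c\<^sup>2 * N)"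
    using N by (intro mult_left_mono) (auto intro!: mult_left_mono)
  also have "\<dots> = exp (- \<epsilon>\<^sup>2 / (4 * c\<^sup>2 * N))"
    using c N unfolding exp_add[symmetric] by (simp add: l_def field_simps power2_eq_square)
  finally show ?thesis .
qed

section \<open>Second moments for sampling without replacement\<close>

lemma cexp_single:
  assumes "pm \<rho>" "e \<in> T - dom \<rho>"
  shows "cexp \<rho> (\<lambda>\<sigma>. R (\<sigma> e)) = (\<Sum>x\<in>H - ran \<rho>. R x) / card (T - dom \<rho>)"
proof -
  have "cexp (\<rho>(e \<mapsto> x)) (\<lambda>\<sigma>. R (\<sigma> e)) = R x" if "x \<in> H - ran \<rho>" for x
  proof -
    have "cexp (\<rho>(e \<mapsto> x)) (\<lambda>\<sigma>. R (\<sigma> e)) = cexp (\<rho>(e \<mapsto> x)) (\<lambda>\<sigma>. R x)"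
      by (rule cexp_cong) (use ext_D in fastforce)
    then show ?thesis using cexp_const[OF pm_upd[OF assms that]] by simp
  qed
  then show ?thesis unfolding cexp_step[OF assms] by simp
qed

text \<open>Once \<open>e\<close> has used the head \<open>x\<close>, the values left for
  \<open>e'\<close> sum to \<open>- R x\<close>: draws without replacement are negatively
  correlated.\<close>

lemma cexp_pair:
  assumes "pm \<rho>" "e \<in> T - dom \<rho>" "e' \<in> T - dom \<rho>" "e \<noteq> e'" and z: "(\<Sum>x\<in>H - ran \<rho>. R x) = 0"
  shows "cexp \<rho> (\<lambda>\<sigma>. R (\<sigma> e) * R (\<sigma> e'))
       = - (\<Sum>x\<in>H - ran \<rho>. (R x)\<^sup>2) / (real (card (T - dom \<rho>)) * (real (card (T - dom \<rho>)) - 1))"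
proof -
  have N1: "card (T - dom \<rho>) \<ge> 1" using assms(2) finT by (simp add: Suc_le_eq card_gt_0_iff) blast
  have "cexp (\<rho>(e \<mapsto> x)) (\<lambda>\<sigma>. R (\<sigma> e) * R (\<sigma> e')) = - (R x)\<^sup>2 / (real (card (T - dom \<rho>)) - 1)"
    if x: "x \<in> H - ran \<rho>" for x
  proof -
    have e': "e' \<in> T - dom (\<rho>(e \<mapsto> x))" using assms by auto
    have "cexp (\<rho>(e \<mapsto> x)) (\<lambda>\<sigma>. R (\<sigma> e) * R (\<sigma> e')) = cexp (\<rho>(e \<mapsto> x)) (\<lambda>\<sigma>. R x * R (\<sigma> e'))"
      by (rule cexp_cong) (use ext_D in fastforce)
    also have "\<dots> = R x * ((\<Sum>y\<in>H - ran (\<rho>(e \<mapsto> x)). R y) / card (T - dom (\<rho>(e \<mapsto> x))))"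
      unfolding cexp_cmult cexp_single[OF pm_upd[OF assms(1,2) x] e'] ..
    also have "H - ran (\<rho>(e \<mapsto> x)) = (H - ran \<rho>) - {x}"
      using assms(2) by (auto simp: ran_map_upd domIff)
    also have "(\<Sum>y\<in>(H - ran \<rho>) - {x}. R y) = - R x"
      using x finH z by (simp add: sum_diff1)
    also have "real (card (T - dom (\<rho>(e \<mapsto> x)))) = real (card (T - dom \<rho>)) - 1"
      using card_rem_upd[OF assms(1,2)] N1 by (simp add: of_nat_diff)
    finally show ?thesis by (simp add: power2_eq_square del: fun_upd_apply)
  qed
  then show ?thesis unfolding cexp_step[OF assms(1,2)]
    by (simp add: sum_negf sum_divide_distrib[symmetric] mult.commute del: fun_upd_apply)
qed

text \<open>By the negative correlation, the off-diagonal terms form a nonpositive multiple of the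
  squared total of \<open>f\<close>, up to a correction on the diagonal. That correction is at most
  the diagonal itself, whence the factor 2.\<close>

lemma cexp_variance_le:
  assumes pm: "pm \<rho>" and z: "(\<Sum>x\<in>H - ran \<rho>. R x) = 0"
  shows "cexp \<rho> (\<lambda>\<sigma>. (\<Sum>e\<in>T - dom \<rho>. f e * R (\<sigma> e))\<^sup>2)
       \<le> 2 * (\<Sum>e\<in>T - dom \<rho>. (f e)\<^sup>2) * ((\<Sum>x\<in>H - ran \<rho>. (R x)\<^sup>2) / card (T - dom \<rho>))"
proof -
  have diag: "(\<Sum>e\<in>S. \<Sum>e'\<in>S. f e * f e' * A + (if e = e' then (f e)\<^sup>2 * B else 0))
      = (\<Sum>e\<in>S. f e)\<^sup>2 * A + (\<Sum>e\<in>S. (f e)\<^sup>2) * B" if "finite S" for S A B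
  proof -
    have "(\<Sum>e'\<in>S. if e = e' then (f e)\<^sup>2 * B else 0) = (f e)\<^sup>2 * B" if "e \<in> S" for e
      using that \<open>finite S\<close> by simp
    moreover have "(\<Sum>e\<in>S. f e)\<^sup>2 * A = (\<Sum>e\<in>S. \<Sum>e'\<in>S. f e * f e' * A)"
      unfolding power2_eq_square sum_product by (simp only: sum_distrib_right)
    ultimately show ?thesis by (simp add: sum.distrib sum_distrib_right)
  qed
  let ?S = "T - dom \<rho>"
  let ?N = "real (card ?S)"
  define r where "r = (\<Sum>x\<in>H - ran \<rho>. (R x)\<^sup>2)"
  define F where "F = (\<Sum>e\<in>?S. (f e)\<^sup>2)"
  have r0: "r \<ge> 0" "F \<ge> 0" by (auto simp: r_def F_def sum_nonneg)
  have fin: "finite ?S" using finT by simp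
  have "cexp \<rho> (\<lambda>\<sigma>. (\<Sum>e\<in>?S. f e * R (\<sigma> e))\<^sup>2)
      = cexp \<rho> (\<lambda>\<sigma>. \<Sum>e\<in>?S. \<Sum>e'\<in>?S. f e * f e' * (R (\<sigma> e) * R (\<sigma> e')))"
    by (intro cexp_cong) (simp add: power2_eq_square sum_product algebra_simps)
  also have "\<dots> = (\<Sum>e\<in>?S. \<Sum>e'\<in>?S. f e * f e' * cexp \<rho> (\<lambda>\<sigma>. R (\<sigma> e) * R (\<sigma> e')))"
    by (simp add: cexp_sum cexp_cmult)
  also have "\<dots> = (\<Sum>e\<in>?S. \<Sum>e'\<in>?S. f e * f e' * (if e = e' then r / ?N else - r / (?N * (?N - 1))))"
  proof (intro sum.cong refl arg_cong2[where f="(*)"])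
    fix e e' assume e: "e \<in> ?S" "e' \<in> ?S"
    show "cexp \<rho> (\<lambda>\<sigma>. R (\<sigma> e) * R (\<sigma> e')) = (if e = e' then r / ?N else - r / (?N * (?N - 1)))"
    proof (cases "e = e'")
      case True
      then show ?thesis using cexp_single[OF pm e(1), of "\<lambda>x. R x * R x"]
        by (simp add: r_def power2_eq_square)
    next
      case False
      then show ?thesis using cexp_pair[OF pm e False z] by (simp add: r_def)
    qed
  qed
  also have "\<dots> = (\<Sum>e\<in>?S. \<Sum>e'\<in>?S. f e * f e' * (- r / (?N * (?N - 1)))
                  + (if e = e' then (f e)\<^sup>2 * (r / ?N + r / (?N * (?N - 1))) else 0))"
    by (intro sum.cong refl) (simp add: power2_eq_square algebra_simps)
  also have "\<dots> = (\<Sum>e\<in>?S. f e)\<^sup>2 * (- r / (?N * (?N - 1))) + F * (r / ?N + r / (?N * (?N - 1)))"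
    unfolding F_def by (rule diag[OF fin])
  finally have eq: "cexp \<rho> (\<lambda>\<sigma>. (\<Sum>e\<in>?S. f e * R (\<sigma> e))\<^sup>2)
      = (\<Sum>e\<in>?S. f e)\<^sup>2 * (- r / (?N * (?N - 1))) + F * (r / ?N + r / (?N * (?N - 1)))" .
  have "\<dots> \<le> 2 * F * (r / ?N)"
  proof (cases "card ?S \<ge> 2")
    case True
    then have N: "?N - 1 \<ge> 1" by simp
    then have p: "?N * (?N - 1) > 0" by simp
    have "(\<Sum>e\<in>?S. f e)\<^sup>2 * (- r / (?N * (?N - 1))) \<le> 0"
      using p r0 by (simp add: mult_nonneg_nonneg)
    moreover have "r / (?N * (?N - 1)) \<le> r / ?N"
      using N r0 by (intro divide_left_mono) (auto intro!: mult_pos_pos)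
    then have "F * (r / ?N + r / (?N * (?N - 1))) \<le> F * (r / ?N + r / ?N)"
      using r0 by (intro mult_left_mono) auto
    ultimately show ?thesis by simp
  next
    case False
    \<comment> \<open>Now \<open>?N * (?N - 1) = 0\<close>, and quotients by it are 0 by
      convention.\<close>
    then have "card ?S = 0 \<or> card ?S = 1" by linarith
    then show ?thesis using r0 by auto
  qed
  then show ?thesis unfolding eq by (simp add: F_def r_def)
qed

lemma cexp_abs_le_sqrt:
  assumes "pm \<rho>"
  shows "cexp \<rho> (\<lambda>\<sigma>. \<bar>X \<sigma>\<bar>) \<le> sqrt (cexp \<rho> (\<lambda>\<sigma>. (X \<sigma>)\<^sup>2))"
proof (rule real_le_rsqrt)
  have c: "real (card (ext \<rho>)) > 0" using ext_nonempty[OF assms] finite_ext by (simp add: card_gt_0_iff)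
  have "(\<Sum>\<sigma>\<in>ext \<rho>. \<bar>X \<sigma>\<bar>)\<^sup>2 \<le> (\<Sum>\<sigma>\<in>ext \<rho>. \<bar>X \<sigma>\<bar>\<^sup>2) * card (ext \<rho>)"
    by (rule sum_squared_le_sum_of_squares)
  then show "(cexp \<rho> (\<lambda>\<sigma>. \<bar>X \<sigma>\<bar>))\<^sup>2 \<le> cexp \<rho> (\<lambda>\<sigma>. (X \<sigma>)\<^sup>2)"
    using c unfolding cexp_def by (simp add: power_divide divide_simps power2_eq_square)
qed

text \<open>A weighted sum of random rows of \<open>Q\<close> is close in l1 norm to the total
  weight times the mean row \<open>avg\<close>. Cauchy-Schwarz over \<open>Y\<close> turns the
  coordinatewise variances into the bound \<open>v\<close> for the mean error; the factor
  \<open>card Y\<close> has to be paid for by small squares of \<open>Q\<close>. Switching moves two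
  tails, each by at most \<open>2 * fm\<close> in l1 norm, so the Lipschitz constant is
  \<open>4 * fm\<close>, and \<open>64 = 4 * 4\<^sup>2\<close>.\<close>

lemma vector_concentration:
  fixes f :: "'a \<Rightarrow> real" and Q :: "'b \<Rightarrow> 'y \<Rightarrow> real"
  assumes pm: "pm \<rho>" and Y: "finite Y" and fm: "fm > 0" and \<epsilon>: "\<epsilon> > 0"
    and f: "\<And>e. e \<in> T - dom \<rho> \<Longrightarrow> \<bar>f e\<bar> \<le> fm"
    and Q: "\<And>x. x \<in> H - ran \<rho> \<Longrightarrow> (\<Sum>y\<in>Y. \<bar>Q x y\<bar>) \<le> 1"
    and N: "real (card (T - dom \<rho>)) \<le> N" "N > 0"
    and avg: "\<And>y. avg y = (\<Sum>x\<in>H - ran \<rho>. Q x y) / card (T - dom \<rho>)"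
    and v: "real (card Y) * (2 * (\<Sum>e\<in>T - dom \<rho>. (f e)\<^sup>2) *
             ((\<Sum>x\<in>H - ran \<rho>. \<Sum>y\<in>Y. (Q x y)\<^sup>2) / card (T - dom \<rho>))) \<le> v\<^sup>2" "v \<ge> 0"
  shows "cexp \<rho> (\<lambda>\<sigma>. of_bool ((\<Sum>y\<in>Y. \<bar>(\<Sum>e\<in>T - dom \<rho>. f e * Q (\<sigma> e) y) - (\<Sum>e\<in>T - dom \<rho>. f e) * avg y\<bar>)
             > v + \<epsilon>)) \<le> exp (- \<epsilon>\<^sup>2 / (64 * fm\<^sup>2 * N))"
proof -
  let ?S = "T - dom \<rho>" and ?X = "H - ran \<rho>"
  define R where "R = (\<lambda>y x. Q x y - avg y)"
  define g where "g = (\<lambda>\<sigma>. \<Sum>y\<in>Y. \<bar>\<Sum>e\<in>?S. f e * R y (\<sigma> e)\<bar>)"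
  have g: "g \<sigma> = (\<Sum>y\<in>Y. \<bar>(\<Sum>e\<in>?S. f e * Q (\<sigma> e) y) - (\<Sum>e\<in>?S. f e) * avg y\<bar>)" for \<sigma>
    unfolding g_def R_def by (simp add: right_diff_distrib sum_subtractf sum_distrib_right)
  have fin: "finite ?S" "finite ?X" using finT finH by auto
  have cX: "card ?X = card ?S" by (rule card_rem[OF pm])
  have R0: "(\<Sum>x\<in>?X. R y x) = 0" for y
    
  proof (cases "?X = {}")
    case True
    then show ?thesis by (metis sum.empty)
  next
    case False
    then show ?thesis unfolding R_def sum_subtractf avg cX[symmetric] using fin by simp
  qed
  have R2: "(\<Sum>x\<in>?X. (R y x)\<^sup>2) \<le> (\<Sum>x\<in>?X. (Q x y)\<^sup>2)" for y
  proof -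
    have "(Q x y)\<^sup>2 = (R y x)\<^sup>2 + 2 * avg y * R y x + (avg y)\<^sup>2" for x
      by (simp add: R_def power2_eq_square algebra_simps)
    then have "(\<Sum>x\<in>?X. (Q x y)\<^sup>2) = (\<Sum>x\<in>?X. (R y x)\<^sup>2) + 2 * avg y * (\<Sum>x\<in>?X. R y x) + card ?X * (avg y)\<^sup>2"
      by (simp add: sum.distrib sum_distrib_left)
    then show ?thesis using R0 by simp
  qed
  have mean: "cexp \<rho> g \<le> v"
  proof -
    define V where "V = (\<lambda>y. 2 * (\<Sum>e\<in>?S. (f e)\<^sup>2) * ((\<Sum>x\<in>?X. (Q x y)\<^sup>2) / card ?S))"
    have V0: "V y \<ge> 0" for y by (simp add: V_def sum_nonneg)
    have "cexp \<rho> g = (\<Sum>y\<in>Y. cexp \<rho> (\<lambda>\<sigma>. \<bar>\<Sum>e\<in>?S. f e * R y (\<sigma> e)\<bar>))"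
      unfolding g_def by (rule cexp_sum)
    also have "\<dots> \<le> (\<Sum>y\<in>Y. sqrt (V y))"
    proof (rule sum_mono)
      fix y
      have "cexp \<rho> (\<lambda>\<sigma>. (\<Sum>e\<in>?S. f e * R y (\<sigma> e))\<^sup>2)
         \<le> 2 * (\<Sum>e\<in>?S. (f e)\<^sup>2) * ((\<Sum>x\<in>?X. (R y x)\<^sup>2) / card ?S)"
        by (rule cexp_variance_le[OF pm R0])
      also have "\<dots> \<le> V y" unfolding V_def
        by (intro mult_left_mono divide_right_mono R2) (auto simp: sum_nonneg)
      finally show "cexp \<rho> (\<lambda>\<sigma>. \<bar>\<Sum>e\<in>?S. f e * R y (\<sigma> e)\<bar>) \<le> sqrt (V y)"
        using cexp_abs_le_sqrt[OF pm, of "\<lambda>\<sigma>. \<Sum>e\<in>?S. f e * R y (\<sigma> e)"] real_sqrt_le_mono order_trans by blast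
    qed
    also have "\<dots> \<le> v"
    proof (rule power2_le_imp_le)
      have "(\<Sum>y\<in>Y. sqrt (V y))\<^sup>2 \<le> (\<Sum>y\<in>Y. (sqrt (V y))\<^sup>2) * card Y"
        by (rule sum_squared_le_sum_of_squares)
      also have "\<dots> = card Y * (\<Sum>y\<in>Y. V y)" using V0 by simp
      also have "(\<Sum>y\<in>Y. V y) = 2 * (\<Sum>e\<in>?S. (f e)\<^sup>2) * ((\<Sum>x\<in>?X. \<Sum>y\<in>Y. (Q x y)\<^sup>2) / card ?S)"
        unfolding V_def by (subst sum.swap) (simp add: sum_distrib_left sum_divide_distrib)
      finally show "(\<Sum>y\<in>Y. sqrt (V y))\<^sup>2 \<le> v\<^sup>2" using v by linarith
    qed (rule v)
    finally show ?thesis .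
  qed
  have swap: "\<bar>g (swap_heads x x' \<sigma>) - g \<sigma>\<bar> \<le> 4 * fm"
    if s: "\<sigma> \<in> ext \<rho>" and x: "x \<in> ?X" "x' \<in> ?X" for \<sigma> x x'
  proof -
    let ?\<tau> = "swap_heads x x' \<sigma>"
    let ?E = "{e \<in> ?S. \<sigma> e = x \<or> \<sigma> e = x'}"
    have out: "Q (?\<tau> e) y - Q (\<sigma> e) y = 0" if "e \<in> ?S - ?E" for e y
      using that by (auto simp: swap_heads_def Transposition.transpose_def)
    have cE: "card ?E \<le> 2"
    proof -
      have "card ?E = card (\<sigma> ` ?E)" by (rule card_image[symmetric]) (rule inj_on_subset[OF ext_inj[OF s]], auto)
      also have "\<dots> \<le> card {x, x'}" by (rule card_mono) auto
      also have "\<dots> \<le> 2" by (simp add: card_insert_if)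
      finally show ?thesis .
    qed
    have "\<bar>g ?\<tau> - g \<sigma>\<bar> \<le> (\<Sum>y\<in>Y. \<bar>(\<Sum>e\<in>?S. f e * R y (?\<tau> e)) - (\<Sum>e\<in>?S. f e * R y (\<sigma> e))\<bar>)"
      unfolding g_def
      by (subst sum_subtractf[symmetric], rule order_trans[OF sum_abs]) (intro sum_mono abs_triangle_ineq3)
    also have "\<dots> = (\<Sum>y\<in>Y. \<bar>\<Sum>e\<in>?S. f e * (Q (?\<tau> e) y - Q (\<sigma> e) y)\<bar>)"
      by (simp add: sum_subtractf[symmetric] R_def right_diff_distrib[symmetric])
    also have "\<dots> = (\<Sum>y\<in>Y. \<bar>\<Sum>e\<in>?E. f e * (Q (?\<tau> e) y - Q (\<sigma> e) y)\<bar>)"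
      using fin out by (intro sum.cong refl arg_cong[where f=abs] sum.mono_neutral_right) auto
    also have "\<dots> \<le> (\<Sum>y\<in>Y. \<Sum>e\<in>?E. fm * (\<bar>Q (?\<tau> e) y\<bar> + \<bar>Q (\<sigma> e) y\<bar>))"
      by (intro sum_mono order_trans[OF sum_abs]) (use fm in \<open>auto simp: abs_mult intro!: mult_mono f\<close>)
    also have "\<dots> = (\<Sum>e\<in>?E. fm * ((\<Sum>y\<in>Y. \<bar>Q (?\<tau> e) y\<bar>) + (\<Sum>y\<in>Y. \<bar>Q (\<sigma> e) y\<bar>)))"
      by (subst sum.swap) (simp add: sum_distrib_left[symmetric] sum.distrib)
    also have "\<dots> \<le> (\<Sum>e\<in>?E. fm * (1 + 1))"
    proof (intro sum_mono mult_left_mono add_mono Q)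
      fix e assume e: "e \<in> ?E"
      then show "\<sigma> e \<in> ?X" using x by auto
      show "?\<tau> e \<in> ?X" using e x by (auto simp: swap_heads_def)
    qed (use fm in auto)
    also have "\<dots> \<le> 4 * fm" using cE fm by simp
    finally show ?thesis .
  qed
  have "cexp \<rho> (\<lambda>\<sigma>. of_bool (g \<sigma> > v + \<epsilon>)) \<le> cexp \<rho> (\<lambda>\<sigma>. of_bool (g \<sigma> > cexp \<rho> g + \<epsilon>))"
    using mean by (intro cexp_mono) auto
  also have "\<dots> \<le> exp (- \<epsilon>\<^sup>2 / (4 * (4 * fm)\<^sup>2 * N))"
    by (rule cexp_tail_le[OF pm _ \<epsilon> swap N]) (use fm in auto)
  also have "\<dots> = exp (- \<epsilon>\<^sup>2 / (64 * fm\<^sup>2 * N))" by (simp add: power_mult_distrib)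
  finally show ?thesis by (simp add: g)
qed

end

section \<open>Random walks on the configuration model\<close>

text \<open>The moment hypothesis enters through two numbers. A vertex met through a random head has
  a size-biased in-degree, whose mean is controlled by the constant \<open>\<beta>\<close>; all
  in-degrees are at most \<open>\<Delta>\<close>, in the application a power of \<open>n\<close>
  with exponent below 1/2.\<close>

locale dcm =
  fixes n K :: nat and din dout :: "nat \<Rightarrow> nat" and \<beta> \<Delta> :: real
  assumes n_pos: "n \<ge> 1"
    and degree_sum: "(\<Sum>v=1..n. dout v) = (\<Sum>v=1..n. din v)"
    and dout_ge: "\<And>v. v \<in> {1..n} \<Longrightarrow> 2 \<le> dout v"
    and dout_le: "\<And>v. v \<in> {1..n} \<Longrightarrow> dout v \<le> K"
    and second_moment: "(\<Sum>v=1..n. (real (din v))\<^sup>2) \<le> \<beta> * n"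
    and max_din: "\<And>v. v \<in> {1..n} \<Longrightarrow> real (din v) \<le> \<Delta>"
begin

abbreviation V :: "nat set" where "V \<equiv> {1..n}"

definition tails :: "(nat \<times> nat) set" where "tails = half_edges n dout"
definition heads :: "(nat \<times> nat) set" where "heads = half_edges n din"

lemma finite_tails: "finite tails" and finite_heads: "finite heads"
  by (auto simp: tails_def heads_def half_edges_def)

lemma card_tails: "card tails = (\<Sum>v\<in>V. dout v)" and card_heads: "card heads = (\<Sum>v\<in>V. din v)"
  by (simp_all add: tails_def heads_def half_edges_def)

sublocale matching_space tails heads
  by unfold_locales (use finite_tails finite_heads card_tails card_heads degree_sum in metis)+

abbreviation M :: "(nat \<times> nat \<Rightarrow> nat \<times> nat) set" where "M \<equiv> ext Map.empty"

lemma M_eq: "M = matchings n din dout"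
  unfolding ext_def matchings_def by (simp add: tails_def heads_def)

lemma ext_M: "\<sigma> \<in> ext \<rho> \<Longrightarrow> \<sigma> \<in> M"
  using ext_antimono[of Map.empty \<rho>] by auto

lemma tails_iff: "(v, i) \<in> tails \<longleftrightarrow> v \<in> V \<and> i < dout v"
  by (simp add: tails_def half_edges_def)

lemma heads_fst: "x \<in> heads \<Longrightarrow> fst x \<in> V"
  by (auto simp: heads_def half_edges_def)

lemma tails_fst: "x \<in> tails \<Longrightarrow> fst x \<in> V"
  by (auto simp: tails_def half_edges_def)

lemma M_maps: "\<sigma> \<in> M \<Longrightarrow> e \<in> tails \<Longrightarrow> \<sigma> e \<in> heads"
  by (auto simp: ext_def bij_betw_def)

lemma M_fst: "\<sigma> \<in> M \<Longrightarrow> e \<in> tails \<Longrightarrow> fst (\<sigma> e) \<in> V"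
  using M_maps heads_fst by blast

lemma two_n_le_card_tails: "2 * n \<le> card tails"
proof -
  have "(\<Sum>v\<in>V. 2) \<le> (\<Sum>v\<in>V. dout v)" by (intro sum_mono dout_ge)
  then show ?thesis by (simp add: card_tails)
qed

lemma card_tails_le: "card tails \<le> K * n"
proof -
  have "(\<Sum>v\<in>V. dout v) \<le> (\<Sum>v\<in>V. K)" by (intro sum_mono dout_le)
  then show ?thesis by (simp add: card_tails mult.commute)
qed

lemma K_ge: "K \<ge> 2"
  using dout_ge[of 1] dout_le[of 1] n_pos by auto

lemma sum_heads: "(\<Sum>x\<in>heads. \<phi> (fst x)) = (\<Sum>v\<in>V. real (din v) * \<phi> v)"
proof -
  have "(\<Sum>x\<in>heads. \<phi> (fst x)) = (\<Sum>(v, i)\<in>(SIGMA v:V. {..<din v}). \<phi> v)"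
    by (simp add: heads_def half_edges_def case_prod_beta)
  also have "\<dots> = (\<Sum>v\<in>V. \<Sum>i<din v. \<phi> v)" by (rule sum.Sigma[symmetric]) auto
  finally show ?thesis by simp
qed

lemma sum_remaining_heads_le:
  assumes "\<And>v. v \<in> V \<Longrightarrow> \<phi> v \<ge> 0"
  shows "(\<Sum>x\<in>heads - ran \<rho>. \<phi> (fst x)) \<le> (\<Sum>v\<in>V. real (din v) * \<phi> v)"
  unfolding sum_heads[symmetric]
  by (rule sum_mono2) (use finite_heads heads_fst assms in auto)

text \<open>Out-degrees at least 2 provide \<open>2 * n\<close> tails, so while at most
  \<open>n\<close> are revealed each free head has conditional probability at most
  \<open>1 / n\<close>.\<close>

lemma card_remaining:
  assumes "pm \<rho>" "card (dom \<rho>) \<le> n"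
  shows "card (tails - dom \<rho>) \<ge> n"
  using assms two_n_le_card_tails pm_finite[OF assms(1)]
  by (simp add: card_Diff_subset pm_def)

text \<open>The number of heads attached to \<open>Z\<close>. While \<open>n\<close> tails are left,
  \<open>D Z / n\<close> bounds the probability that the next revealed head belongs to
  \<open>Z\<close>.\<close>

definition D :: "nat set \<Rightarrow> real" where "D Z = (\<Sum>v\<in>Z. real (din v))"

lemma D_nonneg: "D Z \<ge> 0" by (simp add: D_def sum_nonneg)

lemma D_insert: "Z \<subseteq> V \<Longrightarrow> D (insert v Z) \<le> din v + D Z"
  unfolding D_def by (cases "v \<in> Z") (auto simp: sum.insert_if finite_subset insert_absorb)

lemma D_le_card: "Z \<subseteq> V \<Longrightarrow> D Z \<le> card Z * \<Delta>"
  unfolding D_def using sum_bounded_above[of Z "\<lambda>v. real (din v)" \<Delta>] max_din by blast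

text \<open>Cauchy-Schwarz with the second moment: o(n) vertices carry o(n) heads. For sets of size
  near \<open>n\<close> this is much stronger than the bound through the maximal in-degree.\<close>

lemma D_le_sqrt: "Z \<subseteq> V \<Longrightarrow> D Z \<le> sqrt (card Z * (\<beta> * n))"
proof (rule real_le_rsqrt)
  assume Z: "Z \<subseteq> V"
  have "(D Z)\<^sup>2 \<le> (\<Sum>v\<in>Z. (real (din v))\<^sup>2) * card Z"
    unfolding D_def by (rule sum_squared_le_sum_of_squares)
  also have "(\<Sum>v\<in>Z. (real (din v))\<^sup>2) \<le> (\<Sum>v\<in>V. (real (din v))\<^sup>2)"
    using Z by (intro sum_mono2) auto
  also note second_moment
  finally show "(D Z)\<^sup>2 \<le> card Z * (\<beta> * n)" by (simp add: mult.commute mult_right_mono)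
qed

lemma remaining_heads_in: "Z \<subseteq> V \<Longrightarrow> (\<Sum>x\<in>heads - ran \<rho>. of_bool (fst x \<in> Z)) \<le> D Z"
proof -
  assume Z: "Z \<subseteq> V"
  have "(\<Sum>x\<in>heads - ran \<rho>. of_bool (fst x \<in> Z)) \<le> (\<Sum>v\<in>V. real (din v) * of_bool (v \<in> Z))"
    by (rule sum_remaining_heads_le) simp
  also have "\<dots> = (\<Sum>v\<in>V \<inter> Z. real (din v))"
    by (simp add: sum.If_cases of_bool_def if_distrib cong: if_cong)
  also have "V \<inter> Z = Z" using Z by auto
  finally show ?thesis by (simp add: D_def)
qed

lemma remaining_heads_din: "(\<Sum>x\<in>heads - ran \<rho>. real (din (fst x))) \<le> \<beta> * n"
proof -
  have "(\<Sum>x\<in>heads - ran \<rho>. real (din (fst x))) \<le> (\<Sum>v\<in>V. real (din v) * real (din v))"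
    by (rule sum_remaining_heads_le) simp
  then show ?thesis using second_moment by (simp add: power2_eq_square)
qed

lemma \<beta>_nonneg: "\<beta> \<ge> 0"
proof -
  have "0 \<le> (\<Sum>v=1..n. (real (din v))\<^sup>2)" by (simp add: sum_nonneg)
  then have "0 \<le> \<beta> * n" using second_moment by linarith
  then show ?thesis using n_pos by (simp add: zero_le_mult_iff)
qed

text \<open>The mean of \<open>\<phi>\<close> at time \<open>k\<close> for the walk from
  \<open>u\<close> in the fixed matching \<open>\<sigma>\<close>. Recursion on the first step lets a
  proof reveal a tail exactly when the walk uses it; as a functional of \<open>\<phi>\<close>, it
  treats points, sets and composed walks alike.\<close>

fun walk :: "(nat \<times> nat \<Rightarrow> nat \<times> nat) \<Rightarrow> nat \<Rightarrow> nat \<Rightarrow> (nat \<Rightarrow> real) \<Rightarrow> real" where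
  "walk \<sigma> 0 u \<phi> = \<phi> u"
| "walk \<sigma> (Suc k) u \<phi> = (\<Sum>i<dout u. walk \<sigma> k (fst (\<sigma> (u, i))) \<phi>) / dout u"

lemma average_le:
  fixes f :: "nat \<Rightarrow> real"
  assumes "u \<in> V" "\<And>i. i < dout u \<Longrightarrow> f i \<le> c"
  shows "(\<Sum>i<dout u. f i) / dout u \<le> c"
proof -
  have "(\<Sum>i<dout u. f i) \<le> dout u * c" using sum_bounded_above[of "{..<dout u}" f c] assms by auto
  then show ?thesis using dout_ge[OF assms(1)] by (simp add: divide_le_eq mult.commute)
qed

lemma walk_mono:
  assumes "\<sigma> \<in> M" "u \<in> V" "\<And>v. v \<in> V \<Longrightarrow> \<phi> v \<le> \<psi> v"
  shows "walk \<sigma> k u \<phi> \<le> walk \<sigma> k u \<psi>"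
  using assms(2)
proof (induction k arbitrary: u)
  case (Suc k)
  then show ?case using M_fst[OF assms(1)]
    by (auto intro!: divide_right_mono sum_mono simp: tails_iff)
qed (use assms in auto)

lemma walk_cong:
  assumes "\<sigma> \<in> M" "u \<in> V" "\<And>v. v \<in> V \<Longrightarrow> \<phi> v = \<psi> v"
  shows "walk \<sigma> k u \<phi> = walk \<sigma> k u \<psi>"
  using walk_mono[OF assms(1,2), of \<phi> \<psi> k] walk_mono[OF assms(1,2), of \<psi> \<phi> k] assms(3) by force

lemma walk_const: "\<sigma> \<in> M \<Longrightarrow> u \<in> V \<Longrightarrow> walk \<sigma> k u (\<lambda>_. c) = c"
proof (induction k arbitrary: u)
  case (Suc k)
  have "walk \<sigma> k (fst (\<sigma> (u, i))) (\<lambda>_. c) = c" if "i < dout u" for i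
    using that Suc M_fst[OF Suc(2)] by (simp add: tails_iff)
  then show ?case using dout_ge[OF Suc(3)] by simp
qed simp

lemma walk_cmult: "walk \<sigma> k u (\<lambda>v. c * \<phi> v) = c * walk \<sigma> k u \<phi>"
  by (induction k arbitrary: u) (simp_all add: sum_distrib_left)

lemma walk_add: "walk \<sigma> k u (\<lambda>v. \<phi> v + \<psi> v) = walk \<sigma> k u \<phi> + walk \<sigma> k u \<psi>"
  by (induction k arbitrary: u) (simp_all add: sum.distrib add_divide_distrib)

lemma walk_diff: "walk \<sigma> k u (\<lambda>v. \<phi> v - \<psi> v) = walk \<sigma> k u \<phi> - walk \<sigma> k u \<psi>"
  by (induction k arbitrary: u) (simp_all add: sum_subtractf diff_divide_distrib)

lemma walk_sum: "walk \<sigma> k u (\<lambda>v. \<Sum>i\<in>I. \<phi> i v) = (\<Sum>i\<in>I. walk \<sigma> k u (\<phi> i))"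
proof (induction k arbitrary: u)
  case (Suc k)
  show ?case by (simp add: Suc sum.swap[of _ I] sum_divide_distrib)
qed simp

lemma walk_nonneg: "\<sigma> \<in> M \<Longrightarrow> u \<in> V \<Longrightarrow> (\<And>v. v \<in> V \<Longrightarrow> 0 \<le> \<phi> v) \<Longrightarrow> 0 \<le> walk \<sigma> k u \<phi>"
  using walk_mono[of \<sigma> u "\<lambda>_. 0" \<phi> k] walk_const[of \<sigma> u k 0] by simp

lemma walk_le: "\<sigma> \<in> M \<Longrightarrow> u \<in> V \<Longrightarrow> (\<And>v. v \<in> V \<Longrightarrow> \<phi> v \<le> c) \<Longrightarrow> walk \<sigma> k u \<phi> \<le> c"
  using walk_mono[of \<sigma> u \<phi> "\<lambda>_. c" k] walk_const[of \<sigma> u k c] by simp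

lemma walk_compose: "walk \<sigma> (j + k) u \<phi> = walk \<sigma> j u (\<lambda>v. walk \<sigma> k v \<phi>)"
  by (induction j arbitrary: u) simp_all

lemma walk_expand:
  assumes "\<sigma> \<in> M" "u \<in> V"
  shows "walk \<sigma> k u \<phi> = (\<Sum>y\<in>V. walk \<sigma> k u (\<lambda>z. of_bool (z = y)) * \<phi> y)"
proof -
  have "walk \<sigma> k u \<phi> = walk \<sigma> k u (\<lambda>z. \<Sum>y\<in>V. \<phi> y * of_bool (z = y))"
  proof (rule walk_cong[OF assms])
    fix v assume "v \<in> V"
    then show "\<phi> v = (\<Sum>y\<in>V. \<phi> y * of_bool (v = y))"
      by (simp add: of_bool_def if_distrib cong: if_cong)
  qed
  also have "\<dots> = (\<Sum>y\<in>V. walk \<sigma> k u (\<lambda>z. of_bool (z = y)) * \<phi> y)"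
    unfolding walk_sum walk_cmult by (simp only: mult.commute)
  finally show ?thesis .
qed

lemma walk_total: "\<sigma> \<in> M \<Longrightarrow> u \<in> V \<Longrightarrow> (\<Sum>y\<in>V. walk \<sigma> k u (\<lambda>z. of_bool (z = y))) = 1"
  using walk_expand[of \<sigma> u k "\<lambda>_. 1"] walk_const[of \<sigma> u k 1] by simp

section \<open>Hitting and meeting probabilities averaged over the matching\<close>

lemma pm_upd': "pm \<rho> \<Longrightarrow> e \<in> tails - dom \<rho> \<Longrightarrow> x \<in> heads - ran \<rho> \<Longrightarrow>
   pm (\<rho>(e \<mapsto> x)) \<and> fst x \<in> V \<and> card (tails - dom \<rho>) = Suc (card (tails - dom (\<rho>(e \<mapsto> x))))"
proof -
  assume a: "pm \<rho>" "e \<in> tails - dom \<rho>" "x \<in> heads - ran \<rho>"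
  have "card (tails - dom \<rho>) > 0" using a(2) finite_tails by (auto simp: card_gt_0_iff)
  then show ?thesis using a card_rem_upd[OF a(1,2), of x] pm_upd[OF a] heads_fst by auto
qed

lemma cexp_upd_head: "cexp (\<rho>(e \<mapsto> x)) (\<lambda>\<sigma>. f \<sigma> (\<sigma> e)) = cexp (\<rho>(e \<mapsto> x)) (\<lambda>\<sigma>. f \<sigma> x)"
proof (rule cexp_cong)
  fix \<sigma> assume "\<sigma> \<in> ext (\<rho>(e \<mapsto> x))"
  then have "\<sigma> e = x" by (rule ext_D) simp
  then show "f \<sigma> (\<sigma> e) = f \<sigma> x" by simp
qed

lemma cexp_average_le:
  assumes "u \<in> V" "\<And>i. i < dout u \<Longrightarrow> cexp \<rho> (f i) \<le> c"
  shows "cexp \<rho> (\<lambda>\<sigma>. (\<Sum>i<dout u. f i \<sigma>) / dout u) \<le> c"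
proof -
  have "cexp \<rho> (\<lambda>\<sigma>. (\<Sum>i<dout u. f i \<sigma>) / dout u) = (\<Sum>i<dout u. cexp \<rho> (f i)) / dout u"
    using cexp_cmult[of \<rho> "1 / dout u" "\<lambda>\<sigma>. \<Sum>i<dout u. f i \<sigma>"] by (simp add: cexp_sum)
  then show ?thesis using average_le[OF assms(1), of "\<lambda>i. cexp \<rho> (f i)" c] assms(2) by simp
qed

text \<open>A revealed head is either in \<open>Z\<close>, which has probability at most \<open>D Z / n\<close>, or it belongs to
  a fresh vertex, whose in-degree is size-biased and has mean at most \<open>\<beta>\<close>.\<close>

lemma cexp_le_reveal:
  fixes a b :: real
  assumes pm: "pm \<rho>" and e: "e \<in> tails - dom \<rho>" and Z: "Z \<subseteq> V" and N: "card (tails - dom \<rho>) \<ge> n"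
    and a: "a \<ge> 0" and b: "b \<ge> 0"
    and hit: "\<And>x. x \<in> heads - ran \<rho> \<Longrightarrow> fst x \<in> Z \<Longrightarrow> cexp (\<rho>(e \<mapsto> x)) f \<le> 1"
    and fresh: "\<And>x. x \<in> heads - ran \<rho> \<Longrightarrow> fst x \<notin> Z \<Longrightarrow> cexp (\<rho>(e \<mapsto> x)) f \<le> a * din (fst x) + b"
  shows "cexp \<rho> f \<le> D Z / n + a * \<beta> + b"
proof (rule cexp_le_step[OF pm e])
  fix x assume x: "x \<in> heads - ran \<rho>"
  show "cexp (\<rho>(e \<mapsto> x)) f \<le> of_bool (fst x \<in> Z) + (a * din (fst x) + b)"
    using hit[OF x] fresh[OF x] a b by (cases "fst x \<in> Z") (auto intro: order_trans)
next
  let ?N = "real (card (tails - dom \<rho>))"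
  have "(\<Sum>x\<in>heads - ran \<rho>. of_bool (fst x \<in> Z) + (a * din (fst x) + b))
     = (\<Sum>x\<in>heads - ran \<rho>. of_bool (fst x \<in> Z)) + a * (\<Sum>x\<in>heads - ran \<rho>. real (din (fst x))) + b * ?N"
    by (simp add: sum.distrib sum_distrib_left card_rem[OF pm])
  also have "\<dots> \<le> D Z + a * (\<beta> * n) + b * ?N"
    by (intro add_mono mult_left_mono remaining_heads_in remaining_heads_din Z a) (use b in auto)
  also have "\<dots> = (D Z / n + a * \<beta>) * n + b * ?N" using n_pos by (simp add: field_simps)
  also have "\<dots> \<le> (D Z / n + a * \<beta>) * ?N + b * ?N"
    using N a b \<beta>_nonneg D_nonneg by (intro add_mono mult_left_mono) auto
  finally show "(\<Sum>x\<in>heads - ran \<rho>. of_bool (fst x \<in> Z) + (a * din (fst x) + b))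
     \<le> (D Z / n + a * \<beta> + b) * ?N" by (simp add: algebra_simps)
qed

lemma walk_indicator_le1: "\<sigma> \<in> M \<Longrightarrow> u \<in> V \<Longrightarrow> walk \<sigma> k u (\<lambda>z. of_bool (P z)) \<le> 1"
  by (rule walk_le) auto

text \<open>Matching and walk are averaged together, so that only the tails of one trajectory are
  revealed. At each of the \<open>k + 1\<close> steps the walk may enter the set seen so far, with
  probability at most its number of heads over \<open>n\<close>, and the trivial bound 1 is used
  from there on. Otherwise it stands at a fresh vertex without revealed tails, and the number of
  heads seen grows by at most \<open>\<beta>\<close> in the mean.\<close>

lemma walk_hit:
  assumes "pm \<rho>" "e \<in> tails - dom \<rho>" "fst ` dom \<rho> \<subseteq> Z" "fst e \<in> Z" "Z \<subseteq> V"
    and "card (tails - dom \<rho>) \<ge> n + k"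
  shows "cexp \<rho> (\<lambda>\<sigma>. walk \<sigma> k (fst (\<sigma> e)) (\<lambda>z. of_bool (z \<in> Z))) \<le> (real k + 1) * (D Z + real k * \<beta>) / n"
  using assms
proof (induction k arbitrary: \<rho> e Z)
  case 0
  have "cexp \<rho> (\<lambda>\<sigma>. walk \<sigma> 0 (fst (\<sigma> e)) (\<lambda>z. of_bool (z \<in> Z))) \<le> D Z / n + 0 * \<beta> + 0"
  proof (rule cexp_le_reveal[OF 0(1,2,5)])
    fix x assume x: "x \<in> heads - ran \<rho>"
    note p = pm_upd'[OF 0(1,2) x]
    have "cexp (\<rho>(e \<mapsto> x)) (\<lambda>\<sigma>. walk \<sigma> 0 (fst (\<sigma> e)) (\<lambda>z. of_bool (z \<in> Z))) = of_bool (fst x \<in> Z)"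
      using p by (simp add: cexp_upd_head[of _ _ _ "\<lambda>_ y. of_bool (fst y \<in> Z)"] cexp_const del: fun_upd_apply)
    then show "cexp (\<rho>(e \<mapsto> x)) (\<lambda>\<sigma>. walk \<sigma> 0 (fst (\<sigma> e)) (\<lambda>z. of_bool (z \<in> Z))) \<le> 1"
      "fst x \<notin> Z \<Longrightarrow> cexp (\<rho>(e \<mapsto> x)) (\<lambda>\<sigma>. walk \<sigma> 0 (fst (\<sigma> e)) (\<lambda>z. of_bool (z \<in> Z))) \<le> 0 * real (din (fst x)) + 0"
      by auto
  qed (use 0 in auto)
  then show ?case by simp
next
  case (Suc k)
  note IH = Suc(1) and pm = Suc(2) and e = Suc(3) and dom = Suc(4) and eZ = Suc(5) and Z = Suc(6) and N = Suc(7)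
  let ?f = "\<lambda>\<sigma>. walk \<sigma> (Suc k) (fst (\<sigma> e)) (\<lambda>z. of_bool (z \<in> Z))"
  have "cexp \<rho> ?f \<le> D Z / n + ((real k + 1) / n) * \<beta> + (real k + 1) * (D Z + real k * \<beta>) / n"
  proof (rule cexp_le_reveal[OF pm e Z])
    fix x assume x: "x \<in> heads - ran \<rho>"
    note p = pm_upd'[OF pm e x]
    have eq: "cexp (\<rho>(e \<mapsto> x)) ?f = cexp (\<rho>(e \<mapsto> x)) (\<lambda>\<sigma>. walk \<sigma> (Suc k) (fst x) (\<lambda>z. of_bool (z \<in> Z)))"
      by (rule cexp_upd_head[of _ _ _ "\<lambda>\<sigma> y. walk \<sigma> (Suc k) (fst y) (\<lambda>z. of_bool (z \<in> Z))"])
    show "cexp (\<rho>(e \<mapsto> x)) ?f \<le> 1"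
      unfolding eq using p ext_M by (intro cexp_le_const walk_indicator_le1) auto
    assume xZ: "fst x \<notin> Z"
    let ?Z = "insert (fst x) Z"
    have "cexp (\<rho>(e \<mapsto> x)) ?f \<le> (real k + 1) * (D ?Z + real k * \<beta>) / n"
      unfolding eq unfolding walk.simps
    proof (rule cexp_average_le)
      show "fst x \<in> V" using p by simp
      fix i assume i: "i < dout (fst x)"
      let ?e = "(fst x, i)"
      have "fst x \<noteq> fst e" using xZ eZ by auto
      have dom2: "fst ` dom (\<rho>(e \<mapsto> x)) \<subseteq> ?Z" using dom eZ by auto
      have "?e \<noteq> e" using \<open>fst x \<noteq> fst e\<close> by auto
      moreover have "?e \<notin> dom \<rho>" using xZ dom by (metis fst_conv image_eqI subsetD)
      ultimately have e': "?e \<in> tails - dom (\<rho>(e \<mapsto> x))" using i p by (auto simp: tails_iff)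
      have "cexp (\<rho>(e \<mapsto> x)) (\<lambda>\<sigma>. walk \<sigma> k (fst (\<sigma> ?e)) (\<lambda>z. of_bool (z \<in> Z)))
         \<le> cexp (\<rho>(e \<mapsto> x)) (\<lambda>\<sigma>. walk \<sigma> k (fst (\<sigma> ?e)) (\<lambda>z. of_bool (z \<in> ?Z)))"
        using e' ext_M M_fst by (intro cexp_mono walk_mono) auto
      also have "\<dots> \<le> (real k + 1) * (D ?Z + real k * \<beta>) / n"
        by (rule IH[OF conjunct1[OF p] e' dom2]) (use p Z N in \<open>auto simp del: fun_upd_apply\<close>)
      finally show "cexp (\<rho>(e \<mapsto> x)) (\<lambda>\<sigma>. walk \<sigma> k (fst (\<sigma> ?e)) (\<lambda>z. of_bool (z \<in> Z))) \<le> (real k + 1) * (D ?Z + real k * \<beta>) / n" .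
    qed
    also have "\<dots> \<le> (real k + 1) * (din (fst x) + D Z + real k * \<beta>) / n"
      using D_insert[OF Z, of "fst x"] by (intro divide_right_mono mult_left_mono) auto
    also have "\<dots> = (real k + 1) / n * din (fst x) + (real k + 1) * (D Z + real k * \<beta>) / n"
      using n_pos by (simp add: field_simps)
    finally show "cexp (\<rho>(e \<mapsto> x)) ?f \<le> (real k + 1) / n * din (fst x) + (real k + 1) * (D Z + real k * \<beta>) / n" .
  qed (use N D_nonneg \<beta>_nonneg in auto)
  also have "\<dots> \<le> (real (Suc k) + 1) * (D Z + real (Suc k) * \<beta>) / n"
    using n_pos \<beta>_nonneg D_nonneg[of Z] by (simp add: field_simps)
  finally show ?case by simp
qed

lemma walk_vertex_hit:
  assumes "pm \<rho>" "v \<in> V" "v \<notin> fst ` dom \<rho>" "fst ` dom \<rho> \<subseteq> Z" "v \<in> Z" "Z \<subseteq> V"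
    and "card (tails - dom \<rho>) \<ge> n + k"
  shows "cexp \<rho> (\<lambda>\<sigma>. walk \<sigma> (Suc k) v (\<lambda>z. of_bool (z \<in> Z))) \<le> (real k + 1) * (D Z + real k * \<beta>) / n"
  unfolding walk.simps
proof (rule cexp_average_le[OF assms(2)])
  fix i assume "i < dout v"
  then have "(v, i) \<in> tails - dom \<rho>" using assms(2,3) by (force simp: tails_iff image_iff)
  then show "cexp \<rho> (\<lambda>\<sigma>. walk \<sigma> k (fst (\<sigma> (v, i))) (\<lambda>z. of_bool (z \<in> Z))) \<le> (real k + 1) * (D Z + real k * \<beta>) / n"
    using assms by (intro walk_hit) auto
qed

text \<open>The first walk is revealed up to its end point \<open>y\<close>; the second can end at
  \<open>y\<close> only if it hits the set seen by then. As \<open>v\<close> lies in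
  \<open>Z\<close>, a first walk that enters \<open>v\<close> already counts as a hit, so the tails
  of \<open>v\<close> stay unrevealed until its turn.\<close>

lemma walk_pair_meet:
  assumes "pm \<rho>" "e \<in> tails - dom \<rho>" "fst ` dom \<rho> \<subseteq> Z" "fst e \<in> Z" "Z \<subseteq> V"
    and "v \<in> Z" "v \<noteq> fst e" "v \<notin> fst ` dom \<rho>"
    and "card (tails - dom \<rho>) \<ge> n + j + k + 1"
  shows "cexp \<rho> (\<lambda>\<sigma>. walk \<sigma> j (fst (\<sigma> e)) (\<lambda>y. walk \<sigma> (Suc k) v (\<lambda>z. of_bool (z = y))))
       \<le> (real j + real k + 2) * (D Z + (real j + real k + 2) * \<beta>) / n"
  using assms
proof (induction j arbitrary: \<rho> e Z)
  case 0
  note pm = 0(1) and e = 0(2) and dom = 0(3) and eZ = 0(4) and Z = 0(5) and v = 0(6-8) and N = 0(9)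
  let ?f = "\<lambda>\<sigma>. walk \<sigma> 0 (fst (\<sigma> e)) (\<lambda>y. walk \<sigma> (Suc k) v (\<lambda>z. of_bool (z = y)))"
  have vV: "v \<in> V" using v Z by auto
  have "cexp \<rho> ?f \<le> D Z / n + ((real k + 1) / n) * \<beta> + (real k + 1) * (D Z + real k * \<beta>) / n"
  proof (rule cexp_le_reveal[OF pm e Z])
    fix x assume x: "x \<in> heads - ran \<rho>"
    note p = pm_upd'[OF pm e x]
    have eq: "cexp (\<rho>(e \<mapsto> x)) ?f = cexp (\<rho>(e \<mapsto> x)) (\<lambda>\<sigma>. walk \<sigma> (Suc k) v (\<lambda>z. of_bool (z = fst x)))"
      unfolding walk.simps(1) by (rule cexp_upd_head[of _ _ _ "\<lambda>\<sigma> y. walk \<sigma> (Suc k) v (\<lambda>z. of_bool (z = fst y))"])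
    show "cexp (\<rho>(e \<mapsto> x)) ?f \<le> 1"
      unfolding eq using p ext_M vV by (intro cexp_le_const walk_indicator_le1) auto
    let ?Z = "insert (fst x) Z"
    have "cexp (\<rho>(e \<mapsto> x)) ?f \<le> cexp (\<rho>(e \<mapsto> x)) (\<lambda>\<sigma>. walk \<sigma> (Suc k) v (\<lambda>z. of_bool (z \<in> ?Z)))"
      unfolding eq using vV ext_M by (intro cexp_mono walk_mono) auto
    also have "\<dots> \<le> (real k + 1) * (D ?Z + real k * \<beta>) / n"
    proof (rule walk_vertex_hit[OF _ vV])
      show "fst ` dom (\<rho>(e \<mapsto> x)) \<subseteq> ?Z" using dom eZ by auto
    qed (use p v Z N in auto)
    also have "\<dots> \<le> (real k + 1) * (din (fst x) + D Z + real k * \<beta>) / n"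
      using D_insert[OF Z, of "fst x"] by (intro divide_right_mono mult_left_mono) auto
    also have "\<dots> = (real k + 1) / n * din (fst x) + (real k + 1) * (D Z + real k * \<beta>) / n"
      using n_pos by (simp add: field_simps)
    finally show "cexp (\<rho>(e \<mapsto> x)) ?f \<le> (real k + 1) / n * din (fst x) + (real k + 1) * (D Z + real k * \<beta>) / n" .
  qed (use N D_nonneg \<beta>_nonneg in auto)
  also have "\<dots> \<le> (real 0 + real k + 2) * (D Z + (real 0 + real k + 2) * \<beta>) / n"
    using n_pos \<beta>_nonneg D_nonneg[of Z] by (simp add: field_simps)
  finally show ?case by simp
next
  case (Suc j)
  note IH = Suc(1) and pm = Suc(2) and e = Suc(3) and dom = Suc(4) and eZ = Suc(5) and Z = Suc(6)
    and v = Suc(7-9) and N = Suc(10)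
  let ?g = "\<lambda>\<sigma> y. walk \<sigma> (Suc k) v (\<lambda>z. of_bool (z = y))"
  let ?f = "\<lambda>\<sigma>. walk \<sigma> (Suc j) (fst (\<sigma> e)) (?g \<sigma>)"
  let ?c = "real j + real k + 2"
  have vV: "v \<in> V" using v Z by auto
  have "cexp \<rho> ?f \<le> D Z / n + (?c / n) * \<beta> + ?c * (D Z + ?c * \<beta>) / n"
  proof (rule cexp_le_reveal[OF pm e Z])
    fix x assume x: "x \<in> heads - ran \<rho>"
    note p = pm_upd'[OF pm e x]
    have eq: "cexp (\<rho>(e \<mapsto> x)) ?f = cexp (\<rho>(e \<mapsto> x)) (\<lambda>\<sigma>. walk \<sigma> (Suc j) (fst x) (?g \<sigma>))"
      by (rule cexp_upd_head[of _ _ _ "\<lambda>\<sigma> y. walk \<sigma> (Suc j) (fst y) (?g \<sigma>)"])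
    show "cexp (\<rho>(e \<mapsto> x)) ?f \<le> 1"
      unfolding eq using p ext_M vV by (intro cexp_le_const walk_le walk_indicator_le1) auto
    assume xZ: "fst x \<notin> Z"
    let ?Z = "insert (fst x) Z"
    have "cexp (\<rho>(e \<mapsto> x)) ?f \<le> ?c * (D ?Z + ?c * \<beta>) / n"
      unfolding eq unfolding walk.simps(2)[of _ j]
    proof (rule cexp_average_le)
      show "fst x \<in> V" using p by simp
      fix i assume i: "i < dout (fst x)"
      let ?e = "(fst x, i)"
      have "fst x \<noteq> fst e" using xZ eZ by auto
      have dom2: "fst ` dom (\<rho>(e \<mapsto> x)) \<subseteq> ?Z" using dom eZ by auto
      have "?e \<noteq> e" using \<open>fst x \<noteq> fst e\<close> by auto
      moreover have "?e \<notin> dom \<rho>" using xZ dom by (metis fst_conv image_eqI subsetD)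
      ultimately have e': "?e \<in> tails - dom (\<rho>(e \<mapsto> x))" using i p by (auto simp: tails_iff)
      show "cexp (\<rho>(e \<mapsto> x)) (\<lambda>\<sigma>. walk \<sigma> j (fst (\<sigma> ?e)) (?g \<sigma>)) \<le> ?c * (D ?Z + ?c * \<beta>) / n"
        proof (rule IH[OF conjunct1[OF p] e' dom2])
          show "v \<notin> fst ` dom (\<rho>(e \<mapsto> x))" using v by (simp add: image_insert)
        qed (use p Z N v xZ in \<open>auto simp del: fun_upd_apply\<close>)
    qed
    also have "\<dots> \<le> ?c * (din (fst x) + D Z + ?c * \<beta>) / n"
      using D_insert[OF Z, of "fst x"] by (intro divide_right_mono mult_left_mono) auto
    also have "\<dots> = ?c / n * din (fst x) + ?c * (D Z + ?c * \<beta>) / n"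
      using n_pos by (simp add: field_simps)
    finally show "cexp (\<rho>(e \<mapsto> x)) ?f \<le> ?c / n * din (fst x) + ?c * (D Z + ?c * \<beta>) / n" .
  qed (use N D_nonneg \<beta>_nonneg in auto)
  also have "\<dots> \<le> (real (Suc j) + real k + 2) * (D Z + (real (Suc j) + real k + 2) * \<beta>) / n"
    using n_pos \<beta>_nonneg D_nonneg[of Z] by (simp add: field_simps)
  finally show ?case by simp
qed

lemma walk_vertices_meet:
  assumes "u \<in> V" "v \<in> V" "u \<noteq> v" and "j + k + 1 \<le> n"
  shows "cexp Map.empty (\<lambda>\<sigma>. walk \<sigma> (Suc j) u (\<lambda>y. walk \<sigma> (Suc k) v (\<lambda>z. of_bool (z = y))))
       \<le> (real j + real k + 2) * (real (din u) + real (din v) + (real j + real k + 2) * \<beta>) / n"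
  unfolding walk.simps(2)[of _ j]
proof (rule cexp_average_le[OF assms(1)])
  fix i assume i: "i < dout u"
  have "D {u, v} = real (din u) + real (din v)" using assms by (simp add: D_def)
  then show "cexp Map.empty (\<lambda>\<sigma>. walk \<sigma> j (fst (\<sigma> (u, i))) (\<lambda>y. walk \<sigma> (Suc k) v (\<lambda>z. of_bool (z = y))))
       \<le> (real j + real k + 2) * (real (din u) + real (din v) + (real j + real k + 2) * \<beta>) / n"
    using walk_pair_meet[of Map.empty "(u, i)" "{u, v}" v j k] assms i two_n_le_card_tails pm_empty
    by (simp add: tails_iff del: walk.simps)
qed

end

section \<open>Tree-like neighbourhoods\<close>

context dcm
begin

section \<open>Paths coded by words, and tree-like balls\<close>

fun endpt :: "(nat \<times> nat \<Rightarrow> nat \<times> nat) \<Rightarrow> nat \<Rightarrow> nat list \<Rightarrow> nat" where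
  "endpt \<sigma> z [] = z"
| "endpt \<sigma> z (i # l) = endpt \<sigma> (fst (\<sigma> (z, i))) l"

fun valid :: "(nat \<times> nat \<Rightarrow> nat \<times> nat) \<Rightarrow> nat \<Rightarrow> nat list \<Rightarrow> bool" where
  "valid \<sigma> z [] = True"
| "valid \<sigma> z (i # l) = (i < dout z \<and> valid \<sigma> (fst (\<sigma> (z, i))) l)"

text \<open>A path is coded by the indices of the tails it uses. Injectivity of the end point
  excludes cycles, multiple edges and merging paths at once: a vertex of the ball determines its
  address.\<close>

definition treelike :: "(nat \<times> nat \<Rightarrow> nat \<times> nat) \<Rightarrow> nat \<Rightarrow> nat \<Rightarrow> bool" where
  "treelike \<sigma> r z \<longleftrightarrow> inj_on (endpt \<sigma> z) {l. valid \<sigma> z l \<and> length l \<le> r}"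

lemma endpt_snoc: "endpt \<sigma> z (l @ [i]) = fst (\<sigma> (endpt \<sigma> z l, i))"
  by (induction l arbitrary: z) auto

lemma valid_snoc: "valid \<sigma> z (l @ [i]) \<longleftrightarrow> valid \<sigma> z l \<and> i < dout (endpt \<sigma> z l)"
  by (induction l arbitrary: z) auto

lemma treelikeD:
  "treelike \<sigma> r z \<Longrightarrow> valid \<sigma> z l \<Longrightarrow> valid \<sigma> z l' \<Longrightarrow> length l \<le> r \<Longrightarrow> length l' \<le> r \<Longrightarrow>
   endpt \<sigma> z l = endpt \<sigma> z l' \<Longrightarrow> l = l'"
  unfolding treelike_def inj_on_def by blast

lemma treelike_mono: "treelike \<sigma> r z \<Longrightarrow> r' \<le> r \<Longrightarrow> treelike \<sigma> r' z"
  unfolding treelike_def by (erule inj_on_subset) auto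

lemma treelike_child:
  assumes "treelike \<sigma> (Suc r) z" "i < dout z"
  shows "treelike \<sigma> r (fst (\<sigma> (z, i)))"
  unfolding treelike_def
proof (rule inj_onI, clarify)
  fix l l' assume "valid \<sigma> (fst (\<sigma> (z, i))) l" "length l \<le> r" "valid \<sigma> (fst (\<sigma> (z, i))) l'" "length l' \<le> r"
    "endpt \<sigma> (fst (\<sigma> (z, i))) l = endpt \<sigma> (fst (\<sigma> (z, i))) l'"
  then have "i # l = i # l'" using assms(2) by (intro treelikeD[OF assms(1)]) auto
  then show "l = l'" by simp
qed

lemma walk_nonzero_word:
  "walk \<sigma> k z (\<lambda>y. of_bool (P y)) \<noteq> 0 \<Longrightarrow> \<exists>l. valid \<sigma> z l \<and> length l = k \<and> P (endpt \<sigma> z l)"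
proof (induction k arbitrary: z)
  case 0
  then show ?case by (intro exI[of _ "[]"]) (auto split: if_splits)
next
  case (Suc k)
  then have "(\<Sum>i<dout z. walk \<sigma> k (fst (\<sigma> (z, i))) (\<lambda>y. of_bool (P y))) \<noteq> 0" by auto
  then obtain i where i: "i < dout z" "walk \<sigma> k (fst (\<sigma> (z, i))) (\<lambda>y. of_bool (P y)) \<noteq> 0"
    by (metis (no_types, lifting) lessThan_iff sum.neutral)
  obtain l where "valid \<sigma> (fst (\<sigma> (z, i))) l \<and> length l = k \<and> P (endpt \<sigma> (fst (\<sigma> (z, i))) l)"
    using Suc(1)[OF i(2)] by blast
  then show ?case using i by (intro exI[of _ "i # l"]) auto
qed

lemma average_single_le:
  fixes f :: "nat \<Rightarrow> real"
  assumes z: "z \<in> V" and c: "c \<ge> 0" and f: "\<And>i. i < dout z \<Longrightarrow> f i \<le> c"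
    and one: "\<And>i j. i < dout z \<Longrightarrow> j < dout z \<Longrightarrow> i \<noteq> j \<Longrightarrow> f i = 0 \<or> f j = 0"
  shows "(\<Sum>i<dout z. f i) / dout z \<le> c / 2"
proof -
  have d: "real (dout z) \<ge> 2" using dout_ge[OF z] by simp
  have "(\<Sum>i<dout z. f i) \<le> c"
  proof (cases "\<exists>i<dout z. f i \<noteq> 0")
    case True
    then obtain i where i: "i < dout z" "f i \<noteq> 0" by blast
    have "(\<Sum>j<dout z. f j) = (\<Sum>j\<in>{i}. f j)"
      using i one by (intro sum.mono_neutral_right) auto
    then show ?thesis using f i by simp
  next
    case False
    then show ?thesis using c by simp
  qed
  then have "(\<Sum>i<dout z. f i) / dout z \<le> c / dout z" by (intro divide_right_mono) auto
  also have "\<dots> \<le> c / 2" using d c by (intro divide_left_mono) auto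
  finally show ?thesis .
qed

text \<open>Two children of \<open>z\<close> cannot both lead to \<open>y\<close>, and there are at
  least two children, so each step halves the probability.\<close>

lemma treelike_walk_le:
  assumes "\<sigma> \<in> M" "z \<in> V" "treelike \<sigma> k z"
  shows "walk \<sigma> k z (\<lambda>x. of_bool (x = y)) \<le> (1 / 2) ^ k"
  using assms(2,3)
proof (induction k arbitrary: z)
  case (Suc k)
  have "(\<Sum>i<dout z. walk \<sigma> k (fst (\<sigma> (z, i))) (\<lambda>x. of_bool (x = y))) / dout z \<le> (1 / 2) ^ k / 2"
  proof (rule average_single_le[OF Suc(2)])
    fix i assume i: "i < dout z"
    then show "walk \<sigma> k (fst (\<sigma> (z, i))) (\<lambda>x. of_bool (x = y)) \<le> (1 / 2) ^ k"
      using Suc M_fst[OF assms(1)] by (intro Suc(1) treelike_child) (auto simp: tails_iff)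
    fix j assume j: "j < dout z" "i \<noteq> j"
    show "walk \<sigma> k (fst (\<sigma> (z, i))) (\<lambda>x. of_bool (x = y)) = 0 \<or> walk \<sigma> k (fst (\<sigma> (z, j))) (\<lambda>x. of_bool (x = y)) = 0"
    proof (rule ccontr)
      assume "\<not> ?thesis"
      then obtain l l' where
        "valid \<sigma> (fst (\<sigma> (z, i))) l \<and> length l = k \<and> endpt \<sigma> (fst (\<sigma> (z, i))) l = y"
        "valid \<sigma> (fst (\<sigma> (z, j))) l' \<and> length l' = k \<and> endpt \<sigma> (fst (\<sigma> (z, j))) l' = y"
        using walk_nonzero_word[of \<sigma> k _ "\<lambda>x. x = y"] by metis
      then have "i # l = j # l'" using i j by (intro treelikeD[OF Suc(3)]) auto
      then show False using j by simp
    qed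
  qed simp
  then show ?case by simp
qed simp

lemma treelike_walk_zero:
  "treelike \<sigma> (k + r) z \<Longrightarrow> walk \<sigma> k z (\<lambda>y. of_bool (\<not> treelike \<sigma> r y)) = 0"
proof (induction k arbitrary: z)
  case (Suc k)
  then have "walk \<sigma> k (fst (\<sigma> (z, i))) (\<lambda>y. of_bool (\<not> treelike \<sigma> r y)) = 0" if "i < dout z" for i
    using treelike_child[of \<sigma> "k + r" z i] that by simp
  then show ?case by simp
qed simp

text \<open>At every vertex at most one child has a ball of radius \<open>R\<close> that is not a
  tree, so avoiding the good children has probability at most 1/2 per step. A good child at the
  first step leaves \<open>k - 1\<close> further steps and the radius \<open>r\<close>, whence
  \<open>R + 1\<close>.\<close>

lemma walk_not_treelike_le:
  assumes "\<sigma> \<in> M" and "x \<in> V" and "k + r \<le> R + 1"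
    and twin: "\<And>v i j. v \<in> V \<Longrightarrow> i < dout v \<Longrightarrow> j < dout v \<Longrightarrow> i \<noteq> j \<Longrightarrow>
        treelike \<sigma> R (fst (\<sigma> (v, i))) \<or> treelike \<sigma> R (fst (\<sigma> (v, j)))"
  shows "walk \<sigma> k x (\<lambda>y. of_bool (\<not> treelike \<sigma> r y)) \<le> (1 / 2) ^ k"
  using assms(2,3)
proof (induction k arbitrary: x)
  case (Suc k)
  have "(\<Sum>i<dout x. walk \<sigma> k (fst (\<sigma> (x, i))) (\<lambda>y. of_bool (\<not> treelike \<sigma> r y))) / dout x \<le> (1 / 2) ^ k / 2"
  proof (rule average_single_le[OF Suc(2)])
    fix i assume i: "i < dout x"
    show "walk \<sigma> k (fst (\<sigma> (x, i))) (\<lambda>y. of_bool (\<not> treelike \<sigma> r y)) \<le> (1 / 2) ^ k"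
      using i Suc M_fst[OF assms(1)] by (intro Suc(1)) (auto simp: tails_iff)
    fix j assume j: "j < dout x" "i \<noteq> j"
    have z: "walk \<sigma> k c (\<lambda>y. of_bool (\<not> treelike \<sigma> r y)) = 0" if "treelike \<sigma> R c" for c
      by (rule treelike_walk_zero) (rule treelike_mono[OF that], use Suc in simp)
    show "walk \<sigma> k (fst (\<sigma> (x, i))) (\<lambda>y. of_bool (\<not> treelike \<sigma> r y)) = 0
        \<or> walk \<sigma> k (fst (\<sigma> (x, j))) (\<lambda>y. of_bool (\<not> treelike \<sigma> r y)) = 0"
      using twin[OF Suc(2) i j] z by blast
  qed simp
  then show ?case by simp
qed simp

abbreviation no_edges :: "nat \<times> nat \<rightharpoonup> nat \<times> nat" where "no_edges \<equiv> Map.empty"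

section \<open>Exploration of one out-ball\<close>

definition Words :: "nat \<Rightarrow> nat list set" where
  "Words r = {l. set l \<subseteq> {..<K} \<and> length l \<le> r}"

definition NW :: "nat \<Rightarrow> nat" where "NW r = card (Words r)"

lemma finite_Words: "finite (Words r)"
  unfolding Words_def by (rule finite_lists_length_le) simp

lemma NW_le: "NW r \<le> K ^ (r + 1)"
proof -
  have "NW r = (\<Sum>i\<le>r. K ^ i)"
    unfolding NW_def Words_def using card_lists_length_le[of "{..<K}" r] by simp
  also have "\<dots> \<le> K ^ (r + 1)"
  proof (induction r)
    case 0 then show ?case using K_ge by simp
  next
    case (Suc r)
    then have "(\<Sum>i\<le>Suc r. K ^ i) \<le> 2 * K ^ (r + 1)" by simp
    also have "\<dots> \<le> K * K ^ (r + 1)" using K_ge by (intro mult_right_mono) auto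
    finally show ?case by simp
  qed
  finally show ?thesis .
qed

text \<open>The active tails: the boundary through which the exploration can continue.\<close>

definition act :: "(nat \<times> nat \<rightharpoonup> nat \<times> nat) \<Rightarrow> nat set \<Rightarrow> (nat \<times> nat) set" where
  "act \<rho> S = {e \<in> tails. fst e \<in> S} - dom \<rho>"

lemma finite_act: "finite (act \<rho> S)" using finite_tails by (simp add: act_def)

text \<open>State of the exploration of the out-neighbourhood of \<open>c\<close>: \<open>S\<close> is the set of vertices found so
  far, \<open>ad\<close> their addresses in the tree and \<open>w\<close> the probabilities that the walk follows these
  addresses. Everything explored earlier is confined to the vertex set \<open>G\<close>, with revealed tails
  \<open>D0\<close>.\<close>

definition tree_state where
  "tree_state D0 G c r \<rho> S ad w \<longleftrightarrow>
     pm \<rho> \<and> S \<subseteq> V \<and> S \<inter> G = {} \<and> c \<in> S \<and> ad c = [] \<and> w c = 1 \<and> inj_on ad S \<and> ad ` S \<subseteq> Words r \<and>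
     (\<forall>e\<in>dom \<rho>. fst e \<in> S \<or> e \<in> D0) \<and>
     (\<forall>v\<in>S. \<forall>i x. \<rho> (v, i) = Some x \<longrightarrow>
        fst x \<in> S \<and> ad (fst x) = ad v @ [i] \<and> w (fst x) = w v / dout v) \<and>
     (\<forall>u\<in>S. u = c \<or> (\<exists>v\<in>S. \<exists>i x. i < dout v \<and> \<rho> (v, i) = Some x \<and> fst x = u \<and> ad u = ad v @ [i]
        \<and> w u = w v / dout v)) \<and>
     (\<Sum>e\<in>act \<rho> S. w (fst e) / dout (fst e)) = (1 :: real)"

lemma tree_stateD:
  assumes "tree_state D0 G c r \<rho> S ad w"
  shows "pm \<rho>" "S \<subseteq> V" "S \<inter> G = {}" "c \<in> S" "ad c = []" "w c = 1" "inj_on ad S" "ad ` S \<subseteq> Words r"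
    and "\<And>e. e \<in> dom \<rho> \<Longrightarrow> fst e \<in> S \<or> e \<in> D0"
    and "\<And>v i x. v \<in> S \<Longrightarrow> \<rho> (v, i) = Some x \<Longrightarrow>
        fst x \<in> S \<and> ad (fst x) = ad v @ [i] \<and> w (fst x) = w v / dout v"
    and "\<And>u. u \<in> S \<Longrightarrow> u = c \<or> (\<exists>v\<in>S. \<exists>i x. i < dout v \<and> \<rho> (v, i) = Some x \<and> fst x = u \<and>
        ad u = ad v @ [i] \<and> w u = w v / dout v)"
    and "(\<Sum>e\<in>act \<rho> S. w (fst e) / dout (fst e)) = 1"
  using assms unfolding tree_state_def by blast+

lemma sum_tails_of:
  assumes "u \<in> V"
  shows "(\<Sum>e\<in>{e \<in> tails. fst e = u}. \<phi> (fst e)) = dout u * (\<phi> u :: real)"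
proof -
  have "{e \<in> tails. fst e = u} = {u} \<times> {..<dout u}"
    using assms by (auto simp: tails_def half_edges_def)
  moreover have "(\<Sum>e\<in>{u} \<times> {..<dout u}. \<phi> (fst e)) = (\<Sum>e\<in>{u} \<times> {..<dout u}. \<phi> u)"
    by (rule sum.cong) auto
  ultimately show ?thesis by (simp add: card_cartesian_product)
qed

lemma tree_state_init:
  assumes "pm \<rho>" "fst ` dom \<rho> \<subseteq> G" "c \<in> V" "c \<notin> G"
  shows "tree_state (dom \<rho>) G c r \<rho> {c} (\<lambda>_. []) (\<lambda>_. 1)"
proof -
  have "act \<rho> {c} = {e \<in> tails. fst e = c}"
    using assms by (auto simp: act_def)
  then have "(\<Sum>e\<in>act \<rho> {c}. 1 / real (dout (fst e))) = 1"
    using sum_tails_of[OF assms(3), of "\<lambda>v. 1 / real (dout v)"] dout_ge[OF assms(3)] by simp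
  moreover have "\<rho> (c, i) = None" for i
  proof (rule ccontr)
    assume "\<rho> (c, i) \<noteq> None"
    then have "c \<in> fst ` dom \<rho>" by force
    then show False using assms by auto
  qed
  ultimately show ?thesis using assms by (auto simp: tree_state_def Words_def)
qed

lemma tree_state_address_free:
  assumes st: "tree_state D0 G c r \<rho> S ad w" and e: "(v, i) \<in> act \<rho> S" and u: "u \<in> S"
  shows "ad u \<noteq> ad v @ [i]"
proof
  assume eq: "ad u = ad v @ [i]"
  have vS: "v \<in> S" using e by (simp add: act_def)
  have "u \<noteq> c" using eq st by (auto simp: tree_state_def)
  then obtain v' i' x where v': "v' \<in> S" "\<rho> (v', i') = Some x" "ad u = ad v' @ [i']"
    using tree_stateD(11)[OF st u] by blast
  then have "ad v' = ad v" "i' = i" using eq by auto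
  then have "v' = v" using tree_stateD(7)[OF st] v' vS unfolding inj_on_def by blast
  then show False using v' \<open>i' = i\<close> e by (auto simp: act_def)
qed

lemma tree_state_card:
  assumes "tree_state D0 G c r \<rho> S ad w"
  shows "card S \<le> NW r"
  unfolding NW_def using tree_stateD(7,8)[OF assms] finite_Words card_inj_on_le by blast

lemma tree_state_word:
  assumes st: "tree_state D0 G c r \<rho> S ad w" and e: "(v, i) \<in> act \<rho> S" "length (ad v) < r"
  shows "ad v @ [i] \<in> Words r"
proof -
  have v: "v \<in> S" "v \<in> V" "i < dout v" using e by (auto simp: act_def tails_iff)
  have "ad v \<in> Words r" using st v by (auto simp: tree_state_def)
  moreover have "i < K" using v dout_le[of v] by simp
  ultimately show ?thesis using e by (auto simp: Words_def)
qed

text \<open>A shallow active tail has an address that is not yet taken. So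
  \<open>NW r - card S\<close>, the number of words still free, is the fuel of the
  exploration.\<close>

lemma tree_state_card_less:
  assumes st: "tree_state D0 G c r \<rho> S ad w" and e: "(v, i) \<in> act \<rho> S" "length (ad v) < r"
  shows "card S < NW r"
proof -
  have "ad v @ [i] \<notin> ad ` S" using tree_state_address_free[OF st e(1)] by force
  then have "ad ` S \<subset> Words r" using tree_state_word[OF st e] tree_stateD(8)[OF st] by blast
  then have "card (ad ` S) < NW r" unfolding NW_def by (rule psubset_card_mono[OF finite_Words])
  moreover have "card (ad ` S) = card S" using st by (intro card_image) (auto simp: tree_state_def)
  ultimately show ?thesis by simp
qed

lemma tree_state_step:
  assumes st: "tree_state D0 G c r \<rho> S ad w" and D0: "fst ` D0 \<subseteq> G"
    and e: "(v, i) \<in> act \<rho> S" "length (ad v) < r"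
    and x: "x \<in> heads - ran \<rho>" "fst x \<notin> G \<union> S"
  shows "tree_state D0 G c r (\<rho>((v, i) \<mapsto> x)) (insert (fst x) S) (ad(fst x := ad v @ [i]))
           (w(fst x := w v / dout v))"
proof -
  let ?u = "fst x" and ?\<rho> = "\<rho>((v, i) \<mapsto> x)" and ?S = "insert (fst x) S"
  let ?ad = "ad(fst x := ad v @ [i])" and ?w = "w(fst x := w v / dout v)"
  have pm: "pm \<rho>" and SV: "S \<subseteq> V" and cS: "c \<in> S" and inj: "inj_on ad S" using st by (auto simp: tree_state_def)
  have dom: "\<And>e. e \<in> dom \<rho> \<Longrightarrow> fst e \<in> S \<or> e \<in> D0" using st by (auto simp: tree_state_def)
  note out = tree_stateD(10)[OF st] and par = tree_stateD(11)[OF st]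
  have mass: "(\<Sum>e\<in>act \<rho> S. w (fst e) / dout (fst e)) = 1" using st by (simp add: tree_state_def)
  have v: "v \<in> S" "v \<in> V" "i < dout v" "(v, i) \<in> tails - dom \<rho>" using e by (auto simp: act_def tails_iff)
  have uV: "?u \<in> V" using x heads_fst by auto
  have uS: "?u \<notin> S" "?u \<notin> G" using x by auto
  have nu: "\<rho> (?u, j) = None" for j
  proof (rule ccontr)
    assume "\<rho> (?u, j) \<noteq> None"
    then have "(?u, j) \<in> dom \<rho>" by auto
    then have "?u \<in> S \<or> (?u, j) \<in> D0" using dom by force
    then show False using uS D0 by force
  qed
  have "pm ?\<rho>" using pm_upd[OF pm v(4) x(1)] .
  moreover have "inj_on ?ad ?S"
  proof -
    have "inj_on ?ad S" using inj uS by (auto simp: inj_on_def)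
    moreover have "ad v @ [i] \<notin> ad ` S" using tree_state_address_free[OF st e(1)] by force
    then have "?ad ?u \<notin> ?ad ` (S - {?u})" using uS by (auto simp: image_iff split: if_splits)
    ultimately show ?thesis by (simp add: inj_on_insert)
  qed
  moreover have "?ad ` ?S \<subseteq> Words r"
    using tree_state_word[OF st e] st by (auto simp: tree_state_def)
  moreover have "\<forall>e\<in>dom ?\<rho>. fst e \<in> ?S \<or> e \<in> D0" using dom v by auto
  moreover have "\<forall>v'\<in>?S. \<forall>j y. ?\<rho> (v', j) = Some y \<longrightarrow>
        fst y \<in> ?S \<and> ?ad (fst y) = ?ad v' @ [j] \<and> ?w (fst y) = ?w v' / dout v'"
  proof (intro ballI allI impI)
    fix v' j y assume a: "v' \<in> ?S" "?\<rho> (v', j) = Some y"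
    show "fst y \<in> ?S \<and> ?ad (fst y) = ?ad v' @ [j] \<and> ?w (fst y) = ?w v' / dout v'"
    proof (cases "(v', j) = (v, i)")
      case True
      then show ?thesis using a uS v by auto
    next
      case False
      then have r: "\<rho> (v', j) = Some y" using a(2) by auto
      then have "v' \<noteq> ?u" using nu by auto
      then have "v' \<in> S" using a by simp
      then have "fst y \<in> S \<and> ad (fst y) = ad v' @ [j] \<and> w (fst y) = w v' / dout v'" using out r by blast
      then show ?thesis using uS \<open>v' \<noteq> ?u\<close> by auto
    qed
  qed
  moreover have "\<forall>u\<in>?S. u = c \<or> (\<exists>v'\<in>?S. \<exists>j y. j < dout v' \<and> ?\<rho> (v', j) = Some y \<and> fst y = u \<and> ?ad u = ?ad v' @ [j]
        \<and> ?w u = ?w v' / dout v')"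
  proof
    fix u assume u: "u \<in> ?S"
    show "u = c \<or> (\<exists>v'\<in>?S. \<exists>j y. j < dout v' \<and> ?\<rho> (v', j) = Some y \<and> fst y = u \<and> ?ad u = ?ad v' @ [j]
        \<and> ?w u = ?w v' / dout v')"
    proof (cases "u = ?u")
      case True
      then show ?thesis using v uS by (intro disjI2 bexI[of _ v] exI[of _ i] exI[of _ x]) auto
    next
      case False
      then have "u \<in> S" using u by simp
      from par[OF this] show ?thesis
      proof
        assume "\<exists>v\<in>S. \<exists>i x. i < dout v \<and> \<rho> (v, i) = Some x \<and> fst x = u \<and> ad u = ad v @ [i] \<and> w u = w v / dout v"
        then obtain v' j y where b: "v' \<in> S" "j < dout v'" "\<rho> (v', j) = Some y" "fst y = u" "ad u = ad v' @ [j]" "w u = w v' / dout v'"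
          by blast
        have "(v', j) \<noteq> (v, i)" using b(3) v(4) by auto
        then show ?thesis using b uS False by (intro disjI2 bexI[of _ v'] exI[of _ j] exI[of _ y]) auto
      qed simp
    qed
  qed
  \<comment> \<open>Mass is conserved: the tails of the new vertex share the weight of the revealed
    tail.\<close>
  moreover have "(\<Sum>e\<in>act ?\<rho> ?S. ?w (fst e) / dout (fst e)) = 1"
  proof -
    let ?U = "{e \<in> tails. fst e = ?u}"
    have ac: "act ?\<rho> ?S = (act \<rho> S - {(v, i)}) \<union> ?U"
      using nu uS v by (auto simp: act_def dom_def)
    have disj: "(act \<rho> S - {(v, i)}) \<inter> ?U = {}" using uS by (auto simp: act_def)
    have "(\<Sum>e\<in>act ?\<rho> ?S. ?w (fst e) / dout (fst e))
       = (\<Sum>e\<in>act \<rho> S - {(v, i)}. ?w (fst e) / dout (fst e)) + (\<Sum>e\<in>?U. ?w (fst e) / dout (fst e))"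
      unfolding ac using disj finite_tails finite_act by (intro sum.union_disjoint) auto
    also have "(\<Sum>e\<in>act \<rho> S - {(v, i)}. ?w (fst e) / dout (fst e)) = (\<Sum>e\<in>act \<rho> S - {(v, i)}. w (fst e) / dout (fst e))"
      using uS by (intro sum.cong) (auto simp: act_def)
    also have "\<dots> = 1 - w v / dout v" using mass e(1) finite_act by (simp add: sum_diff1)
    also have "(\<Sum>e\<in>?U. ?w (fst e) / dout (fst e)) = w v / dout v"
      using sum_tails_of[OF uV, of "\<lambda>y. ?w y / dout y"] dout_ge[OF uV] by simp
    finally show ?thesis by linarith
  qed
  moreover have "?S \<subseteq> V" "?S \<inter> G = {}" "c \<in> ?S" using uV SV uS tree_stateD(3)[OF st] cS by auto
  moreover have "?ad c = []" "?w c = 1" using tree_stateD(5,6)[OF st] cS uS by auto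
  ultimately show ?thesis
    unfolding tree_state_def by (intro conjI) assumption+
qed

text \<open>When no shallow tail is active, every valid word of length at most \<open>r\<close> is
  read inside \<open>S\<close> and is the address of its end point, so distinct words have distinct
  end points.\<close>

lemma tree_state_complete:
  assumes st: "tree_state D0 G c r \<rho> S ad w"
    and full: "\<And>e. e \<in> act \<rho> S \<Longrightarrow> r \<le> length (ad (fst e))"
    and s: "\<sigma> \<in> ext \<rho>"
  shows "treelike \<sigma> r c"
proof -
  have "endpt \<sigma> c l \<in> S \<and> ad (endpt \<sigma> c l) = l" if "valid \<sigma> c l" "length l \<le> r" for l
    using that
  proof (induction l rule: rev_induct)
    case Nil
    then show ?case using st by (simp add: tree_state_def)
  next
    case (snoc i l)
    let ?v = "endpt \<sigma> c l"
    have v: "?v \<in> S" "ad ?v = l" "i < dout ?v" using snoc by (auto simp: valid_snoc)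
    have "(?v, i) \<notin> act \<rho> S" using full[of "(?v, i)"] v snoc(3) by auto
    moreover have "(?v, i) \<in> tails" using v tree_stateD(2)[OF st] by (auto simp: tails_iff)
    ultimately obtain x where x: "\<rho> (?v, i) = Some x" using v by (auto simp: act_def)
    then have "\<sigma> (?v, i) = x" using s ext_D by blast
    moreover have "fst x \<in> S \<and> ad (fst x) = ad ?v @ [i]" using tree_stateD(10)[OF st v(1) x] by blast
    ultimately show ?case using v by (simp add: endpt_snoc)
  qed
  then show ?thesis unfolding treelike_def by (intro inj_onI) (metis mem_Collect_eq)
qed

lemma tree_state_endpt:
  assumes st: "tree_state D0 G c r \<rho> S ad w" and s: "\<sigma> \<in> ext \<rho>" and u: "u \<in> S"
  shows "valid \<sigma> c (ad u) \<and> endpt \<sigma> c (ad u) = u"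
  using u
proof (induction "length (ad u)" arbitrary: u)
  case 0
  have "c \<in> S" "ad c = []" "inj_on ad S" using st by (auto simp: tree_state_def)
  then have "u = c" using 0 by (auto simp: inj_on_def)
  then show ?case using \<open>ad c = []\<close> by simp
next
  case (Suc k)
  have "u \<noteq> c" using Suc(2) st by (auto simp: tree_state_def)
  then obtain v i x where v: "v \<in> S" "i < dout v" "\<rho> (v, i) = Some x" "fst x = u" "ad u = ad v @ [i]"
    using tree_stateD(11)[OF st Suc(3)] by blast
  have "valid \<sigma> c (ad v) \<and> endpt \<sigma> c (ad v) = v" using Suc v by auto
  moreover have "\<sigma> (v, i) = x" using v s ext_D by blast
  ultimately show ?case using v by (simp add: endpt_snoc valid_snoc)
qed

text \<open>The vertex that is hit already has an address, different from that of the path just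
  completed: two words with one end point.\<close>

lemma tree_state_collision:
  assumes st: "tree_state D0 {} c r \<rho> S ad w" and e: "(v, i) \<in> act \<rho> S" "length (ad v) < r"
    and x: "fst x \<in> S" and s: "\<sigma> \<in> ext (\<rho>((v, i) \<mapsto> x))"
  shows "\<not> treelike \<sigma> r c"
proof
  assume t: "treelike \<sigma> r c"
  have v: "v \<in> S" "i < dout v" "(v, i) \<notin> dom \<rho>" using e by (auto simp: act_def tails_iff)
  have s': "\<sigma> \<in> ext \<rho>" 
  proof -
    have "\<rho> \<subseteq>\<^sub>m \<rho>((v, i) \<mapsto> x)" unfolding map_le_def
    proof
      fix a assume "a \<in> dom \<rho>"
      then have "a \<noteq> (v, i)" using v by blast
      then show "\<rho> a = (\<rho>((v, i) \<mapsto> x)) a" by simp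
    qed
    then show ?thesis using s ext_antimono by blast
  qed
  have sx: "\<sigma> (v, i) = x" using s ext_D[of \<sigma> "\<rho>((v, i) \<mapsto> x)" "(v, i)" x] by simp
  have "ad (fst x) = ad v @ [i]"
  proof (rule treelikeD[OF t])
    have "ad (fst x) \<in> Words r" using st x by (auto simp: tree_state_def)
    then show "length (ad (fst x)) \<le> r" by (simp add: Words_def)
  qed (use tree_state_endpt[OF st s' x] tree_state_endpt[OF st s' v(1)] v sx e in \<open>auto simp: valid_snoc endpt_snoc\<close>)
  then show False using tree_state_address_free[OF st e(1) x] by simp
qed

text \<open>A union bound over at most \<open>NW r - card S\<close> reveals, each hitting
  \<open>G\<close> or the tree explored so far with probability at most \<open>p\<close>;
  \<open>f\<close> costs \<open>q\<close> after a hit and \<open>q'\<close> if the ball is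
  completed. Leaving \<open>f\<close>, \<open>q\<close> and \<open>q'\<close> abstract permits three
  uses: \<open>q = 1\<close> for one failing ball, \<open>q\<close> again a small probability for
  two failing balls, and \<open>q = 0\<close> when only completed balls are continued.\<close>

lemma tree_exploration:
  fixes p q q' :: real
  assumes st: "tree_state D0 G c r \<rho> S ad w" and D0: "fst ` D0 \<subseteq> G" and G: "G \<subseteq> V"
    and q: "q \<ge> 0" and q': "q' \<ge> 0"
    and collision: "\<And>\<rho>' S' ad' w' e x. tree_state D0 G c r \<rho>' S' ad' w' \<Longrightarrow> e \<in> act \<rho>' S' \<Longrightarrow>
        length (ad' (fst e)) < r \<Longrightarrow> x \<in> heads - ran \<rho>' \<Longrightarrow> fst x \<in> G \<union> S' \<Longrightarrow>
        card (dom \<rho>') < d \<Longrightarrow> cexp (\<rho>'(e \<mapsto> x)) f \<le> q"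
    and completion: "\<And>\<rho>' S' ad' w'. tree_state D0 G c r \<rho>' S' ad' w' \<Longrightarrow>
        (\<And>e. e \<in> act \<rho>' S' \<Longrightarrow> r \<le> length (ad' (fst e))) \<Longrightarrow> card (dom \<rho>') \<le> d \<Longrightarrow> cexp \<rho>' f \<le> q'"
    and p: "real (card G + NW r) * \<Delta> \<le> p * n" "p \<ge> 0"
    and d: "card (dom \<rho>) + (NW r - card S) \<le> d" "d \<le> n"
  shows "cexp \<rho> f \<le> q' + real (NW r - card S) * p * q"
  using st d(1)
proof (induction "NW r - card S" arbitrary: \<rho> S ad w)
  case less: 0
  note st = less(2)
  have "r \<le> length (ad (fst e))" if "e \<in> act \<rho> S" for e
    using tree_state_card_less[OF st, of "fst e" "snd e"] that less(1) by fastforce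
  then have "cexp \<rho> f \<le> q'" using less(3) by (intro completion[OF st]) auto
  then show ?case using p q by (simp add: less(1)[symmetric])
next
  case (Suc k)
  note IH = Suc(1) and k = Suc(2) and st = Suc(3) and d' = Suc(4)
  have pm: "pm \<rho>" and SV: "S \<subseteq> V" and SG: "S \<inter> G = {}" using st by (auto simp: tree_state_def)
  have pq: "p * q \<ge> 0" using p q by simp
  show ?case
  proof (cases "\<exists>e\<in>act \<rho> S. length (ad (fst e)) < r")
    case False
    then have "cexp \<rho> f \<le> q'" using d' by (intro completion[OF st]) (auto simp: not_less)
    then show ?thesis using p q by (smt (verit) mult_nonneg_nonneg of_nat_0_le_iff)
  next
    case True
    then obtain v i where e: "(v, i) \<in> act \<rho> S" "length (ad v) < r" by auto
    have e': "(v, i) \<in> tails - dom \<rho>" using e by (simp add: act_def)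
    have N: "card (tails - dom \<rho>) \<ge> n" using card_remaining[OF pm] d' d(2) by simp
    let ?N = "real (card (tails - dom \<rho>))"
    let ?c = "q' + real k * p * q"
    have c0: "?c \<ge> 0" using q' pq by (simp add: mult.assoc)
    show ?thesis
    proof (rule cexp_le_step[OF pm e'])
      fix x assume x: "x \<in> heads - ran \<rho>"
      show "cexp (\<rho>((v, i) \<mapsto> x)) f \<le> q * of_bool (fst x \<in> G \<union> S) + ?c"
      proof (cases "fst x \<in> G \<union> S")
        case True
        then have "cexp (\<rho>((v, i) \<mapsto> x)) f \<le> q"
          using collision[OF st e(1)] e(2) x d' k by auto
        then show ?thesis using c0 True by simp
      next
        case False
        note st' = tree_state_step[OF st D0 e x False]
        have fin: "finite S" using SV finite_subset by blast
        have cS: "card (insert (fst x) S) = Suc (card S)" using False fin by simp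
        have k': "k = NW r - card (insert (fst x) S)" using k cS by simp
        have cd: "card (dom (\<rho>((v, i) \<mapsto> x))) = Suc (card (dom \<rho>))"
          using e' pm_finite[OF pm] by simp
        have "cexp (\<rho>((v, i) \<mapsto> x)) f \<le> q' + real (NW r - card (insert (fst x) S)) * p * q"
          by (rule IH[OF k' st']) (use cd cS d' k in linarith)
        then show ?thesis using False k' by simp
      qed
    next
      have "(\<Sum>x\<in>heads - ran \<rho>. q * of_bool (fst x \<in> G \<union> S) + ?c)
          = q * (\<Sum>x\<in>heads - ran \<rho>. of_bool (fst x \<in> G \<union> S)) + ?c * ?N"
        by (simp add: sum.distrib sum_distrib_left card_rem[OF pm])
      also have "\<dots> \<le> q * D (G \<union> S) + ?c * ?N"
        using remaining_heads_in[of "G \<union> S" \<rho>] SV G q by (intro add_right_mono mult_left_mono) auto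
      also have "D (G \<union> S) \<le> p * ?N"
      proof -
        have "D (G \<union> S) \<le> card (G \<union> S) * \<Delta>" using SV G by (intro D_le_card) auto
        also have "\<dots> \<le> real (card G + NW r) * \<Delta>"
        proof (rule mult_right_mono)
          show "0 \<le> \<Delta>" using max_din[of 1] n_pos by (meson atLeastAtMost_iff of_nat_0_le_iff order_refl order_trans)
          show "real (card (G \<union> S)) \<le> real (card G + NW r)"
            using card_Un_le[of G S] tree_state_card[OF st] by linarith
        qed
        also have "\<dots> \<le> p * n" by (rule p)
        also have "\<dots> \<le> p * ?N" using N p by (intro mult_left_mono) auto
        finally show ?thesis .
      qed
      then have "q * D (G \<union> S) + ?c * ?N \<le> q * (p * ?N) + ?c * ?N" using q by (intro add_right_mono mult_left_mono)
      also have "\<dots> = (q' + real (NW r - card S) * p * q) * ?N"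
        unfolding k[symmetric] by (simp add: algebra_simps)
      finally show "(\<Sum>x\<in>heads - ran \<rho>. q * of_bool (fst x \<in> G \<union> S) + ?c)
         \<le> (q' + real (NW r - card S) * p * q) * ?N" .
    qed
  qed
qed

lemma tree_exploration_start:
  fixes p q :: real
  assumes "pm \<rho>" "fst ` dom \<rho> \<subseteq> G" "G \<subseteq> V" "c \<in> V" "c \<notin> G" and q: "q \<ge> 0"
    and collision: "\<And>\<rho>' S' ad' w' e x. tree_state (dom \<rho>) G c r \<rho>' S' ad' w' \<Longrightarrow> e \<in> act \<rho>' S' \<Longrightarrow>
        length (ad' (fst e)) < r \<Longrightarrow> x \<in> heads - ran \<rho>' \<Longrightarrow> fst x \<in> G \<union> S' \<Longrightarrow>
        card (dom \<rho>') < card (dom \<rho>) + NW r \<Longrightarrow> cexp (\<rho>'(e \<mapsto> x)) f \<le> q"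
    and zero: "\<And>\<sigma>. \<sigma> \<in> M \<Longrightarrow> treelike \<sigma> r c \<Longrightarrow> f \<sigma> \<le> 0"
    and p: "real (card G + NW r) * \<Delta> \<le> p * n" "p \<ge> 0"
    and d: "card (dom \<rho>) + NW r \<le> n"
  shows "cexp \<rho> f \<le> NW r * p * q"
proof -
  have "cexp \<rho> f \<le> 0 + real (NW r - card {c}) * p * q"
  proof (rule tree_exploration[OF tree_state_init[OF assms(1,2,4,5)] assms(2,3) q _ collision])
    fix \<rho>' S' ad' w'
    assume st: "tree_state (dom \<rho>) G c r \<rho>' S' ad' w'" and full: "\<And>e. e \<in> act \<rho>' S' \<Longrightarrow> r \<le> length (ad' (fst e))"
    have "pm \<rho>'" using st by (simp add: tree_state_def)
    then show "cexp \<rho>' f \<le> 0"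
      using zero tree_state_complete[OF st full] ext_M by (intro cexp_le_const) auto
  qed (use p d in auto)
  also have "\<dots> \<le> NW r * p * q" using p q by (auto intro!: mult_right_mono)
  finally show ?thesis .
qed

section \<open>Probability that one ball, or two sibling balls, fail to be trees\<close>

lemma not_treelike_prob:
  fixes p :: real
  assumes "z \<in> V" and p: "real (NW r) * \<Delta> \<le> p * n" "p \<ge> 0" and d: "NW r \<le> n"
  shows "cexp no_edges (\<lambda>\<sigma>. of_bool (\<not> treelike \<sigma> r z)) \<le> NW r * p"
proof -
  have "cexp no_edges (\<lambda>\<sigma>. of_bool (\<not> treelike \<sigma> r z)) \<le> NW r * p * 1"
  proof (rule tree_exploration_start[of _ "{}"])
    fix \<rho>' S' ad' w' e x
    assume "tree_state (dom no_edges) {} z r \<rho>' S' ad' w'" "e \<in> act \<rho>' S'" "x \<in> heads - ran \<rho>'"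
    then have "pm (\<rho>'(e \<mapsto> x))" by (intro pm_upd tree_stateD(1)) (auto simp: act_def)
    then show "cexp (\<rho>'(e \<mapsto> x)) (\<lambda>\<sigma>. of_bool (\<not> treelike \<sigma> r z)) \<le> 1"
      by (rule cexp_le_const) simp
  qed (use assms pm_empty in auto)
  then show ?thesis by simp
qed

text \<open>Stated relative to what the interrupted exploration of the first child has revealed. The
  few vertices seen there form the forbidden set \<open>G\<close>, and touching it counts as a
  collision.\<close>

lemma second_child_not_treelike:
  fixes p :: real
  assumes pm: "pm \<rho>" and G: "fst ` dom \<rho> \<subseteq> G" "G \<subseteq> V" "z \<in> G" and e: "(z, j) \<in> tails - dom \<rho>"
    and cG: "card G \<le> NW r + 1" and cd: "card (dom \<rho>) \<le> NW r + 1"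
    and p: "real (2 * NW r + 1) * \<Delta> \<le> p * n" "p \<ge> 0" and d: "2 * NW r + 2 \<le> n"
  shows "cexp \<rho> (\<lambda>\<sigma>. of_bool (\<not> treelike \<sigma> r (fst (\<sigma> (z, j))))) \<le> (NW r + 1) * p"
proof -
  let ?f = "\<lambda>\<sigma>. of_bool (\<not> treelike \<sigma> r (fst (\<sigma> (z, j)))) :: real"
  have D0: "\<Delta> \<ge> 0" using max_din[of 1] n_pos by (meson atLeastAtMost_iff of_nat_0_le_iff order_refl order_trans)
  have p': "real (card G + NW r) * \<Delta> \<le> p * n"
    using p(1) cG D0 by (elim order_trans[rotated]) (auto intro!: mult_right_mono)
  have N: "card (tails - dom \<rho>) \<ge> n" using card_remaining[OF pm] cd d by simp
  have "cexp \<rho> ?f \<le> D G / n + 0 * \<beta> + NW r * p"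
  proof (rule cexp_le_reveal[OF pm e G(2) N])
    fix x assume x: "x \<in> heads - ran \<rho>"
    note pu = pm_upd'[OF pm e x]
    show "cexp (\<rho>((z, j) \<mapsto> x)) ?f \<le> 1" using pu by (intro cexp_le_const) auto
    assume xG: "fst x \<notin> G"
    have eq: "cexp (\<rho>((z, j) \<mapsto> x)) ?f = cexp (\<rho>((z, j) \<mapsto> x)) (\<lambda>\<sigma>. of_bool (\<not> treelike \<sigma> r (fst x)))"
      by (rule cexp_upd_head[of _ _ _ "\<lambda>\<sigma> y. of_bool (\<not> treelike \<sigma> r (fst y))"])
    have "cexp (\<rho>((z, j) \<mapsto> x)) ?f \<le> NW r * p * 1"
      unfolding eq
    proof (rule tree_exploration_start[where G = G])
      show "fst ` dom (\<rho>((z, j) \<mapsto> x)) \<subseteq> G" using G by auto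
      show "card (dom (\<rho>((z, j) \<mapsto> x))) + NW r \<le> n"
        using e cd d pm_finite[OF pm] by simp
      fix \<rho>' S' ad' w' e' x'
      assume "tree_state (dom (\<rho>((z, j) \<mapsto> x))) G (fst x) r \<rho>' S' ad' w'" "e' \<in> act \<rho>' S'" "x' \<in> heads - ran \<rho>'"
      then have "pm (\<rho>'(e' \<mapsto> x'))" by (intro pm_upd tree_stateD(1)) (auto simp: act_def)
      then show "cexp (\<rho>'(e' \<mapsto> x')) (\<lambda>\<sigma>. of_bool (\<not> treelike \<sigma> r (fst x))) \<le> 1"
        by (rule cexp_le_const) simp
    qed (use pu xG G p' p in auto)
    then show "cexp (\<rho>((z, j) \<mapsto> x)) ?f \<le> 0 * real (din (fst x)) + NW r * p" by simp
  qed (use p in auto)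
  also have "D G / n \<le> p"
  proof -
    have "D G \<le> card G * \<Delta>" by (rule D_le_card[OF G(2)])
    also have "\<dots> \<le> real (card G + NW r) * \<Delta>" using D0 by (intro mult_right_mono) auto
    finally show ?thesis using p' n_pos by (simp add: divide_le_eq)
  qed
  finally show ?thesis by (simp add: algebra_simps)
qed

text \<open>Two collisions are needed, one in each ball. The exploration of the first ball stops at
  its collision; at that moment few vertices are seen and the tail \<open>(z, j)\<close> is still
  unrevealed, so the second ball pays the same price again. The square keeps the bound small after
  summation over all vertices.\<close>

lemma twin_prob:
  fixes p :: real
  assumes z: "z \<in> V" "i < dout z" "j < dout z" "i \<noteq> j"
    and p: "real (2 * NW r + 1) * \<Delta> \<le> p * n" "p \<ge> 0" and d: "2 * NW r + 2 \<le> n"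
  shows "cexp no_edges (\<lambda>\<sigma>. of_bool (\<not> treelike \<sigma> r (fst (\<sigma> (z, i))) \<and> \<not> treelike \<sigma> r (fst (\<sigma> (z, j)))))
       \<le> ((NW r + 1) * p)\<^sup>2"
proof -
  let ?g = "\<lambda>\<sigma> y. of_bool (\<not> treelike \<sigma> r y \<and> \<not> treelike \<sigma> r (fst (\<sigma> (z, j)))) :: real"
  let ?f = "\<lambda>\<sigma>. ?g \<sigma> (fst (\<sigma> (z, i)))"
  let ?q = "(NW r + 1) * p"
  have q0: "?q \<ge> 0" using p by simp
  have D0: "\<Delta> \<ge> 0" using max_din[of 1] n_pos by (meson atLeastAtMost_iff of_nat_0_le_iff order_refl order_trans)
  have p1: "real (1 + NW r) * \<Delta> \<le> p * n"
    using p(1) D0 by (elim order_trans[rotated]) (auto intro!: mult_right_mono)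
  have N: "card (tails - dom no_edges) \<ge> n" using card_remaining[OF pm_empty] by simp
  have e: "(z, i) \<in> tails - dom no_edges" using z by (simp add: tails_iff)
  have second: "cexp \<rho> (\<lambda>\<sigma>. ?g \<sigma> y) \<le> ?q"
    if "pm \<rho>" "fst ` dom \<rho> \<subseteq> G" "G \<subseteq> V" "z \<in> G" "(z, j) \<notin> dom \<rho>" "card G \<le> NW r + 1" "card (dom \<rho>) \<le> NW r + 1"
    for \<rho> G y
  proof -
    have "cexp \<rho> (\<lambda>\<sigma>. ?g \<sigma> y) \<le> cexp \<rho> (\<lambda>\<sigma>. of_bool (\<not> treelike \<sigma> r (fst (\<sigma> (z, j)))))"
      by (rule cexp_mono) auto
    also have "\<dots> \<le> ?q"
      using that z by (intro second_child_not_treelike[OF _ _ _ _ _ _ _ p d]) (auto simp: tails_iff)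
    finally show ?thesis .
  qed
  have NW1: "NW r \<ge> 1"
  proof -
    have "Words r \<noteq> {}" by (auto simp: Words_def intro: exI[of _ "[]"])
    then show ?thesis using finite_Words by (simp add: NW_def Suc_le_eq card_gt_0_iff)
  qed
  have "cexp no_edges ?f \<le> NW r * p * ?q + p * ?q"
  proof (rule cexp_le_step[OF pm_empty e])
    fix x assume x: "x \<in> heads - ran no_edges"
    note pu = pm_upd'[OF pm_empty e x]
    have eq: "cexp (no_edges((z, i) \<mapsto> x)) ?f = cexp (no_edges((z, i) \<mapsto> x)) (\<lambda>\<sigma>. ?g \<sigma> (fst x))"
      by (rule cexp_upd_head[of _ _ _ "\<lambda>\<sigma> y. ?g \<sigma> (fst y)"])
    show "cexp (no_edges((z, i) \<mapsto> x)) ?f \<le> NW r * p * ?q + of_bool (fst x \<in> {z}) * ?q"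
    proof (cases "fst x = z")
      \<comment> \<open>A loop at \<open>z\<close> counts as the first collision.\<close>
      case True
      have "cexp (no_edges((z, i) \<mapsto> x)) ?f \<le> ?q"
        unfolding eq by (rule second[of _ "{z}"]) (use pu z in auto)
      then show ?thesis using True mult_nonneg_nonneg[OF mult_nonneg_nonneg[OF of_nat_0_le_iff p(2)] q0, of "NW r"]
        by (simp del: fun_upd_apply)
    next
      case False
      have "cexp (no_edges((z, i) \<mapsto> x)) ?f \<le> NW r * p * ?q"
        unfolding eq
      proof (rule tree_exploration_start[where G = "{z}"])
        show "card (dom (no_edges((z, i) \<mapsto> x))) + NW r \<le> n" using d by simp
        show "real (card {z} + NW r) * \<Delta> \<le> p * n" using p1 by simp
        fix \<rho>' S' ad' w' e' x'
        assume st: "tree_state (dom (no_edges((z, i) \<mapsto> x))) {z} (fst x) r \<rho>' S' ad' w'" and e': "e' \<in> act \<rho>' S'"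
          and x': "x' \<in> heads - ran \<rho>'" and l: "length (ad' (fst e')) < r" and col: "fst x' \<in> {z} \<union> S'"
          and cd: "card (dom \<rho>') < card (dom (no_edges((z, i) \<mapsto> x))) + NW r"
        have pm': "pm (\<rho>'(e' \<mapsto> x'))" using tree_stateD(1)[OF st] e' x' by (intro pm_upd) (auto simp: act_def)
        have dom: "\<forall>e\<in>dom \<rho>'. fst e \<in> S' \<or> e = (z, i)" using tree_stateD(9)[OF st] by (auto split: if_splits)
        have S': "S' \<subseteq> V" "z \<notin> S'" using tree_stateD(2,3)[OF st] by auto
        have eS: "fst e' \<in> S'" using e' by (simp add: act_def)
        show "cexp (\<rho>'(e' \<mapsto> x')) (\<lambda>\<sigma>. ?g \<sigma> (fst x)) \<le> ?q"
        proof (rule second[OF pm', of "insert z S'"])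
          show "fst ` dom (\<rho>'(e' \<mapsto> x')) \<subseteq> insert z S'" using dom eS by auto
          have "(z, j) \<notin> dom \<rho>'" using dom S'(2) z(4) by force
          then show "(z, j) \<notin> dom (\<rho>'(e' \<mapsto> x'))" using S'(2) eS by auto
          have "card S' < NW r"
            using tree_state_card_less[OF st, of "fst e'" "snd e'"] e' l by simp
          then show "card (insert z S') \<le> NW r + 1" using card_insert_le_m1[of "NW r + 1" S' z] by simp
          have "card (dom (\<rho>'(e' \<mapsto> x'))) \<le> Suc (card (dom \<rho>'))" using card_insert_le_m1[of "Suc (card (dom \<rho>'))" "dom \<rho>'" e'] by simp
          then show "card (dom (\<rho>'(e' \<mapsto> x'))) \<le> NW r + 1" using cd by simp
        qed (use S' z in auto)
      qed (use pu False z q0 p in auto)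
      then show ?thesis using False q0 by simp
    qed
  next
    let ?N = "real (card (tails - dom no_edges))"
    have "(\<Sum>x\<in>heads - ran no_edges. NW r * p * ?q + of_bool (fst x \<in> {z}) * ?q)
       = NW r * p * ?q * ?N + (\<Sum>x\<in>heads - ran no_edges. of_bool (fst x \<in> {z})) * ?q"
      by (simp add: sum.distrib sum_distrib_right card_rem[OF pm_empty] card_eq)
    also have "\<dots> \<le> NW r * p * ?q * ?N + (p * ?N) * ?q"
    proof (intro add_left_mono mult_right_mono q0)
      have "(\<Sum>x\<in>heads - ran no_edges. of_bool (fst x \<in> {z})) \<le> D {z}" using z by (intro remaining_heads_in) auto
      also have "\<dots> \<le> real (1 + NW r) * \<Delta>" using D_le_card[of "{z}"] z D0 by (simp add: algebra_simps)
        (smt (verit) mult_nonneg_nonneg of_nat_0_le_iff)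
      also have "\<dots> \<le> p * n" by (rule p1)
      also have "\<dots> \<le> p * ?N" using N p by (intro mult_left_mono) auto
      finally show "(\<Sum>x\<in>heads - ran no_edges. of_bool (fst x \<in> {z})) \<le> p * ?N" .
    qed
    finally show "(\<Sum>x\<in>heads - ran no_edges. NW r * p * ?q + of_bool (fst x \<in> {z}) * ?q) \<le> (NW r * p * ?q + p * ?q) * ?N"
      by (simp add: algebra_simps)
  qed
  also have "\<dots> = ((NW r + 1) * p)\<^sup>2" by (simp add: power2_eq_square algebra_simps)
  finally show ?thesis .
qed

end

section \<open>Exploration of the likely paths\<close>

context dcm
begin

section \<open>Entropy rate and path weights\<close>

definition Hr :: real where "Hr = entropy_rate n din dout"

abbreviation L :: real where "L \<equiv> ln (real K)"

lemma L_pos: "L > 0" using K_ge by simp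

lemma ln_dout: "v \<in> V \<Longrightarrow> 0 \<le> ln (real (dout v)) \<and> ln (real (dout v)) \<le> L"
  using dout_ge[of v] dout_le[of v] by simp

lemma card_heads_pos: "card heads > 0"
  using two_n_le_card_tails n_pos card_eq by linarith

lemma Hr_eq: "Hr * card heads = (\<Sum>v\<in>V. real (din v) * ln (real (dout v)))"
  unfolding Hr_def entropy_rate_def card_heads[symmetric]
  using card_heads_pos by (simp add: sum_divide_distrib[symmetric])

text \<open>The entropy rate is the mean log-out-degree at a uniform head, so the deviation of a
  path has almost no drift as long as few heads are used up.\<close>

lemma sum_centered_ln: "(\<Sum>x\<in>heads. ln (real (dout (fst x))) - Hr) = 0"
  using sum_heads[of "\<lambda>v. ln (real (dout v))"] Hr_eq by (simp add: sum_subtractf mult.commute)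

lemma Hr_bounds: "ln 2 \<le> Hr" "Hr \<le> L"
proof -
  have c: "real (card heads) = (\<Sum>v\<in>V. real (din v))" by (simp add: card_heads)
  have "ln 2 * card heads \<le> Hr * card heads"
    unfolding Hr_eq unfolding c sum_distrib_left
  proof (intro sum_mono)
    fix v assume "v \<in> V"
    then have "ln 2 \<le> ln (real (dout v))" using dout_ge[of v] by (subst ln_le_cancel_iff) auto
    then show "ln 2 * real (din v) \<le> real (din v) * ln (real (dout v))" by (simp add: mult.commute mult_left_mono)
  qed
  then show "ln 2 \<le> Hr" using card_heads_pos by simp
  have "Hr * card heads \<le> L * card heads"
    unfolding Hr_eq unfolding c sum_distrib_left
    by (intro sum_mono) (use ln_dout in \<open>auto simp: mult.commute intro!: mult_left_mono\<close>)
  then show "Hr \<le> L" using card_heads_pos by simp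
qed

lemma Hr_nonneg: "Hr \<ge> 0" using Hr_bounds(1) by (smt (verit) ln_ge_zero)

definition tw :: "(nat \<Rightarrow> real) \<Rightarrow> nat \<times> nat \<Rightarrow> real" where
  "tw w e = w (fst e) / dout (fst e)"

text \<open>The deviation of \<open>- ln (tw w e)\<close>, the log-weight of the path through the tail \<open>e\<close>, from its
  typical value.\<close>

definition dev :: "(nat \<Rightarrow> nat) \<Rightarrow> (nat \<Rightarrow> real) \<Rightarrow> nat \<times> nat \<Rightarrow> real" where
  "dev dep w e = - ln (tw w e) - dep (fst e) * Hr"

text \<open>\<open>S\<close> is the explored set, \<open>dep\<close> and \<open>w\<close> the length and the probability of the path from \<open>z\<close> by which
  a vertex was first found; other paths are forgotten, whence total mass \<open>\<le> 1\<close>. Revealing a tail of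
  weight \<open>\<ge> \<theta>\<close> moves mass \<open>\<ge> \<theta>\<close> one step closer to depth \<open>t0\<close>, so \<open>B\<close> bounds \<open>\<theta>\<close> times the number of
  revealed tails.\<close>

definition main_state where
  "main_state t0 \<theta> wmax B z \<rho> S dep w \<longleftrightarrow>
     pm \<rho> \<and> S \<subseteq> V \<and> z \<in> S \<and> fst ` dom \<rho> \<subseteq> S \<and> (\<forall>v\<in>S. dep v \<le> t0) \<and>
     (\<forall>u\<in>S. (u = z \<and> dep u = 0 \<and> w u = 1) \<or>
        (\<exists>v\<in>S. \<exists>i x. i < dout v \<and> \<rho> (v, i) = Some x \<and> fst x = u \<and> dep u = Suc (dep v) \<and> w u = w v / dout v)) \<and>
     (\<forall>e\<in>act \<rho> S. tw w e \<le> wmax) \<and>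
     real (card (dom \<rho>)) * \<theta> + (\<Sum>e\<in>act \<rho> S. tw w e * (real t0 - dep (fst e))) \<le> B \<and>
     (\<Sum>e\<in>act \<rho> S. tw w e) \<le> 1"

lemma main_stateD:
  assumes "main_state t0 \<theta> wmax B z \<rho> S dep w"
  shows "pm \<rho>" "S \<subseteq> V" "z \<in> S" "fst ` dom \<rho> \<subseteq> S" "\<And>v. v \<in> S \<Longrightarrow> dep v \<le> t0"
    and "\<And>u. u \<in> S \<Longrightarrow> (u = z \<and> dep u = 0 \<and> w u = 1) \<or>
        (\<exists>v\<in>S. \<exists>i x. i < dout v \<and> \<rho> (v, i) = Some x \<and> fst x = u \<and> dep u = Suc (dep v) \<and> w u = w v / dout v)"
    and "\<And>e. e \<in> act \<rho> S \<Longrightarrow> tw w e \<le> wmax"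
    and "real (card (dom \<rho>)) * \<theta> + (\<Sum>e\<in>act \<rho> S. tw w e * (real t0 - dep (fst e))) \<le> B"
    and "(\<Sum>e\<in>act \<rho> S. tw w e) \<le> 1"
  using assms unfolding main_state_def by blast+

lemma main_state_weight:
  assumes st: "main_state t0 \<theta> wmax B z \<rho> S dep w" and u: "u \<in> S"
  shows "(1 / real K) ^ dep u \<le> w u \<and> w u \<le> (1 / 2) ^ dep u"
  using u
proof (induction "dep u" arbitrary: u)
  case 0
  from main_stateD(6)[OF st 0(2)] 0 show ?case by auto
next
  case (Suc k)
  from main_stateD(6)[OF st Suc(3)] Suc(2) obtain v where
    v: "v \<in> S" "dep u = Suc (dep v)" "w u = w v / dout v" by auto
  have IH: "(1 / real K) ^ dep v \<le> w v \<and> w v \<le> (1 / 2) ^ dep v" using Suc v by auto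
  have vV: "v \<in> V" using v main_stateD(2)[OF st] by auto
  have d: "real (dout v) \<ge> 2" "real (dout v) \<le> K" using dout_ge[OF vV] dout_le[OF vV] by auto
  have "w v / dout v \<le> (1 / 2) ^ dep v / 2" using IH d by (intro frac_le) auto
  moreover have "(1 / real K) ^ dep v / K \<le> w v / dout v"
    using IH d by (intro frac_le) (auto intro: order_trans[of 0 "(1 / real K) ^ dep v"])
  ultimately show ?case using v by simp
qed

lemma main_state_tw:
  assumes st: "main_state t0 \<theta> wmax B z \<rho> S dep w" and e: "e \<in> act \<rho> S"
  shows "tw w e > 0" "(1 / real K) ^ Suc (dep (fst e)) \<le> tw w e" "tw w e \<le> (1 / 2) ^ Suc (dep (fst e))"
proof -
  let ?v = "fst e"
  have v: "?v \<in> S" "?v \<in> V" using e tails_fst by (auto simp: act_def)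
  have IH: "(1 / real K) ^ dep ?v \<le> w ?v \<and> w ?v \<le> (1 / 2) ^ dep ?v" by (rule main_state_weight[OF st v(1)])
  have d: "real (dout ?v) \<ge> 2" "real (dout ?v) \<le> K" using dout_ge[OF v(2)] dout_le[OF v(2)] by auto
  show 1: "(1 / real K) ^ Suc (dep (fst e)) \<le> tw w e"
    unfolding tw_def using IH d frac_le[of "w ?v" "(1 / real K) ^ dep ?v" "dout ?v" K]
    by (simp add: order_trans[of 0 "(1 / real K) ^ dep ?v"])
  have "(1 / real K) ^ Suc (dep (fst e)) > 0" using K_ge by simp
  then show "tw w e > 0" using 1 by linarith
  show "tw w e \<le> (1 / 2) ^ Suc (dep (fst e))"
    unfolding tw_def using IH d frac_le[of "(1 / 2) ^ dep ?v" "w ?v" 2 "dout ?v"] by simp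
qed

lemma main_state_dev:
  assumes st: "main_state t0 \<theta> wmax B z \<rho> S dep w" and e: "e \<in> act \<rho> S"
  shows "\<bar>dev dep w e\<bar> \<le> (real (dep (fst e)) + 1) * L"
proof -
  note b = main_state_tw[OF st e]
  let ?k = "dep (fst e)"
  have "ln ((1 / real K) ^ Suc ?k) \<le> ln (tw w e)" using b K_ge by (subst ln_le_cancel_iff) auto
  then have 1: "- ln (tw w e) \<le> (?k + 1) * L"
    using K_ge by (simp add: ln_realpow ln_div ln_mult algebra_simps)
  have "tw w e \<le> 1" using b(3) power_le_one[of "1 / 2 :: real" "Suc ?k"] by linarith
  then have 2: "0 \<le> - ln (tw w e)" using b(1) by simp
  have "?k * Hr \<le> ?k * L" "0 \<le> ?k * Hr" using Hr_bounds Hr_nonneg by (auto intro!: mult_left_mono)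
  then show ?thesis using 1 2 L_pos unfolding dev_def by (simp add: algebra_simps)
qed

lemma main_state_card:
  assumes st: "main_state t0 \<theta> wmax B z \<rho> S dep w"
  shows "card S \<le> card (dom \<rho>) + 1"
proof -
  note fd = pm_finite[OF main_stateD(1)[OF st]]
  have "S \<subseteq> insert z ((\<lambda>e. fst (the (\<rho> e))) ` dom \<rho>)"
  proof
    fix u assume "u \<in> S"
    from main_stateD(6)[OF st this] show "u \<in> insert z ((\<lambda>e. fst (the (\<rho> e))) ` dom \<rho>)"
      by (force simp: image_iff dom_def)
  qed
  then have "card S \<le> card (insert z ((\<lambda>e. fst (the (\<rho> e))) ` dom \<rho>))" using fd by (intro card_mono) auto
  also have "\<dots> \<le> Suc (card ((\<lambda>e. fst (the (\<rho> e))) ` dom \<rho>))" by (rule card_insert_le_m1) auto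
  also have "\<dots> \<le> Suc (card (dom \<rho>))" using card_image_le[OF fd] by simp
  finally show ?thesis by simp
qed

text \<open>The weights come from paths that are already revealed, so they bound transition
  probabilities from below whatever the rest of the matching is.\<close>

lemma main_state_walk:
  assumes st: "main_state t0 \<theta> wmax B z \<rho> S dep w" and u: "u \<in> S" and s: "\<sigma> \<in> ext \<rho>"
  shows "w u \<le> walk \<sigma> (dep u) z (\<lambda>y. of_bool (y = u))"
  using u
proof (induction "dep u" arbitrary: u)
  case 0
  from main_stateD(6)[OF st 0(2)] 0 show ?case by auto
next
  case (Suc k)
  have sM: "\<sigma> \<in> M" using s by (rule ext_M)
  have zV: "z \<in> V" using main_stateD(2,3)[OF st] by auto
  from main_stateD(6)[OF st Suc(3)] Suc(2) obtain v i x where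
    v: "v \<in> S" "i < dout v" "\<rho> (v, i) = Some x" "fst x = u" "dep u = Suc (dep v)" "w u = w v / dout v" by auto
  have IH: "w v \<le> walk \<sigma> (dep v) z (\<lambda>y. of_bool (y = v))" using Suc v by auto
  have vV: "v \<in> V" using v main_stateD(2)[OF st] by auto
  have sx: "\<sigma> (v, i) = x" using s v ext_D by blast
  have one: "1 / real (dout v) \<le> walk \<sigma> 1 v (\<lambda>y. of_bool (y = u))"
  proof -
    have "of_bool (fst (\<sigma> (v, i)) = u) \<le> (\<Sum>i<dout v. of_bool (fst (\<sigma> (v, i)) = u) :: real)"
      using v by (intro member_le_sum) auto
    then have "1 \<le> (\<Sum>i<dout v. of_bool (fst (\<sigma> (v, i)) = u) :: real)" using sx v by simp
    then show ?thesis by (simp add: divide_right_mono)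
  qed
  have "w u \<le> walk \<sigma> (dep v) z (\<lambda>y. of_bool (y = v)) / dout v"
    using IH v by (simp add: divide_right_mono)
  also have "\<dots> = walk \<sigma> (dep v) z (\<lambda>y. 1 / dout v * of_bool (y = v))"
    unfolding walk_cmult by simp
  also have "\<dots> \<le> walk \<sigma> (dep v) z (\<lambda>y. walk \<sigma> 1 y (\<lambda>y. of_bool (y = u)))"
    by (intro walk_mono sM zV) (use one sM in \<open>auto intro!: walk_nonneg simp del: walk.simps One_nat_def\<close>)
  also have "\<dots> = walk \<sigma> (dep u) z (\<lambda>y. of_bool (y = u))"
    using walk_compose[of \<sigma> "dep v" 1] v by simp
  finally show ?case .
qed

text \<open>\<open>\<kappa>\<close> times the second moment of the deviation under the walk, plus
  the mass lost in collisions. By Chebyshev, a small final value puts nearly all mass on tails of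
  typical weight.\<close>

definition potJ :: "real \<Rightarrow> (nat \<times> nat \<rightharpoonup> nat \<times> nat) \<Rightarrow> nat set \<Rightarrow> (nat \<Rightarrow> nat) \<Rightarrow> (nat \<Rightarrow> real) \<Rightarrow> real" where
  "potJ \<kappa> \<rho> S dep w = \<kappa> * (\<Sum>e\<in>act \<rho> S. tw w e * (dev dep w e)\<^sup>2) + (1 - (\<Sum>e\<in>act \<rho> S. tw w e))"

text \<open>The work left: active mass times the number of steps missing to depth \<open>t0\<close>.
  It is at most \<open>t0\<close> at the start, so the total drift to be paid for is at most
  \<open>\<mu> * t0\<close>.\<close>

definition potR :: "nat \<Rightarrow> (nat \<times> nat \<rightharpoonup> nat \<times> nat) \<Rightarrow> nat set \<Rightarrow> (nat \<Rightarrow> nat) \<Rightarrow> (nat \<Rightarrow> real) \<Rightarrow> real" where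
  "potR t0 \<rho> S dep w = (\<Sum>e\<in>act \<rho> S. tw w e * (real t0 - dep (fst e)))"

lemma potR_nonneg:
  assumes st: "main_state t0 \<theta> wmax B z \<rho> S dep w"
  shows "potR t0 \<rho> S dep w \<ge> 0"
  unfolding potR_def
proof (rule sum_nonneg)
  fix e assume e: "e \<in> act \<rho> S"
  then have "fst e \<in> S" by (simp add: act_def)
  then show "0 \<le> tw w e * (real t0 - dep (fst e))"
    using main_state_tw(1)[OF st e] main_stateD(5)[OF st] by simp
qed

section \<open>Effect of revealing one tail\<close>

lemma act_fresh:
  assumes st: "main_state t0 \<theta> wmax B z \<rho> S dep w" and e: "e \<in> act \<rho> S"
    and u: "u \<notin> S" "u \<in> V"
  shows "act (\<rho>(e \<mapsto> x)) (insert u S) = (act \<rho> S - {e}) \<union> {a \<in> tails. fst a = u}"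
    and "(act \<rho> S - {e}) \<inter> {a \<in> tails. fst a = u} = {}"
proof -
  have "a \<notin> dom \<rho>" if "fst a = u" for a using main_stateD(4)[OF st] that u by blast
  moreover have "fst e \<in> S" using e by (simp add: act_def)
  ultimately show "act (\<rho>(e \<mapsto> x)) (insert u S) = (act \<rho> S - {e}) \<union> {a \<in> tails. fst a = u}"
    using u by (auto simp: act_def dom_def)
  show "(act \<rho> S - {e}) \<inter> {a \<in> tails. fst a = u} = {}" using u by (auto simp: act_def)
qed

lemma sum_act_fresh:
  fixes c :: real
  assumes st: "main_state t0 \<theta> wmax B z \<rho> S dep w" and e: "e \<in> act \<rho> S"
    and u: "u \<notin> S" "u \<in> V"
    and old: "\<And>a. fst a \<in> S \<Longrightarrow> \<phi>' a = (\<phi> a :: real)" and new: "\<And>a. fst a = u \<Longrightarrow> \<phi>' a = c"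
  shows "(\<Sum>a\<in>act (\<rho>(e \<mapsto> x)) (insert u S). \<phi>' a) = (\<Sum>a\<in>act \<rho> S. \<phi> a) - \<phi> e + dout u * c"
proof -
  have "(\<Sum>a\<in>act (\<rho>(e \<mapsto> x)) (insert u S). \<phi>' a)
     = (\<Sum>a\<in>act \<rho> S - {e}. \<phi>' a) + (\<Sum>a\<in>{a \<in> tails. fst a = u}. \<phi>' a)"
    unfolding act_fresh(1)[OF assms(1-4)] using act_fresh(2)[OF assms(1-4)] finite_act finite_tails
    by (intro sum.union_disjoint) auto
  also have "(\<Sum>a\<in>act \<rho> S - {e}. \<phi>' a) = (\<Sum>a\<in>act \<rho> S - {e}. \<phi> a)"
    by (rule sum.cong) (use old in \<open>auto simp: act_def\<close>)
  also have "\<dots> = (\<Sum>a\<in>act \<rho> S. \<phi> a) - \<phi> e" using sum.remove[OF finite_act e, of \<phi>] by simp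
  also have "(\<Sum>a\<in>{a \<in> tails. fst a = u}. \<phi>' a) = (\<Sum>a\<in>{a \<in> tails. fst a = u}. c)"
    by (intro sum.cong new refl) auto
  also have "\<dots> = dout u * c" by (rule sum_tails_of[OF u(2)])
  finally show ?thesis .
qed

lemma act_collision: "e \<in> act \<rho> S \<Longrightarrow> act (\<rho>(e \<mapsto> x)) S = act \<rho> S - {e}"
  by (auto simp: act_def)

context
  fixes t0 :: nat and \<theta> wmax B z e \<rho> S dep w x
  assumes st: "main_state t0 \<theta> wmax B z \<rho> S dep w" and e: "e \<in> act \<rho> S" and dep: "dep (fst e) < t0"
    and \<theta>: "\<theta> \<le> tw w e" and x: "x \<in> heads - ran \<rho>"
begin

lemma e_facts: "fst e \<in> S" "e \<in> tails - dom \<rho>" "fst e \<in> V" "snd e < dout (fst e)" "fst x \<in> V"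
  "card (dom (\<rho>(e \<mapsto> x))) = card (dom \<rho>) + 1"
proof -
  show 1: "fst e \<in> S" and 2: "e \<in> tails - dom \<rho>" using e by (auto simp: act_def)
  show "fst e \<in> V" "snd e < dout (fst e)" using 2 tails_iff[of "fst e" "snd e"] by auto
  show "fst x \<in> V" using x heads_fst by auto
  show "card (dom (\<rho>(e \<mapsto> x))) = card (dom \<rho>) + 1"
    using 2 pm_finite[OF main_stateD(1)[OF st]] by simp
qed

lemma par_upd:
  assumes "u \<in> S"
  shows "(u = z \<and> dep u = 0 \<and> w u = 1) \<or>
        (\<exists>v\<in>S. \<exists>i y. i < dout v \<and> (\<rho>(e \<mapsto> x)) (v, i) = Some y \<and> fst y = u \<and> dep u = Suc (dep v) \<and> w u = w v / dout v)"
  using main_stateD(6)[OF st assms]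
proof
  assume "\<exists>v\<in>S. \<exists>i y. i < dout v \<and> \<rho> (v, i) = Some y \<and> fst y = u \<and> dep u = Suc (dep v) \<and> w u = w v / dout v"
  then obtain v i y where v: "v \<in> S" "i < dout v" "\<rho> (v, i) = Some y" "fst y = u" "dep u = Suc (dep v)" "w u = w v / dout v"
    by blast
  moreover have "(v, i) \<noteq> e" using v(3) e_facts(2) by auto
  ultimately show ?thesis by (intro disjI2 bexI[of _ v] exI[of _ i] exI[of _ y]) auto
qed blast

text \<open>The path through \<open>e\<close> is given up: its weight passes from the active mass to
  the lost mass, and its share of the second moment disappears.\<close>

lemma main_state_collision:
  assumes u: "fst x \<in> S" and \<kappa>: "\<kappa> \<ge> 0"
  shows "main_state t0 \<theta> wmax B z (\<rho>(e \<mapsto> x)) S dep w"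
    and "potJ \<kappa> (\<rho>(e \<mapsto> x)) S dep w \<le> potJ \<kappa> \<rho> S dep w + tw w e"
    and "potR t0 (\<rho>(e \<mapsto> x)) S dep w \<le> potR t0 \<rho> S dep w - tw w e"
proof -
  have s: "(\<Sum>a\<in>act (\<rho>(e \<mapsto> x)) S. \<phi> a) = (\<Sum>a\<in>act \<rho> S. \<phi> a) - \<phi> e" for \<phi> :: "nat \<times> nat \<Rightarrow> real"
    unfolding act_collision[OF e] using sum.remove[OF finite_act e, of \<phi>] by simp
  have t: "tw w e * 1 \<le> tw w e * (real t0 - dep (fst e))"
    using main_state_tw(1)[OF st e] dep by (intro mult_left_mono) auto
  show R: "potR t0 (\<rho>(e \<mapsto> x)) S dep w \<le> potR t0 \<rho> S dep w - tw w e"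
    unfolding potR_def s using t by simp
  have "0 \<le> \<kappa> * (tw w e * (dev dep w e)\<^sup>2)" using \<kappa> main_state_tw(1)[OF st e] by simp
  then show "potJ \<kappa> (\<rho>(e \<mapsto> x)) S dep w \<le> potJ \<kappa> \<rho> S dep w + tw w e"
    unfolding potJ_def s by (simp add: algebra_simps)
  show "main_state t0 \<theta> wmax B z (\<rho>(e \<mapsto> x)) S dep w"
    unfolding main_state_def
  proof (intro conjI ballI)
    show "pm (\<rho>(e \<mapsto> x))" using pm_upd[OF main_stateD(1)[OF st] e_facts(2) x] .
    show "fst ` dom (\<rho>(e \<mapsto> x)) \<subseteq> S" using main_stateD(4)[OF st] e_facts(1) by simp
    fix a assume "a \<in> act (\<rho>(e \<mapsto> x)) S"
    then show "tw w a \<le> wmax" unfolding act_collision[OF e] using main_stateD(7)[OF st] by auto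
  next
    show "real (card (dom (\<rho>(e \<mapsto> x)))) * \<theta> + (\<Sum>e\<in>act (\<rho>(e \<mapsto> x)) S. tw w e * (real t0 - dep (fst e))) \<le> B"
      using main_stateD(8)[OF st] R \<theta> unfolding potR_def e_facts(6) by (simp add: algebra_simps)
    show "(\<Sum>e\<in>act (\<rho>(e \<mapsto> x)) S. tw w e) \<le> 1"
      using main_stateD(9)[OF st] main_state_tw(1)[OF st e] unfolding s by linarith
  qed (use main_stateD(2,3,5)[OF st] par_upd in auto)
qed

text \<open>The tails of the new vertex together inherit the weight of \<open>e\<close>, and each
  has deviation \<open>dev dep w e + g\<close>. The second moment changes by a cross term, linear in
  the nearly centred \<open>g\<close>, and by the bounded \<open>g\<^sup>2\<close>.\<close>

lemma main_state_fresh: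
  assumes u: "fst x \<notin> S"
  defines "S' \<equiv> insert (fst x) S" and "dep' \<equiv> dep(fst x := Suc (dep (fst e)))" and "w' \<equiv> w(fst x := tw w e)"
    and "g \<equiv> ln (dout (fst x)) - Hr"
  shows "main_state t0 \<theta> wmax B z (\<rho>(e \<mapsto> x)) S' dep' w'"
    and "potJ \<kappa> (\<rho>(e \<mapsto> x)) S' dep' w' = potJ \<kappa> \<rho> S dep w + tw w e * (\<kappa> * (2 * dev dep w e * g + g\<^sup>2))"
    and "potR t0 (\<rho>(e \<mapsto> x)) S' dep' w' = potR t0 \<rho> S dep w - tw w e"
proof -
  have uV: "fst x \<in> V" by (rule e_facts)
  have d: "real (dout (fst x)) \<ge> 2" using dout_ge[OF uV] by simp
  have tw0: "tw w e > 0" by (rule main_state_tw[OF st e])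
  have old: "tw w' a = tw w a" "dep' (fst a) = dep (fst a)" "dev dep' w' a = dev dep w a" if "fst a \<in> S" for a
    using that u by (auto simp: tw_def w'_def dep'_def dev_def)
  have new: "tw w' a = tw w e / dout (fst x)" "dep' (fst a) = Suc (dep (fst e))" "dev dep' w' a = dev dep w e + g" if "fst a = fst x" for a
  proof -
    show t: "tw w' a = tw w e / dout (fst x)" and p: "dep' (fst a) = Suc (dep (fst e))"
      using that by (simp_all add: tw_def w'_def dep'_def)
    have "ln (tw w e / dout (fst x)) = ln (tw w e) - ln (dout (fst x))" using tw0 d by (simp add: ln_div)
    then show "dev dep' w' a = dev dep w e + g" unfolding dev_def t p g_def by (simp add: algebra_simps)
  qed
  have d0: "dout (fst x) * (tw w e / dout (fst x) * c) = tw w e * c" for c using d by simp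
  note sm = sum_act_fresh[OF st e u uV, folded S'_def]
  have s1: "(\<Sum>a\<in>act (\<rho>(e \<mapsto> x)) S'. tw w' a) = (\<Sum>a\<in>act \<rho> S. tw w a)"
  proof -
    have "(\<Sum>a\<in>act (\<rho>(e \<mapsto> x)) S'. tw w' a) = (\<Sum>a\<in>act \<rho> S. tw w a) - tw w e + dout (fst x) * (tw w e / dout (fst x) * 1)"
      by (rule sm) (simp_all only: old new mult_1_right)
    then show ?thesis unfolding d0 by simp
  qed
  have s2: "(\<Sum>a\<in>act (\<rho>(e \<mapsto> x)) S'. tw w' a * (real t0 - dep' (fst a))) = potR t0 \<rho> S dep w - tw w e"
  proof -
    have "(\<Sum>a\<in>act (\<rho>(e \<mapsto> x)) S'. tw w' a * (real t0 - dep' (fst a)))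
       = (\<Sum>a\<in>act \<rho> S. tw w a * (real t0 - dep (fst a))) - tw w e * (real t0 - dep (fst e))
         + dout (fst x) * (tw w e / dout (fst x) * (real t0 - Suc (dep (fst e))))"
      by (rule sm) (simp_all only: old new)
    then show ?thesis unfolding d0 potR_def by (simp add: algebra_simps)
  qed
  have s3: "(\<Sum>a\<in>act (\<rho>(e \<mapsto> x)) S'. tw w' a * (dev dep' w' a)\<^sup>2)
      = (\<Sum>a\<in>act \<rho> S. tw w a * (dev dep w a)\<^sup>2) + tw w e * (2 * dev dep w e * g + g\<^sup>2)"
  proof -
    have "(\<Sum>a\<in>act (\<rho>(e \<mapsto> x)) S'. tw w' a * (dev dep' w' a)\<^sup>2)
       = (\<Sum>a\<in>act \<rho> S. tw w a * (dev dep w a)\<^sup>2) - tw w e * (dev dep w e)\<^sup>2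
         + dout (fst x) * (tw w e / dout (fst x) * (dev dep w e + g)\<^sup>2)"
      by (rule sm) (simp_all only: old new)
    then show ?thesis unfolding d0 by (simp add: power2_eq_square algebra_simps)
  qed
  show "potR t0 (\<rho>(e \<mapsto> x)) S' dep' w' = potR t0 \<rho> S dep w - tw w e"
    unfolding potR_def[of t0 "\<rho>(e \<mapsto> x)"] by (rule s2)
  show "potJ \<kappa> (\<rho>(e \<mapsto> x)) S' dep' w' = potJ \<kappa> \<rho> S dep w + tw w e * (\<kappa> * (2 * dev dep w e * g + g\<^sup>2))"
    unfolding potJ_def s1 s3 by (simp add: algebra_simps)
  show "main_state t0 \<theta> wmax B z (\<rho>(e \<mapsto> x)) S' dep' w'"
    unfolding main_state_def
  proof (intro conjI ballI)
    show "pm (\<rho>(e \<mapsto> x))" using pm_upd[OF main_stateD(1)[OF st] e_facts(2) x] .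
    show "fst ` dom (\<rho>(e \<mapsto> x)) \<subseteq> S'" using main_stateD(4)[OF st] e_facts(1) by (auto simp: S'_def)
    show "S' \<subseteq> V" "z \<in> S'" using main_stateD(2,3)[OF st] uV by (auto simp: S'_def)
    show "dep' v \<le> t0" if "v \<in> S'" for v using that main_stateD(5)[OF st] dep by (auto simp: dep'_def S'_def)
    show "real (card (dom (\<rho>(e \<mapsto> x)))) * \<theta> + (\<Sum>e\<in>act (\<rho>(e \<mapsto> x)) S'. tw w' e * (real t0 - dep' (fst e))) \<le> B"
      using main_stateD(8)[OF st] \<theta> unfolding s2 e_facts(6) potR_def by (simp add: algebra_simps)
    show "(\<Sum>e\<in>act (\<rho>(e \<mapsto> x)) S'. tw w' e) \<le> 1" using main_stateD(9)[OF st] unfolding s1 .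
  next
    fix a assume a: "a \<in> act (\<rho>(e \<mapsto> x)) S'"
    have twm: "tw w e \<le> wmax" using main_stateD(7)[OF st e] .
    show "tw w' a \<le> wmax"
    proof (cases "fst a = fst x")
      case True
      have "tw w e / dout (fst x) \<le> tw w e" using d tw0 by (simp add: divide_le_eq)
      then show ?thesis using new(1)[OF True] twm by simp
    next
      case False
      then have "a \<in> act \<rho> S" using a by (auto simp: act_def S'_def)
      moreover from this have "fst a \<in> S" by (simp add: act_def)
      ultimately show ?thesis using old(1) main_stateD(7)[OF st] by simp
    qed
  next
    fix v assume v: "v \<in> S'"
    show "(v = z \<and> dep' v = 0 \<and> w' v = 1) \<or>
        (\<exists>v'\<in>S'. \<exists>i y. i < dout v' \<and> (\<rho>(e \<mapsto> x)) (v', i) = Some y \<and> fst y = v \<and> dep' v = Suc (dep' v') \<and> w' v = w' v' / dout v')"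
    proof (cases "v = fst x")
      case True
      have "fst e \<noteq> fst x" using e_facts(1) u by auto
      then show ?thesis using True e_facts
        by (intro disjI2 bexI[of _ "fst e"] exI[of _ "snd e"] exI[of _ x]) (auto simp: dep'_def w'_def tw_def S'_def)
    next
      case False
      then have vS: "v \<in> S" using v by (simp add: S'_def)
      have eq: "dep' y = dep y" "w' y = w y" if "y \<in> S" for y using that u by (auto simp: dep'_def w'_def)
      from par_upd[OF vS] show ?thesis using eq vS unfolding S'_def by (metis insertCI)
    qed
  qed
qed

end

text \<open>Over all heads the sum vanishes, so only the heads already used contribute, each at most
  \<open>L\<close>.\<close>

lemma sum_remaining_ln_le:
  assumes pm: "pm \<rho>"
  shows "\<bar>\<Sum>x\<in>heads - ran \<rho>. ln (real (dout (fst x))) - Hr\<bar> \<le> card (dom \<rho>) * L"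
proof -
  let ?g = "\<lambda>x. ln (real (dout (fst x))) - Hr"
  have ran: "ran \<rho> \<subseteq> heads" using pm by (simp add: pm_def)
  then have "(\<Sum>x\<in>heads - ran \<rho>. ?g x) = - (\<Sum>x\<in>ran \<rho>. ?g x)"
    using sum_centered_ln finite_heads by (simp add: sum_diff)
  then have "\<bar>\<Sum>x\<in>heads - ran \<rho>. ?g x\<bar> \<le> (\<Sum>x\<in>ran \<rho>. \<bar>?g x\<bar>)" by simp
  also have "\<dots> \<le> (\<Sum>x\<in>ran \<rho>. L)"
  proof (rule sum_mono)
    fix x assume "x \<in> ran \<rho>"
    then have "fst x \<in> V" using ran heads_fst by blast
    then show "\<bar>?g x\<bar> \<le> L" using ln_dout Hr_bounds Hr_nonneg by (smt (verit))
  qed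
  also have "\<dots> = card (dom \<rho>) * L" using card_ran[OF pm] by simp
  finally show ?thesis .
qed

text \<open>\<open>exp (l * (potJ + \<mu> * potR))\<close> is a supermartingale of the exploration: \<open>potR\<close> decreases by at least
  the weight of the revealed tail, which pays for the expected increase of \<open>potJ\<close>.\<close>

lemma main_exploration:
  fixes \<theta> wmax B l \<mu> \<mu>1 \<kappa> \<epsilon> \<zeta> :: real and Nx :: nat
  assumes st: "main_state t0 \<theta> wmax B z \<rho> S dep w"
    and \<theta>: "\<theta> > 0" and Nx: "B \<le> \<theta> * Nx" "Nx \<le> n" and l: "l \<ge> 0" and \<kappa>: "\<kappa> \<ge> 0" and \<zeta>: "\<zeta> \<ge> 0" and wmax: "wmax \<ge> 0"
    and \<kappa>1: "2 * \<kappa> * ((real t0 + 1) * L) * L \<le> 1" and \<kappa>2: "\<kappa> * L\<^sup>2 \<le> 1" and lw: "4 * l * wmax \<le> 1"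
    and \<mu>1: "Nx + \<kappa> * L\<^sup>2 * n + 2 * sqrt ((real Nx + 1) * (\<beta> * n)) \<le> \<mu>1 * n"
    and \<mu>: "\<mu>1 + 16 * l * wmax \<le> \<mu>"
    and terminal: "\<And>\<rho>' S' dep' w'. main_state t0 \<theta> wmax B z \<rho>' S' dep' w' \<Longrightarrow>
        (\<And>e. e \<in> act \<rho>' S' \<Longrightarrow> dep' (fst e) < t0 \<Longrightarrow> tw w' e < \<theta>) \<Longrightarrow> potJ \<kappa> \<rho>' S' dep' w' \<le> \<epsilon> \<Longrightarrow> cexp \<rho>' f \<le> \<zeta>"
    and f1: "\<And>\<sigma>. \<sigma> \<in> M \<Longrightarrow> f \<sigma> \<le> 1"
  shows "cexp \<rho> f \<le> \<zeta> + exp (l * (potJ \<kappa> \<rho> S dep w + \<mu> * potR t0 \<rho> S dep w - \<epsilon>))"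
  using st
proof (induction "card (tails - dom \<rho>)" arbitrary: \<rho> S dep w rule: less_induct)
  case less
  note IH = less(1) and st = less(2)
  note pm = main_stateD(1)[OF st]
  let ?E = "l * (potJ \<kappa> \<rho> S dep w + \<mu> * potR t0 \<rho> S dep w - \<epsilon>)"
  have \<mu>1_\<kappa>: "\<kappa> * L\<^sup>2 \<le> \<mu>1"
  proof -
    have "sqrt ((real Nx + 1) * (\<beta> * n)) \<ge> 0" using \<beta>_nonneg by simp
    then have "\<kappa> * L\<^sup>2 * n \<le> \<mu>1 * n" using \<mu>1 of_nat_0_le_iff[of Nx] by linarith
    then show ?thesis using n_pos by simp
  qed
  then have \<mu>10: "\<mu>1 \<ge> 0" using \<kappa> by (smt (verit) mult_nonneg_nonneg zero_le_power2)
  then have \<mu>0: "\<mu> \<ge> 0" using \<mu> l wmax by (smt (verit) mult_nonneg_nonneg)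
  show ?case
  proof (cases "\<exists>e\<in>act \<rho> S. dep (fst e) < t0 \<and> \<theta> \<le> tw w e")
    case False
    show ?thesis
    proof (cases "potJ \<kappa> \<rho> S dep w \<le> \<epsilon>")
      case True
      have "cexp \<rho> f \<le> \<zeta>" using False by (intro terminal[OF st _ True]) force
      then show ?thesis by (smt (verit) exp_ge_zero)
    next
      \<comment> \<open>As in Markov's inequality: above the threshold the exponential is at least 1
        and dominates \<open>f\<close>.\<close>
      case J: False
      have "\<mu> * potR t0 \<rho> S dep w \<ge> 0" using \<mu>0 potR_nonneg[OF st] by simp
      then have "?E \<ge> 0" using J l by (intro mult_nonneg_nonneg) auto
      then have "1 \<le> exp ?E" by simp
      moreover have "cexp \<rho> f \<le> 1" using f1 ext_M by (intro cexp_le_const[OF pm]) auto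
      ultimately show ?thesis using \<zeta> by linarith
    qed
  next
    case True
    then obtain e where e: "e \<in> act \<rho> S" "dep (fst e) < t0" "\<theta> \<le> tw w e" by blast
    have e': "e \<in> tails - dom \<rho>" using e by (simp add: act_def)
    have tw: "tw w e > 0" "tw w e \<le> wmax" using main_state_tw(1)[OF st e(1)] main_stateD(7)[OF st e(1)] by auto
    define y where "y = dev dep w e"
    define a where "a = l * tw w e"
    have a0: "a \<ge> 0" using l tw by (simp add: a_def)
    have a1: "4 * a \<le> 1"
      using lw mult_left_mono[OF tw(2), of l] l by (simp add: a_def)
    have y: "2 * \<kappa> * \<bar>y\<bar> * L \<le> 1"
    proof -
      have "\<bar>y\<bar> \<le> (real (dep (fst e)) + 1) * L" unfolding y_def by (rule main_state_dev[OF st e(1)])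
      also have "\<dots> \<le> (real t0 + 1) * L" using e(2) L_pos by (intro mult_right_mono) auto
      finally have "2 * \<kappa> * \<bar>y\<bar> * L \<le> 2 * \<kappa> * ((real t0 + 1) * L) * L"
        using \<kappa> L_pos by (intro mult_right_mono mult_left_mono) auto
      then show ?thesis using \<kappa>1 by linarith
    qed
    have cd: "card (dom \<rho>) \<le> Nx"
    proof -
      have "real (card (dom \<rho>)) * \<theta> \<le> B" using main_stateD(8)[OF st] potR_nonneg[OF st] unfolding potR_def by linarith
      also have "\<dots> \<le> Nx * \<theta>" using Nx by (simp add: mult.commute)
      finally show ?thesis using \<theta> by simp
    qed
    have N: "card (tails - dom \<rho>) \<ge> n" using card_remaining[OF pm] cd Nx by simp
    let ?N = "real (card (tails - dom \<rho>))"
    define g where "g = (\<lambda>x :: nat \<times> nat. ln (real (dout (fst x))) - Hr)"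
    \<comment> \<open>A bound for the increment of \<open>potJ\<close> per unit of revealed weight:
      cross term, square term and collision. A collision costs 1, but the cross term may be as low
      as \<open>- 1\<close> there, hence the 2.\<close>
    define X where "X = (\<lambda>x. 2 * \<kappa> * y * g x + \<kappa> * L\<^sup>2 + 2 * of_bool (fst x \<in> S))"
    have g: "\<bar>g x\<bar> \<le> L" if "x \<in> heads" for x
      using ln_dout[OF heads_fst[OF that]] Hr_bounds Hr_nonneg unfolding g_def by linarith
    have yg: "\<bar>2 * \<kappa> * y * g x\<bar> \<le> 1" if "x \<in> heads" for x
    proof -
      have "\<bar>2 * \<kappa> * y * g x\<bar> = 2 * \<kappa> * \<bar>y\<bar> * \<bar>g x\<bar>" using \<kappa> by (simp add: abs_mult)
      also have "\<dots> \<le> 2 * \<kappa> * \<bar>y\<bar> * L" using g[OF that] \<kappa> by (intro mult_left_mono) auto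
      finally show ?thesis using y by linarith
    qed
    have step: "cexp (\<rho>(e \<mapsto> x)) f \<le> \<zeta> + exp ?E * exp (a * (X x - \<mu>))" if x: "x \<in> heads - ran \<rho>" for x
    proof -
      have less: "card (tails - dom (\<rho>(e \<mapsto> x))) < card (tails - dom \<rho>)"
        using pm_upd'[OF pm e' x] by simp
      have "\<exists>S' dep' w'. main_state t0 \<theta> wmax B z (\<rho>(e \<mapsto> x)) S' dep' w' \<and>
          potJ \<kappa> (\<rho>(e \<mapsto> x)) S' dep' w' + \<mu> * potR t0 (\<rho>(e \<mapsto> x)) S' dep' w'
          \<le> potJ \<kappa> \<rho> S dep w + \<mu> * potR t0 \<rho> S dep w + tw w e * (X x - \<mu>)"
      proof (cases "fst x \<in> S")
        case True
        note c = main_state_collision[OF st e x True \<kappa>]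
        have "0 \<le> \<kappa> * L\<^sup>2" using \<kappa> by simp
        moreover have "- 1 \<le> 2 * \<kappa> * y * g x" using yg[of x] x by (simp add: abs_le_iff)
        ultimately have "1 \<le> X x" using True by (simp add: X_def)
        then have "tw w e * 1 \<le> tw w e * X x" using tw by (intro mult_left_mono) auto
        moreover have "\<mu> * potR t0 (\<rho>(e \<mapsto> x)) S dep w \<le> \<mu> * (potR t0 \<rho> S dep w - tw w e)"
          using c(3) \<mu>0 by (intro mult_left_mono) auto
        ultimately have "potJ \<kappa> (\<rho>(e \<mapsto> x)) S dep w + \<mu> * potR t0 (\<rho>(e \<mapsto> x)) S dep w
          \<le> potJ \<kappa> \<rho> S dep w + \<mu> * potR t0 \<rho> S dep w + tw w e * (X x - \<mu>)"
          using c(2) by (simp add: algebra_simps)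
        then show ?thesis using c(1) by blast
      next
        case False
        note c = main_state_fresh[OF st e x False, folded y_def]
        have "(g x)\<^sup>2 \<le> L\<^sup>2" using g[of x] x L_pos by (simp add: abs_le_square_iff[symmetric])
        then have "\<kappa> * (2 * y * g x + (g x)\<^sup>2) \<le> X x"
          using \<kappa> mult_left_mono[of "(g x)\<^sup>2" "L\<^sup>2" \<kappa>] by (simp add: X_def algebra_simps)
        then have "tw w e * (\<kappa> * (2 * y * g x + (g x)\<^sup>2)) \<le> tw w e * X x" using tw by (intro mult_left_mono) auto
        then have "potJ \<kappa> (\<rho>(e \<mapsto> x)) (insert (fst x) S) (dep(fst x := Suc (dep (fst e)))) (w(fst x := tw w e))
            + \<mu> * potR t0 (\<rho>(e \<mapsto> x)) (insert (fst x) S) (dep(fst x := Suc (dep (fst e)))) (w(fst x := tw w e))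
          \<le> potJ \<kappa> \<rho> S dep w + \<mu> * potR t0 \<rho> S dep w + tw w e * (X x - \<mu>)"
          unfolding c(2)[of \<kappa>] c(3) g_def by (simp add: algebra_simps)
        with c(1) show ?thesis by blast
      qed
      then obtain S' dep' w' where s': "main_state t0 \<theta> wmax B z (\<rho>(e \<mapsto> x)) S' dep' w'"
        and le: "potJ \<kappa> (\<rho>(e \<mapsto> x)) S' dep' w' + \<mu> * potR t0 (\<rho>(e \<mapsto> x)) S' dep' w'
          \<le> potJ \<kappa> \<rho> S dep w + \<mu> * potR t0 \<rho> S dep w + tw w e * (X x - \<mu>)" by blast
      have "cexp (\<rho>(e \<mapsto> x)) f \<le> \<zeta> + exp (l * (potJ \<kappa> (\<rho>(e \<mapsto> x)) S' dep' w' + \<mu> * potR t0 (\<rho>(e \<mapsto> x)) S' dep' w' - \<epsilon>))"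
        by (rule IH[OF less s'])
      also have "\<dots> \<le> \<zeta> + exp (?E + a * (X x - \<mu>))"
        using mult_left_mono[OF le l] by (simp add: a_def algebra_simps)
      finally show ?thesis by (simp add: exp_add)
    qed
    have Xle: "\<bar>X x\<bar> \<le> 4" if "x \<in> heads" for x
    proof -
      have "0 \<le> \<kappa> * L\<^sup>2" using \<kappa> by simp
      then show ?thesis using yg[OF that] \<kappa>2 by (auto simp: X_def abs_le_iff)
    qed
    have sumX: "(\<Sum>x\<in>heads - ran \<rho>. X x) \<le> \<mu>1 * ?N"
    proof -
      have "(\<Sum>x\<in>heads - ran \<rho>. X x) = 2 * \<kappa> * y * (\<Sum>x\<in>heads - ran \<rho>. g x) + \<kappa> * L\<^sup>2 * ?N
            + 2 * (\<Sum>x\<in>heads - ran \<rho>. of_bool (fst x \<in> S))"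
        by (simp add: X_def sum.distrib sum_distrib_left card_rem[OF pm])
      also have "2 * \<kappa> * y * (\<Sum>x\<in>heads - ran \<rho>. g x) \<le> Nx"
      proof -
        have "2 * \<kappa> * y * (\<Sum>x\<in>heads - ran \<rho>. g x) \<le> \<bar>2 * \<kappa> * y * (\<Sum>x\<in>heads - ran \<rho>. g x)\<bar>" by simp
        also have "\<dots> = 2 * \<kappa> * \<bar>y\<bar> * \<bar>\<Sum>x\<in>heads - ran \<rho>. g x\<bar>" using \<kappa> by (simp add: abs_mult)
        also have "\<dots> \<le> 2 * \<kappa> * \<bar>y\<bar> * (card (dom \<rho>) * L)"
          unfolding g_def using sum_remaining_ln_le[OF pm] \<kappa> by (intro mult_left_mono) auto
        also have "\<dots> = (2 * \<kappa> * \<bar>y\<bar> * L) * card (dom \<rho>)" by simp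
        also have "\<dots> \<le> 1 * real (card (dom \<rho>))" using y by (intro mult_right_mono) auto
        finally show ?thesis using cd by simp
      qed
      also have "(\<Sum>x\<in>heads - ran \<rho>. of_bool (fst x \<in> S)) \<le> sqrt ((real Nx + 1) * (\<beta> * n))"
      proof -
        have "(\<Sum>x\<in>heads - ran \<rho>. of_bool (fst x \<in> S)) \<le> D S" using main_stateD(2)[OF st] by (rule remaining_heads_in)
        also have "\<dots> \<le> sqrt (card S * (\<beta> * n))" using main_stateD(2)[OF st] by (rule D_le_sqrt)
        also have "\<dots> \<le> sqrt ((real Nx + 1) * (\<beta> * n))"
          using main_state_card[OF st] cd \<beta>_nonneg by (intro real_sqrt_le_mono mult_right_mono) auto
        finally show ?thesis .
      qed
      finally have "(\<Sum>x\<in>heads - ran \<rho>. X x) \<le> (Nx + 2 * sqrt ((real Nx + 1) * (\<beta> * n))) + \<kappa> * L\<^sup>2 * ?N" by simp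
      also have "\<dots> \<le> (\<mu>1 - \<kappa> * L\<^sup>2) * n + \<kappa> * L\<^sup>2 * ?N" using \<mu>1 by (simp add: algebra_simps)
      also have "\<dots> \<le> (\<mu>1 - \<kappa> * L\<^sup>2) * ?N + \<kappa> * L\<^sup>2 * ?N"
        using N \<mu>1_\<kappa> by (intro add_right_mono mult_left_mono) auto
      finally show ?thesis by (simp add: algebra_simps)
    qed
    \<comment> \<open>As \<open>4 * a \<le> 1\<close> and \<open>\<bar>X x\<bar> \<le> 4\<close>,
      the quadratic bound for \<open>exp\<close> applies. In \<open>\<mu>\<close>, the part
      \<open>\<mu>1\<close> pays for the mean of \<open>X\<close> and \<open>16 * l * wmax\<close>
      for the second-order term.\<close>
    have "(\<Sum>x\<in>heads - ran \<rho>. exp (a * X x)) \<le> ?N * exp (a * \<mu>)"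
    proof -
      have "exp (a * X x) \<le> 1 + a * X x + 16 * a\<^sup>2" if x: "x \<in> heads - ran \<rho>" for x
      proof -
        have X4: "\<bar>X x\<bar> \<le> 4" using Xle x by auto
        have "a * X x \<le> a * 4" using X4 a0 by (intro mult_left_mono) auto
        then have "exp (a * X x) \<le> 1 + a * X x + (a * X x)\<^sup>2" using a1 by (intro exp_le_quadratic) linarith
        also have "(a * X x)\<^sup>2 \<le> a\<^sup>2 * 4\<^sup>2"
          unfolding power_mult_distrib using X4 abs_le_square_iff[of "X x" 4] by (intro mult_left_mono) auto
        finally show ?thesis by simp
      qed
      then have "(\<Sum>x\<in>heads - ran \<rho>. exp (a * X x)) \<le> (\<Sum>x\<in>heads - ran \<rho>. 1 + a * X x + 16 * a\<^sup>2)" by (rule sum_mono)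
      also have "\<dots> = ?N + a * (\<Sum>x\<in>heads - ran \<rho>. X x) + 16 * a\<^sup>2 * ?N"
        by (simp add: sum.distrib sum_distrib_left card_rem[OF pm])
      also have "\<dots> \<le> ?N + a * (\<mu>1 * ?N) + 16 * a\<^sup>2 * ?N" using sumX a0 by (intro add_mono mult_left_mono) auto
      also have "\<dots> = ?N * (1 + a * (\<mu>1 + 16 * a))" by (simp add: algebra_simps power2_eq_square)
      also have "\<dots> \<le> ?N * (1 + a * \<mu>)"
      proof -
        have "a \<le> l * wmax" unfolding a_def using tw l by (intro mult_left_mono) auto
        then have "\<mu>1 + 16 * a \<le> \<mu>" using \<mu> by linarith
        then show ?thesis using a0 by (intro mult_left_mono add_left_mono) auto
      qed
      also have "\<dots> \<le> ?N * exp (a * \<mu>)" by (intro mult_left_mono) (auto simp: exp_ge_add_one_self)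
      finally show ?thesis .
    qed
    note sumexp = this
    show ?thesis
    proof (rule cexp_le_step[OF pm e' step])
      have "exp (a * (X x - \<mu>)) = exp (- a * \<mu>) * exp (a * X x)" for x
        unfolding exp_add[symmetric] by (simp add: algebra_simps)
      then have "(\<Sum>x\<in>heads - ran \<rho>. \<zeta> + exp ?E * exp (a * (X x - \<mu>)))
         = (\<Sum>x\<in>heads - ran \<rho>. \<zeta> + exp ?E * exp (- a * \<mu>) * exp (a * X x))"
        by (simp only: mult.assoc)
      also have "\<dots> = \<zeta> * ?N + exp ?E * exp (- a * \<mu>) * (\<Sum>x\<in>heads - ran \<rho>. exp (a * X x))"
        unfolding sum.distrib sum_distrib_left[symmetric] by (simp add: card_rem[OF pm])
      also have "\<dots> \<le> \<zeta> * ?N + exp ?E * exp (- a * \<mu>) * (?N * exp (a * \<mu>))"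
        using sumexp by (intro add_left_mono mult_left_mono) auto
      also have "\<dots> = \<zeta> * ?N + exp ?E * ?N * (exp (- a * \<mu>) * exp (a * \<mu>))" by (simp only: mult_ac)
      also have "exp (- a * \<mu>) * exp (a * \<mu>) = 1" unfolding exp_add[symmetric] by simp
      also have "\<zeta> * ?N + exp ?E * ?N * 1 = (\<zeta> + exp ?E) * ?N" by (simp only: distrib_right mult_1_right)
      finally show "(\<Sum>x\<in>heads - ran \<rho>. \<zeta> + exp ?E * exp (a * (X x - \<mu>))) \<le> (\<zeta> + exp ?E) * ?N" .
    qed
  qed
qed

text \<open>Hand-over from the completed ball. All active tails lie at depth \<open>s\<close>, so
  they weigh at most \<open>(1 / 2) ^ s\<close>; this cap is what the ball is explored for. Its
  contribution to the second moment is bounded crudely, deviations being at most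
  \<open>(s + 1) * L\<close>.\<close>

lemma tree_state_main_state:
  assumes st: "tree_state {} {} z s \<rho> S ad w" and full: "\<And>e. e \<in> act \<rho> S \<Longrightarrow> s \<le> length (ad (fst e))"
    and s: "s \<le> t0" and wmax: "(1 / 2) ^ s \<le> wmax" and B: "real (card (dom \<rho>)) * \<theta> + t0 \<le> B"
  shows "main_state t0 \<theta> wmax B z \<rho> S (\<lambda>v. length (ad v)) w"
    and "\<kappa> \<ge> 0 \<Longrightarrow> potJ \<kappa> \<rho> S (\<lambda>v. length (ad v)) w \<le> \<kappa> * ((real s + 1) * L)\<^sup>2"
    and "potR t0 \<rho> S (\<lambda>v. length (ad v)) w \<le> t0"
proof -
  let ?dep = "\<lambda>v. length (ad v)"
  note D = tree_stateD[OF st]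
  have len: "?dep v \<le> s" if "v \<in> S" for v using D(8) that by (auto simp: Words_def)
  have mass: "(\<Sum>e\<in>act \<rho> S. tw w e) = 1" using D(12) by (simp add: tw_def)
  have par: "\<And>u. u \<in> S \<Longrightarrow> (u = z \<and> ?dep u = 0 \<and> w u = 1) \<or>
        (\<exists>v\<in>S. \<exists>i x. i < dout v \<and> \<rho> (v, i) = Some x \<and> fst x = u \<and> ?dep u = Suc (?dep v) \<and> w u = w v / dout v)"
  proof -
    fix u assume "u \<in> S"
    from D(11)[OF this] show "(u = z \<and> ?dep u = 0 \<and> w u = 1) \<or>
        (\<exists>v\<in>S. \<exists>i x. i < dout v \<and> \<rho> (v, i) = Some x \<and> fst x = u \<and> ?dep u = Suc (?dep v) \<and> w u = w v / dout v)"
    proof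
      assume "u = z"
      then show ?thesis using D(5,6) by simp
    next
      assume "\<exists>v\<in>S. \<exists>i x. i < dout v \<and> \<rho> (v, i) = Some x \<and> fst x = u \<and> ad u = ad v @ [i] \<and> w u = w v / dout v"
      then obtain v i x where "v \<in> S" "i < dout v" "\<rho> (v, i) = Some x" "fst x = u" "ad u = ad v @ [i]" "w u = w v / dout v" by blast
      then show ?thesis by (intro disjI2 bexI[of _ v] exI[of _ i] exI[of _ x]) auto
    qed
  qed
  \<comment> \<open>The bounds on the weights do not depend on the last two components of the state.\<close>
  have pre: "main_state t0 0 (max wmax (Max (tw w ` act \<rho> S))) (\<Sum>e\<in>act \<rho> S. tw w e * (real t0 - ?dep (fst e))) z \<rho> S ?dep w"
    unfolding main_state_def using D(1-4) D(9) len s par finite_act mass by (auto simp: le_max_iff_disj dest: order_trans[OF len s])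
  have tw: "0 < tw w e" "tw w e \<le> wmax" if "e \<in> act \<rho> S" for e
  proof -
    have "tw w e \<le> (1 / 2) ^ Suc (?dep (fst e))" by (rule main_state_tw[OF pre that])
    also have "\<dots> \<le> (1 / 2) ^ s" using full[OF that] by (intro power_decreasing) auto
    finally show "tw w e \<le> wmax" using wmax by linarith
    show "0 < tw w e" by (rule main_state_tw[OF pre that])
  qed
  have "potR t0 \<rho> S ?dep w \<le> (\<Sum>e\<in>act \<rho> S. tw w e * t0)"
    unfolding potR_def using tw(1) by (intro sum_mono mult_left_mono) (auto simp: less_imp_le)
  also have "\<dots> = t0" using mass by (simp add: sum_distrib_right[symmetric])
  finally show R: "potR t0 \<rho> S ?dep w \<le> t0" .
  then show "main_state t0 \<theta> wmax B z \<rho> S ?dep w"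
    using pre B tw(2) unfolding main_state_def potR_def by auto
  assume \<kappa>: "\<kappa> \<ge> 0"
  have "(\<Sum>e\<in>act \<rho> S. tw w e * (dev ?dep w e)\<^sup>2) \<le> (\<Sum>e\<in>act \<rho> S. tw w e * ((real s + 1) * L)\<^sup>2)"
  proof (intro sum_mono mult_left_mono)
    fix e assume e: "e \<in> act \<rho> S"
    then have "fst e \<in> S" by (simp add: act_def)
    have "\<bar>dev ?dep w e\<bar> \<le> (real (?dep (fst e)) + 1) * L" by (rule main_state_dev[OF pre e])
    also have "\<dots> \<le> (real s + 1) * L" using len[OF \<open>fst e \<in> S\<close>] L_pos by (intro mult_right_mono) auto
    finally show "(dev ?dep w e)\<^sup>2 \<le> ((real s + 1) * L)\<^sup>2"
      using L_pos by (intro abs_le_square_iff[THEN iffD1]) (auto simp: abs_mult)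
    show "0 \<le> tw w e" using tw(1)[OF e] by simp
  qed
  also have "\<dots> = ((real s + 1) * L)\<^sup>2" using mass by (simp add: sum_distrib_right[symmetric])
  finally show "potJ \<kappa> \<rho> S ?dep w \<le> \<kappa> * ((real s + 1) * L)\<^sup>2"
    unfolding potJ_def mass using \<kappa> by (simp add: mult_left_mono)
qed

text \<open>\<open>f\<close> is nonpositive unless \<open>z\<close> is tree-like, so a collision
  inside the ball ends the exploration at no cost (\<open>q = 0\<close>); a completed ball is
  continued by the main exploration.\<close>

lemma explore_from_treelike:
  fixes \<theta> wmax B l \<mu> \<mu>1 \<kappa> \<epsilon> \<zeta> :: real and Nx :: nat
  assumes z: "z \<in> V" and s: "s \<le> t0" and wmax: "(1 / 2) ^ s \<le> wmax" and B: "real (NW s) * \<theta> + t0 \<le> B" and NW: "NW s \<le> n"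
    and \<theta>: "\<theta> > 0" and Nx: "B \<le> \<theta> * Nx" "Nx \<le> n" and l: "l \<ge> 0" and \<kappa>: "\<kappa> \<ge> 0" and \<zeta>: "\<zeta> \<ge> 0"
    and \<kappa>1: "2 * \<kappa> * ((real t0 + 1) * L) * L \<le> 1" and \<kappa>2: "\<kappa> * L\<^sup>2 \<le> 1" and lw: "4 * l * wmax \<le> 1"
    and \<mu>1: "Nx + \<kappa> * L\<^sup>2 * n + 2 * sqrt ((real Nx + 1) * (\<beta> * n)) \<le> \<mu>1 * n"
    and \<mu>: "\<mu>1 + 16 * l * wmax \<le> \<mu>" "\<mu> \<ge> 0"
    and terminal: "\<And>\<rho>' S' dep' w'. main_state t0 \<theta> wmax B z \<rho>' S' dep' w' \<Longrightarrow>
        (\<And>e. e \<in> act \<rho>' S' \<Longrightarrow> dep' (fst e) < t0 \<Longrightarrow> tw w' e < \<theta>) \<Longrightarrow> potJ \<kappa> \<rho>' S' dep' w' \<le> \<epsilon> \<Longrightarrow> cexp \<rho>' f \<le> \<zeta>"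
    and f1: "\<And>\<sigma>. \<sigma> \<in> M \<Longrightarrow> f \<sigma> \<le> 1"
    and f0: "\<And>\<sigma>. \<sigma> \<in> M \<Longrightarrow> \<not> treelike \<sigma> s z \<Longrightarrow> f \<sigma> \<le> 0"
  shows "cexp Map.empty f \<le> \<zeta> + exp (l * (\<kappa> * ((real s + 1) * L)\<^sup>2 + \<mu> * t0 - \<epsilon>))"
proof -
  define q' where "q' = \<zeta> + exp (l * (\<kappa> * ((real s + 1) * L)\<^sup>2 + \<mu> * t0 - \<epsilon>))"
  have D0: "\<Delta> \<ge> 0" using max_din[of 1] n_pos by (meson atLeastAtMost_iff of_nat_0_le_iff order_refl order_trans)
  \<comment> \<open>The collision rate is multiplied by \<open>q = 0\<close>;
    \<open>real (NW s) * \<Delta>\<close> is an admissible value because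
    \<open>n \<ge> 1\<close>.\<close>
  have "cexp no_edges f \<le> q' + real (NW s - card {z}) * (real (NW s) * \<Delta>) * 0"
  proof (rule tree_exploration[of "{}" "{}" z s no_edges])
    show "tree_state {} {} z s no_edges {z} (\<lambda>_. []) (\<lambda>_. 1)"
      using tree_state_init[OF pm_empty, of "{}" z s] z by simp
    show "0 \<le> q'" using \<zeta> by (simp add: q'_def)
    show "NW s \<le> n" by (rule NW)
    show "card (dom no_edges) + (NW s - card {z}) \<le> NW s" by simp
    show "real (card {} + NW s) * \<Delta> \<le> real (NW s) * \<Delta> * real n"
      using D0 n_pos mult_left_mono[of 1 "real n" "real (NW s) * \<Delta>"] by simp
    show "0 \<le> real (NW s) * \<Delta>" using D0 by simp
  next
    fix \<rho>' S' ad' w' e x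
    assume st: "tree_state {} {} z s \<rho>' S' ad' w'" and e: "e \<in> act \<rho>' S'" "length (ad' (fst e)) < s"
      and x: "x \<in> heads - ran \<rho>'" "fst x \<in> {} \<union> S'"
    have "pm (\<rho>'(e \<mapsto> x))" using e x by (intro pm_upd tree_stateD(1)[OF st]) (auto simp: act_def)
    then show "cexp (\<rho>'(e \<mapsto> x)) f \<le> 0"
    proof (rule cexp_le_const)
      fix \<sigma> assume s: "\<sigma> \<in> ext (\<rho>'(e \<mapsto> x))"
      have "\<not> treelike \<sigma> s z"
        using tree_state_collision[OF st, of "fst e" "snd e" x \<sigma>] e x s by simp
      then show "f \<sigma> \<le> 0" using f0 ext_M[OF s] by blast
    qed
  next
    fix \<rho>' S' ad' w'
    assume st: "tree_state {} {} z s \<rho>' S' ad' w'" and full: "\<And>e. e \<in> act \<rho>' S' \<Longrightarrow> s \<le> length (ad' (fst e))"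
      and cd: "card (dom \<rho>') \<le> NW s"
    have "real (card (dom \<rho>')) * \<theta> \<le> real (NW s) * \<theta>" using cd \<theta> by (intro mult_right_mono) auto
    then have B': "real (card (dom \<rho>')) * \<theta> + t0 \<le> B" using B by linarith
    have ms: "main_state t0 \<theta> wmax B z \<rho>' S' (\<lambda>v. length (ad' v)) w'"
      "potJ \<kappa> \<rho>' S' (\<lambda>v. length (ad' v)) w' \<le> \<kappa> * ((real s + 1) * L)\<^sup>2"
      "potR t0 \<rho>' S' (\<lambda>v. length (ad' v)) w' \<le> t0"
      using tree_state_main_state[OF st full s wmax B'] \<kappa> by auto
    have w0: "0 \<le> wmax" using wmax by (rule order_trans[rotated]) simp
    have "cexp \<rho>' f \<le> \<zeta> + exp (l * (potJ \<kappa> \<rho>' S' (\<lambda>v. length (ad' v)) w' + \<mu> * potR t0 \<rho>' S' (\<lambda>v. length (ad' v)) w' - \<epsilon>))"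
      by (rule main_exploration[OF ms(1) \<theta> Nx l \<kappa> \<zeta> w0 \<kappa>1 \<kappa>2 lw \<mu>1 \<mu>(1) terminal f1])
    also have "\<dots> \<le> q'"
      unfolding q'_def using ms(2) mult_left_mono[OF ms(3) \<mu>(2)] l
      by (auto intro!: mult_left_mono)
    finally show "cexp \<rho>' f \<le> q'" .
  qed simp_all
  then show ?thesis by (simp add: q'_def)
qed

end

section \<open>Mixing from the boundary of the explored region\<close>

context dcm
begin

section \<open>Transition probabilities and the reference law\<close>

definition trans_prob :: "(nat \<times> nat \<Rightarrow> nat \<times> nat) \<Rightarrow> nat \<Rightarrow> nat \<Rightarrow> nat \<Rightarrow> real" where
  "trans_prob \<sigma> k u y = walk \<sigma> k u (\<lambda>z. of_bool (z = y))"

definition nu :: "(nat \<times> nat \<Rightarrow> nat \<times> nat) \<Rightarrow> nat \<Rightarrow> nat \<Rightarrow> (nat \<Rightarrow> real) \<Rightarrow> real" where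
  "nu \<sigma> b k \<phi> = (\<Sum>u=1..b. walk \<sigma> k u \<phi>) / b"

lemma walk_expand': "\<sigma> \<in> M \<Longrightarrow> u \<in> V \<Longrightarrow> walk \<sigma> k u \<phi> = (\<Sum>y\<in>V. trans_prob \<sigma> k u y * \<phi> y)"
  unfolding trans_prob_def by (rule walk_expand)

lemma trans_prob_nonneg: "\<sigma> \<in> M \<Longrightarrow> u \<in> V \<Longrightarrow> 0 \<le> trans_prob \<sigma> k u y"
  unfolding trans_prob_def by (rule walk_nonneg) auto

lemma trans_prob_total: "\<sigma> \<in> M \<Longrightarrow> u \<in> V \<Longrightarrow> (\<Sum>y\<in>V. trans_prob \<sigma> k u y) = 1"
  unfolding trans_prob_def by (rule walk_total)

lemma sum_trans_prob: "\<sigma> \<in> M \<Longrightarrow> u \<in> V \<Longrightarrow> Z \<subseteq> V \<Longrightarrow> walk \<sigma> k u (\<lambda>y. of_bool (y \<in> Z)) = (\<Sum>y\<in>Z. trans_prob \<sigma> k u y)"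
proof -
  assume a: "\<sigma> \<in> M" "u \<in> V" "Z \<subseteq> V"
  have "walk \<sigma> k u (\<lambda>y. of_bool (y \<in> Z)) = (\<Sum>y\<in>V. trans_prob \<sigma> k u y * of_bool (y \<in> Z))"
    by (rule walk_expand'[OF a(1,2)])
  also have "\<dots> = (\<Sum>y\<in>Z. trans_prob \<sigma> k u y * of_bool (y \<in> Z))"
    using a(3) by (intro sum.mono_neutral_right) auto
  finally show ?thesis by simp
qed

lemma nu_expand:
  assumes "\<sigma> \<in> M" "b \<le> n"
  shows "nu \<sigma> b k \<phi> = (\<Sum>y\<in>V. nu \<sigma> b k (\<lambda>z. of_bool (z = y)) * \<phi> y)"
proof -
  have "(\<Sum>u=1..b. walk \<sigma> k u \<phi>) = (\<Sum>u=1..b. \<Sum>y\<in>V. walk \<sigma> k u (\<lambda>z. of_bool (z = y)) * \<phi> y)"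
    using assms by (intro sum.cong refl walk_expand) auto
  also have "\<dots> = (\<Sum>y\<in>V. (\<Sum>u=1..b. walk \<sigma> k u (\<lambda>z. of_bool (z = y))) * \<phi> y)"
    by (subst sum.swap) (simp add: sum_distrib_right)
  finally show ?thesis unfolding nu_def by (simp add: sum_divide_distrib[symmetric])
qed

lemma nu_mono:
  assumes "\<sigma> \<in> M" "b \<le> n" "\<And>v. v \<in> V \<Longrightarrow> \<phi> v \<le> \<psi> v"
  shows "nu \<sigma> b k \<phi> \<le> nu \<sigma> b k \<psi>"
  unfolding nu_def using assms by (intro divide_right_mono sum_mono walk_mono) auto

lemma nu_nonneg: "\<sigma> \<in> M \<Longrightarrow> b \<le> n \<Longrightarrow> (\<And>v. v \<in> V \<Longrightarrow> 0 \<le> \<phi> v) \<Longrightarrow> 0 \<le> nu \<sigma> b k \<phi>"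
  unfolding nu_def by (intro divide_nonneg_nonneg sum_nonneg walk_nonneg) auto

lemma nu_const: "\<sigma> \<in> M \<Longrightarrow> 1 \<le> b \<Longrightarrow> b \<le> n \<Longrightarrow> nu \<sigma> b k (\<lambda>_. c) = c"
  unfolding nu_def using walk_const[of \<sigma> _ k c] by simp

lemma nu_add: "nu \<sigma> b k (\<lambda>v. \<phi> v + \<psi> v) = nu \<sigma> b k \<phi> + nu \<sigma> b k \<psi>"
  unfolding nu_def by (simp add: walk_add sum.distrib add_divide_distrib)

lemma nu_total:
  assumes "\<sigma> \<in> M" "1 \<le> b" "b \<le> n"
  shows "(\<Sum>y\<in>V. nu \<sigma> b k (\<lambda>z. of_bool (z = y))) = 1"
  using nu_expand[OF assms(1,3), of k "\<lambda>_. 1"] nu_const[OF assms, of k 1] by simp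

lemma nu_set_sum:
  assumes "\<sigma> \<in> M" "b \<le> n" "Z \<subseteq> V"
  shows "nu \<sigma> b k (\<lambda>y. of_bool (y \<in> Z)) = (\<Sum>y\<in>Z. nu \<sigma> b k (\<lambda>z. of_bool (z = y)))"
proof -
  have "nu \<sigma> b k (\<lambda>y. of_bool (y \<in> Z)) = (\<Sum>y\<in>V. nu \<sigma> b k (\<lambda>z. of_bool (z = y)) * of_bool (y \<in> Z))"
    by (rule nu_expand[OF assms(1,2)])
  also have "\<dots> = (\<Sum>y\<in>Z. nu \<sigma> b k (\<lambda>z. of_bool (z = y)) * of_bool (y \<in> Z))"
    using assms(3) by (intro sum.mono_neutral_right) auto
  finally show ?thesis by simp
qed

text \<open>Cauchy-Schwarz: a law of small l2 norm gives little mass to every small set, even one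
  that depends on the matching. It is applied to the boundary of the explored region and to the set
  that carries the walk in the lower bound.\<close>

lemma nu_set_le:
  fixes \<gamma> :: real
  assumes "\<sigma> \<in> M" "b \<le> n" "Z \<subseteq> V" and \<gamma>: "(\<Sum>y\<in>V. (nu \<sigma> b k (\<lambda>z. of_bool (z = y)))\<^sup>2) \<le> \<gamma>"
  shows "nu \<sigma> b k (\<lambda>y. of_bool (y \<in> Z)) \<le> sqrt (card Z * \<gamma>)"
proof (rule real_le_rsqrt)
  have "(nu \<sigma> b k (\<lambda>y. of_bool (y \<in> Z)))\<^sup>2 \<le> (\<Sum>y\<in>Z. (nu \<sigma> b k (\<lambda>z. of_bool (z = y)))\<^sup>2) * card Z"
    unfolding nu_set_sum[OF assms(1-3)] by (rule sum_squared_le_sum_of_squares)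
  also have "(\<Sum>y\<in>Z. (nu \<sigma> b k (\<lambda>z. of_bool (z = y)))\<^sup>2) \<le> (\<Sum>y\<in>V. (nu \<sigma> b k (\<lambda>z. of_bool (z = y)))\<^sup>2)"
    using assms(3) by (intro sum_mono2) auto
  also note \<gamma>
  finally show "(nu \<sigma> b k (\<lambda>y. of_bool (y \<in> Z)))\<^sup>2 \<le> card Z * \<gamma>" by (simp add: mult.commute mult_right_mono)
qed

lemma walk_Suc_tails:
  assumes "v \<in> V"
  shows "walk \<sigma> (Suc k) v \<phi> = (\<Sum>e\<in>{e \<in> tails. fst e = v}. walk \<sigma> k (fst (\<sigma> e)) \<phi> / dout (fst e))"
proof -
  have eq: "{e \<in> tails. fst e = v} = Pair v ` {..<dout v}"
    using assms by (auto simp: tails_def half_edges_def)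
  have "(\<Sum>e\<in>{e \<in> tails. fst e = v}. walk \<sigma> k (fst (\<sigma> e)) \<phi> / dout (fst e))
      = (\<Sum>i<dout v. walk \<sigma> k (fst (\<sigma> (v, i))) \<phi> / dout v)"
    unfolding eq by (subst sum.reindex) (auto simp: inj_on_def)
  then show ?thesis by (simp add: sum_divide_distrib)
qed

lemma sum_by_tail:
  fixes g :: "nat \<times> nat \<Rightarrow> real"
  assumes "X \<subseteq> V"
  shows "(\<Sum>v\<in>X. \<Sum>e\<in>{e \<in> tails. fst e = v}. g e) = (\<Sum>e\<in>{e \<in> tails. fst e \<in> X}. g e)"
proof -
  have "(\<Sum>v\<in>X. \<Sum>e\<in>{e \<in> {e \<in> tails. fst e \<in> X}. fst e = v}. g e) = (\<Sum>e\<in>{e \<in> tails. fst e \<in> X}. g e)"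
    using assms finite_tails by (intro sum.group) (auto intro: finite_subset)
  moreover have "{e \<in> {e \<in> tails. fst e \<in> X}. fst e = v} = {e \<in> tails. fst e = v}" if "v \<in> X" for v
    using that by auto
  ultimately show ?thesis by simp
qed

lemma nu_Suc_tails:
  assumes "b \<le> n"
  shows "nu \<sigma> b (Suc k) \<phi> = (\<Sum>e\<in>{e \<in> tails. fst e \<le> b}. 1 / (b * dout (fst e)) * walk \<sigma> k (fst (\<sigma> e)) \<phi>)"
proof -
  have eq: "{e \<in> tails. fst e \<le> b} = {e \<in> tails. fst e \<in> {1..b}}" using tails_fst by force
  have "nu \<sigma> b (Suc k) \<phi> = (\<Sum>v=1..b. \<Sum>e\<in>{e \<in> tails. fst e = v}. walk \<sigma> k (fst (\<sigma> e)) \<phi> / dout (fst e)) / b"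
    unfolding nu_def using assms by (intro arg_cong2[where f="(/)"] sum.cong refl walk_Suc_tails) auto
  also have "\<dots> = (\<Sum>e\<in>{e \<in> tails. fst e \<in> {1..b}}. walk \<sigma> k (fst (\<sigma> e)) \<phi> / dout (fst e)) / b"
    using assms by (subst sum_by_tail) auto
  finally show ?thesis unfolding eq by (simp add: sum_divide_distrib mult.commute)
qed

text \<open>The walk killed when it leaves a vertex of \<open>X\<close>; it may end in \<open>X\<close>. It only sees the matching of the
  tails outside \<open>X\<close>.\<close>

fun kwalk :: "nat set \<Rightarrow> (nat \<times> nat \<Rightarrow> nat \<times> nat) \<Rightarrow> nat \<Rightarrow> nat \<Rightarrow> (nat \<Rightarrow> real) \<Rightarrow> real" where
  "kwalk X \<sigma> 0 u \<phi> = \<phi> u"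
| "kwalk X \<sigma> (Suc k) u \<phi> = (if u \<in> X then 0 else (\<Sum>i<dout u. kwalk X \<sigma> k (fst (\<sigma> (u, i))) \<phi>) / dout u)"

lemma kwalk_nonneg:
  "\<sigma> \<in> M \<Longrightarrow> u \<in> V \<Longrightarrow> (\<And>v. v \<in> V \<Longrightarrow> 0 \<le> \<phi> v) \<Longrightarrow> 0 \<le> kwalk X \<sigma> k u \<phi>"
proof (induction k arbitrary: u)
  case (Suc k)
  have "0 \<le> kwalk X \<sigma> k (fst (\<sigma> (u, i))) \<phi>" if "i < dout u" for i
    using Suc M_fst[OF Suc(2)] that by (simp add: tails_iff)
  then show ?case by (auto intro!: divide_nonneg_nonneg sum_nonneg)
qed simp

lemma kwalk_le_walk:
  "\<sigma> \<in> M \<Longrightarrow> u \<in> V \<Longrightarrow> (\<And>v. v \<in> V \<Longrightarrow> 0 \<le> \<phi> v) \<Longrightarrow> kwalk X \<sigma> k u \<phi> \<le> walk \<sigma> k u \<phi>"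
proof (induction k arbitrary: u)
  case (Suc k)
  have le: "kwalk X \<sigma> k (fst (\<sigma> (u, i))) \<phi> \<le> walk \<sigma> k (fst (\<sigma> (u, i))) \<phi>" if "i < dout u" for i
    using Suc M_fst[OF Suc(2)] that by (simp add: tails_iff)
  have "0 \<le> walk \<sigma> (Suc k) u \<phi>" by (rule walk_nonneg[OF Suc(2,3,4)])
  then show ?case using le by (auto intro!: divide_right_mono sum_mono)
qed simp

lemma kwalk_sum: "kwalk X \<sigma> k u (\<lambda>v. \<Sum>i\<in>I. \<phi> i v) = (\<Sum>i\<in>I. kwalk X \<sigma> k u (\<phi> i))"
proof (induction k arbitrary: u)
  case (Suc k)
  show ?case by (simp add: Suc sum.swap[of _ I] sum_divide_distrib)
qed simp

lemma kwalk_cong: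
  "\<sigma> \<in> M \<Longrightarrow> u \<in> V \<Longrightarrow> (\<And>v. v \<in> V \<Longrightarrow> \<phi> v = \<psi> v) \<Longrightarrow> kwalk X \<sigma> k u \<phi> = kwalk X \<sigma> k u \<psi>"
proof (induction k arbitrary: u)
  case (Suc k)
  have "kwalk X \<sigma> k (fst (\<sigma> (u, i))) \<phi> = kwalk X \<sigma> k (fst (\<sigma> (u, i))) \<psi>" if "i < dout u" for i
    using Suc M_fst[OF Suc(2)] that by (simp add: tails_iff)
  then show ?case by simp
qed simp

text \<open>This makes the killed walk a fixed kernel while the boundary tails are matched; the only
  randomness left is which head each of them receives.\<close>

lemma kwalk_agree:
  assumes "\<sigma> \<in> M" "\<sigma>' \<in> M" "\<And>e. e \<in> tails \<Longrightarrow> fst e \<notin> X \<Longrightarrow> \<sigma> e = \<sigma>' e" "u \<in> V"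
  shows "kwalk X \<sigma> k u \<phi> = kwalk X \<sigma>' k u \<phi>"
  using assms(4)
proof (induction k arbitrary: u)
  case (Suc k)
  have "kwalk X \<sigma> k (fst (\<sigma> (u, i))) \<phi> = kwalk X \<sigma>' k (fst (\<sigma>' (u, i))) \<phi>" if "i < dout u" "u \<notin> X" for i
    using Suc(1)[of "fst (\<sigma>' (u, i))"] assms(3)[of "(u, i)"] M_fst[OF assms(2), of "(u, i)"] Suc(2) that
    by (simp add: tails_iff)
  then show ?case by simp
qed simp

text \<open>A union bound over the times \<open>i < k\<close> at which the unkilled walk stands in
  \<open>X\<close>; standing there at time \<open>k\<close> kills nothing.\<close>

lemma killed_mass:
  "\<sigma> \<in> M \<Longrightarrow> u \<in> V \<Longrightarrow> 1 - kwalk X \<sigma> k u (\<lambda>_. 1) \<le> (\<Sum>i<k. walk \<sigma> i u (\<lambda>y. of_bool (y \<in> X)))"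
proof (induction k arbitrary: u)
  case (Suc k)
  have d: "real (dout u) > 0" using dout_ge[OF Suc(3)] by simp
  have sum0: "0 \<le> (\<Sum>i<k. walk \<sigma> (Suc i) u (\<lambda>y. of_bool (y \<in> X)))"
    using Suc by (intro sum_nonneg walk_nonneg) auto
  have split: "(\<Sum>i<Suc k. walk \<sigma> i u (\<lambda>y. of_bool (y \<in> X))) = of_bool (u \<in> X) + (\<Sum>i<k. walk \<sigma> (Suc i) u (\<lambda>y. of_bool (y \<in> X)))"
    by (subst sum.lessThan_Suc_shift) simp
  show ?case
  proof (cases "u \<in> X")
    case True
    then show ?thesis unfolding split using sum0 by simp
  next
    case False
    have le: "1 - kwalk X \<sigma> k (fst (\<sigma> (u, j))) (\<lambda>_. 1) \<le> (\<Sum>i<k. walk \<sigma> i (fst (\<sigma> (u, j))) (\<lambda>y. of_bool (y \<in> X)))" if "j < dout u" for j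
      using Suc(1)[OF Suc(2)] M_fst[OF Suc(2)] Suc(3) that by (simp add: tails_iff)
    have "1 - kwalk X \<sigma> (Suc k) u (\<lambda>_. 1) = (\<Sum>j<dout u. 1 - kwalk X \<sigma> k (fst (\<sigma> (u, j))) (\<lambda>_. 1)) / dout u"
      using False d by (simp add: sum_subtractf diff_divide_distrib)
    also have "\<dots> \<le> (\<Sum>j<dout u. \<Sum>i<k. walk \<sigma> i (fst (\<sigma> (u, j))) (\<lambda>y. of_bool (y \<in> X))) / dout u"
      using le by (intro divide_right_mono sum_mono) auto
    also have "\<dots> = (\<Sum>i<k. walk \<sigma> (Suc i) u (\<lambda>y. of_bool (y \<in> X)))"
      by (subst sum.swap) (simp add: sum_divide_distrib)
    finally show ?thesis unfolding split using False by simp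
  qed
qed simp

text \<open>What is needed of the reference walk: it seldom returns to its starting set, its laws
  are spread out in l2, and it mostly starts at tree-like vertices. The vertex \<open>z\<close> is
  not mentioned, so these events may fail with any probability o(1) and stay outside the union bound
  over \<open>z\<close>.\<close>

definition global_good :: "nat \<Rightarrow> nat \<Rightarrow> real \<Rightarrow> real \<Rightarrow> real \<Rightarrow> (nat \<times> nat \<Rightarrow> nat \<times> nat) \<Rightarrow> bool" where
  "global_good b h \<tau> \<gamma> \<xi> \<sigma> \<longleftrightarrow>
     (\<forall>k\<in>{1..h}. nu \<sigma> b k (\<lambda>y. of_bool (y \<in> {1..b})) \<le> \<tau>) \<and>
     (\<forall>k\<in>{1..h+1}. (\<Sum>y\<in>V. (nu \<sigma> b k (\<lambda>z. of_bool (z = y)))\<^sup>2) \<le> \<gamma>) \<and>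
     (\<Sum>u=1..b. of_bool (\<not> treelike \<sigma> (h + 1) u)) \<le> \<xi> * b"

section \<open>Matching the boundary tails\<close>

lemma sum_square_le_max:
  fixes q :: "'a \<Rightarrow> real"
  assumes "finite Y" "\<And>y. y \<in> Y \<Longrightarrow> 0 \<le> q y \<and> q y \<le> c" "(\<Sum>y\<in>Y. q y) \<le> 1" "c \<ge> 0"
  shows "(\<Sum>y\<in>Y. (q y)\<^sup>2) \<le> c"
proof -
  have "(\<Sum>y\<in>Y. (q y)\<^sup>2) \<le> (\<Sum>y\<in>Y. c * q y)"
    using assms by (intro sum_mono) (auto simp: power2_eq_square intro!: mult_right_mono)
  also have "\<dots> = c * (\<Sum>y\<in>Y. q y)" by (simp add: sum_distrib_left)
  also have "\<dots> \<le> c * 1" using assms by (intro mult_left_mono) auto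
  finally show ?thesis by simp
qed

text \<open>Only the tails in \<open>A\<close> and \<open>B\<close>, two possibly overlapping sets, are still unmatched: the walk from the exploration continues through \<open>A\<close>, the reference walk through \<open>B\<close>.\<close>

lemma matched_boundary:
  fixes fA fB :: "nat \<times> nat \<Rightarrow> real" and P :: "(nat \<times> nat \<Rightarrow> nat \<times> nat) \<Rightarrow> bool"
  assumes pm: "pm \<rho>" and rest: "tails - dom \<rho> = A \<union> B"
    and X: "X = fst ` (A \<union> B)"
    and fA: "\<And>e. 0 \<le> fA e \<and> fA e \<le> fm" and fB: "\<And>e. 0 \<le> fB e \<and> fB e \<le> fm" and fm: "fm > 0"
    and fA0: "\<And>e. e \<notin> A \<Longrightarrow> fA e = 0" and fB0: "\<And>e. e \<notin> B \<Longrightarrow> fB e = 0"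
    and WA: "(\<Sum>e\<in>A \<union> B. fA e) = WA" "WA \<le> 1" "1 - \<alpha> \<le> WA"
    and WB: "(\<Sum>e\<in>A \<union> B. fB e) = WB" "WB \<le> 1" "1 - \<omega> \<le> WB" "\<omega> \<le> 1 / 2"
    and N: "real (card tails) \<le> N" and \<epsilon>: "\<epsilon> > 0" and v4: "4 * fm \<le> v4\<^sup>2" "v4 \<ge> 0"
    and r: "r = 2 * (\<xi> + v4 + \<epsilon>)" and v1: "real n * (4 * fm * r) \<le> v1\<^sup>2" "v1 \<ge> 0"
    and hitB: "\<And>\<sigma>. \<sigma> \<in> ext \<rho> \<Longrightarrow> P \<sigma> \<Longrightarrow> (\<Sum>e\<in>A \<union> B. fB e * (1 - kwalk X \<sigma> h (fst (\<sigma> e)) (\<lambda>_. 1))) \<le> hit"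
    and sqB: "\<And>\<sigma>. \<sigma> \<in> ext \<rho> \<Longrightarrow> P \<sigma> \<Longrightarrow>
        (\<Sum>e\<in>A \<union> B. fB e * (\<Sum>y\<in>V. (kwalk X \<sigma> h (fst (\<sigma> e)) (\<lambda>z. of_bool (z = y)))\<^sup>2)) \<le> \<xi>"
    and concl: "\<And>\<sigma>. \<sigma> \<in> ext \<rho> \<Longrightarrow> P \<sigma> \<Longrightarrow>
        (\<Sum>y\<in>V. \<bar>(\<Sum>e\<in>A \<union> B. fA e * kwalk X \<sigma> h (fst (\<sigma> e)) (\<lambda>z. of_bool (z = y)))
                - (\<Sum>e\<in>A \<union> B. fB e * kwalk X \<sigma> h (fst (\<sigma> e)) (\<lambda>z. of_bool (z = y)))\<bar>) \<le> v1 + \<epsilon> + \<alpha> + \<omega> \<Longrightarrow>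
        (\<Sum>e\<in>A \<union> B. fA e * (1 - kwalk X \<sigma> h (fst (\<sigma> e)) (\<lambda>_. 1))) \<le> 2 * (hit + v4 + \<epsilon>) + v4 + \<epsilon> \<Longrightarrow> False"
  shows "cexp \<rho> (\<lambda>\<sigma>. of_bool (P \<sigma>)) \<le> 2 * exp (- \<epsilon>\<^sup>2 / (64 * fm\<^sup>2 * N))"
proof -
  let ?S = "A \<union> B" and ?H = "heads - ran \<rho>"
  \<comment> \<open>Any extension serves to read off the killed kernel, which is the same for all of
    them.\<close>
  obtain \<tau>0 where \<tau>0: "\<tau>0 \<in> ext \<rho>" using ext_nonempty[OF pm] by blast
  have \<tau>0M: "\<tau>0 \<in> M" using \<tau>0 by (rule ext_M)
  have N0: "N > 0" using N two_n_le_card_tails n_pos by linarith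
  have cN: "real (card ?S) \<le> N"
    using N card_mono[OF finite_tails, of ?S] rest by (metis Diff_subset of_nat_mono order_trans)
  have finS: "finite ?S" using rest finite_tails by (metis finite_Diff)
  define Q where "Q = (\<lambda>(x :: nat \<times> nat) y. kwalk X \<tau>0 h (fst x) (\<lambda>z. of_bool (z = y)))"
  define ka where "ka = (\<lambda>x :: nat \<times> nat. 1 - kwalk X \<tau>0 h (fst x) (\<lambda>_. 1))"
  define k2 where "k2 = (\<lambda>x. \<Sum>y\<in>V. (Q x y)\<^sup>2)"
  have kw: "kwalk X \<sigma> h (fst x) \<phi> = kwalk X \<tau>0 h (fst x) \<phi>" if s: "\<sigma> \<in> ext \<rho>" and x: "x \<in> heads" for \<sigma> x \<phi>
  proof (rule kwalk_agree[OF ext_M[OF s] \<tau>0M _ heads_fst[OF x]])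
    fix e assume e: "e \<in> tails" "fst e \<notin> X"
    then have "e \<notin> ?S" using X by auto
    then have "e \<in> dom \<rho>" using rest e by auto
    then show "\<sigma> e = \<tau>0 e" using ext_D[OF s] ext_D[OF \<tau>0] by fastforce
  qed
  have mapsH: "\<sigma> e \<in> heads" if "\<sigma> \<in> ext \<rho>" "e \<in> ?S" for \<sigma> e
    using that M_maps[OF ext_M] rest by blast
  have Q0: "0 \<le> Q x y" if "x \<in> heads" for x y
    unfolding Q_def using that heads_fst \<tau>0M by (intro kwalk_nonneg) auto
  have Qsum: "(\<Sum>y\<in>V. Q x y) = 1 - ka x" if x: "x \<in> heads" for x
  proof -
    have "kwalk X \<tau>0 h (fst x) (\<lambda>_. 1) = kwalk X \<tau>0 h (fst x) (\<lambda>v. \<Sum>y\<in>V. of_bool (v = y))"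
      using x heads_fst \<tau>0M by (intro kwalk_cong) (auto simp: of_bool_def)
    also have "\<dots> = (\<Sum>y\<in>V. Q x y)" unfolding Q_def by (rule kwalk_sum)
    finally show ?thesis by (simp add: ka_def)
  qed
  have ka: "0 \<le> ka x" "ka x \<le> 1" if x: "x \<in> heads" for x
  proof -
    have "kwalk X \<tau>0 h (fst x) (\<lambda>_. 1) \<le> walk \<tau>0 h (fst x) (\<lambda>_. 1)"
      using x heads_fst \<tau>0M by (intro kwalk_le_walk) auto
    then show "0 \<le> ka x" using walk_const[OF \<tau>0M heads_fst[OF x], of h 1] by (simp add: ka_def)
    show "ka x \<le> 1" unfolding ka_def using kwalk_nonneg[OF \<tau>0M heads_fst[OF x], of "\<lambda>_. 1" X h] by simp
  qed
  have Q1: "Q x y \<le> 1" if "x \<in> heads" "y \<in> V" for x y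
    using member_le_sum[of y V "Q x"] Q0 Qsum[OF that(1)] ka(1)[OF that(1)] that by fastforce
  have k2: "0 \<le> k2 x" "k2 x \<le> 1" if x: "x \<in> heads" for x
    unfolding k2_def using sum_square_le_max[of V "Q x" 1] Q0[OF x] Q1[OF x] Qsum[OF x] ka(1)[OF x]
    by (auto intro: sum_nonneg)
  have sq: "(\<Sum>e\<in>?S. (g e)\<^sup>2) \<le> fm * c"
    if "\<And>e. e \<in> ?S \<Longrightarrow> \<bar>g e\<bar> \<le> fm" "(\<Sum>e\<in>?S. \<bar>g e\<bar>) \<le> c" for g :: "nat \<times> nat \<Rightarrow> real" and c
  proof -
    have "(\<Sum>e\<in>?S. (g e)\<^sup>2) \<le> (\<Sum>e\<in>?S. fm * \<bar>g e\<bar>)"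
    proof (rule sum_mono)
      fix e assume "e \<in> ?S"
      then have "\<bar>g e\<bar> * \<bar>g e\<bar> \<le> fm * \<bar>g e\<bar>" using that by (intro mult_right_mono) auto
      then show "(g e)\<^sup>2 \<le> fm * \<bar>g e\<bar>" by (simp add: power2_eq_square)
    qed
    also have "\<dots> \<le> fm * c" using that fm by (simp add: sum_distrib_left[symmetric])
    finally show ?thesis .
  qed
  let ?avg = "\<lambda>R. (\<Sum>x\<in>?H. R x) / real (card ?S)"
  have avg01: "0 \<le> ?avg R \<and> ?avg R \<le> 1" if "\<And>x. x \<in> heads \<Longrightarrow> 0 \<le> R x \<and> R x \<le> 1" for R :: "nat \<times> nat \<Rightarrow> real"
  proof
    show "0 \<le> ?avg R" using that by (intro divide_nonneg_nonneg sum_nonneg) auto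
    have "(\<Sum>x\<in>?H. R x) \<le> real (card ?H) * 1" using that by (intro sum_bounded_above) auto
    then show "?avg R \<le> 1" using card_rem[OF pm] rest by (simp add: divide_le_eq)
  qed
  let ?p = "exp (- \<epsilon>\<^sup>2 / (64 * fm\<^sup>2 * N))"
  have scalar: "cexp \<rho> (\<lambda>\<sigma>. of_bool (\<bar>(\<Sum>e\<in>?S. g e * R (\<sigma> e)) - (\<Sum>e\<in>?S. g e) * ?avg R\<bar> > v4 + \<epsilon>)) \<le> ?p"
    if g: "\<And>e. 0 \<le> g e \<and> g e \<le> fm" "(\<Sum>e\<in>?S. g e) \<le> 1" and R: "\<And>x. x \<in> heads \<Longrightarrow> 0 \<le> R x \<and> R x \<le> 1"
    for g :: "nat \<times> nat \<Rightarrow> real" and R :: "nat \<times> nat \<Rightarrow> real"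
  proof -
    have g2: "(\<Sum>e\<in>?S. (g e)\<^sup>2) \<le> fm" using sq[of g 1] g by simp
    have R2: "0 \<le> ?avg (\<lambda>x. (R x)\<^sup>2) \<and> ?avg (\<lambda>x. (R x)\<^sup>2) \<le> 1"
      by (rule avg01) (use R in \<open>auto simp: power_le_one\<close>)
    have "(\<Sum>e\<in>?S. (g e)\<^sup>2) * ?avg (\<lambda>x. (R x)\<^sup>2) \<le> fm * 1"
      using g2 R2 fm by (intro mult_mono) auto
    then have v: "real (card {()}) * (2 * (\<Sum>e\<in>tails - dom \<rho>. (g e)\<^sup>2) *
        ((\<Sum>x\<in>?H. \<Sum>y\<in>{()}. (R x)\<^sup>2) / card (tails - dom \<rho>))) \<le> v4\<^sup>2"
      using v4 fm unfolding rest by simp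
    have "cexp \<rho> (\<lambda>\<sigma>. of_bool ((\<Sum>y\<in>{()}. \<bar>(\<Sum>e\<in>tails - dom \<rho>. g e * R (\<sigma> e)) - (\<Sum>e\<in>tails - dom \<rho>. g e) * ?avg R\<bar>) > v4 + \<epsilon>)) \<le> ?p"
      using vector_concentration[where Q = "\<lambda>x _. R x" and Y = "{()}" and f = g and avg = "\<lambda>_. ?avg R" and v = v4, OF pm _ fm \<epsilon> _ _ _ N0 _ v v4(2)]
        g R cN rest by auto
    then show ?thesis unfolding rest by simp
  qed
  have repl_ka: "(\<Sum>e\<in>?S. g e * (1 - kwalk X \<sigma> h (fst (\<sigma> e)) (\<lambda>_. 1))) = (\<Sum>e\<in>?S. g e * ka (\<sigma> e))"
    if "\<sigma> \<in> ext \<rho>" for g \<sigma>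
    unfolding ka_def using kw[OF that mapsH[OF that]] by (intro sum.cong) auto
  have repl_Q: "(\<Sum>e\<in>?S. g e * kwalk X \<sigma> h (fst (\<sigma> e)) (\<lambda>z. of_bool (z = y))) = (\<Sum>e\<in>?S. g e * Q (\<sigma> e) y)"
    if "\<sigma> \<in> ext \<rho>" for g \<sigma> y
    unfolding Q_def using kw[OF that mapsH[OF that]] by (intro sum.cong) auto
  have repl_k2: "(\<Sum>e\<in>?S. g e * (\<Sum>y\<in>V. (kwalk X \<sigma> h (fst (\<sigma> e)) (\<lambda>z. of_bool (z = y)))\<^sup>2)) = (\<Sum>e\<in>?S. g e * k2 (\<sigma> e))"
    if "\<sigma> \<in> ext \<rho>" for g \<sigma>
    unfolding k2_def Q_def using kw[OF that mapsH[OF that]] by (intro sum.cong) auto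
  have WB2: "1 / 2 \<le> WB" using WB by linarith
  have half: "a \<le> 2 * c" if "WB * a \<le> c" "0 \<le> a" for a c
  proof -
    have "1 / 2 * a \<le> WB * a" using WB2 that(2) by (intro mult_right_mono)
    then show ?thesis using that(1) by linarith
  qed
  have ka_avg: "0 \<le> ?avg ka \<and> ?avg ka \<le> 1" and k2_avg: "0 \<le> ?avg k2 \<and> ?avg k2 \<le> 1"
    by (rule avg01, use ka in blast, rule avg01, use k2 in blast)
  have p0: "?p \<ge> 0" by simp
  \<comment> \<open>The averages over the free heads are constants given \<open>\<rho>\<close>,
    while \<open>P\<close> still depends on the open tails. If an average is too large, the
    \<open>fB\<close>-sum concentrates near its multiple by \<open>WB \<ge> 1 / 2\<close> and
    violates \<open>hitB\<close> or \<open>sqB\<close>, so \<open>P\<close> itself is unlikely.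
    Otherwise the sums for \<open>fA\<close> and \<open>fB\<close> concentrate near multiples of the
    same mean row.\<close>
  consider (1) "?avg ka > 2 * (hit + v4 + \<epsilon>)" | (2) "?avg k2 > r" | (3) "?avg ka \<le> 2 * (hit + v4 + \<epsilon>)" "?avg k2 \<le> r"
    by linarith
  then show ?thesis
  proof cases
    case 1
    have "cexp \<rho> (\<lambda>\<sigma>. of_bool (P \<sigma>)) \<le> cexp \<rho> (\<lambda>\<sigma>. of_bool (\<bar>(\<Sum>e\<in>?S. fB e * ka (\<sigma> e)) - (\<Sum>e\<in>?S. fB e) * ?avg ka\<bar> > v4 + \<epsilon>))"
    proof (rule cexp_mono)
      fix \<sigma> assume s: "\<sigma> \<in> ext \<rho>"
      have "\<bar>(\<Sum>e\<in>?S. fB e * ka (\<sigma> e)) - (\<Sum>e\<in>?S. fB e) * ?avg ka\<bar> > v4 + \<epsilon>" if "P \<sigma>"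
      proof (rule ccontr)
        assume "\<not> ?thesis"
        then have "WB * ?avg ka \<le> hit + v4 + \<epsilon>"
          using hitB[OF s that] unfolding repl_ka[OF s] WB(1) by linarith
        then show False using half ka_avg 1 by fastforce
      qed
      then show "of_bool (P \<sigma>) \<le> (of_bool (\<bar>(\<Sum>e\<in>?S. fB e * ka (\<sigma> e)) - (\<Sum>e\<in>?S. fB e) * ?avg ka\<bar> > v4 + \<epsilon>) :: real)"
        by auto
    qed
    also have "\<dots> \<le> ?p" by (rule scalar) (use fB WB ka in auto)
    finally show ?thesis using p0 by linarith
  next
    case 2
    have "cexp \<rho> (\<lambda>\<sigma>. of_bool (P \<sigma>)) \<le> cexp \<rho> (\<lambda>\<sigma>. of_bool (\<bar>(\<Sum>e\<in>?S. fB e * k2 (\<sigma> e)) - (\<Sum>e\<in>?S. fB e) * ?avg k2\<bar> > v4 + \<epsilon>))"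
    proof (rule cexp_mono)
      fix \<sigma> assume s: "\<sigma> \<in> ext \<rho>"
      have "\<bar>(\<Sum>e\<in>?S. fB e * k2 (\<sigma> e)) - (\<Sum>e\<in>?S. fB e) * ?avg k2\<bar> > v4 + \<epsilon>" if "P \<sigma>"
      proof (rule ccontr)
        assume "\<not> ?thesis"
        then have "WB * ?avg k2 \<le> \<xi> + v4 + \<epsilon>"
          using sqB[OF s that] unfolding repl_k2[OF s] WB(1) by linarith
        then show False using half k2_avg 2 r by fastforce
      qed
      then show "of_bool (P \<sigma>) \<le> (of_bool (\<bar>(\<Sum>e\<in>?S. fB e * k2 (\<sigma> e)) - (\<Sum>e\<in>?S. fB e) * ?avg k2\<bar> > v4 + \<epsilon>) :: real)"
        by auto
    qed
    also have "\<dots> \<le> ?p" by (rule scalar) (use fB WB k2 in auto)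
    finally show ?thesis using p0 by linarith
  next
    case 3
    \<comment> \<open>Both sums are compared at once: the one for the difference has mean
      \<open>(WA - WB) * avgQ y\<close>, whose l1 norm is at most
      \<open>\<alpha> + \<omega>\<close>.\<close>
    define f where "f = (\<lambda>e. fA e - fB e)"
    define avgQ where "avgQ = (\<lambda>y. ?avg (\<lambda>x. Q x y))"
    have fle: "\<bar>f e\<bar> \<le> fm" for e using fA[of e] fB[of e] by (auto simp: f_def)
    have "(\<Sum>e\<in>?S. \<bar>f e\<bar>) \<le> (\<Sum>e\<in>?S. fA e + fB e)" using fA fB by (intro sum_mono) (auto simp: f_def abs_le_iff add_increasing add_increasing2)
    also have "\<dots> \<le> 2" using WA WB by (simp add: sum.distrib)
    finally have f2: "(\<Sum>e\<in>?S. (f e)\<^sup>2) \<le> fm * 2" using sq[of f 2] fle by blast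
    have v: "real (card V) * (2 * (\<Sum>e\<in>tails - dom \<rho>. (f e)\<^sup>2) *
        ((\<Sum>x\<in>?H. \<Sum>y\<in>V. (Q x y)\<^sup>2) / card (tails - dom \<rho>))) \<le> v1\<^sup>2"
    proof -
      have "(\<Sum>e\<in>?S. (f e)\<^sup>2) * ?avg k2 \<le> (fm * 2) * r" using f2 3 k2_avg fm by (intro mult_mono) auto
      then have "real n * (2 * ((\<Sum>e\<in>?S. (f e)\<^sup>2) * ?avg k2)) \<le> real n * (4 * fm * r)" by (intro mult_left_mono) auto
      also note v1(1)
      finally show ?thesis unfolding rest k2_def by (simp add: mult.assoc)
    qed
    have vec: "cexp \<rho> (\<lambda>\<sigma>. of_bool ((\<Sum>y\<in>V. \<bar>(\<Sum>e\<in>?S. f e * Q (\<sigma> e) y) - (\<Sum>e\<in>?S. f e) * avgQ y\<bar>) > v1 + \<epsilon>)) \<le> ?p"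
      using vector_concentration[where Q = Q and Y = V and f = f and avg = avgQ and v = v1, OF pm _ fm \<epsilon> fle _ _ N0 _ v v1(2)]
        Q0 Qsum ka(1) cN rest by (auto simp: avgQ_def)
    have "cexp \<rho> (\<lambda>\<sigma>. of_bool (P \<sigma>)) \<le> cexp \<rho> (\<lambda>\<sigma>. of_bool ((\<Sum>y\<in>V. \<bar>(\<Sum>e\<in>?S. f e * Q (\<sigma> e) y) - (\<Sum>e\<in>?S. f e) * avgQ y\<bar>) > v1 + \<epsilon>)
       + of_bool (\<bar>(\<Sum>e\<in>?S. fA e * ka (\<sigma> e)) - (\<Sum>e\<in>?S. fA e) * ?avg ka\<bar> > v4 + \<epsilon>))"
    proof (rule cexp_mono)
      fix \<sigma> assume s: "\<sigma> \<in> ext \<rho>"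
      have "(\<Sum>y\<in>V. \<bar>(\<Sum>e\<in>?S. f e * Q (\<sigma> e) y) - (\<Sum>e\<in>?S. f e) * avgQ y\<bar>) > v1 + \<epsilon> \<or>
         \<bar>(\<Sum>e\<in>?S. fA e * ka (\<sigma> e)) - (\<Sum>e\<in>?S. fA e) * ?avg ka\<bar> > v4 + \<epsilon>" if P: "P \<sigma>"
      proof (rule ccontr)
        assume "\<not> ?thesis"
        then have n1: "(\<Sum>y\<in>V. \<bar>(\<Sum>e\<in>?S. f e * Q (\<sigma> e) y) - (\<Sum>e\<in>?S. f e) * avgQ y\<bar>) \<le> v1 + \<epsilon>"
          and n2: "(\<Sum>e\<in>?S. fA e * ka (\<sigma> e)) \<le> WA * ?avg ka + v4 + \<epsilon>" unfolding WA(1) by linarith+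
        have "WA * ?avg ka \<le> 1 * ?avg ka" using WA ka_avg by (intro mult_right_mono) auto
        then have c2: "(\<Sum>e\<in>?S. fA e * ka (\<sigma> e)) \<le> 2 * (hit + v4 + \<epsilon>) + v4 + \<epsilon>" using n2 3 by linarith
        have avgQ0: "0 \<le> avgQ y" for y unfolding avgQ_def using Q0 by (intro divide_nonneg_nonneg sum_nonneg) auto
        have "(\<Sum>y\<in>V. avgQ y) = ?avg (\<lambda>x. \<Sum>y\<in>V. Q x y)"
          unfolding avgQ_def sum_divide_distrib[symmetric] by (subst sum.swap) simp
        also have "\<dots> \<le> 1"
        proof (rule conjunct2[OF avg01])
          fix x assume "x \<in> heads"
          then show "0 \<le> (\<Sum>y\<in>V. Q x y) \<and> (\<Sum>y\<in>V. Q x y) \<le> 1" using Qsum ka Q0 by (auto intro: sum_nonneg)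
        qed
        finally have avgQ1: "(\<Sum>y\<in>V. avgQ y) \<le> 1" .
        have fs: "(\<Sum>e\<in>?S. f e) = WA - WB" by (simp add: f_def sum_subtractf WA(1) WB(1))
        have "(\<Sum>y\<in>V. \<bar>(\<Sum>e\<in>?S. fA e * Q (\<sigma> e) y) - (\<Sum>e\<in>?S. fB e * Q (\<sigma> e) y)\<bar>)
            \<le> (\<Sum>y\<in>V. \<bar>(\<Sum>e\<in>?S. f e * Q (\<sigma> e) y) - (\<Sum>e\<in>?S. f e) * avgQ y\<bar> + \<bar>WA - WB\<bar> * avgQ y)"
        proof (rule sum_mono)
          fix y
          have "\<bar>(WA - WB) * avgQ y\<bar> = \<bar>WA - WB\<bar> * avgQ y" using avgQ0 by (simp add: abs_mult)
          then show "\<bar>(\<Sum>e\<in>?S. fA e * Q (\<sigma> e) y) - (\<Sum>e\<in>?S. fB e * Q (\<sigma> e) y)\<bar>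
              \<le> \<bar>(\<Sum>e\<in>?S. f e * Q (\<sigma> e) y) - (\<Sum>e\<in>?S. f e) * avgQ y\<bar> + \<bar>WA - WB\<bar> * avgQ y"
            unfolding fs by (simp add: f_def left_diff_distrib sum_subtractf)
        qed
        also have "\<dots> \<le> (v1 + \<epsilon>) + \<bar>WA - WB\<bar> * 1"
          unfolding sum.distrib sum_distrib_left[symmetric] using n1 avgQ1 by (intro add_mono mult_left_mono) auto
        also have "\<dots> \<le> v1 + \<epsilon> + \<alpha> + \<omega>"
        proof -
          have "0 \<le> \<alpha>" "0 \<le> \<omega>" using WA WB by linarith+
          then have "\<bar>WA - WB\<bar> \<le> \<alpha> + \<omega>" using WA(2,3) WB(2,3) by (intro abs_leI) linarith+
          then show ?thesis unfolding mult_1_right add.assoc by (intro add_left_mono)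
        qed
        finally show False
          using concl[OF s P, unfolded repl_Q[OF s] repl_ka[OF s]] c2 by blast
      qed
      then show "of_bool (P \<sigma>) \<le> (of_bool ((\<Sum>y\<in>V. \<bar>(\<Sum>e\<in>?S. f e * Q (\<sigma> e) y) - (\<Sum>e\<in>?S. f e) * avgQ y\<bar>) > v1 + \<epsilon>)
       + of_bool (\<bar>(\<Sum>e\<in>?S. fA e * ka (\<sigma> e)) - (\<Sum>e\<in>?S. fA e) * ?avg ka\<bar> > v4 + \<epsilon>) :: real)"
        by auto
    qed
    also have "\<dots> \<le> ?p + ?p"
      unfolding cexp_add by (intro add_mono vec scalar) (use fA WA ka in auto)
    finally show ?thesis by simp
  qed
qed

end

text \<open>Killed walks give only lower bounds for the two laws. If these minorants are close and
  the first has nearly full mass, so has the second, and the little that lies above them cannot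
  separate the laws.\<close>

lemma compare_minorants:
  fixes \<mu> \<nu> p q :: "'a \<Rightarrow> real"
  assumes V: "finite V" and \<mu>: "(\<Sum>y\<in>V. \<mu> y) = 1" and \<nu>: "(\<Sum>y\<in>V. \<nu> y) = 1"
    and p: "\<And>y. y \<in> V \<Longrightarrow> p y \<le> \<mu> y" and q: "\<And>y. y \<in> V \<Longrightarrow> q y \<le> \<nu> y"
    and d: "(\<Sum>y\<in>V. \<bar>p y - q y\<bar>) \<le> d" and c: "1 - c \<le> (\<Sum>y\<in>V. p y)" and Z: "Z \<subseteq> V"
  shows "\<bar>(\<Sum>y\<in>Z. \<mu> y) - (\<Sum>y\<in>Z. \<nu> y)\<bar> \<le> 2 * d + c"
proof -
  have split: "(\<Sum>y\<in>V. g y) = (\<Sum>y\<in>Z. g y) + (\<Sum>y\<in>V - Z. g y)" for g :: "'a \<Rightarrow> real"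
    using V Z sum.subset_diff[of Z V g] by simp
  have fZ: "finite Z" using V Z finite_subset by blast
  have dS: "\<bar>(\<Sum>y\<in>S. p y) - (\<Sum>y\<in>S. q y)\<bar> \<le> d" if "S \<subseteq> V" for S
  proof -
    have "\<bar>(\<Sum>y\<in>S. p y) - (\<Sum>y\<in>S. q y)\<bar> \<le> (\<Sum>y\<in>S. \<bar>p y - q y\<bar>)"
      unfolding sum_subtractf[symmetric] by (rule sum_abs)
    also have "\<dots> \<le> (\<Sum>y\<in>V. \<bar>p y - q y\<bar>)" using V that by (intro sum_mono2) auto
    finally show ?thesis using d by linarith
  qed
  have "(\<Sum>y\<in>Z. p y) \<le> (\<Sum>y\<in>Z. \<mu> y)" "(\<Sum>y\<in>V - Z. p y) \<le> (\<Sum>y\<in>V - Z. \<mu> y)"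
    "(\<Sum>y\<in>Z. q y) \<le> (\<Sum>y\<in>Z. \<nu> y)" "(\<Sum>y\<in>V - Z. q y) \<le> (\<Sum>y\<in>V - Z. \<nu> y)"
    using p q Z by (auto intro!: sum_mono)
  then show ?thesis
    using split[of \<mu>] split[of \<nu>] split[of p] split[of q] \<mu> \<nu> c dS[OF Z] dS[of V] by (auto simp: abs_le_iff)
qed

context dcm
begin

section \<open>Terminal states of the exploration\<close>

lemma main_state_card_dom:
  fixes B \<theta> :: real
  assumes st: "main_state t0 \<theta> wmax B z \<rho> S dep w" and "\<theta> > 0" "B \<le> \<theta> * Nx"
  shows "real (card (dom \<rho>)) \<le> Nx"
proof -
  have "real (card (dom \<rho>)) * \<theta> \<le> B" using main_stateD(8)[OF st] potR_nonneg[OF st] unfolding potR_def by linarith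
  also have "\<dots> \<le> Nx * \<theta>" using assms by (simp add: mult.commute)
  finally show ?thesis using assms by simp
qed

lemma sum_start_tails:
  assumes "1 \<le> b" "b \<le> n"
  shows "(\<Sum>e\<in>{e \<in> tails. fst e \<le> b}. 1 / (b * dout (fst e)) * g (fst e)) = (\<Sum>u=1..b. g u) / b"
proof -
  have eq: "{e \<in> tails. fst e \<le> b} = {e \<in> tails. fst e \<in> {1..b}}" using tails_fst by force
  have "(\<Sum>e\<in>{e \<in> tails. fst e = u}. 1 / (b * dout (fst e)) * g (fst e)) = g u / b" if "u \<in> {1..b}" for u
  proof -
    have uV: "u \<in> V" using that assms by auto
    show ?thesis using sum_tails_of[OF uV, of "\<lambda>u. 1 / (b * dout u) * g u"] dout_ge[OF uV] by simp
  qed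
  then have "(\<Sum>u=1..b. \<Sum>e\<in>{e \<in> tails. fst e = u}. 1 / (b * dout (fst e)) * g (fst e)) = (\<Sum>u=1..b. g u / b)"
    by (intro sum.cong refl)
  also have "(\<Sum>u=1..b. \<Sum>e\<in>{e \<in> tails. fst e = u}. 1 / (b * dout (fst e)) * g (fst e))
      = (\<Sum>e\<in>{e \<in> tails. fst e \<in> {1..b}}. 1 / (b * dout (fst e)) * g (fst e))"
    using assms by (intro sum_by_tail) auto
  finally show ?thesis unfolding eq by (simp only: sum_divide_distrib)
qed

definition near where
  "near t0 h b err z \<sigma> \<longleftrightarrow> (\<forall>Z\<subseteq>V. \<bar>walk \<sigma> (t0 + Suc h) z (\<lambda>y. of_bool (y \<in> Z)) - nu \<sigma> b (Suc h) (\<lambda>y. of_bool (y \<in> Z))\<bar> \<le> err)"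

definition confined where
  "confined t0 Nx \<alpha> z \<sigma> \<longleftrightarrow> (\<exists>Z\<subseteq>V. card Z \<le> Nx + 1 \<and> 1 - \<alpha> \<le> walk \<sigma> t0 z (\<lambda>y. of_bool (y \<in> Z)))"

text \<open>Chebyshev. A bad active tail either stopped short of depth \<open>t0\<close> with weight
  below \<open>\<theta>\<close>, and is too light, or reached \<open>t0\<close> with weight above
  \<open>wU\<close>, and is too heavy; \<open>P1\<close> and \<open>P2\<close> say that either way
  the deviation is at least \<open>dv\<close> in absolute value.\<close>

lemma terminal_mass:
  fixes \<kappa> dv :: real
  assumes st: "main_state t0 \<theta> wmax B z \<rho> S dep w"
    and stop: "\<And>e. e \<in> act \<rho> S \<Longrightarrow> dep (fst e) < t0 \<Longrightarrow> tw w e < \<theta>" and J: "potJ \<kappa> \<rho> S dep w \<le> \<epsilon>1"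
    and \<kappa>: "\<kappa> > 0" and dv: "dv > 0" and \<theta>: "\<theta> > 0" and wU: "wU > 0"
    and P1: "dv \<le> - ln \<theta> - t0 * Hr" and P2: "- ln wU - t0 * Hr \<le> - dv"
  shows "1 - (\<epsilon>1 + \<epsilon>1 / (\<kappa> * dv\<^sup>2)) \<le> (\<Sum>e\<in>{e \<in> act \<rho> S. dep (fst e) = t0 \<and> tw w e \<le> wU}. tw w e)"
proof -
  let ?A = "{e \<in> act \<rho> S. dep (fst e) = t0 \<and> tw w e \<le> wU}"
  have tw0: "tw w e > 0" if "e \<in> act \<rho> S" for e by (rule main_state_tw[OF st that])
  have Vge: "0 \<le> (\<Sum>e\<in>act \<rho> S. tw w e * (dev dep w e)\<^sup>2)"
    using tw0 by (intro sum_nonneg) (simp add: less_imp_le)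
  have J1: "\<kappa> * (\<Sum>e\<in>act \<rho> S. tw w e * (dev dep w e)\<^sup>2) \<le> \<epsilon>1" and J2: "1 - \<epsilon>1 \<le> (\<Sum>e\<in>act \<rho> S. tw w e)"
    using J main_stateD(9)[OF st] mult_nonneg_nonneg[OF less_imp_le[OF \<kappa>] Vge] unfolding potJ_def by linarith+
  have big: "dv \<le> \<bar>dev dep w e\<bar>" if e: "e \<in> act \<rho> S - ?A" for e
  proof -
    have eS: "fst e \<in> S" using e by (auto simp: act_def)
    have t: "tw w e > 0" using e tw0 by auto
    show ?thesis
    proof (cases "dep (fst e) < t0")
      case True
      then have "ln (tw w e) < ln \<theta>" using stop e t \<theta> by (subst ln_less_cancel_iff) auto
      moreover have "dep (fst e) * Hr \<le> t0 * Hr" using True Hr_nonneg by (intro mult_right_mono) auto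
      ultimately have "dv \<le> dev dep w e" using P1 unfolding dev_def by linarith
      then show ?thesis by linarith
    next
      case False
      then have d: "dep (fst e) = t0" using main_stateD(5)[OF st eS] by simp
      then have "ln wU < ln (tw w e)" using e t wU by (subst ln_less_cancel_iff) auto
      then have "dev dep w e \<le> - dv" using P2 unfolding dev_def d by linarith
      then show ?thesis by linarith
    qed
  qed
  have "(\<Sum>e\<in>act \<rho> S - ?A. tw w e) * dv\<^sup>2 = (\<Sum>e\<in>act \<rho> S - ?A. tw w e * dv\<^sup>2)" by (simp add: sum_distrib_right)
  also have "\<dots> \<le> (\<Sum>e\<in>act \<rho> S - ?A. tw w e * (dev dep w e)\<^sup>2)"
  proof (intro sum_mono mult_left_mono)
    fix e assume e: "e \<in> act \<rho> S - ?A"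
    show "dv\<^sup>2 \<le> (dev dep w e)\<^sup>2" using big[OF e] dv abs_le_square_iff[of dv "dev dep w e"] by simp
    show "0 \<le> tw w e" using tw0[of e] e by auto
  qed
  also have "\<dots> \<le> (\<Sum>e\<in>act \<rho> S. tw w e * (dev dep w e)\<^sup>2)"
    using tw0 finite_act by (intro sum_mono2) (auto simp: less_imp_le)
  finally have "\<kappa> * ((\<Sum>e\<in>act \<rho> S - ?A. tw w e) * dv\<^sup>2) \<le> \<kappa> * (\<Sum>e\<in>act \<rho> S. tw w e * (dev dep w e)\<^sup>2)"
    using \<kappa> by (intro mult_left_mono) auto
  then have "(\<Sum>e\<in>act \<rho> S - ?A. tw w e) * (\<kappa> * dv\<^sup>2) \<le> \<epsilon>1" using J1 by (simp add: mult_ac)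
  then have "(\<Sum>e\<in>act \<rho> S - ?A. tw w e) \<le> \<epsilon>1 / (\<kappa> * dv\<^sup>2)" using \<kappa> dv by (simp add: pos_le_divide_eq)
  moreover have "(\<Sum>e\<in>act \<rho> S. tw w e) = (\<Sum>e\<in>act \<rho> S - ?A. tw w e) + (\<Sum>e\<in>?A. tw w e)"
    using finite_act by (intro sum.subset_diff) auto
  ultimately show ?thesis using J2 by linarith
qed

text \<open>Everything is revealed except the good tails \<open>A\<close> at depth \<open>t0\<close>
  and the still open tails \<open>B'\<close> of the starting vertices of the reference walk. At most
  \<open>Nx\<close> tails of starting vertices were revealed before, which costs the reference law a
  mass of at most \<open>\<omega>\<close>.\<close>

lemma terminal_bound:
  fixes \<theta> wmax B \<kappa> dv wU \<epsilon>1 \<epsilon> \<tau> \<gamma> \<xi> v1 v4 \<omega> N :: real and Nx b h :: nat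
  defines "\<alpha> \<equiv> \<epsilon>1 + \<epsilon>1 / (\<kappa> * dv\<^sup>2)"
    and "hit \<equiv> h * (\<tau> + sqrt ((real Nx + 1) * \<gamma>))"
    and "\<xi>' \<equiv> \<xi> + (1 / 2) ^ h"
  defines "err \<equiv> 2 * (v1 + \<epsilon> + \<alpha> + \<omega>) + (\<alpha> + (2 * (hit + v4 + \<epsilon>) + v4 + \<epsilon>))"
  assumes st: "main_state t0 \<theta> wmax B z \<rho> S dep w"
    and stop: "\<And>e. e \<in> act \<rho> S \<Longrightarrow> dep (fst e) < t0 \<Longrightarrow> tw w e < \<theta>" and J: "potJ \<kappa> \<rho> S dep w \<le> \<epsilon>1"
    and \<kappa>: "\<kappa> > 0" and dv: "dv > 0" and \<theta>: "\<theta> > 0" and wU: "wU > 0"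
    and P1: "dv \<le> - ln \<theta> - t0 * Hr" and P2: "- ln wU - t0 * Hr \<le> - dv"
    and Nx: "B \<le> \<theta> * Nx" and b: "1 \<le> b" "b \<le> n" "1 / b \<le> wU" and \<omega>: "Nx / b \<le> \<omega>" "\<omega> \<le> 1 / 2"
    and N: "real (card tails) \<le> N" and \<epsilon>: "\<epsilon> > 0" and v4: "4 * wU \<le> v4\<^sup>2" "v4 \<ge> 0"
    and v1: "real n * (4 * wU * (2 * (\<xi>' + v4 + \<epsilon>))) \<le> v1\<^sup>2" "v1 \<ge> 0" and \<gamma>: "\<gamma> \<ge> 0"
  shows "cexp \<rho> (\<lambda>\<sigma>. of_bool (global_good b h \<tau> \<gamma> \<xi> \<sigma> \<and> \<not> (near t0 h b err z \<sigma> \<and> confined t0 Nx \<alpha> z \<sigma>)))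
       \<le> 2 * exp (- \<epsilon>\<^sup>2 / (64 * wU\<^sup>2 * N))"
proof -
  define A where "A = {e \<in> act \<rho> S. dep (fst e) = t0 \<and> tw w e \<le> wU}"
  define B' where "B' = {e \<in> tails. fst e \<le> b} - dom \<rho>"
  define X where "X = fst ` (A \<union> B')"
  define fA where "fA = (\<lambda>e. if e \<in> A then tw w e else 0)"
  define fB where "fB = (\<lambda>e. if e \<in> B' then 1 / (b * dout (fst e)) else 0)"
  let ?P = "\<lambda>\<sigma>. global_good b h \<tau> \<gamma> \<xi> \<sigma> \<and> \<not> (near t0 h b err z \<sigma> \<and> confined t0 Nx \<alpha> z \<sigma>)"
  let ?T = "{e \<in> tails. fst e \<le> b}"
  note pm = main_stateD(1)[OF st]
  have SV: "S \<subseteq> V" and zV: "z \<in> V" using main_stateD(2,3)[OF st] by auto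
  have cd: "real (card (dom \<rho>)) \<le> Nx" by (rule main_state_card_dom[OF st \<theta> Nx])
  have AT: "A \<subseteq> tails - dom \<rho>" "A \<subseteq> act \<rho> S" by (auto simp: A_def act_def)
  have BT: "B' \<subseteq> tails - dom \<rho>" "B' \<subseteq> ?T" by (auto simp: B'_def)
  have finA: "finite A" "finite B'" "finite (A \<union> B')" using AT BT finite_tails finite_subset by blast+
  have AS: "fst ` A \<subseteq> S" by (auto simp: A_def act_def)
  have cA: "card (fst ` A) \<le> Nx + 1"
  proof -
    have "card (fst ` A) \<le> card S" using AS SV by (intro card_mono) (auto intro: finite_subset)
    then show ?thesis using main_state_card[OF st] cd by linarith
  qed
  have tw0: "tw w e > 0" if "e \<in> act \<rho> S" for e by (rule main_state_tw[OF st that])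
  have mass: "1 - \<alpha> \<le> (\<Sum>e\<in>A. tw w e)"
    unfolding \<alpha>_def A_def by (rule terminal_mass[OF st stop J \<kappa> dv \<theta> wU P1 P2])
  have mass1: "(\<Sum>e\<in>A. tw w e) \<le> 1"
    using sum_mono2[OF finite_act AT(2), of "tw w"] tw0 main_stateD(9)[OF st] by (force simp: less_imp_le)
  have sumA: "(\<Sum>e\<in>A \<union> B'. fA e * g e) = (\<Sum>e\<in>A. tw w e * g e)" for g
    unfolding fA_def using finA by (intro sum.mono_neutral_cong_right) auto
  have sumB: "(\<Sum>e\<in>A \<union> B'. fB e * g e) = (\<Sum>e\<in>B'. 1 / (b * dout (fst e)) * g e)" for g
    unfolding fB_def using finA by (intro sum.mono_neutral_cong_right) auto
  have sumBle: "(\<Sum>e\<in>A \<union> B'. fB e * g e) \<le> (\<Sum>e\<in>?T. 1 / (b * dout (fst e)) * g' e)"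
    if "\<And>e. e \<in> ?T \<Longrightarrow> 0 \<le> g' e" "\<And>e. e \<in> ?T \<Longrightarrow> g e \<le> g' e" for g g'
  proof -
    have "(\<Sum>e\<in>B'. 1 / (b * dout (fst e)) * g e) \<le> (\<Sum>e\<in>B'. 1 / (b * dout (fst e)) * g' e)"
      using that BT by (intro sum_mono mult_left_mono) auto
    also have "\<dots> \<le> (\<Sum>e\<in>?T. 1 / (b * dout (fst e)) * g' e)"
      using that BT finite_tails by (intro sum_mono2) auto
    finally show ?thesis unfolding sumB .
  qed
  have d2: "real (dout (fst e)) \<ge> 2" if "e \<in> tails" for e using dout_ge[OF tails_fst[OF that]] by simp
  have fBle: "1 / (b * dout (fst e)) \<le> 1 / b" if "e \<in> tails" for e
    using d2[OF that] b by (intro divide_left_mono) auto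
  have WB: "1 - \<omega> \<le> (\<Sum>e\<in>A \<union> B'. fB e)" "(\<Sum>e\<in>A \<union> B'. fB e) \<le> 1"
  proof -
    have tot: "(\<Sum>e\<in>?T. 1 / (b * dout (fst e))) = 1" using sum_start_tails[OF b(1,2), of "\<lambda>_. 1"] b by simp
    show "(\<Sum>e\<in>A \<union> B'. fB e) \<le> 1" using sumBle[of "\<lambda>_. 1" "\<lambda>_. 1"] tot by simp
    have "(\<Sum>e\<in>?T. 1 / (b * dout (fst e))) = (\<Sum>e\<in>?T \<inter> dom \<rho>. 1 / (b * dout (fst e))) + (\<Sum>e\<in>B'. 1 / (b * dout (fst e)))"
      unfolding B'_def using finite_tails by (subst sum.Int_Diff[of _ _ "dom \<rho>"]) auto
    moreover have "(\<Sum>e\<in>?T \<inter> dom \<rho>. 1 / (b * dout (fst e))) \<le> card (?T \<inter> dom \<rho>) * (1 / b)"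
      using fBle by (intro sum_bounded_above) auto
    moreover have "real (card (?T \<inter> dom \<rho>)) \<le> card (dom \<rho>)" using pm_finite[OF pm] by (simp add: card_mono)
    then have "card (?T \<inter> dom \<rho>) * (1 / b) \<le> \<omega>"
      using cd \<omega>(1) mult_right_mono[of "real (card (?T \<inter> dom \<rho>))" "real Nx" "1 / b"] by simp
    moreover have "(\<Sum>e\<in>A \<union> B'. fB e) = (\<Sum>e\<in>B'. 1 / (b * dout (fst e)))" using sumB[of "\<lambda>_. 1"] by simp
    ultimately show "1 - \<omega> \<le> (\<Sum>e\<in>A \<union> B'. fB e)" using tot by linarith
  qed
  show ?thesis
  proof (rule cexp_reveal_le[OF pm, of "tails - (A \<union> B')"])
    fix \<rho>' assume pm': "pm \<rho>'" and le: "\<rho> \<subseteq>\<^sub>m \<rho>'" and dom': "dom \<rho>' = dom \<rho> \<union> (tails - (A \<union> B'))"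
    have rest: "tails - dom \<rho>' = A \<union> B'" using dom' AT BT by auto
    have ext: "\<sigma> \<in> ext \<rho>" if "\<sigma> \<in> ext \<rho>'" for \<sigma> using that le ext_antimono by blast
    show "cexp \<rho>' (\<lambda>\<sigma>. of_bool (?P \<sigma>)) \<le> 2 * exp (- \<epsilon>\<^sup>2 / (64 * wU\<^sup>2 * N))"
    proof (rule matched_boundary[where fA = fA and fB = fB and h = h and hit = hit and \<xi> = \<xi>' and \<alpha> = \<alpha> and \<omega> = \<omega> and r = "2 * (\<xi>' + v4 + \<epsilon>)",
          OF pm' rest X_def _ _ wU _ _ refl _ _ refl WB(2,1) \<omega>(2) N \<epsilon> v4 refl v1])
      show "0 \<le> fA e \<and> fA e \<le> wU" for e using tw0 wU by (auto simp: fA_def A_def less_imp_le)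
      show "0 \<le> fB e \<and> fB e \<le> wU" for e
        using fBle[of e] b(3) wU BT by (auto simp: fB_def intro: order_trans)
      show "e \<notin> A \<Longrightarrow> fA e = 0" "e \<notin> B' \<Longrightarrow> fB e = 0" for e by (auto simp: fA_def fB_def)
      show "(\<Sum>e\<in>A \<union> B'. fA e) \<le> 1" "1 - \<alpha> \<le> (\<Sum>e\<in>A \<union> B'. fA e)" using sumA[of "\<lambda>_. 1"] mass mass1 by auto
    next
      fix \<sigma> assume s: "\<sigma> \<in> ext \<rho>'" and P: "?P \<sigma>"
      note sM = ext_M[OF s]
      note G = P[THEN conjunct1, unfolded global_good_def]
      let ?f = "\<lambda>i e. walk \<sigma> i (fst (\<sigma> e)) (\<lambda>y. of_bool (y \<in> X))"
      have "(\<Sum>e\<in>A \<union> B'. fB e * (1 - kwalk X \<sigma> h (fst (\<sigma> e)) (\<lambda>_. 1))) \<le> (\<Sum>e\<in>?T. 1 / (b * dout (fst e)) * (\<Sum>i<h. ?f i e))"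
        using sM M_fst[OF sM] by (intro sumBle killed_mass sum_nonneg walk_nonneg) auto
      also have "\<dots> = (\<Sum>i<h. nu \<sigma> b (Suc i) (\<lambda>y. of_bool (y \<in> X)))"
        unfolding nu_Suc_tails[OF b(2)] sum_distrib_left by (rule sum.swap)
      also have "\<dots> \<le> (\<Sum>i<h. \<tau> + sqrt ((real Nx + 1) * \<gamma>))"
      proof (rule sum_mono)
        fix i assume "i \<in> {..<h}"
        then have i: "Suc i \<in> {1..h}" "Suc i \<in> {1..h + 1}" by auto
        \<comment> \<open>The killing set consists of starting vertices, treated by the return
          bound, and of at most \<open>Nx + 1\<close> explored vertices, treated by the l2
          bound.\<close>
        have "nu \<sigma> b (Suc i) (\<lambda>y. of_bool (y \<in> X)) \<le> nu \<sigma> b (Suc i) (\<lambda>y. of_bool (y \<in> {1..b}) + of_bool (y \<in> fst ` A))"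
        proof (rule nu_mono[OF sM b(2)])
          fix v assume "v \<in> V"
          have "v \<in> X \<Longrightarrow> v \<in> {1..b} \<or> v \<in> fst ` A" using BT \<open>v \<in> V\<close> by (force simp: X_def)
          then show "of_bool (v \<in> X) \<le> (of_bool (v \<in> {1..b}) + of_bool (v \<in> fst ` A) :: real)" by auto
        qed
        also have "\<dots> \<le> \<tau> + sqrt (card (fst ` A) * \<gamma>)"
          unfolding nu_add
        proof (rule add_mono)
          show "nu \<sigma> b (Suc i) (\<lambda>y. of_bool (y \<in> {1..b})) \<le> \<tau>" using G i(1) by blast
          have "(\<Sum>y\<in>V. (nu \<sigma> b (Suc i) (\<lambda>z. of_bool (z = y)))\<^sup>2) \<le> \<gamma>" using G i(2) by blast
          moreover have "fst ` A \<subseteq> V" using AS SV by blast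
          ultimately show "nu \<sigma> b (Suc i) (\<lambda>y. of_bool (y \<in> fst ` A)) \<le> sqrt (card (fst ` A) * \<gamma>)"
            by (intro nu_set_le[OF sM b(2)])
        qed
        also have "sqrt (card (fst ` A) * \<gamma>) \<le> sqrt ((real Nx + 1) * \<gamma>)"
          using cA \<gamma> by (intro real_sqrt_le_mono mult_right_mono) auto
        finally show "nu \<sigma> b (Suc i) (\<lambda>y. of_bool (y \<in> X)) \<le> \<tau> + sqrt ((real Nx + 1) * \<gamma>)" by simp
      qed
      finally show "(\<Sum>e\<in>A \<union> B'. fB e * (1 - kwalk X \<sigma> h (fst (\<sigma> e)) (\<lambda>_. 1))) \<le> hit" by (simp add: hit_def)
    next
      fix \<sigma> assume s: "\<sigma> \<in> ext \<rho>'" and P: "?P \<sigma>"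
      note sM = ext_M[OF s]
      note G = P[THEN conjunct1, unfolded global_good_def]
      have "(\<Sum>e\<in>A \<union> B'. fB e * (\<Sum>y\<in>V. (kwalk X \<sigma> h (fst (\<sigma> e)) (\<lambda>z. of_bool (z = y)))\<^sup>2))
          \<le> (\<Sum>e\<in>?T. 1 / (b * dout (fst e)) * (of_bool (\<not> treelike \<sigma> (h + 1) (fst e)) + (1 / 2) ^ h))"
      proof (rule sumBle)
        fix e assume e: "e \<in> ?T"
        have cV: "fst (\<sigma> e) \<in> V" using M_fst[OF sM] e by auto
        let ?q = "\<lambda>y. kwalk X \<sigma> h (fst (\<sigma> e)) (\<lambda>z. of_bool (z = y))"
        have q: "0 \<le> ?q y" "?q y \<le> trans_prob \<sigma> h (fst (\<sigma> e)) y" for y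
          unfolding trans_prob_def using sM cV by (auto intro!: kwalk_nonneg kwalk_le_walk)
        have tp1: "trans_prob \<sigma> h (fst (\<sigma> e)) y \<le> 1" for y
          unfolding trans_prob_def using sM cV by (rule walk_indicator_le1)
        have "(\<Sum>y\<in>V. ?q y) \<le> 1" using sum_mono[of V ?q "trans_prob \<sigma> h (fst (\<sigma> e))"] q trans_prob_total[OF sM cV] by simp
        note sq = sum_square_le_max[OF _ _ this]
        show "(\<Sum>y\<in>V. (?q y)\<^sup>2) \<le> of_bool (\<not> treelike \<sigma> (h + 1) (fst e)) + (1 / 2) ^ h"
        proof (cases "treelike \<sigma> (h + 1) (fst e)")
          case True
          \<comment> \<open>Radius \<open>h + 1\<close> at the start leaves radius \<open>h\<close>
            after one step; then all entries are at most \<open>(1 / 2) ^ h\<close>, and so is the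
            sum of their squares.\<close>
          have "treelike \<sigma> h (fst (\<sigma> (fst e, snd e)))"
            using True e tails_iff[of "fst e" "snd e"] by (intro treelike_child) auto
          then have "trans_prob \<sigma> h (fst (\<sigma> e)) y \<le> (1 / 2) ^ h" for y
            unfolding trans_prob_def using treelike_walk_le[OF sM cV] by simp
          then have "(\<Sum>y\<in>V. (?q y)\<^sup>2) \<le> (1 / 2) ^ h" using q by (intro sq) (auto intro: order_trans)
          then show ?thesis using True by simp
        next
          case False
          have "(\<Sum>y\<in>V. (?q y)\<^sup>2) \<le> 1" using q tp1 by (intro sq) (auto intro: order_trans)
          then show ?thesis using False by (simp add: add_increasing2)
        qed
      qed simp
      also have "\<dots> = (\<Sum>u=1..b. of_bool (\<not> treelike \<sigma> (h + 1) u) + (1 / 2) ^ h) / b"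
        by (rule sum_start_tails[OF b(1,2)])
      also have "\<dots> = (\<Sum>u=1..b. of_bool (\<not> treelike \<sigma> (h + 1) u)) / b + (1 / 2) ^ h"
        using b by (simp add: sum.distrib add_divide_distrib del: sum_of_bool_eq)
      also have "\<dots> \<le> \<xi> + (1 / 2) ^ h" using G b by (simp add: pos_divide_le_eq del: sum_of_bool_eq)
      finally show "(\<Sum>e\<in>A \<union> B'. fB e * (\<Sum>y\<in>V. (kwalk X \<sigma> h (fst (\<sigma> e)) (\<lambda>z. of_bool (z = y)))\<^sup>2)) \<le> \<xi>'"
        by (simp add: \<xi>'_def)
    next
      fix \<sigma> assume s: "\<sigma> \<in> ext \<rho>'" and P: "?P \<sigma>"
      let ?k = "\<lambda>e y. kwalk X \<sigma> h (fst (\<sigma> e)) (\<lambda>z. of_bool (z = y))"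
      let ?p = "\<lambda>y. \<Sum>e\<in>A \<union> B'. fA e * ?k e y" and ?q = "\<lambda>y. \<Sum>e\<in>A \<union> B'. fB e * ?k e y"
      assume c1: "(\<Sum>y\<in>V. \<bar>?p y - ?q y\<bar>) \<le> v1 + \<epsilon> + \<alpha> + \<omega>"
        and c2: "(\<Sum>e\<in>A \<union> B'. fA e * (1 - kwalk X \<sigma> h (fst (\<sigma> e)) (\<lambda>_. 1))) \<le> 2 * (hit + v4 + \<epsilon>) + v4 + \<epsilon>"
      note sM = ext_M[OF s]
      have cV: "fst (\<sigma> e) \<in> V" if "e \<in> tails" for e using M_fst[OF sM that] .
      have k0: "0 \<le> ?k e y" "?k e y \<le> walk \<sigma> h (fst (\<sigma> e)) (\<lambda>z. of_bool (z = y))" if "e \<in> tails" for e y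
        using sM cV[OF that] by (auto intro!: kwalk_nonneg kwalk_le_walk)
      have wle: "w v \<le> trans_prob \<sigma> t0 z v" if v: "v \<in> fst ` A" for v
      proof -
        have "v \<in> S" "dep v = t0" using v by (auto simp: A_def act_def)
        then show ?thesis using main_state_walk[OF st _ ext[OF s]] unfolding trans_prob_def by blast
      qed
      \<comment> \<open>The good tails are grouped by their vertex \<open>v\<close>: the weight
        \<open>w v\<close> is at most the transition probability to \<open>v\<close>, and the tails
        of \<open>v\<close> add up to at most one step of the walk.\<close>
      have below: "(\<Sum>e\<in>A. tw w e * g e) \<le> (\<Sum>v\<in>fst ` A. trans_prob \<sigma> t0 z v * \<psi> v)"
        if g0: "\<And>e. e \<in> tails \<Longrightarrow> 0 \<le> g e" and psi: "\<And>v. v \<in> fst ` A \<Longrightarrow> (\<Sum>e\<in>{e \<in> tails. fst e = v}. g e / dout (fst e)) \<le> \<psi> v" for g \<psi>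
      proof -
        have "(\<Sum>e\<in>A. tw w e * g e) = (\<Sum>v\<in>fst ` A. \<Sum>e\<in>{e \<in> A. fst e = v}. tw w e * g e)"
          using finA by (intro sum.group[symmetric]) auto
        also have "\<dots> \<le> (\<Sum>v\<in>fst ` A. trans_prob \<sigma> t0 z v * \<psi> v)"
        proof (rule sum_mono)
          fix v assume v: "v \<in> fst ` A"
          then have vS: "v \<in> S" using AS by auto
          have "0 \<le> (1 / real K) ^ dep v" by simp
          then have w0: "0 \<le> w v" using main_state_weight[OF st vS] by linarith
          have "(\<Sum>e\<in>{e \<in> A. fst e = v}. tw w e * g e) = w v * (\<Sum>e\<in>{e \<in> A. fst e = v}. g e / dout (fst e))"
            unfolding sum_distrib_left by (intro sum.cong) (auto simp: tw_def)
          also have "\<dots> \<le> w v * (\<Sum>e\<in>{e \<in> tails. fst e = v}. g e / dout (fst e))"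
            using w0 AT finite_tails g0 by (intro mult_left_mono sum_mono2) auto
          also have "\<dots> \<le> w v * \<psi> v" using w0 psi[OF v] by (intro mult_left_mono)
          also have "\<dots> \<le> trans_prob \<sigma> t0 z v * \<psi> v"
          proof (intro mult_right_mono wle v)
            have "0 \<le> (\<Sum>e\<in>{e \<in> tails. fst e = v}. g e / dout (fst e))" using g0 by (intro sum_nonneg) auto
            then show "0 \<le> \<psi> v" using psi[OF v] by linarith
          qed
          finally show "(\<Sum>e\<in>{e \<in> A. fst e = v}. tw w e * g e) \<le> trans_prob \<sigma> t0 z v * \<psi> v" .
        qed
        finally show ?thesis .
      qed
      have AV: "fst ` A \<subseteq> V" using AS SV by auto
      have "confined t0 Nx \<alpha> z \<sigma>"
        unfolding confined_def
      proof (intro exI conjI)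
        show "fst ` A \<subseteq> V" by (rule AV)
        show "card (fst ` A) \<le> Nx + 1" by (rule cA)
        have one: "(\<Sum>e\<in>{e \<in> tails. fst e = v}. 1 / real (dout (fst e))) \<le> 1" if "v \<in> fst ` A" for v
        proof -
          have vV: "v \<in> V" using that AV by blast
          have "(\<Sum>e\<in>{e \<in> tails. fst e = v}. 1 / real (dout (fst e))) = dout v * (1 / real (dout v))"
            by (rule sum_tails_of[OF vV])
          then show ?thesis by simp
        qed
        have "(\<Sum>e\<in>A. tw w e * 1) \<le> (\<Sum>v\<in>fst ` A. trans_prob \<sigma> t0 z v * 1)" by (rule below) (use one in auto)
        then show "1 - \<alpha> \<le> walk \<sigma> t0 z (\<lambda>y. of_bool (y \<in> fst ` A))"
          unfolding sum_trans_prob[OF sM zV AV] using mass by simp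
      qed
      moreover have "near t0 h b err z \<sigma>"
        unfolding near_def
      proof (intro allI impI)
        fix Z assume Z: "Z \<subseteq> V"
        have "\<bar>(\<Sum>y\<in>Z. trans_prob \<sigma> (t0 + Suc h) z y) - (\<Sum>y\<in>Z. nu \<sigma> b (Suc h) (\<lambda>z. of_bool (z = y)))\<bar>
            \<le> 2 * (v1 + \<epsilon> + \<alpha> + \<omega>) + (\<alpha> + (2 * (hit + v4 + \<epsilon>) + v4 + \<epsilon>))"
        proof (rule compare_minorants[OF _ _ _ _ _ c1 _ Z])
          show "(\<Sum>y\<in>V. trans_prob \<sigma> (t0 + Suc h) z y) = 1" by (rule trans_prob_total[OF sM zV])
          show "(\<Sum>y\<in>V. nu \<sigma> b (Suc h) (\<lambda>z. of_bool (z = y))) = 1" by (rule nu_total[OF sM b(1,2)])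
          fix y
          have "?p y \<le> (\<Sum>v\<in>fst ` A. trans_prob \<sigma> t0 z v * walk \<sigma> (Suc h) v (\<lambda>z. of_bool (z = y)))"
            unfolding sumA
          proof (rule below)
            fix v assume "v \<in> fst ` A"
            then have "v \<in> V" using AV by auto
            then show "(\<Sum>e\<in>{e \<in> tails. fst e = v}. ?k e y / dout (fst e)) \<le> walk \<sigma> (Suc h) v (\<lambda>z. of_bool (z = y))"
              unfolding walk_Suc_tails[OF \<open>v \<in> V\<close>] using k0 by (intro sum_mono divide_right_mono) auto
          qed (use k0 in auto)
          also have "\<dots> \<le> (\<Sum>v\<in>V. trans_prob \<sigma> t0 z v * walk \<sigma> (Suc h) v (\<lambda>z. of_bool (z = y)))"
            using AV sM zV by (intro sum_mono2 mult_nonneg_nonneg trans_prob_nonneg walk_nonneg) auto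
          also have "\<dots> = trans_prob \<sigma> (t0 + Suc h) z y"
            unfolding trans_prob_def[of _ "t0 + Suc h"] walk_compose walk_expand'[OF sM zV, of t0] ..
          finally show "?p y \<le> trans_prob \<sigma> (t0 + Suc h) z y" .
          show "?q y \<le> nu \<sigma> b (Suc h) (\<lambda>z. of_bool (z = y))"
            unfolding nu_Suc_tails[OF b(2)]
          proof (rule sumBle)
            fix e assume "e \<in> ?T"
            then have e: "e \<in> tails" by simp
            show "?k e y \<le> walk \<sigma> h (fst (\<sigma> e)) (\<lambda>z. of_bool (z = y))" by (rule k0(2)[OF e])
            show "0 \<le> walk \<sigma> h (fst (\<sigma> e)) (\<lambda>z. of_bool (z = y))" using k0[OF e] by (rule order_trans)
          qed
        next
          have "(\<Sum>y\<in>V. ?p y) = (\<Sum>e\<in>A \<union> B'. fA e * kwalk X \<sigma> h (fst (\<sigma> e)) (\<lambda>_. 1))"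
          proof -
            have tot: "(\<Sum>y\<in>V. ?k e y) = kwalk X \<sigma> h (fst (\<sigma> e)) (\<lambda>_. 1)" if "e \<in> tails" for e
              unfolding kwalk_sum[symmetric] using sM cV[OF that] by (intro kwalk_cong) (auto simp: of_bool_def)
            have "(\<Sum>y\<in>V. ?p y) = (\<Sum>e\<in>A \<union> B'. fA e * (\<Sum>y\<in>V. ?k e y))"
              unfolding sum_distrib_left by (rule sum.swap)
            also have "\<dots> = (\<Sum>e\<in>A \<union> B'. fA e * kwalk X \<sigma> h (fst (\<sigma> e)) (\<lambda>_. 1))"
              using AT BT by (intro sum.cong refl arg_cong2[where f="(*)"] tot) auto
            finally show ?thesis .
          qed
          also have "\<dots> = (\<Sum>e\<in>A \<union> B'. fA e) - (\<Sum>e\<in>A \<union> B'. fA e * (1 - kwalk X \<sigma> h (fst (\<sigma> e)) (\<lambda>_. 1)))"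
            by (simp add: right_diff_distrib sum_subtractf)
          finally show "1 - (\<alpha> + (2 * (hit + v4 + \<epsilon>) + v4 + \<epsilon>)) \<le> (\<Sum>y\<in>V. ?p y)"
            using c2 mass sumA[of "\<lambda>_. 1"] by simp
        qed simp
        then show "\<bar>walk \<sigma> (t0 + Suc h) z (\<lambda>y. of_bool (y \<in> Z)) - nu \<sigma> b (Suc h) (\<lambda>y. of_bool (y \<in> Z))\<bar> \<le> err"
          unfolding sum_trans_prob[OF sM zV Z] nu_set_sum[OF sM b(2) Z] err_def .
      qed
      ultimately show False using P by blast
    qed
  qed auto
qed

end

section \<open>Total variation distance\<close>

lemma tv_dist_ge: "finite V \<Longrightarrow> A \<subseteq> V \<Longrightarrow> \<bar>sum \<mu> A - sum \<nu> A\<bar> \<le> tv_dist V \<mu> \<nu>"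
  unfolding tv_dist_def by (intro Max_ge) auto

lemma tv_dist_le: "finite V \<Longrightarrow> (\<And>A. A \<subseteq> V \<Longrightarrow> \<bar>sum \<mu> A - sum \<nu> A\<bar> \<le> c) \<Longrightarrow> tv_dist V \<mu> \<nu> \<le> c"
  unfolding tv_dist_def by (subst Max_le_iff) auto

lemma tv_dist_nonneg: "finite V \<Longrightarrow> 0 \<le> tv_dist V \<mu> \<nu>"
  using tv_dist_ge[of V "{}" \<mu> \<nu>] by simp

lemma tv_dist_le_1:
  assumes "finite V" "\<And>y. y \<in> V \<Longrightarrow> 0 \<le> \<mu> y" "\<And>y. y \<in> V \<Longrightarrow> 0 \<le> \<nu> y" "sum \<mu> V = 1" "sum \<nu> V = 1"
  shows "tv_dist V \<mu> \<nu> \<le> 1"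
proof (rule tv_dist_le[OF assms(1)])
  fix A assume A: "A \<subseteq> V"
  have "0 \<le> sum \<mu> A" "0 \<le> sum \<nu> A" using A assms by (auto intro!: sum_nonneg)
  moreover have "sum \<mu> A \<le> 1" "sum \<nu> A \<le> 1" using A assms sum_mono2[OF assms(1) A] by (metis DiffD1)+
  ultimately show "\<bar>sum \<mu> A - sum \<nu> A\<bar> \<le> 1" by (auto simp: abs_le_iff)
qed

text \<open>The extremal set is where one law exceeds the other. The extension from sets to
  functions with values in [0, 1] is what makes the distance to a stationary law monotone in
  time.\<close>

lemma tv_dist_functions:
  fixes \<phi> :: "'a \<Rightarrow> real"
  assumes V: "finite V" and \<phi>: "\<And>y. y \<in> V \<Longrightarrow> 0 \<le> \<phi> y \<and> \<phi> y \<le> 1"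
  shows "\<bar>(\<Sum>y\<in>V. \<mu> y * \<phi> y) - (\<Sum>y\<in>V. \<nu> y * \<phi> y)\<bar> \<le> tv_dist V \<mu> \<nu>"
proof -
  have one: "(\<Sum>y\<in>V. \<mu> y * \<phi> y) - (\<Sum>y\<in>V. \<nu> y * \<phi> y) \<le> \<bar>sum \<mu> A - sum \<nu> A\<bar>"
    if "A = {y \<in> V. \<mu> y \<ge> \<nu> y}" for \<mu> \<nu> :: "'a \<Rightarrow> real" and A
  proof -
    have "(\<Sum>y\<in>V. \<mu> y * \<phi> y) - (\<Sum>y\<in>V. \<nu> y * \<phi> y) = (\<Sum>y\<in>V. (\<mu> y - \<nu> y) * \<phi> y)"
      by (simp add: sum_subtractf left_diff_distrib)
    also have "\<dots> \<le> (\<Sum>y\<in>V. if y \<in> A then \<mu> y - \<nu> y else 0)"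
    proof (rule sum_mono)
      fix y assume y: "y \<in> V"
      show "(\<mu> y - \<nu> y) * \<phi> y \<le> (if y \<in> A then \<mu> y - \<nu> y else 0)"
      proof (cases "y \<in> A")
        case True
        then show ?thesis using \<phi>[OF y] that mult_left_mono[of "\<phi> y" 1 "\<mu> y - \<nu> y"] by simp
      next
        case False
        then have "\<mu> y - \<nu> y \<le> 0" using y that by auto
        then show ?thesis using \<phi>[OF y] False by (simp add: mult_nonpos_nonneg)
      qed
    qed
    also have "\<dots> = sum \<mu> A - sum \<nu> A"
      using V that by (simp add: sum.inter_filter[symmetric] sum_subtractf)
    finally show ?thesis by linarith
  qed
  have "(\<Sum>y\<in>V. \<mu> y * \<phi> y) - (\<Sum>y\<in>V. \<nu> y * \<phi> y) \<le> tv_dist V \<mu> \<nu>"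
    using one[OF refl, of \<mu> \<nu>] tv_dist_ge[OF V, of "{y \<in> V. \<mu> y \<ge> \<nu> y}" \<mu> \<nu>] by force
  moreover have "(\<Sum>y\<in>V. \<nu> y * \<phi> y) - (\<Sum>y\<in>V. \<mu> y * \<phi> y) \<le> tv_dist V \<mu> \<nu>"
    using one[OF refl, of \<nu> \<mu>] tv_dist_ge[OF V, of "{y \<in> V. \<nu> y \<ge> \<mu> y}" \<mu> \<nu>] by force
  ultimately show ?thesis by linarith
qed

section \<open>Bounds for a fixed number of vertices\<close>

context dcm
begin

section \<open>Matchings and the walk on the multigraph\<close>

abbreviation graph :: "(nat \<times> nat \<Rightarrow> nat \<times> nat) \<Rightarrow> (nat, nat \<times> nat) pre_digraph" where
  "graph \<sigma> \<equiv> matching_graph n dout \<sigma>"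

lemma srw_eq:
  assumes "z \<in> V"
  shows "srw (graph \<sigma>) z y = trans_prob \<sigma> 1 z y"
proof -
  have "{e \<in> arcs (graph \<sigma>). tail (graph \<sigma>) e = z \<and> head (graph \<sigma>) e = y} = Pair z ` {i \<in> {..<dout z}. fst (\<sigma> (z, i)) = y}"
    using assms by (auto simp: matching_graph_def half_edges_def)
  then have "multiplicity_arc (graph \<sigma>) z y = card {i \<in> {..<dout z}. fst (\<sigma> (z, i)) = y}"
    unfolding multiplicity_arc_def by (simp add: card_image inj_on_def)
  moreover have "{i \<in> {..<dout z}. fst (\<sigma> (z, i)) = y} = {..<dout z} \<inter> {i. fst (\<sigma> (z, i)) = y}" by auto
  ultimately show ?thesis
    unfolding srw_def out_degree_matching_graph[OF assms] trans_prob_def by simp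
qed

lemma verts_graph: "verts (graph \<sigma>) = V" by (simp add: matching_graph_def)

lemma srw_pow_eq:
  assumes "\<sigma> \<in> M" "x \<in> V"
  shows "srw_pow (graph \<sigma>) t x y = trans_prob \<sigma> t x y"
proof (induction t arbitrary: y)
  case 0
  then show ?case by (auto simp: trans_prob_def)
next
  case (Suc t)
  have "srw_pow (graph \<sigma>) (Suc t) x y = (\<Sum>z\<in>V. trans_prob \<sigma> t x z * trans_prob \<sigma> 1 z y)"
    using Suc srw_eq by (simp add: verts_graph)
  also have "\<dots> = walk \<sigma> (t + 1) x (\<lambda>z. of_bool (z = y))"
    unfolding walk_compose walk_expand'[OF assms, of t] by (simp only: trans_prob_def)
  finally show ?case by (simp add: trans_prob_def)
qed

lemma stationary_walk:
  assumes \<sigma>: "\<sigma> \<in> M" and p: "stationary (graph \<sigma>) p"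
  shows "(\<Sum>x\<in>V. p x * walk \<sigma> t x \<phi>) = (\<Sum>x\<in>V. p x * \<phi> x)"
proof (induction t)
  case (Suc t)
  have p': "p x = (\<Sum>y\<in>V. p y * trans_prob \<sigma> 1 y x)" if "x \<in> V" for x
  proof -
    have "(\<Sum>y\<in>V. p y * srw (graph \<sigma>) y x) = p x" using p that by (simp add: stationary_def verts_graph)
    then show ?thesis using srw_eq by simp
  qed
  have "(\<Sum>x\<in>V. p x * walk \<sigma> (1 + t) x \<phi>) = (\<Sum>y\<in>V. \<Sum>x\<in>V. p y * trans_prob \<sigma> 1 y x * walk \<sigma> t x \<phi>)"
  proof (rule sum.cong[OF refl])
    fix x assume x: "x \<in> V"
    have "walk \<sigma> (1 + t) x \<phi> = (\<Sum>y\<in>V. trans_prob \<sigma> 1 x y * walk \<sigma> t y \<phi>)"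
      unfolding walk_compose by (rule walk_expand'[OF \<sigma> x])
    then show "p x * walk \<sigma> (1 + t) x \<phi> = (\<Sum>y\<in>V. p x * trans_prob \<sigma> 1 x y * walk \<sigma> t y \<phi>)"
      by (simp only: sum_distrib_left mult.assoc)
  qed
  also have "\<dots> = (\<Sum>x\<in>V. (\<Sum>y\<in>V. p y * trans_prob \<sigma> 1 y x) * walk \<sigma> t x \<phi>)"
    unfolding sum_distrib_right by (rule sum.swap)
  also have "\<dots> = (\<Sum>x\<in>V. p x * walk \<sigma> t x \<phi>)" using p' by simp
  finally show ?case using Suc by simp
qed simp

definition dist_to :: "(nat \<times> nat \<Rightarrow> nat \<times> nat) \<Rightarrow> nat \<Rightarrow> nat \<Rightarrow> (nat \<Rightarrow> real) \<Rightarrow> real" where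
  "dist_to \<sigma> t x p = tv_dist V (srw_pow (graph \<sigma>) t x) p"

lemma dist_to_eq: "\<sigma> \<in> M \<Longrightarrow> x \<in> V \<Longrightarrow> dist_to \<sigma> t x p = tv_dist V (trans_prob \<sigma> t x) p"
proof -
  assume "\<sigma> \<in> M" "x \<in> V"
  then have "srw_pow (graph \<sigma>) t x = trans_prob \<sigma> t x" using srw_pow_eq by (intro ext)
  then show ?thesis by (simp add: dist_to_def)
qed

text \<open>Further steps turn an indicator into a function with values in [0, 1] and leave
  \<open>p\<close> unchanged. Thus one early and one late time settle all others.\<close>

lemma dist_to_antimono:
  assumes \<sigma>: "\<sigma> \<in> M" and x: "x \<in> V" and p: "stationary (graph \<sigma>) p" and t: "t \<le> t'"
  shows "dist_to \<sigma> t' x p \<le> dist_to \<sigma> t x p"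
  unfolding dist_to_eq[OF \<sigma> x]
proof (rule tv_dist_le)
  obtain k where k: "t' = t + k" using t le_Suc_ex by blast
  fix Z assume Z: "Z \<subseteq> V"
  let ?\<phi> = "\<lambda>y. walk \<sigma> k y (\<lambda>z. of_bool (z \<in> Z))"
  have "(\<Sum>y\<in>Z. trans_prob \<sigma> t' x y) = (\<Sum>y\<in>V. trans_prob \<sigma> t x y * ?\<phi> y)"
    unfolding sum_trans_prob[OF \<sigma> x Z, symmetric] k walk_compose by (rule walk_expand'[OF \<sigma> x])
  moreover have "(\<Sum>y\<in>Z. p y) = (\<Sum>y\<in>V. p y * ?\<phi> y)"
  proof -
    have "(\<Sum>y\<in>V. p y * ?\<phi> y) = (\<Sum>y\<in>V. p y * of_bool (y \<in> Z))" by (rule stationary_walk[OF \<sigma> p])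
    also have "\<dots> = (\<Sum>y\<in>Z. p y * of_bool (y \<in> Z))" using Z by (intro sum.mono_neutral_right) auto
    finally show ?thesis by simp
  qed
  ultimately show "\<bar>(\<Sum>y\<in>Z. trans_prob \<sigma> t' x y) - (\<Sum>y\<in>Z. p y)\<bar> \<le> tv_dist V (trans_prob \<sigma> t x) p"
    using tv_dist_functions[of V ?\<phi> "trans_prob \<sigma> t x" p] walk_indicator_le1[OF \<sigma>] walk_nonneg[OF \<sigma>] by simp
qed simp

lemma dist_to_le_1:
  assumes \<sigma>: "\<sigma> \<in> M" and x: "x \<in> V" and p: "stationary (graph \<sigma>) p"
  shows "dist_to \<sigma> t x p \<le> 1"
  unfolding dist_to_eq[OF \<sigma> x]
  by (rule tv_dist_le_1) (use p trans_prob_nonneg[OF \<sigma> x] trans_prob_total[OF \<sigma> x] in \<open>auto simp: stationary_def verts_graph\<close>)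

text \<open>No probability is left here. The lower bound needs one small set for \<open>x\<close>:
  the union of the sets belonging to the tree-like vertices that \<open>x\<close> reaches in
  \<open>s\<close> steps. It has little stationary mass because \<open>p\<close> is near the
  spread-out reference law.\<close>

lemma cutoff_deterministic:
  fixes \<gamma> err \<alpha> :: real
  assumes \<sigma>: "\<sigma> \<in> M" and b: "1 \<le> b" "b \<le> n"
    and \<gamma>: "(\<Sum>y\<in>V. (nu \<sigma> b (Suc h) (\<lambda>z. of_bool (z = y)))\<^sup>2) \<le> \<gamma>" "\<gamma> \<ge> 0"
    and twin: "\<And>v i j. v \<in> V \<Longrightarrow> i < dout v \<Longrightarrow> j < dout v \<Longrightarrow> i \<noteq> j \<Longrightarrow>
        treelike \<sigma> (2 * s) (fst (\<sigma> (v, i))) \<or> treelike \<sigma> (2 * s) (fst (\<sigma> (v, j)))"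
    and good: "\<And>z. z \<in> V \<Longrightarrow> treelike \<sigma> s z \<Longrightarrow> near t0 h b err z \<sigma> \<and> confined t0 Nx \<alpha> z \<sigma>"
    and err: "err \<ge> 0" and \<alpha>: "\<alpha> \<ge> 0"
    and p: "stationary (graph \<sigma>) p" and x: "x \<in> V"
  shows "dist_to \<sigma> (s + (t0 + Suc h)) x p \<le> 2 * (err + (1 / 2) ^ s)"
    and "dist_to \<sigma> (s + t0) x p \<ge> 1 - (\<alpha> + err + 2 * (1 / 2) ^ s + sqrt (real (NW s * (Nx + 1)) * \<gamma>))"
proof -
  let ?T = "s + (t0 + Suc h)"
  let ?I = "\<lambda>Z y. of_bool (y \<in> Z) :: real"
  have bad: "walk \<sigma> s x (\<lambda>y. of_bool (\<not> treelike \<sigma> s y)) \<le> (1 / 2) ^ s" if "x \<in> V" for x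
    by (rule walk_not_treelike_le[OF \<sigma> that _ twin]) simp
  have nearx: "\<bar>walk \<sigma> ?T x (?I Z) - nu \<sigma> b (Suc h) (?I Z)\<bar> \<le> err + (1 / 2) ^ s" if x: "x \<in> V" and Z: "Z \<subseteq> V" for x Z
  proof -
    let ?c = "nu \<sigma> b (Suc h) (?I Z)"
    have c01: "0 \<le> ?c" "?c \<le> 1"
      using nu_nonneg[OF \<sigma> b(2), of "?I Z"] nu_mono[OF \<sigma> b(2), of "?I Z" "\<lambda>_. 1"] nu_const[OF \<sigma> b, of _ 1] by auto
    have pt: "\<bar>walk \<sigma> (t0 + Suc h) z (?I Z) - ?c\<bar> \<le> err + of_bool (\<not> treelike \<sigma> s z)" if "z \<in> V" for z
    proof (cases "treelike \<sigma> s z")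
      case True
      then show ?thesis using good[OF that] Z unfolding near_def by simp
    next
      case False
      have "0 \<le> walk \<sigma> (t0 + Suc h) z (?I Z)" "walk \<sigma> (t0 + Suc h) z (?I Z) \<le> 1"
        using \<sigma> that by (auto intro!: walk_nonneg walk_indicator_le1 simp del: walk.simps)
      then show ?thesis using c01 err False by (auto simp: abs_le_iff)
    qed
    have "walk \<sigma> ?T x (?I Z) - ?c = walk \<sigma> s x (\<lambda>z. walk \<sigma> (t0 + Suc h) z (?I Z) - ?c)"
      unfolding walk_diff walk_compose[of _ s] walk_const[OF \<sigma> x] ..
    moreover have "walk \<sigma> s x (\<lambda>z. walk \<sigma> (t0 + Suc h) z (?I Z) - ?c) \<le> walk \<sigma> s x (\<lambda>z. err + of_bool (\<not> treelike \<sigma> s z))"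
      using pt by (intro walk_mono[OF \<sigma> x]) (auto simp: abs_le_iff)
    moreover have "walk \<sigma> s x (\<lambda>z. (-1) * (err + of_bool (\<not> treelike \<sigma> s z))) \<le> walk \<sigma> s x (\<lambda>z. walk \<sigma> (t0 + Suc h) z (?I Z) - ?c)"
      using pt by (intro walk_mono[OF \<sigma> x]) (force simp: abs_le_iff)
    moreover have "walk \<sigma> s x (\<lambda>z. err + of_bool (\<not> treelike \<sigma> s z)) \<le> err + (1 / 2) ^ s"
      unfolding walk_add walk_const[OF \<sigma> x] using bad[OF x] by simp
    ultimately show ?thesis unfolding walk_cmult by (auto simp: abs_le_iff)
  qed
  have p0: "\<And>x. x \<in> V \<Longrightarrow> 0 \<le> p x" and p1: "(\<Sum>x\<in>V. p x) = 1" using p by (auto simp: stationary_def verts_graph)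
  have pZ: "(\<Sum>y\<in>Z. p y) = (\<Sum>y\<in>V. p y * ?I Z y)" if "Z \<subseteq> V" for Z
  proof -
    have "(\<Sum>y\<in>V. p y * ?I Z y) = (\<Sum>y\<in>Z. p y * ?I Z y)" using that by (intro sum.mono_neutral_right) auto
    then show ?thesis by simp
  qed
  \<comment> \<open>Stationarity makes \<open>p\<close> a mixture of the laws of the walk at time
    \<open>?T\<close>, each close to the reference law. This covers every stationary
    \<open>p\<close>.\<close>
  have pnu: "\<bar>(\<Sum>y\<in>Z. p y) - nu \<sigma> b (Suc h) (?I Z)\<bar> \<le> err + (1 / 2) ^ s" if Z: "Z \<subseteq> V" for Z
  proof -
    have "(\<Sum>y\<in>Z. p y) - nu \<sigma> b (Suc h) (?I Z) = (\<Sum>y\<in>V. p y * (walk \<sigma> ?T y (?I Z) - nu \<sigma> b (Suc h) (?I Z)))"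
    proof -
      have "(\<Sum>y\<in>V. p y * (walk \<sigma> ?T y (?I Z) - nu \<sigma> b (Suc h) (?I Z)))
          = (\<Sum>y\<in>V. p y * walk \<sigma> ?T y (?I Z)) - (\<Sum>y\<in>V. p y) * nu \<sigma> b (Suc h) (?I Z)"
        by (simp only: right_diff_distrib sum_subtractf sum_distrib_right)
      then show ?thesis by (simp only: stationary_walk[OF \<sigma> p] p1 pZ[OF Z] mult_1_left)
    qed
    also have "\<bar>\<dots>\<bar> \<le> (\<Sum>y\<in>V. p y * (err + (1 / 2) ^ s))"
    proof (intro order_trans[OF sum_abs] sum_mono)
      fix y assume y: "y \<in> V"
      show "\<bar>p y * (walk \<sigma> ?T y (?I Z) - nu \<sigma> b (Suc h) (?I Z))\<bar> \<le> p y * (err + (1 / 2) ^ s)"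
        unfolding abs_mult using p0[OF y] nearx[OF y Z] by (simp add: mult_left_mono del: walk.simps)
    qed
    also have "\<dots> = err + (1 / 2) ^ s" unfolding sum_distrib_right[symmetric] p1 by simp
    finally show ?thesis .
  qed
  have triangle: "\<bar>u - w\<bar> \<le> e \<Longrightarrow> \<bar>v - w\<bar> \<le> e \<Longrightarrow> \<bar>u - v\<bar> \<le> 2 * e" for u v w e :: real by linarith
  show "dist_to \<sigma> ?T x p \<le> 2 * (err + (1 / 2) ^ s)"
    unfolding dist_to_eq[OF \<sigma> x]
  proof (rule tv_dist_le)
    fix Z assume Z: "Z \<subseteq> V"
    show "\<bar>(\<Sum>y\<in>Z. trans_prob \<sigma> ?T x y) - (\<Sum>y\<in>Z. p y)\<bar> \<le> 2 * (err + (1 / 2) ^ s)"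
      unfolding sum_trans_prob[OF \<sigma> x Z, symmetric] by (rule triangle[OF nearx[OF x Z] pnu[OF Z]])
  qed simp
  define Zf where "Zf = (\<lambda>z. SOME Z. Z \<subseteq> V \<and> card Z \<le> Nx + 1 \<and> 1 - \<alpha> \<le> walk \<sigma> t0 z (?I Z))"
  have Zf: "Zf z \<subseteq> V \<and> card (Zf z) \<le> Nx + 1 \<and> 1 - \<alpha> \<le> walk \<sigma> t0 z (?I (Zf z))" if "z \<in> V" "treelike \<sigma> s z" for z
    unfolding Zf_def by (rule someI_ex) (use good[OF that] in \<open>auto simp: confined_def\<close>)
  define R where "R = {z \<in> endpt \<sigma> x ` Words s. z \<in> V \<and> treelike \<sigma> s z}"
  define Z where "Z = (\<Union>z\<in>R. Zf z)"
  have finR: "finite R" "card R \<le> NW s"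
  proof -
    have "R \<subseteq> endpt \<sigma> x ` Words s" by (auto simp: R_def)
    moreover have "finite (endpt \<sigma> x ` Words s)" using finite_Words by (rule finite_imageI)
    ultimately show "finite R" and "card R \<le> NW s"
      using card_mono[of "endpt \<sigma> x ` Words s" R] card_image_le[OF finite_Words, of "endpt \<sigma> x" s]
      unfolding NW_def by (auto dest: finite_subset)
  qed
  have ZV: "Z \<subseteq> V" using Zf by (auto simp: Z_def R_def)
  have "card Z \<le> (\<Sum>z\<in>R. card (Zf z))" unfolding Z_def by (rule card_UN_le[OF finR(1)])
  also have "\<dots> \<le> card R * (Nx + 1)" using Zf sum_bounded_above[of R "\<lambda>z. card (Zf z)" "Nx + 1"] by (auto simp: R_def)
  also have "\<dots> \<le> NW s * (Nx + 1)" using finR(2) by (rule mult_right_mono) simp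
  finally have cZ: "card Z \<le> NW s * (Nx + 1)" .
  have mass: "walk \<sigma> (s + t0) x (?I Z) \<ge> 1 - \<alpha> - (1 / 2) ^ s"
  proof -
    have reach: "y \<in> R" if "y \<in> V" "treelike \<sigma> s y" "trans_prob \<sigma> s x y \<noteq> 0" for y
    proof -
      obtain l where l: "valid \<sigma> x l" "length l = s" "endpt \<sigma> x l = y"
        using walk_nonzero_word[of \<sigma> s x "\<lambda>z. z = y"] \<open>trans_prob \<sigma> s x y \<noteq> 0\<close> unfolding trans_prob_def by blast
      have "set l \<subseteq> {..<K}"
        using l(1) x
      proof (induction l arbitrary: x)
        case (Cons i l)
        then have "i < K" using dout_le[of x] by simp
        moreover have "fst (\<sigma> (x, i)) \<in> V" using Cons M_fst[OF \<sigma>] by (auto simp: tails_iff)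
        ultimately show ?case using Cons by auto
      qed simp
      then show ?thesis using l that by (auto simp: R_def Words_def)
    qed
    have "1 - \<alpha> - (1 / 2) ^ s \<le> (\<Sum>y\<in>V. trans_prob \<sigma> s x y * (1 - \<alpha> - of_bool (\<not> treelike \<sigma> s y)))"
    proof -
      have "(\<Sum>y\<in>V. trans_prob \<sigma> s x y * (1 - \<alpha> - of_bool (\<not> treelike \<sigma> s y)))
          = walk \<sigma> s x (\<lambda>y. (1 - \<alpha>) - of_bool (\<not> treelike \<sigma> s y))" by (rule walk_expand'[OF \<sigma> x, symmetric])
      then show ?thesis unfolding walk_diff walk_const[OF \<sigma> x] using bad[OF x] by simp
    qed
    also have "\<dots> \<le> (\<Sum>y\<in>V. trans_prob \<sigma> s x y * walk \<sigma> t0 y (?I Z))"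
    proof (rule sum_mono)
      fix y assume y: "y \<in> V"
      show "trans_prob \<sigma> s x y * (1 - \<alpha> - of_bool (\<not> treelike \<sigma> s y)) \<le> trans_prob \<sigma> s x y * walk \<sigma> t0 y (?I Z)"
      proof (cases "trans_prob \<sigma> s x y = 0")
        case False
        have "1 - \<alpha> - of_bool (\<not> treelike \<sigma> s y) \<le> walk \<sigma> t0 y (?I Z)"
        proof (cases "treelike \<sigma> s y")
          case True
          have "walk \<sigma> t0 y (?I (Zf y)) \<le> walk \<sigma> t0 y (?I Z)"
            using reach[OF y True False] by (intro walk_mono[OF \<sigma> y]) (auto simp: Z_def)
          then show ?thesis using Zf[OF y True] True by simp
        next
          case False
          have "0 \<le> walk \<sigma> t0 y (?I Z)" by (intro walk_nonneg[OF \<sigma> y]) auto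
          then show ?thesis using False \<alpha> by simp
        qed
        then show ?thesis using trans_prob_nonneg[OF \<sigma> x] by (intro mult_left_mono)
      qed simp
    qed
    also have "\<dots> = walk \<sigma> (s + t0) x (?I Z)" unfolding walk_compose by (rule walk_expand'[OF \<sigma> x, symmetric])
    finally show ?thesis .
  qed
  have "nu \<sigma> b (Suc h) (?I Z) \<le> sqrt (card Z * \<gamma>)" by (rule nu_set_le[OF \<sigma> b(2) ZV \<gamma>(1)])
  also have "\<dots> \<le> sqrt (real (NW s * (Nx + 1)) * \<gamma>)"
    using cZ \<gamma>(2) by (intro real_sqrt_le_mono mult_right_mono) (auto simp del: of_nat_mult)
  finally have "(\<Sum>y\<in>Z. p y) \<le> err + (1 / 2) ^ s + sqrt (real (NW s * (Nx + 1)) * \<gamma>)"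
    using abs_le_D1[OF pnu[OF ZV]] by linarith
  moreover have "(\<Sum>y\<in>Z. trans_prob \<sigma> (s + t0) x y) - (\<Sum>y\<in>Z. p y) \<le> dist_to \<sigma> (s + t0) x p"
    unfolding dist_to_eq[OF \<sigma> x] by (rule abs_le_D1[OF tv_dist_ge[OF _ ZV]]) simp
  ultimately show "dist_to \<sigma> (s + t0) x p \<ge> 1 - (\<alpha> + err + 2 * (1 / 2) ^ s + sqrt (real (NW s * (Nx + 1)) * \<gamma>))"
    using mass unfolding sum_trans_prob[OF \<sigma> x ZV] by linarith
qed

section \<open>First-moment bounds for the global events\<close>

lemma cexp_markov:
  fixes X :: "(nat \<times> nat \<Rightarrow> nat \<times> nat) \<Rightarrow> real"
  assumes "a > 0" "\<And>\<sigma>. \<sigma> \<in> M \<Longrightarrow> 0 \<le> X \<sigma>" "cexp no_edges X \<le> c"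
  shows "cexp no_edges (\<lambda>\<sigma>. of_bool (\<not> X \<sigma> \<le> a)) \<le> c / a"
proof -
  have "cexp no_edges (\<lambda>\<sigma>. of_bool (\<not> X \<sigma> \<le> a)) \<le> cexp no_edges (\<lambda>\<sigma>. 1 / a * X \<sigma>)"
    using assms by (intro cexp_mono) (auto simp: field_simps)
  also have "\<dots> = 1 / a * cexp no_edges X" by (rule cexp_cmult)
  also have "\<dots> \<le> c / a" using assms by (simp add: divide_right_mono)
  finally show ?thesis .
qed

lemma cexp_union:
  fixes c :: real
  assumes "finite I" "\<And>i. i \<in> I \<Longrightarrow> cexp \<rho> (\<lambda>\<sigma>. of_bool (P i \<sigma>)) \<le> c"
  shows "cexp \<rho> (\<lambda>\<sigma>. of_bool (\<exists>i\<in>I. P i \<sigma>)) \<le> card I * c"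
proof -
  have "cexp \<rho> (\<lambda>\<sigma>. of_bool (\<exists>i\<in>I. P i \<sigma>)) \<le> cexp \<rho> (\<lambda>\<sigma>. \<Sum>i\<in>I. of_bool (P i \<sigma>))"
  proof (rule cexp_mono)
    fix \<sigma>
    show "of_bool (\<exists>i\<in>I. P i \<sigma>) \<le> (\<Sum>i\<in>I. of_bool (P i \<sigma>) :: real)"
    proof (cases "\<exists>i\<in>I. P i \<sigma>")
      case True
      then obtain i where i: "i \<in> I" "P i \<sigma>" by blast
      then have "of_bool (P i \<sigma>) \<le> (\<Sum>i\<in>I. of_bool (P i \<sigma>) :: real)" using assms(1) by (intro member_le_sum) auto
      then show ?thesis using i by simp
    qed (simp add: sum_nonneg)
  qed
  also have "\<dots> = (\<Sum>i\<in>I. cexp \<rho> (\<lambda>\<sigma>. of_bool (P i \<sigma>)))" by (rule cexp_sum)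
  also have "\<dots> \<le> card I * c" using assms by (intro sum_bounded_above)
  finally show ?thesis .
qed

lemma cexp_or: "cexp \<rho> (\<lambda>\<sigma>. of_bool (P \<sigma> \<or> Q \<sigma>)) \<le> cexp \<rho> (\<lambda>\<sigma>. of_bool (P \<sigma>)) + cexp \<rho> (\<lambda>\<sigma>. of_bool (Q \<sigma>))"
  unfolding cexp_add[symmetric] by (intro cexp_mono) auto

lemma expected_return:
  assumes b: "1 \<le> b" "b \<le> n" and k: "1 \<le> k" "k \<le> h" and h: "h \<le> n"
  shows "cexp no_edges (\<lambda>\<sigma>. nu \<sigma> b k (\<lambda>y. of_bool (y \<in> {1..b}))) \<le> h * (D {1..b} + h * \<beta>) / n"
proof -
  obtain j where j: "k = Suc j" using k by (cases k) auto
  have "cexp no_edges (\<lambda>\<sigma>. walk \<sigma> k u (\<lambda>y. of_bool (y \<in> {1..b}))) \<le> h * (D {1..b} + h * \<beta>) / n" if "u \<in> {1..b}" for u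
  proof -
    have "cexp no_edges (\<lambda>\<sigma>. walk \<sigma> (Suc j) u (\<lambda>y. of_bool (y \<in> {1..b}))) \<le> (real j + 1) * (D {1..b} + real j * \<beta>) / n"
      using that b k j h two_n_le_card_tails pm_empty by (intro walk_vertex_hit) auto
    also have "\<dots> \<le> h * (D {1..b} + h * \<beta>) / n"
      using k j D_nonneg \<beta>_nonneg by (intro divide_right_mono mult_mono add_mono) auto
    finally show ?thesis unfolding j .
  qed
  then have "(\<Sum>u=1..b. cexp no_edges (\<lambda>\<sigma>. walk \<sigma> k u (\<lambda>y. of_bool (y \<in> {1..b})))) \<le> real (card {1..b}) * (h * (D {1..b} + h * \<beta>) / n)"
    by (rule sum_bounded_above)
  moreover have "cexp no_edges (\<lambda>\<sigma>. nu \<sigma> b k (\<lambda>y. of_bool (y \<in> {1..b})))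
      = 1 / b * (\<Sum>u=1..b. cexp no_edges (\<lambda>\<sigma>. walk \<sigma> k u (\<lambda>y. of_bool (y \<in> {1..b}))))"
    unfolding cexp_sum[symmetric] cexp_cmult[symmetric] nu_def by simp
  ultimately show ?thesis using b by (simp add: divide_le_eq mult.commute)
qed

text \<open>The squared l2 norm is the probability that two walks, independent given the matching
  and started uniformly in \<open>{1..b}\<close>, end together. Equal starting points contribute
  \<open>1 / b\<close>, distinct ones the meeting bound.\<close>

lemma expected_square:
  assumes b: "1 \<le> b" "b \<le> n" and k: "1 \<le> k" "k \<le> h" and h: "2 * h \<le> n"
  shows "cexp no_edges (\<lambda>\<sigma>. \<Sum>y\<in>V. (nu \<sigma> b k (\<lambda>z. of_bool (z = y)))\<^sup>2)
      \<le> 1 / b + 2 * real h * (2 * D {1..b} / b + 2 * real h * \<beta>) / n"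
proof -
  obtain j where j: "k = Suc j" using k by (cases k) auto
  let ?m = "\<lambda>\<sigma> u v. walk \<sigma> k u (\<lambda>y. walk \<sigma> k v (\<lambda>z. of_bool (z = y)))"
  let ?c = "\<lambda>u v. of_bool (u = v) + 2 * real h * (real (din u) + real (din v) + 2 * real h * \<beta>) / n"
  have m: "cexp no_edges (\<lambda>\<sigma>. ?m \<sigma> u v) \<le> ?c u v" if uv: "u \<in> {1..b}" "v \<in> {1..b}" for u v
  proof (cases "u = v")
    case True
    have "cexp no_edges (\<lambda>\<sigma>. ?m \<sigma> u v) \<le> 1"
      using uv b by (intro cexp_le_const[OF pm_empty] walk_le walk_indicator_le1) auto
    also have "\<dots> \<le> ?c u v" using True \<beta>_nonneg by simp
    finally show ?thesis .
  next
    case False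
    have "cexp no_edges (\<lambda>\<sigma>. ?m \<sigma> u v) \<le> (real j + real j + 2) * (real (din u) + real (din v) + (real j + real j + 2) * \<beta>) / n"
      unfolding j using uv b False k j h by (intro walk_vertices_meet) auto
    also have "\<dots> \<le> 2 * real h * (real (din u) + real (din v) + 2 * real h * \<beta>) / n"
      using k j \<beta>_nonneg by (intro divide_right_mono mult_mono add_mono) auto
    finally show ?thesis using False by simp
  qed
  have "(\<Sum>y\<in>V. (nu \<sigma> b k (\<lambda>z. of_bool (z = y)))\<^sup>2) = (1 / b)\<^sup>2 * (\<Sum>u=1..b. \<Sum>v=1..b. ?m \<sigma> u v)" if s: "\<sigma> \<in> ext no_edges" for \<sigma>
  proof -
    have "(\<Sum>y\<in>V. (nu \<sigma> b k (\<lambda>z. of_bool (z = y)))\<^sup>2)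
        = (1 / b)\<^sup>2 * (\<Sum>y\<in>V. \<Sum>u=1..b. \<Sum>v=1..b. trans_prob \<sigma> k u y * trans_prob \<sigma> k v y)"
      unfolding nu_def trans_prob_def by (simp add: power_divide power2_eq_square sum_product sum_divide_distrib)
    also have "(\<Sum>y\<in>V. \<Sum>u=1..b. \<Sum>v=1..b. trans_prob \<sigma> k u y * trans_prob \<sigma> k v y)
        = (\<Sum>u=1..b. \<Sum>v=1..b. \<Sum>y\<in>V. trans_prob \<sigma> k u y * trans_prob \<sigma> k v y)"
      by (subst sum.swap, intro sum.cong refl sum.swap)
    also have "\<dots> = (\<Sum>u=1..b. \<Sum>v=1..b. ?m \<sigma> u v)"
      using s b by (intro sum.cong refl) (auto simp: walk_expand'[of \<sigma> _ k] trans_prob_def[of \<sigma> k, symmetric])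
    finally show ?thesis .
  qed
  then have "cexp no_edges (\<lambda>\<sigma>. \<Sum>y\<in>V. (nu \<sigma> b k (\<lambda>z. of_bool (z = y)))\<^sup>2)
      = cexp no_edges (\<lambda>\<sigma>. (1 / b)\<^sup>2 * (\<Sum>u=1..b. \<Sum>v=1..b. ?m \<sigma> u v))"
    by (rule cexp_cong)
  also have "\<dots> = (1 / b)\<^sup>2 * (\<Sum>u=1..b. \<Sum>v=1..b. cexp no_edges (\<lambda>\<sigma>. ?m \<sigma> u v))"
    unfolding cexp_cmult cexp_sum ..
  also have "\<dots> \<le> (1 / b)\<^sup>2 * (\<Sum>u=1..b. \<Sum>v=1..b. ?c u v)"
    by (intro mult_left_mono sum_mono m) auto
  also have "(\<Sum>u=1..b. \<Sum>v=1..b. ?c u v) = b + 2 * real h * (2 * b * D {1..b} + b * b * (2 * real h * \<beta>)) / n"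
  proof -
    have "(\<Sum>u=1..b. \<Sum>v=1..b. of_bool (u = v) :: real) = b"
      by (simp add: of_bool_def)
    moreover have "(\<Sum>u=1..b. \<Sum>v=1..b. 2 * real h * (real (din u) + real (din v) + 2 * real h * \<beta>) / n)
        = 2 * real h * (2 * b * D {1..b} + b * b * (2 * real h * \<beta>)) / n"
      unfolding sum_divide_distrib[symmetric] sum_distrib_left[symmetric] sum.distrib D_def
      by (simp add: algebra_simps sum_distrib_left[symmetric])
    ultimately show ?thesis unfolding sum.distrib by simp
  qed
  also have "(1 / b)\<^sup>2 * (b + 2 * real h * (2 * b * D {1..b} + b * b * (2 * real h * \<beta>)) / n)
      = 1 / b + 2 * real h * (2 * D {1..b} / b + 2 * real h * \<beta>) / n"
    using b n_pos by (simp add: field_simps power2_eq_square)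
  finally show ?thesis .
qed

lemma not_global_good_prob:
  fixes \<tau> \<gamma> \<xi> p1 p2 p3 p :: real
  assumes b: "1 \<le> b" "b \<le> n" and h: "2 * (h + 1) \<le> n"
    and \<tau>: "\<tau> > 0" and \<gamma>: "\<gamma> > 0" and \<xi>: "\<xi> > 0"
    and p: "real (NW (h + 1)) * \<Delta> \<le> p * n" "p \<ge> 0" "NW (h + 1) \<le> n"
  shows "cexp no_edges (\<lambda>\<sigma>. of_bool (\<not> global_good b h \<tau> \<gamma> \<xi> \<sigma>))
     \<le> h * (h * (D {1..b} + h * \<beta>) / n / \<tau>)
       + (real h + 1) * ((1 / b + 2 * (real h + 1) * (2 * D {1..b} / b + 2 * (real h + 1) * \<beta>) / n) / \<gamma>)
       + NW (h + 1) * p / \<xi>"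
proof -
  let ?P1 = "\<lambda>\<sigma>. \<exists>k\<in>{1..h}. \<not> nu \<sigma> b k (\<lambda>y. of_bool (y \<in> {1..b})) \<le> \<tau>"
  let ?P2 = "\<lambda>\<sigma>. \<exists>k\<in>{1..h+1}. \<not> (\<Sum>y\<in>V. (nu \<sigma> b k (\<lambda>z. of_bool (z = y)))\<^sup>2) \<le> \<gamma>"
  let ?P3 = "\<lambda>\<sigma>. \<not> (\<Sum>u=1..b. of_bool (\<not> treelike \<sigma> (h + 1) u) :: real) \<le> \<xi> * b"
  have "cexp no_edges (\<lambda>\<sigma>. of_bool (\<not> global_good b h \<tau> \<gamma> \<xi> \<sigma>)) = cexp no_edges (\<lambda>\<sigma>. of_bool ((?P1 \<sigma> \<or> ?P2 \<sigma>) \<or> ?P3 \<sigma>))"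
    unfolding global_good_def by (rule cexp_cong) (auto simp del: sum_of_bool_eq)
  also have "\<dots> \<le> (cexp no_edges (\<lambda>\<sigma>. of_bool (?P1 \<sigma>)) + cexp no_edges (\<lambda>\<sigma>. of_bool (?P2 \<sigma>))) + cexp no_edges (\<lambda>\<sigma>. of_bool (?P3 \<sigma>))"
    by (intro order_trans[OF cexp_or] add_right_mono cexp_or)
  also have "cexp no_edges (\<lambda>\<sigma>. of_bool (?P1 \<sigma>)) \<le> card {1..h} * (h * (D {1..b} + h * \<beta>) / n / \<tau>)"
    using b h by (intro cexp_union cexp_markov[OF \<tau>] expected_return nu_nonneg) auto
  also have "cexp no_edges (\<lambda>\<sigma>. of_bool (?P2 \<sigma>)) \<le> card {1..h+1} * ((1 / b + 2 * real (h + 1) * (2 * D {1..b} / b + 2 * real (h + 1) * \<beta>) / n) / \<gamma>)"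
    using b h by (intro cexp_union cexp_markov[OF \<gamma>] expected_square sum_nonneg) auto
  also have "cexp no_edges (\<lambda>\<sigma>. of_bool (?P3 \<sigma>)) \<le> (b * (NW (h + 1) * p)) / (\<xi> * b)"
  proof (rule cexp_markov)
    have "(\<Sum>u=1..b. cexp no_edges (\<lambda>\<sigma>. of_bool (\<not> treelike \<sigma> (h + 1) u))) \<le> real (card {1..b}) * (NW (h + 1) * p)"
      using b p by (intro sum_bounded_above not_treelike_prob) auto
    then show "cexp no_edges (\<lambda>\<sigma>. \<Sum>u=1..b. of_bool (\<not> treelike \<sigma> (h + 1) u)) \<le> b * (NW (h + 1) * p)"
      unfolding cexp_sum by simp
    show "\<xi> * b > 0" using \<xi> b by simp
  qed (simp add: sum_nonneg)
  finally show ?thesis using b by (simp add: add.commute[of 1])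
qed

lemma twins_prob:
  fixes p :: real
  assumes p: "real (2 * NW r + 1) * \<Delta> \<le> p * n" "p \<ge> 0" and d: "2 * NW r + 2 \<le> n"
  shows "cexp no_edges (\<lambda>\<sigma>. of_bool (\<exists>e\<in>{(v, i, j). v \<in> V \<and> i < dout v \<and> j < dout v \<and> i \<noteq> j}.
            case e of (v, i, j) \<Rightarrow> \<not> treelike \<sigma> r (fst (\<sigma> (v, i))) \<and> \<not> treelike \<sigma> r (fst (\<sigma> (v, j)))))
       \<le> real (n * (K * K)) * ((NW r + 1) * p)\<^sup>2"
proof -
  let ?I = "{(v, i, j). v \<in> V \<and> i < dout v \<and> j < dout v \<and> i \<noteq> j}"
  have sub: "?I \<subseteq> V \<times> {..<K} \<times> {..<K}" using dout_le by force
  then have fin: "finite ?I" by (rule finite_subset) simp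
  have "card ?I \<le> card (V \<times> {..<K} \<times> {..<K})" using sub by (intro card_mono) auto
  then have c: "card ?I \<le> n * (K * K)" by (simp add: card_cartesian_product)
  have "cexp no_edges (\<lambda>\<sigma>. of_bool (\<exists>e\<in>?I. case e of (v, i, j) \<Rightarrow> \<not> treelike \<sigma> r (fst (\<sigma> (v, i))) \<and> \<not> treelike \<sigma> r (fst (\<sigma> (v, j)))))
     \<le> card ?I * ((NW r + 1) * p)\<^sup>2"
    by (rule cexp_union[OF fin]) (use twin_prob[OF _ _ _ _ p d] in auto)
  also have "\<dots> \<le> real (n * (K * K)) * ((NW r + 1) * p)\<^sup>2" using c by (intro mult_right_mono) (auto simp del: of_nat_mult)
  finally show ?thesis .
qed

text \<open>Stated for every stationary law, so that the event depends on the matching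
  alone.\<close>

definition cut where
  "cut t t' \<epsilon> \<epsilon>' \<sigma> \<longleftrightarrow> (\<forall>p x. stationary (graph \<sigma>) p \<longrightarrow> x \<in> V \<longrightarrow>
     dist_to \<sigma> t x p \<ge> 1 - \<epsilon> \<and> dist_to \<sigma> t' x p \<le> \<epsilon>')"

text \<open>A union bound over the ways to fail: a bad reference walk, two failing siblings, and,
  for each \<open>z\<close>, a tree-like start whose exploration or final matching goes wrong. Only
  the last is multiplied by \<open>n\<close> and has to be o(1/n).\<close>

lemma cutoff_prob:
  fixes \<theta> wmax B \<kappa> dv wU \<epsilon>1 \<epsilon> \<tau> \<gamma> \<xi> v1 v4 \<omega> N l \<mu> \<mu>1 p p' :: real and Nx b h s t0 :: nat
  defines "\<alpha> \<equiv> \<epsilon>1 + \<epsilon>1 / (\<kappa> * dv\<^sup>2)"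
    and "hit \<equiv> h * (\<tau> + sqrt ((real Nx + 1) * \<gamma>))"
    and "\<xi>' \<equiv> \<xi> + (1 / 2) ^ h"
  defines "err \<equiv> 2 * (v1 + \<epsilon> + \<alpha> + \<omega>) + (\<alpha> + (2 * (hit + v4 + \<epsilon>) + v4 + \<epsilon>))"
  assumes s: "s \<le> t0" and wmax: "(1 / 2) ^ s \<le> wmax" and B: "real (NW s) * \<theta> + t0 \<le> B"
    and \<theta>: "\<theta> > 0" and Nx: "B \<le> \<theta> * Nx" "Nx \<le> n" and l: "l \<ge> 0" and \<kappa>: "\<kappa> > 0"
    and \<kappa>1: "2 * \<kappa> * ((real t0 + 1) * L) * L \<le> 1" and \<kappa>2: "\<kappa> * L\<^sup>2 \<le> 1" and lw: "4 * l * wmax \<le> 1"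
    and \<mu>1: "Nx + \<kappa> * L\<^sup>2 * n + 2 * sqrt ((real Nx + 1) * (\<beta> * n)) \<le> \<mu>1 * n"
    and \<mu>: "\<mu>1 + 16 * l * wmax \<le> \<mu>" "\<mu> \<ge> 0"
    and dv: "dv > 0" and wU: "wU > 0" and \<epsilon>1: "\<epsilon>1 \<ge> 0"
    and P1: "dv \<le> - ln \<theta> - t0 * Hr" and P2: "- ln wU - t0 * Hr \<le> - dv"
    and b: "1 \<le> b" "b \<le> n" "1 / b \<le> wU" and \<omega>: "Nx / b \<le> \<omega>" "\<omega> \<le> 1 / 2"
    and N: "real (card tails) \<le> N" and \<epsilon>: "\<epsilon> > 0" and v4: "4 * wU \<le> v4\<^sup>2" "v4 \<ge> 0"
    and v1: "real n * (4 * wU * (2 * (\<xi>' + v4 + \<epsilon>))) \<le> v1\<^sup>2" "v1 \<ge> 0"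
    and \<tau>: "\<tau> > 0" and \<gamma>: "\<gamma> > 0" and \<xi>: "\<xi> > 0"
    and h: "2 * (h + 1) \<le> n" and p: "real (NW (h + 1)) * \<Delta> \<le> p * n" "p \<ge> 0" "NW (h + 1) \<le> n"
    and p': "real (2 * NW (2 * s) + 1) * \<Delta> \<le> p' * n" "p' \<ge> 0" "2 * NW (2 * s) + 2 \<le> n"
  shows "cexp no_edges (\<lambda>\<sigma>. of_bool (\<not> cut (s + t0) (s + (t0 + Suc h))
        (\<alpha> + err + 2 * (1 / 2) ^ s + sqrt (real (NW s * (Nx + 1)) * \<gamma>)) (2 * (err + (1 / 2) ^ s)) \<sigma>))
     \<le> (h * (h * (D {1..b} + h * \<beta>) / n / \<tau>)
       + (real h + 1) * ((1 / b + 2 * (real h + 1) * (2 * D {1..b} / b + 2 * (real h + 1) * \<beta>) / n) / \<gamma>)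
       + NW (h + 1) * p / \<xi>)
       + real (n * (K * K)) * ((NW (2 * s) + 1) * p')\<^sup>2
       + n * (2 * exp (- \<epsilon>\<^sup>2 / (64 * wU\<^sup>2 * N)) + exp (l * (\<kappa> * ((real s + 1) * L)\<^sup>2 + \<mu> * t0 - \<epsilon>1)))"
    (is "?lhs \<le> ?E1 + ?E2 + real n * ?E3")
proof -
  let ?G = "global_good b h \<tau> \<gamma> \<xi>"
  let ?I = "{(v, i, j). v \<in> V \<and> i < dout v \<and> j < dout v \<and> i \<noteq> j}"
  let ?tw = "\<lambda>e \<sigma>. case e of (v, i, j) \<Rightarrow> \<not> treelike \<sigma> (2 * s) (fst (\<sigma> (v, i))) \<and> \<not> treelike \<sigma> (2 * s) (fst (\<sigma> (v, j)))"
  let ?ok = "\<lambda>z \<sigma>. near t0 h b err z \<sigma> \<and> confined t0 Nx \<alpha> z \<sigma>"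
  let ?F = "\<lambda>z \<sigma>. treelike \<sigma> s z \<and> ?G \<sigma> \<and> \<not> ?ok z \<sigma>"
  have \<alpha>0: "\<alpha> \<ge> 0" using \<epsilon>1 \<kappa> unfolding \<alpha>_def by simp
  have hit0: "hit \<ge> 0" using \<tau> \<gamma> unfolding hit_def by simp
  have "0 \<le> Nx / b" by simp
  then have \<omega>0: "\<omega> \<ge> 0" using \<omega> by linarith
  have err0: "err \<ge> 0" using \<alpha>0 hit0 v1 v4 \<epsilon> \<omega>0 unfolding err_def by simp
  have NWs: "NW s \<le> n"
  proof -
    have "NW s \<le> NW (2 * s)" unfolding NW_def by (rule card_mono[OF finite_Words]) (auto simp: Words_def)
    then show ?thesis using p'(3) by simp
  qed
  have imp: "?G \<sigma> \<longrightarrow> (\<exists>e\<in>?I. ?tw e \<sigma>) \<or> (\<exists>z\<in>V. ?F z \<sigma>) \<or> cut (s + t0) (s + (t0 + Suc h))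
        (\<alpha> + err + 2 * (1 / 2) ^ s + sqrt (real (NW s * (Nx + 1)) * \<gamma>)) (2 * (err + (1 / 2) ^ s)) \<sigma>" if \<sigma>: "\<sigma> \<in> M" for \<sigma>
  proof (intro impI, rule ccontr)
    assume G: "?G \<sigma>" and not: "\<not> ((\<exists>e\<in>?I. ?tw e \<sigma>) \<or> (\<exists>z\<in>V. ?F z \<sigma>) \<or> cut (s + t0) (s + (t0 + Suc h))
        (\<alpha> + err + 2 * (1 / 2) ^ s + sqrt (real (NW s * (Nx + 1)) * \<gamma>)) (2 * (err + (1 / 2) ^ s)) \<sigma>)"
    have sq: "(\<Sum>y\<in>V. (nu \<sigma> b (Suc h) (\<lambda>z. of_bool (z = y)))\<^sup>2) \<le> \<gamma>"
      using G[unfolded global_good_def, THEN conjunct2, THEN conjunct1, THEN bspec, of "Suc h"] by simp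
    have twin: "treelike \<sigma> (2 * s) (fst (\<sigma> (v, i))) \<or> treelike \<sigma> (2 * s) (fst (\<sigma> (v, j)))"
      if "v \<in> V" "i < dout v" "j < dout v" "i \<noteq> j" for v i j using not that by blast
    have good: "?ok z \<sigma>" if "z \<in> V" "treelike \<sigma> s z" for z using not that G by blast
    have "cut (s + t0) (s + (t0 + Suc h))
        (\<alpha> + err + 2 * (1 / 2) ^ s + sqrt (real (NW s * (Nx + 1)) * \<gamma>)) (2 * (err + (1 / 2) ^ s)) \<sigma>"
      unfolding cut_def
      using cutoff_deterministic[OF \<sigma> b(1,2) sq less_imp_le[OF \<gamma>] twin good err0 \<alpha>0] by blast
    then show False using not by blast
  qed
  have "?lhs \<le> cexp no_edges (\<lambda>\<sigma>. of_bool ((\<not> ?G \<sigma> \<or> (\<exists>e\<in>?I. ?tw e \<sigma>)) \<or> (\<exists>z\<in>V. ?F z \<sigma>)))"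
    by (rule cexp_mono) (use imp in auto)
  also have "\<dots> \<le> (cexp no_edges (\<lambda>\<sigma>. of_bool (\<not> ?G \<sigma>)) + cexp no_edges (\<lambda>\<sigma>. of_bool (\<exists>e\<in>?I. ?tw e \<sigma>)))
      + cexp no_edges (\<lambda>\<sigma>. of_bool (\<exists>z\<in>V. ?F z \<sigma>))"
    by (intro order_trans[OF cexp_or] add_right_mono cexp_or)
  also have "\<dots> \<le> ?E1 + ?E2 + real (card V) * ?E3"
  proof (intro add_mono)
    show "cexp no_edges (\<lambda>\<sigma>. of_bool (\<not> ?G \<sigma>)) \<le> ?E1" by (rule not_global_good_prob[OF b(1,2) h \<tau> \<gamma> \<xi> p])
    show "cexp no_edges (\<lambda>\<sigma>. of_bool (\<exists>e\<in>?I. ?tw e \<sigma>)) \<le> ?E2" by (rule twins_prob[OF p'])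
    show "cexp no_edges (\<lambda>\<sigma>. of_bool (\<exists>z\<in>V. ?F z \<sigma>)) \<le> real (card V) * ?E3"
    proof (rule cexp_union)
      fix z assume z: "z \<in> V"
      have \<zeta>: "0 \<le> 2 * exp (- \<epsilon>\<^sup>2 / (64 * wU\<^sup>2 * N))" by simp
      show "cexp no_edges (\<lambda>\<sigma>. of_bool (?F z \<sigma>)) \<le> ?E3"
      proof (rule explore_from_treelike[OF z s wmax B NWs \<theta> Nx l less_imp_le[OF \<kappa>] \<zeta> \<kappa>1 \<kappa>2 lw \<mu>1 \<mu>])
        fix \<rho>' S' dep' w'
        assume st: "main_state t0 \<theta> wmax B z \<rho>' S' dep' w'"
          and stop: "\<And>e. e \<in> act \<rho>' S' \<Longrightarrow> dep' (fst e) < t0 \<Longrightarrow> tw w' e < \<theta>" and J: "potJ \<kappa> \<rho>' S' dep' w' \<le> \<epsilon>1"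
        have "cexp \<rho>' (\<lambda>\<sigma>. of_bool (?F z \<sigma>)) \<le> cexp \<rho>' (\<lambda>\<sigma>. of_bool (?G \<sigma> \<and> \<not> ?ok z \<sigma>))"
          by (rule cexp_mono) auto
        also have "\<dots> \<le> 2 * exp (- \<epsilon>\<^sup>2 / (64 * wU\<^sup>2 * N))"
          unfolding err_def hit_def \<alpha>_def
          by (rule terminal_bound[OF st stop J \<kappa> dv \<theta> wU P1 P2 Nx(1) b \<omega> N \<epsilon> v4 v1[unfolded \<xi>'_def] less_imp_le[OF \<gamma>]])
        finally show "cexp \<rho>' (\<lambda>\<sigma>. of_bool (?F z \<sigma>)) \<le> 2 * exp (- \<epsilon>\<^sup>2 / (64 * wU\<^sup>2 * N))" .
      qed auto
    qed simp
  qed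
  finally show ?thesis by simp
qed

lemma prob_config_model:
  "measure_pmf.prob (config_model n din dout) {G. P G} = cexp no_edges (\<lambda>\<sigma>. of_bool (P (graph \<sigma>)))"
proof -
  have "measure_pmf.prob (config_model n din dout) {G. P G} = measure_pmf.prob (pmf_of_set M) {\<sigma>. P (graph \<sigma>)}"
    by (simp add: config_model_def M_eq measure_map_pmf vimage_def)
  also have "\<dots> = card (M \<inter> {\<sigma>. P (graph \<sigma>)}) / card M"
    using ext_nonempty[OF pm_empty] finite_ext by (rule measure_pmf_of_set)
  also have "\<dots> = cexp no_edges (\<lambda>\<sigma>. of_bool (P (graph \<sigma>)))" using finite_ext by (simp add: cexp_def)
  finally show ?thesis .
qed

lemma config_model_support: "set_pmf (config_model n din dout) = graph ` M"
  using ext_nonempty[OF pm_empty] finite_ext by (simp add: config_model_def M_eq[symmetric])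

end

section \<open>Asymptotics\<close>

text \<open>\<open>x\<close> stands for the number of vertices and \<open>q\<close> for \<open>log 2 K\<close>, so that \<open>K ^ 2 * ln x powr (3 * q)\<close> bounds
  the size of a ball of radius \<open>s\<close>; the conditions are those of \<open>cutoff_prob\<close> for the parameters chosen in
  \<open>cutoff_window\<close>.\<close>

definition large_enough :: "real \<Rightarrow> real \<Rightarrow> real \<Rightarrow> real \<Rightarrow> real \<Rightarrow> real \<Rightarrow> real \<Rightarrow> real \<Rightarrow> real \<Rightarrow> real \<Rightarrow> bool" where
  "large_enough K \<beta> C q L \<delta> \<epsilon> \<gamma>0 a x \<longleftrightarrow>
     (3 * log 2 (ln x) + 1 \<le> (1 - 2 * \<delta>) * ln x / L - 1) \<and>
     (2 * ln x powr (-3/2) * ((2 * ln x + 1) * L) * L \<le> 1) \<and>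
     (ln x powr (-3/2) * L\<^sup>2 \<le> 1) \<and>
     (4 * ln x powr (3/2) * ln x powr (-3) \<le> 1) \<and>
     ((K\<^sup>2 * ln x powr (3 * q)) + 2 * ln x * x powr (1 - \<delta>) + 2 \<le> x powr (1 - 3/4 * \<delta>)) \<and>
     (ln x / 2 + 2 \<le> ln x) \<and>
     (2 * (ln x + 1) \<le> x) \<and>
     ((K ^ 3 * x powr (4 * \<delta> * q)) \<le> x) \<and>
     (2 * (K ^ 3 * ln x powr (6 * q)) + 2 \<le> x) \<and>
     (L \<le> \<delta> / 2 * ln x) \<and>
     (x powr (- \<delta> / 2) \<le> min \<epsilon> (1 / 2)) \<and>
     (4 \<le> \<delta>\<^sup>2 * ln x powr (1/2)) \<and>
     (ln x * (x powr (- \<delta> / 32) + sqrt (x powr (- \<delta> / 2))) \<le> \<epsilon>) \<and>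
     (2 * sqrt (x powr (- (1 - 3 * \<delta>))) \<le> \<epsilon>) \<and>
     (x powr (- 1/4) \<le> \<epsilon>) \<and>
     (sqrt (x * (4 * x powr (- (1 - 3 * \<delta>)) * (2 * (x powr (- 4 * \<delta>) + x powr (- 4 * \<delta>) + 2 * sqrt (x powr (- (1 - 3 * \<delta>))) + x powr (- 1/4))))) \<le> \<epsilon>) \<and>
     (ln x powr (-3) \<le> \<epsilon>) \<and>
     (sqrt ((K\<^sup>2 * ln x powr (3 * q)) * (x powr (1 - 3/4 * \<delta>) * x powr (- 1 + \<delta> / 4))) \<le> \<epsilon>) \<and>
     (ln x * (ln x * (sqrt (2 * \<beta>) * x powr (1 - \<delta> / 16) + ln x * \<beta>) / x / x powr (- \<delta> / 32)) \<le> \<epsilon>) \<and>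
     ((ln x + 1) * ((x powr (- 1 + \<delta> / 8) + 2 * (ln x + 1) * (2 * sqrt (\<beta> * x powr (\<delta> / 8)) + 2 * (ln x + 1) * \<beta>) / x) / x powr (- 1 + \<delta> / 4)) \<le> \<epsilon>) \<and>
     ((K ^ 3 * x powr (4 * \<delta> * q)) * ((K ^ 3 * x powr (4 * \<delta> * q)) * (C * x powr a) / x) / x powr (- 4 * \<delta>) \<le> \<epsilon>) \<and>
     (x * K\<^sup>2 * (((K ^ 3 * ln x powr (6 * q)) + 1) * ((2 * (K ^ 3 * ln x powr (6 * q)) + 1) * (C * x powr a) / x))\<^sup>2 \<le> \<epsilon>) \<and>
     (x * (2 * exp (- (x powr (- 1/4))\<^sup>2 / (64 * (x powr (- (1 - 3 * \<delta>)))\<^sup>2 * (K * x)))) \<le> \<epsilon>) \<and>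
     (ln x powr (-3/2) * ((3 * log 2 (ln x) + 2) * L)\<^sup>2 + ((x powr (1 - 3/4 * \<delta>) + ln x powr (-3/2) * L\<^sup>2 * x + 2 * sqrt (x powr (1 - 3/4 * \<delta>) * (\<beta> * x))) / x + 16 * ln x powr (3/2) * ln x powr (-3)) * (2 * ln x) \<le> \<epsilon> / 2) \<and>
     (x * exp (- (ln x powr (3/2) * (\<epsilon> / 2))) \<le> \<epsilon>) \<and>
     (1 \<le> \<delta> * ln x / L) \<and>
     (3 * log 2 (ln x) + 3 \<le> \<gamma>0 / 2 * ln x / L) \<and>
     (ln x > 0 \<and> x > 1)"

lemma large_enoughD:
  assumes "large_enough K \<beta> C q L \<delta> \<epsilon> \<gamma>0 a x"
  shows "3 * log 2 (ln x) + 1 \<le> (1 - 2 * \<delta>) * ln x / L - 1"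
    and "2 * ln x powr (-3/2) * ((2 * ln x + 1) * L) * L \<le> 1"
    and "ln x powr (-3/2) * L\<^sup>2 \<le> 1"
    and "4 * ln x powr (3/2) * ln x powr (-3) \<le> 1"
    and "(K\<^sup>2 * ln x powr (3 * q)) + 2 * ln x * x powr (1 - \<delta>) + 2 \<le> x powr (1 - 3/4 * \<delta>)"
    and "ln x / 2 + 2 \<le> ln x"
    and "2 * (ln x + 1) \<le> x"
    and "(K ^ 3 * x powr (4 * \<delta> * q)) \<le> x"
    and "2 * (K ^ 3 * ln x powr (6 * q)) + 2 \<le> x"
    and "L \<le> \<delta> / 2 * ln x"
    and "x powr (- \<delta> / 2) \<le> min \<epsilon> (1 / 2)"
    and "4 \<le> \<delta>\<^sup>2 * ln x powr (1/2)"
    and "ln x * (x powr (- \<delta> / 32) + sqrt (x powr (- \<delta> / 2))) \<le> \<epsilon>"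
    and "2 * sqrt (x powr (- (1 - 3 * \<delta>))) \<le> \<epsilon>"
    and "x powr (- 1/4) \<le> \<epsilon>"
    and "sqrt (x * (4 * x powr (- (1 - 3 * \<delta>)) * (2 * (x powr (- 4 * \<delta>) + x powr (- 4 * \<delta>) + 2 * sqrt (x powr (- (1 - 3 * \<delta>))) + x powr (- 1/4))))) \<le> \<epsilon>"
    and "ln x powr (-3) \<le> \<epsilon>"
    and "sqrt ((K\<^sup>2 * ln x powr (3 * q)) * (x powr (1 - 3/4 * \<delta>) * x powr (- 1 + \<delta> / 4))) \<le> \<epsilon>"
    and "ln x * (ln x * (sqrt (2 * \<beta>) * x powr (1 - \<delta> / 16) + ln x * \<beta>) / x / x powr (- \<delta> / 32)) \<le> \<epsilon>"
    and "(ln x + 1) * ((x powr (- 1 + \<delta> / 8) + 2 * (ln x + 1) * (2 * sqrt (\<beta> * x powr (\<delta> / 8)) + 2 * (ln x + 1) * \<beta>) / x) / x powr (- 1 + \<delta> / 4)) \<le> \<epsilon>"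
    and "(K ^ 3 * x powr (4 * \<delta> * q)) * ((K ^ 3 * x powr (4 * \<delta> * q)) * (C * x powr a) / x) / x powr (- 4 * \<delta>) \<le> \<epsilon>"
    and "x * K\<^sup>2 * (((K ^ 3 * ln x powr (6 * q)) + 1) * ((2 * (K ^ 3 * ln x powr (6 * q)) + 1) * (C * x powr a) / x))\<^sup>2 \<le> \<epsilon>"
    and "x * (2 * exp (- (x powr (- 1/4))\<^sup>2 / (64 * (x powr (- (1 - 3 * \<delta>)))\<^sup>2 * (K * x)))) \<le> \<epsilon>"
    and "ln x powr (-3/2) * ((3 * log 2 (ln x) + 2) * L)\<^sup>2 + ((x powr (1 - 3/4 * \<delta>) + ln x powr (-3/2) * L\<^sup>2 * x + 2 * sqrt (x powr (1 - 3/4 * \<delta>) * (\<beta> * x))) / x + 16 * ln x powr (3/2) * ln x powr (-3)) * (2 * ln x) \<le> \<epsilon> / 2"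
    and "x * exp (- (ln x powr (3/2) * (\<epsilon> / 2))) \<le> \<epsilon>"
    and "1 \<le> \<delta> * ln x / L"
    and "3 * log 2 (ln x) + 3 \<le> \<gamma>0 / 2 * ln x / L"
    and "ln x > 0 \<and> x > 1"
  using assms unfolding large_enough_def by blast+

lemma eventually_large_enough:
  fixes K \<beta> C q L \<delta> \<epsilon> \<gamma>0 a :: real
  assumes "K \<ge> 2" "\<beta> > 0" "C > 0" "q \<ge> 1" "L > 0" "\<epsilon> > 0" "\<gamma>0 > 0" "0 < \<delta>" "96 * \<delta> * q \<le> 1" "0 < a" "2 * a < 1"
  shows "eventually (large_enough K \<beta> C q L \<delta> \<epsilon> \<gamma>0 a) at_top"
proof -
  have "96 * \<delta> \<le> 1" using assms mult_left_mono[of 1 q "96 * \<delta>"] by linarith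
  \<comment> \<open>Numerical bounds on \<open>\<delta>\<close> and \<open>\<delta> * q\<close>
    decide the signs of the exponents of \<open>x\<close>.\<close>
  then have "\<delta> < 1 / 95" "\<delta> * q < 1 / 95" using assms by linarith+
  with assms show ?thesis
    unfolding large_enough_def by (intro eventually_conj; real_asymp)
qed

section \<open>Elementary bounds for the parameters\<close>

lemma powr_log_swap:
  fixes a b c y :: real
  assumes "a > 1" "b > 1" "y > 0"
  shows "a powr (c * log b y) = y powr (c * log b a)"
  using assms by (simp add: powr_def log_def mult.commute)

lemma nat_ceiling_bounds:
  fixes z :: real
  assumes "z \<ge> 0"
  shows "z \<le> nat \<lceil>z\<rceil>" "nat \<lceil>z\<rceil> \<le> z + 1"
  using assms by linarith+

lemma half_power_le:
  fixes k :: nat and y c :: real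
  assumes "y > 0" "c * log 2 y \<le> k"
  shows "(1 / 2 :: real) ^ k \<le> y powr (- c)"
proof -
  have "y powr (- c) = 2 powr (- c * log 2 y)"
    using powr_log_swap[of 2 2 y "- c"] assms by simp
  also have "\<dots> \<ge> 2 powr (- real k)"
    using assms by (intro powr_mono) auto
  also have "2 powr (- real k) = (1 / 2) ^ k"
    by (simp add: powr_minus powr_realpow field_simps)
  finally show ?thesis .
qed

context dcm
begin

lemma cut_weaken: "cut t t' a b \<sigma> \<Longrightarrow> a \<le> a' \<Longrightarrow> b \<le> b' \<Longrightarrow> cut t t' a' b' \<sigma>"
  unfolding cut_def by (meson diff_left_mono order_trans)

text \<open>A ball whose radius is \<open>c * log 2 y\<close> has size of order
  \<open>y powr (c * log 2 K)\<close>: polylogarithmic for \<open>y = ln x\<close>, a small power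
  for \<open>y = x\<close> and small \<open>c\<close>.\<close>

lemma NW_bound:
  assumes "real r \<le> c * log 2 y + i" "y > 0"
  shows "real (NW r) \<le> real K ^ (Suc i) * y powr (c * log 2 K)"
proof -
  have "real (NW r) \<le> real (K ^ (r + 1))"
    using NW_le of_nat_le_iff by blast
  also have "\<dots> = real K powr (real (r + 1))"
    using K_ge by (simp add: powr_add powr_realpow)
  also have "\<dots> \<le> real K powr (real (Suc i) + c * log 2 y)"
    using assms K_ge by (intro powr_mono) auto
  also have "\<dots> = real K ^ (Suc i) * y powr (c * log 2 K)"
    using assms K_ge by (simp add: powr_add powr_log_swap powr_realpow flip: powr_realpow)
  finally show ?thesis .
qed

text \<open>The two times are \<open>s + t0\<close> and \<open>s + t0 + h + 1\<close>. The condition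
  \<open>8 * \<delta> * L \<le> \<gamma>0 * ln 2\<close> lets \<open>4 * \<delta> * log 2 n\<close>,
  the main part of \<open>h\<close>, use at most half of the margin
  \<open>\<gamma>0 * (ln n / Hr)\<close>; \<open>s\<close> is only of order log log n.\<close>

lemma cutoff_window:
  fixes \<delta> e \<gamma>0 a C :: real
  assumes large: "large_enough K \<beta> C (log 2 K) L \<delta> e \<gamma>0 a n"
    and \<Delta>: "\<Delta> \<le> C * real n powr a" and \<delta>: "0 < \<delta>" "96 * \<delta> * log 2 K \<le> 1" "3 * \<delta> \<le> \<gamma>0" "8 * \<delta> * L \<le> \<gamma>0 * ln 2"
    and e: "e > 0"
  shows "\<exists>t t'. (1 - \<gamma>0) * (ln n / Hr) \<le> real t \<and> real t' \<le> (1 + \<gamma>0) * (ln n / Hr)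
      \<and> cexp no_edges (\<lambda>\<sigma>. of_bool (\<not> cut t t' (25 * e) (42 * e) \<sigma>)) \<le> 6 * e"
proof -
  define x where "x = real n"
  define lx where "lx = ln x"
  note large' = large_enoughD[OF large, folded x_def, folded lx_def]
  have lx4: "lx \<ge> 4" and x1: "x > 1" using large'(6,28) by linarith+
  have x0: "x > 0" and lx0: "lx > 0" using x1 lx4 by linarith+
  have q1: "log 2 K \<ge> 1" using K_ge by (simp add: le_log_iff)
  have \<delta>': "96 * \<delta> \<le> 1" using mult_left_mono[OF q1, of "96 * \<delta>"] \<delta> by linarith
  have Hr: "1 / 2 \<le> Hr" "Hr \<le> L" "Hr > 0" using Hr_bounds ln2_ge_two_thirds by linarith+
  have ll0: "log 2 lx \<ge> 0" using lx4 by simp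
  have \<Delta>0: "\<Delta> \<ge> 0" using max_din[of 1] n_pos by (smt (verit) atLeastAtMost_iff of_nat_0_le_iff order_refl)
  \<comment> \<open>Below the entropic time by the fraction \<open>2 * \<delta>\<close>, so that the
    typical weight \<open>exp (- t0 * Hr)\<close>, about
    \<open>x powr (- (1 - 2 * \<delta>))\<close>, lies between \<open>\<theta>\<close> and
    \<open>wU\<close>, at logarithmic distance about \<open>\<delta> * lx\<close> from both;
    \<open>dv\<close> is half of that.\<close>
  define t0 where "t0 = nat \<lfloor>(1 - 2 * \<delta>) * lx / Hr\<rfloor>"
  define s where "s = nat \<lceil>3 * log 2 lx\<rceil>"
  define h where "h = nat \<lceil>4 * \<delta> * log 2 x\<rceil>"
  \<comment> \<open>Many more vertices than revealed tails, as
    \<open>Nx + 1 \<le> x powr (1 - 3/4 * \<delta>)\<close>, yet only o(x) of them, so that by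
    \<open>D_le_sqrt\<close> the reference walk seldom returns to them.\<close>
  define b where "b = nat \<lceil>x powr (1 - \<delta> / 8)\<rceil>"
  define \<theta> where "\<theta> = x powr (- (1 - \<delta>))"
  define wU where "wU = x powr (- (1 - 3 * \<delta>))"
  define wmax where "wmax = lx powr (-3)"
  \<comment> \<open>\<open>\<kappa> * lx\<close> tends to 0, which makes the drift negligible over
    \<open>t0\<close> steps, while \<open>\<kappa> * dv\<^sup>2\<close>, of order
    \<open>lx powr (1/2)\<close>, tends to infinity, which is the Chebyshev gain. For
    \<open>l\<close>, the product \<open>l * wmax\<close> is o(1 / lx), and \<open>l * e\<close>
    exceeds every multiple of \<open>lx\<close>, which beats the factor \<open>n\<close>.\<close>
  define \<kappa> where "\<kappa> = lx powr (-3/2)"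
  define l where "l = lx powr (3/2)"
  define dv where "dv = \<delta> / 2 * lx"
  define B where "B = real (NW s) * \<theta> + t0"
  define Nx where "Nx = nat \<lceil>B / \<theta>\<rceil>"
  \<comment> \<open>Small, but with \<open>\<epsilon>\<^sup>2 / (wU\<^sup>2 * N)\<close> of order
    \<open>x powr (1/2 - 6 * \<delta>)\<close>, so that concentration survives the union over
    \<open>n\<close> vertices.\<close>
  define \<epsilon> where "\<epsilon> = x powr (-1/4)"
  define \<tau> where "\<tau> = x powr (- \<delta> / 32)"
  \<comment> \<open>Above the expected squared l2 norm, about \<open>1 / b\<close>, by
    \<open>x powr (\<delta> / 8)\<close>, for Markov's inequality, and still small against
    \<open>1 / Nx\<close>.\<close>
  define \<gamma> where "\<gamma> = x powr (- 1 + \<delta> / 4)"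
  define \<xi> where "\<xi> = x powr (- 4 * \<delta>)"
  define v4 where "v4 = 2 * sqrt wU"
  define \<xi>' where "\<xi>' = \<xi> + (1 / 2) ^ h"
  define v1 where "v1 = sqrt (real n * (4 * wU * (2 * (\<xi>' + v4 + \<epsilon>))))"
  define N where "N = real K * x"
  define \<omega> where "\<omega> = x powr (- \<delta> / 2)"
  define \<mu>1 where "\<mu>1 = (Nx + \<kappa> * L\<^sup>2 * n + 2 * sqrt ((real Nx + 1) * (\<beta> * n))) / n"
  define \<mu> where "\<mu> = \<mu>1 + 16 * l * wmax"
  define p where "p = real (NW (h + 1)) * \<Delta> / n"
  define p' where "p' = real (2 * NW (2 * s) + 1) * \<Delta> / n"
  define y where "y = x powr (1 - 3/4 * \<delta>)"
  define A1 where "A1 = real K ^ 2 * lx powr (3 * log 2 K)"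
  define A2 where "A2 = real K ^ 3 * lx powr (6 * log 2 K)"
  define A3 where "A3 = real K ^ 3 * x powr (4 * \<delta> * log 2 K)"
  define \<alpha> where "\<alpha> = e + e / (\<kappa> * dv\<^sup>2)"
  define hit where "hit = h * (\<tau> + sqrt ((real Nx + 1) * \<gamma>))"
  define err where "err = 2 * (v1 + \<epsilon> + \<alpha> + \<omega>) + (\<alpha> + (2 * (hit + v4 + \<epsilon>) + v4 + \<epsilon>))"
  note large = large'[folded \<theta>_def wU_def wmax_def \<kappa>_def l_def \<epsilon>_def \<tau>_def \<gamma>_def \<xi>_def \<omega>_def y_def A1_def A2_def A3_def]
  have pos: "\<theta> > 0" "wU > 0" "wmax > 0" "\<kappa> > 0" "l > 0" "dv > 0" "\<epsilon> > 0" "\<tau> > 0" "\<gamma> > 0" "\<xi> > 0" "v4 > 0" "\<omega> > 0" "y > 0"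
    using x0 lx0 \<delta> unfolding \<theta>_def wU_def wmax_def \<kappa>_def l_def dv_def \<epsilon>_def \<tau>_def \<gamma>_def \<xi>_def v4_def \<omega>_def y_def by simp_all
  have n0: "real n > 0" using n_pos by simp

  have r0: "(1 - 2 * \<delta>) * lx / Hr \<ge> 0" using \<delta>' lx0 Hr by simp
  have t0_le: "t0 \<le> (1 - 2 * \<delta>) * lx / Hr" and t0_ge: "t0 \<ge> (1 - 2 * \<delta>) * lx / Hr - 1"
    using r0 unfolding t0_def by linarith+
  have t0Hr: "t0 * Hr \<le> (1 - 2 * \<delta>) * lx" "t0 * Hr \<ge> (1 - 2 * \<delta>) * lx - Hr"
    using t0_le t0_ge Hr by (simp_all add: field_simps)
  have lxHr: "lx / L \<le> lx / Hr" using Hr lx0 by (intro divide_left_mono) auto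
  have "t0 * (1 / 2) \<le> t0 * Hr" using Hr by (intro mult_left_mono) auto
  moreover have "2 * \<delta> * lx \<ge> 0" using \<delta> lx0 by simp
  ultimately have t0_2: "t0 \<le> 2 * lx" using t0Hr(1) by (simp add: algebra_simps)
  have s_ge: "3 * log 2 lx \<le> s" and s_le: "s \<le> 3 * log 2 lx + 1"
    using nat_ceiling_bounds[of "3 * log 2 lx"] ll0 unfolding s_def by auto
  have h_ge: "4 * \<delta> * log 2 x \<le> h" and h_le: "h \<le> 4 * \<delta> * log 2 x + 1"
    using nat_ceiling_bounds[of "4 * \<delta> * log 2 x"] \<delta> x1 unfolding h_def by auto
  have "(1 - 2 * \<delta>) * lx / L \<le> (1 - 2 * \<delta>) * lx / Hr"
    using mult_left_mono[OF lxHr, of "1 - 2 * \<delta>"] \<delta>' by simp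
  then have h1: "s \<le> t0" using large(1) s_le t0_ge by linarith
  have h2: "(1 / 2) ^ s \<le> wmax" unfolding wmax_def using half_power_le[OF lx0 s_ge] by simp
  have h3: "real (NW s) * \<theta> + t0 \<le> B" by (simp add: B_def)
  have B0: "B / \<theta> \<ge> 0" using pos by (simp add: B_def)
  have h5: "B \<le> \<theta> * Nx" using nat_ceiling_bounds(1)[OF B0] pos unfolding Nx_def by (simp add: field_simps)
  have NWs: "NW s \<le> A1" using NW_bound[of s 3 lx 1] s_le lx0 unfolding A1_def by (simp add: numeral_2_eq_2)
  have NW2s: "NW (2 * s) \<le> A2"
    using NW_bound[of "2 * s" 6 lx 2] s_le lx0 unfolding A2_def by (simp add: numeral_3_eq_3)
  have NWh: "NW (h + 1) \<le> A3"
    using NW_bound[of "h + 1" "4 * \<delta>" x 2] h_le x0 unfolding A3_def by (simp add: numeral_3_eq_3)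
  have "B / \<theta> = NW s + t0 * x powr (1 - \<delta>)"
    using pos x0 unfolding B_def \<theta>_def by (simp add: powr_minus field_simps powr_diff)
  also have "\<dots> \<le> A1 + 2 * lx * x powr (1 - \<delta>)" using NWs t0_2 by (intro add_mono mult_right_mono) auto
  finally have Nx_y: "real Nx + 1 \<le> y"
    using nat_ceiling_bounds(2)[OF B0] large(5) unfolding Nx_def by linarith
  have y_x: "y \<le> x" using powr_mono[of "1 - 3/4 * \<delta>" 1 x] x1 \<delta> unfolding y_def by simp
  have h6: "Nx \<le> n" using Nx_y y_x unfolding x_def by linarith
  have h9: "2 * \<kappa> * ((real t0 + 1) * L) * L \<le> 1"
    by (rule order_trans[OF _ large(2)]) (use t0_2 L_pos pos in \<open>intro mult_right_mono mult_left_mono; simp\<close>)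
  have h12: "Nx + \<kappa> * L\<^sup>2 * n + 2 * sqrt ((real Nx + 1) * (\<beta> * n)) \<le> \<mu>1 * n"
    using n0 by (simp add: \<mu>1_def)
  have \<mu>10: "\<mu>1 \<ge> 0" using pos \<beta>_nonneg unfolding \<mu>1_def by simp
  have h13: "\<mu>1 + 16 * l * wmax \<le> \<mu>" by (simp add: \<mu>_def)
  have h14: "\<mu> \<ge> 0" using pos \<mu>10 unfolding \<mu>_def by simp
  have h18: "dv \<le> - ln \<theta> - t0 * Hr"
    using t0Hr(1) x0 mult_pos_pos[OF \<delta>(1) lx0] unfolding dv_def \<theta>_def by (simp add: ln_powr lx_def[symmetric] algebra_simps)
  have h19: "- ln wU - t0 * Hr \<le> - dv"
    using t0Hr(2) x0 Hr(2) large(10) unfolding dv_def wU_def by (simp add: ln_powr lx_def[symmetric] algebra_simps)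
  have xb: "x powr (1 - \<delta> / 8) \<ge> 1" using x1 \<delta>' by (intro ge_one_powr_ge_zero) auto
  have b_ge: "x powr (1 - \<delta> / 8) \<le> b" and b_le: "b \<le> 2 * x powr (1 - \<delta> / 8)"
    using nat_ceiling_bounds[of "x powr (1 - \<delta> / 8)"] xb unfolding b_def by linarith+
  have h20: "1 \<le> b" using b_ge xb by linarith
  have "x powr (1 - \<delta> / 8) \<le> x powr 1" using x1 \<delta> by (intro powr_mono) auto
  then have h21: "b \<le> n" unfolding b_def x_def by (simp add: ceiling_le_iff nat_le_iff)
  have inv_b: "1 / b \<le> x powr (- 1 + \<delta> / 8)"
  proof -
    have "1 / b \<le> 1 / x powr (1 - \<delta> / 8)" using b_ge xb by (intro divide_left_mono mult_pos_pos; linarith)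
    also have "\<dots> = x powr (- 1 + \<delta> / 8)" using powr_minus_divide[of x "1 - \<delta> / 8"] by simp
    finally show ?thesis .
  qed
  have h22: "1 / b \<le> wU"
    by (rule order_trans[OF inv_b]) (use x1 \<delta> in \<open>auto simp: wU_def intro!: powr_mono\<close>)
  have h23: "Nx / b \<le> \<omega>"
  proof -
    have "Nx * (1 / b) \<le> y * x powr (- 1 + \<delta> / 8)" using Nx_y inv_b pos by (intro mult_mono) auto
    also have "\<dots> = x powr (- (5/8) * \<delta>)" unfolding y_def by (simp add: powr_add[symmetric])
    also have "\<dots> \<le> \<omega>" unfolding \<omega>_def using x1 \<delta> by (intro powr_mono) auto
    finally show ?thesis by simp
  qed
  have h25: "real (card tails) \<le> N" using card_tails_le unfolding N_def x_def by (metis of_nat_le_iff of_nat_mult)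
  have h27: "4 * wU \<le> v4\<^sup>2" using pos by (simp add: v4_def power_mult_distrib)
  have \<xi>'_le: "\<xi>' \<le> \<xi> + \<xi>" unfolding \<xi>'_def \<xi>_def using half_power_le[OF x0 h_ge] by simp
  have v1sq: "0 \<le> real n * (4 * wU * (2 * (\<xi>' + v4 + \<epsilon>)))" using pos n0 unfolding \<xi>'_def by simp
  have h29: "real n * (4 * wU * (2 * (\<xi> + (1 / 2) ^ h + v4 + \<epsilon>))) \<le> v1\<^sup>2" "v1 \<ge> 0"
    using v1sq unfolding v1_def \<xi>'_def by simp_all
  have hlx: "real h + 1 \<le> lx"
  proof -
    have "log 2 x = lx / ln 2" by (simp add: lx_def log_def)
    also have "\<dots> \<le> lx / (1 / 2)" using ln2_ge_two_thirds lx0 by (intro divide_left_mono) auto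
    finally have "4 * \<delta> * log 2 x \<le> 4 * \<delta> * (2 * lx)" using \<delta> by (intro mult_left_mono) auto
    also have "\<dots> \<le> lx / 2" using mult_right_mono[OF \<delta>', of "lx"] lx0 \<delta> by (simp add: field_simps)
    finally show ?thesis using h_le large(6) by linarith
  qed
  have h34: "2 * (h + 1) \<le> n" 
  proof -
    have "real (2 * (h + 1)) \<le> real n" using hlx large(7) unfolding x_def by simp
    then show ?thesis by (simp only: of_nat_le_iff)
  qed
  have h35: "real (NW (h + 1)) * \<Delta> \<le> p * n" "p \<ge> 0" using n0 \<Delta>0 by (simp_all add: p_def)
  have h37: "NW (h + 1) \<le> n" using NWh large(8) unfolding x_def by linarith
  have h38: "real (2 * NW (2 * s) + 1) * \<Delta> \<le> p' * n" "p' \<ge> 0" using n0 \<Delta>0 by (simp_all add: p'_def)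
  have h40: "2 * NW (2 * s) + 2 \<le> n" using NW2s large(9) unfolding x_def by linarith
  have \<omega>2: "\<omega> \<le> 1 / 2" "\<omega> \<le> e" using large(11) by auto
  note main = cutoff_prob[OF h1 h2 h3 pos(1) h5 h6 less_imp_le[OF pos(5)] pos(4) h9 large(3) large(4) h12
      h13 h14 pos(6,2) less_imp_le[OF e] h18 h19 h20 h21 h22 h23 \<omega>2(1) h25 pos(7) h27
      less_imp_le[OF pos(11)] h29 pos(8,9,10) h34 h35 h37 h38 h40, folded \<alpha>_def hit_def, folded err_def]

  have \<alpha>_le: "\<alpha> \<le> 2 * e"
  proof -
    have "lx powr (-3/2) * lx powr 2 = lx powr (1/2)" using powr_add[of lx "-3/2" 2] by simp
    then have "\<kappa> * dv\<^sup>2 = \<delta>\<^sup>2 * lx powr (1/2) / 4"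
      using lx0 by (simp add: \<kappa>_def dv_def power_mult_distrib power_divide algebra_simps powr_numeral)
    then have "\<kappa> * dv\<^sup>2 \<ge> 1" using large(12) by simp
    then have "e / (\<kappa> * dv\<^sup>2) \<le> e / 1" using e by (intro divide_left_mono) auto
    then show ?thesis by (simp add: \<alpha>_def)
  qed
  have Nx\<gamma>: "(real Nx + 1) * \<gamma> \<le> x powr (- \<delta> / 2)"
  proof -
    have "(real Nx + 1) * \<gamma> \<le> y * \<gamma>" using Nx_y pos by (intro mult_right_mono) auto
    also have "\<dots> = x powr (- \<delta> / 2)" unfolding y_def \<gamma>_def by (simp add: powr_add[symmetric])
    finally show ?thesis .
  qed
  have hit_le: "hit \<le> e"
    by (rule order_trans[OF _ large(13)[unfolded \<omega>_def]])
      (use hlx Nx\<gamma> pos in \<open>auto simp: hit_def \<omega>_def intro!: mult_mono add_mono\<close>)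
  have v4_le: "v4 \<le> e" using large(14) by (simp add: v4_def)
  have v1_le: "v1 \<le> e"
  proof -
    have "v1 \<le> sqrt (x * (4 * wU * (2 * (\<xi> + \<xi> + 2 * sqrt wU + \<epsilon>))))"
      using \<xi>'_le pos n0 unfolding v1_def v4_def x_def by (intro real_sqrt_le_mono mult_left_mono add_mono) auto
    then show ?thesis using large(16) by linarith
  qed
  \<comment> \<open>Each term is at most \<open>e\<close>, except \<open>\<alpha>\<close> with
    \<open>2 * e\<close>; the two halves of \<open>err\<close> give 10 each. Then 25 = 2 + 20 + 2 +
    1 in \<open>low\<close> and 42 = 2 * (20 + 1) in \<open>up\<close>.\<close>
  have err_le: "err \<le> 20 * e"
    using \<alpha>_le hit_le v4_le v1_le large(15) \<omega>2(2) unfolding err_def by (simp add: algebra_simps)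
  have halfs: "(1 / 2) ^ s \<le> e" using h2 large(17) by linarith
  have sq_le: "sqrt (real (NW s * (Nx + 1)) * \<gamma>) \<le> e"
  proof -
    have "real (NW s * (Nx + 1)) * \<gamma> = real (NW s) * ((real Nx + 1) * \<gamma>)" by (simp add: algebra_simps)
    also have "\<dots> \<le> A1 * (y * \<gamma>)" using NWs Nx_y pos by (intro mult_mono) auto
    finally show ?thesis using large(18) real_sqrt_le_mono by (meson order_trans)
  qed
  have low: "\<alpha> + err + 2 * (1 / 2) ^ s + sqrt (real (NW s * (Nx + 1)) * \<gamma>) \<le> 25 * e"
    using \<alpha>_le err_le halfs sq_le by linarith
  have up: "2 * (err + (1 / 2) ^ s) \<le> 42 * e" using err_le halfs by (simp add: algebra_simps)

  have Db: "D {1..b} \<le> sqrt (b * (\<beta> * x))" using D_le_sqrt[of "{1..b}"] h21 by (simp add: x_def)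
  have Db1: "D {1..b} \<le> sqrt (2 * \<beta>) * x powr (1 - \<delta> / 16)"
  proof -
    have "b * (\<beta> * x) \<le> 2 * x powr (1 - \<delta> / 8) * (\<beta> * x)"
      using b_le \<beta>_nonneg x0 by (intro mult_right_mono) auto
    also have "\<dots> = 2 * \<beta> * (x powr (1 - \<delta> / 8) * x powr 1)" using x0 by simp
    also have "\<dots> = 2 * \<beta> * (x powr (1 - \<delta> / 16))\<^sup>2"
      using x0 by (simp only: powr_add[symmetric] power2_eq_square) simp
    finally have "sqrt (b * (\<beta> * x)) \<le> sqrt (2 * \<beta> * (x powr (1 - \<delta> / 16))\<^sup>2)" by simp
    then show ?thesis using Db by (simp add: real_sqrt_mult)
  qed
  have Db2: "D {1..b} / b \<le> sqrt (\<beta> * x powr (\<delta> / 8))"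
  proof -
    have "D {1..b} / b \<le> sqrt (b * (\<beta> * x)) / b" using Db by (intro divide_right_mono) auto
    also have "\<dots> = sqrt (\<beta> * x * (1 / b))" using h20
      by (simp add: real_sqrt_mult real_sqrt_divide field_simps) (simp flip: real_sqrt_mult)?
    also have "\<dots> \<le> sqrt (\<beta> * x * x powr (- 1 + \<delta> / 8))"
      using inv_b \<beta>_nonneg x0 by (intro real_sqrt_le_mono mult_left_mono) auto
    also have "\<beta> * x * x powr (- 1 + \<delta> / 8) = \<beta> * (x powr 1 * x powr (- 1 + \<delta> / 8))" using x0 by simp
    also have "\<dots> = \<beta> * x powr (\<delta> / 8)" by (simp only: powr_add[symmetric]) simp
    finally show ?thesis .
  qed
  have D0: "D {1..b} \<ge> 0" by (rule D_nonneg)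
  \<comment> \<open>\<open>T1\<close> to \<open>T6\<close> are the six failure terms of
    \<open>cutoff_prob\<close>: returns of the reference walk, its l2 norm, its starting balls,
    twins, concentration and supermartingale. Together they give \<open>6 * e\<close>.\<close>
  have T1: "h * (h * (D {1..b} + h * \<beta>) / n / \<tau>) \<le> e"
    by (rule order_trans[OF _ large(19)])
      (use hlx Db1 D0 \<beta>_nonneg pos n0 lx0 in \<open>auto simp: x_def[symmetric] intro!: mult_mono divide_right_mono add_mono mult_nonneg_nonneg divide_nonneg_nonneg add_nonneg_nonneg\<close>)
  have T2: "(real h + 1) * ((1 / b + 2 * (real h + 1) * (2 * D {1..b} / b + 2 * (real h + 1) * \<beta>) / n) / \<gamma>) \<le> e"
  proof -
    have "2 * D {1..b} / b + 2 * (real h + 1) * \<beta> \<le> 2 * sqrt (\<beta> * x powr (\<delta> / 8)) + 2 * (lx + 1) * \<beta>"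
      using Db2 hlx \<beta>_nonneg by (intro add_mono mult_right_mono) auto
    then have "2 * (real h + 1) * (2 * D {1..b} / b + 2 * (real h + 1) * \<beta>) / n
        \<le> 2 * (lx + 1) * (2 * sqrt (\<beta> * x powr (\<delta> / 8)) + 2 * (lx + 1) * \<beta>) / x"
      unfolding x_def using hlx D0 \<beta>_nonneg by (intro divide_right_mono mult_mono) auto
    then have "(1 / b + 2 * (real h + 1) * (2 * D {1..b} / b + 2 * (real h + 1) * \<beta>) / n) / \<gamma>
        \<le> (x powr (- 1 + \<delta> / 8) + 2 * (lx + 1) * (2 * sqrt (\<beta> * x powr (\<delta> / 8)) + 2 * (lx + 1) * \<beta>) / x) / \<gamma>"
      using inv_b pos by (intro divide_right_mono add_mono) auto
    then show ?thesis
      by (intro order_trans[OF _ large(20)] mult_mono) (use hlx D0 \<beta>_nonneg pos lx0 in auto)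
  qed
  have Ca: "C * x powr a \<ge> 0" using \<Delta> \<Delta>0 x_def by simp
  have T3: "NW (h + 1) * p / \<xi> \<le> e"
  proof -
    have "real (NW (h + 1)) * \<Delta> \<le> A3 * (C * x powr a)" using NWh \<Delta> \<Delta>0 unfolding x_def by (intro mult_mono) auto
    then have "p \<le> A3 * (C * x powr a) / x" unfolding p_def x_def by (intro divide_right_mono) auto
    then have "NW (h + 1) * p / \<xi> \<le> A3 * (A3 * (C * x powr a) / x) / \<xi>"
      using NWh h35 pos by (intro divide_right_mono mult_mono) auto
    then show ?thesis using large(21) by linarith
  qed
  have T4: "real (n * (K * K)) * ((NW (2 * s) + 1) * p')\<^sup>2 \<le> e"
  proof -
    have "real (2 * NW (2 * s) + 1) * \<Delta> \<le> (2 * A2 + 1) * (C * x powr a)"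
      using NW2s \<Delta> \<Delta>0 unfolding x_def by (intro mult_mono) auto
    then have "p' \<le> (2 * A2 + 1) * (C * x powr a) / x" unfolding p'_def x_def by (intro divide_right_mono) auto
    then have "((NW (2 * s) + 1) * p')\<^sup>2 \<le> ((A2 + 1) * ((2 * A2 + 1) * (C * x powr a) / x))\<^sup>2"
      using NW2s h38 by (intro power_mono mult_mono) auto
    then have "x * (real K)\<^sup>2 * ((NW (2 * s) + 1) * p')\<^sup>2 \<le> x * (real K)\<^sup>2 * ((A2 + 1) * ((2 * A2 + 1) * (C * x powr a) / x))\<^sup>2"
      using x0 by (intro mult_left_mono) auto
    then show ?thesis using large(22) by (simp add: x_def power2_eq_square[of "real K"])
  qed
  have T5: "n * (2 * exp (- \<epsilon>\<^sup>2 / (64 * wU\<^sup>2 * N))) \<le> e"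
    using large(23) unfolding N_def x_def[symmetric] by simp
  have T6: "n * exp (l * (\<kappa> * ((real s + 1) * L)\<^sup>2 + \<mu> * t0 - e)) \<le> e"
  proof -
    have "\<mu>1 \<le> (y + \<kappa> * L\<^sup>2 * x + 2 * sqrt (y * (\<beta> * x))) / x"
      using Nx_y \<beta>_nonneg n0 unfolding \<mu>1_def x_def[symmetric]
      by (intro divide_right_mono add_mono mult_left_mono real_sqrt_le_mono mult_right_mono) (use pos x0 in auto)
    then have "\<mu> * t0 \<le> ((y + \<kappa> * L\<^sup>2 * x + 2 * sqrt (y * (\<beta> * x))) / x + 16 * l * wmax) * (2 * lx)"
      using t0_2 h14 unfolding \<mu>_def by (intro mult_mono) (use \<mu>10 pos in auto)
    moreover have "\<kappa> * ((real s + 1) * L)\<^sup>2 \<le> \<kappa> * ((3 * log 2 lx + 2) * L)\<^sup>2"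
      using s_le pos L_pos by (intro mult_left_mono power_mono mult_right_mono) auto
    ultimately have "\<kappa> * ((real s + 1) * L)\<^sup>2 + \<mu> * t0 - e \<le> - (e / 2)" using large(24) by linarith
    then have "l * (\<kappa> * ((real s + 1) * L)\<^sup>2 + \<mu> * t0 - e) \<le> l * (- (e / 2))" using pos by (intro mult_left_mono) auto
    then have "n * exp (l * (\<kappa> * ((real s + 1) * L)\<^sup>2 + \<mu> * t0 - e)) \<le> x * exp (- (l * (e / 2)))"
      unfolding x_def by (intro mult_left_mono) auto
    then show ?thesis using large(25) by linarith
  qed
  have fin: "cexp no_edges (\<lambda>\<sigma>. of_bool (\<not> cut (s + t0) (s + (t0 + Suc h)) (25 * e) (42 * e) \<sigma>)) \<le> 6 * e"
  proof -
    have "cexp no_edges (\<lambda>\<sigma>. of_bool (\<not> cut (s + t0) (s + (t0 + Suc h)) (25 * e) (42 * e) \<sigma>))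
      \<le> cexp no_edges (\<lambda>\<sigma>. of_bool (\<not> cut (s + t0) (s + (t0 + Suc h))
        (\<alpha> + err + 2 * (1 / 2) ^ s + sqrt (real (NW s * (Nx + 1)) * \<gamma>)) (2 * (err + (1 / 2) ^ s)) \<sigma>))"
      by (intro cexp_mono) (use cut_weaken[OF _ low up] in auto)
    moreover note main
    ultimately show ?thesis using T1 T2 T3 T4 T5 T6 by (simp add: distrib_left)
  qed
  define R where "R = lx / Hr"
  have R0: "\<delta> * R \<ge> 0" using \<delta> lx0 Hr by (simp add: R_def)
  have t0R: "t0 \<le> R - 2 * (\<delta> * R)" "R - 2 * (\<delta> * R) - 1 \<le> t0"
    using t0_le t0_ge unfolding R_def by (simp_all add: algebra_simps diff_divide_distrib)
  have lower: "(1 - \<gamma>0) * R \<le> real (s + t0)"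
  proof -
    have "1 \<le> \<delta> * R" using large(26) mult_left_mono[OF lxHr, of \<delta>] \<delta> by (simp add: R_def)
    moreover have "3 * (\<delta> * R) \<le> \<gamma>0 * R"
      using mult_right_mono[of "3 * \<delta>" \<gamma>0 R] \<delta> lx0 Hr by (simp add: R_def mult.assoc)
    ultimately have "R - \<gamma>0 * R \<le> real s + real t0" using t0R by linarith
    then show ?thesis by (simp add: left_diff_distrib)
  qed
  have upper: "real (s + (t0 + Suc h)) \<le> (1 + \<gamma>0) * R"
  proof -
    have "4 * \<delta> / ln 2 \<le> \<gamma>0 / 2 / L" using \<delta>(4) L_pos by (simp add: field_simps)
    from mult_right_mono[OF this, of lx] have "4 * \<delta> * log 2 x \<le> \<gamma>0 * (lx / L) / 2"
      using lx0 by (simp add: log_def lx_def)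
    moreover have "\<gamma>0 * (lx / L) \<le> \<gamma>0 * R" unfolding R_def using lxHr \<delta> by (intro mult_left_mono) auto
    moreover have "3 * log 2 lx + 3 \<le> \<gamma>0 * (lx / L) / 2" using large(27) by simp
    ultimately have "real s + (real t0 + 1 + real h) \<le> R + \<gamma>0 * R" using s_le h_le t0R R0 by linarith
    then show ?thesis by (simp add: distrib_right)
  qed
  from lower upper fin show ?thesis unfolding R_def lx_def x_def by blast
qed

end

section \<open>Cutoff\<close>

text \<open>A statement about a single graph from which both assertions of the theorem are read off;
  \<open>verts G\<close> is recorded because the mixing time takes its maximum there.\<close>

definition sharp_cutoff ::
  "nat \<Rightarrow> (nat, nat \<times> nat) pre_digraph \<Rightarrow> (nat \<Rightarrow> real) \<Rightarrow> real \<Rightarrow> real \<Rightarrow> real \<Rightarrow> bool" where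
  "sharp_cutoff n G \<mu> T \<gamma> \<epsilon> \<longleftrightarrow> verts G = {1..n} \<and>
     (\<forall>x\<in>{1..n}. \<forall>t. tv_dist {1..n} (srw_pow G t x) \<mu> \<le> 1 \<and>
        (real t \<le> (1 - \<gamma>) * T \<longrightarrow> 1 - \<epsilon> \<le> tv_dist {1..n} (srw_pow G t x) \<mu>) \<and>
        ((1 + \<gamma>) * T \<le> real t \<longrightarrow> tv_dist {1..n} (srw_pow G t x) \<mu> \<le> \<epsilon>))"

lemma (in dcm) sharp_cutoff_prob:
  fixes \<delta> \<epsilon> \<gamma> a C :: real
  assumes stat: "\<And>G. G \<in> set_pmf (config_model n din dout) \<Longrightarrow> stationary G (\<mu> G)"
    and large: "large_enough K \<beta> C (log 2 K) L \<delta> (\<epsilon> / 42) \<gamma> a n"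
    and \<Delta>: "\<Delta> \<le> C * real n powr a" and \<delta>: "0 < \<delta>" "96 * \<delta> * log 2 K \<le> 1" "3 * \<delta> \<le> \<gamma>" "8 * \<delta> * L \<le> \<gamma> * ln 2"
    and \<epsilon>: "\<epsilon> > 0"
  shows "measure_pmf.prob (config_model n din dout)
      {G. \<not> sharp_cutoff n G (\<mu> G) (entropic_time n din dout) \<gamma> \<epsilon>} \<le> \<epsilon>"
proof -
  let ?T = "entropic_time n din dout"
  have T: "?T = ln n / Hr" by (simp add: entropic_time_def Hr_def)
  obtain t t' where tt: "(1 - \<gamma>) * ?T \<le> real t" "real t' \<le> (1 + \<gamma>) * ?T"
    and c: "cexp no_edges (\<lambda>\<sigma>. of_bool (\<not> cut t t' (25 * (\<epsilon> / 42)) (42 * (\<epsilon> / 42)) \<sigma>)) \<le> 6 * (\<epsilon> / 42)"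
    using cutoff_window[OF large \<Delta> \<delta>] \<epsilon> unfolding T by auto
  have sharp: "sharp_cutoff n (graph \<sigma>) (\<mu> (graph \<sigma>)) ?T \<gamma> \<epsilon>"
    if \<sigma>: "\<sigma> \<in> M" and cut: "cut t t' (25 * (\<epsilon> / 42)) (42 * (\<epsilon> / 42)) \<sigma>" for \<sigma>
  proof -
    have st: "stationary (graph \<sigma>) (\<mu> (graph \<sigma>))" using stat \<sigma> unfolding config_model_support by blast
    have lo: "dist_to \<sigma> t x (\<mu> (graph \<sigma>)) \<ge> 1 - \<epsilon>" and hi: "dist_to \<sigma> t' x (\<mu> (graph \<sigma>)) \<le> \<epsilon>" if "x \<in> V" for x
      using cut st that \<epsilon> unfolding cut_def by force+
    have mono: "dist_to \<sigma> j x (\<mu> (graph \<sigma>)) \<le> dist_to \<sigma> i x (\<mu> (graph \<sigma>))" if "x \<in> V" "real i \<le> real j" for x i j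
      using dist_to_antimono[OF \<sigma> that(1) st] that(2) by simp
    have "1 - \<epsilon> \<le> dist_to \<sigma> i x (\<mu> (graph \<sigma>))" if "x \<in> V" "real i \<le> (1 - \<gamma>) * ?T" for x i
      using mono[OF that(1), of i t] lo[OF that(1)] that(2) tt(1) by linarith
    moreover have "dist_to \<sigma> i x (\<mu> (graph \<sigma>)) \<le> \<epsilon>" if "x \<in> V" "(1 + \<gamma>) * ?T \<le> real i" for x i
      using mono[OF that(1), of t' i] hi[OF that(1)] that(2) tt(2) by linarith
    ultimately show ?thesis
      using dist_to_le_1[OF \<sigma> _ st] unfolding sharp_cutoff_def dist_to_def verts_graph by blast
  qed
  have "measure_pmf.prob (config_model n din dout) {G. \<not> sharp_cutoff n G (\<mu> G) ?T \<gamma> \<epsilon>}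
      = cexp no_edges (\<lambda>\<sigma>. of_bool (\<not> sharp_cutoff n (graph \<sigma>) (\<mu> (graph \<sigma>)) ?T \<gamma> \<epsilon>))"
    by (rule prob_config_model)
  also have "\<dots> \<le> cexp no_edges (\<lambda>\<sigma>. of_bool (\<not> cut t t' (25 * (\<epsilon> / 42)) (42 * (\<epsilon> / 42)) \<sigma>))"
    by (intro cexp_mono) (use sharp in auto)
  also have "\<dots> \<le> \<epsilon>" using c \<epsilon> by linarith
  finally show ?thesis .
qed

section \<open>Passage to the limit\<close>

lemma tendsto_in_probI:
  assumes "\<And>\<delta> \<epsilon>. \<delta> > 0 \<Longrightarrow> \<epsilon> > 0 \<Longrightarrow>
    eventually (\<lambda>n. measure_pmf.prob (p n) {\<omega>. \<bar>X n \<omega> - ereal c\<bar> > ereal \<delta>} \<le> \<epsilon>) sequentially"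
  shows "tendsto_in_prob p X c"
  unfolding tendsto_in_prob_def
proof (intro allI impI tendstoI)
  fix \<delta> \<epsilon> :: real assume "\<delta> > 0" "\<epsilon> > 0"
  then have "eventually (\<lambda>n. measure_pmf.prob (p n) {\<omega>. \<bar>X n \<omega> - ereal c\<bar> > ereal \<delta>} \<le> \<epsilon> / 2) sequentially"
    by (intro assms) auto
  then show "eventually (\<lambda>n. dist (measure_pmf.prob (p n) {\<omega>. \<bar>X n \<omega> - ereal c\<bar> > ereal \<delta>}) 0 < \<epsilon>) sequentially"
    using \<open>\<epsilon> > 0\<close> by (auto elim!: eventually_mono)
qed

text \<open>Rounding the upper time up costs 1. Up to time \<open>(1 - \<gamma>) * T\<close> the
  distance is at least \<open>1 - \<epsilon>'\<close>, which exceeds \<open>\<epsilon>\<close>, so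
  none of these times qualifies. The infimum is attained because the set is nonempty.\<close>

lemma mixing_time_bounds:
  assumes sharp: "sharp_cutoff n G \<mu> T \<gamma> \<epsilon>'" and n: "n \<ge> 1" and \<epsilon>': "\<epsilon>' < \<epsilon>" "\<epsilon>' < 1 - \<epsilon>" and T: "(1 + \<gamma>) * T \<ge> 0"
  obtains N where "mixing_time G \<mu> \<epsilon> = enat N" "(1 - \<gamma>) * T \<le> N" "N \<le> (1 + \<gamma>) * T + 1"
proof -
  let ?S = "{t. Max ((\<lambda>v. tv_dist (verts G) (srw_pow G t v) \<mu>) ` verts G) < \<epsilon>}"
  have S: "t \<in> ?S \<longleftrightarrow> (\<forall>v\<in>{1..n}. tv_dist {1..n} (srw_pow G t v) \<mu> < \<epsilon>)" for t
    using sharp n by (simp add: sharp_cutoff_def)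
  define t' where "t' = nat \<lceil>(1 + \<gamma>) * T\<rceil>"
  have t': "(1 + \<gamma>) * T \<le> t'" "t' \<le> (1 + \<gamma>) * T + 1" using nat_ceiling_bounds[OF T] unfolding t'_def by auto
  have "t' \<in> ?S" unfolding S using sharp t'(1) \<epsilon>' by (force simp: sharp_cutoff_def)
  then have "Inf (enat ` ?S) \<in> enat ` ?S" "Inf (enat ` ?S) \<le> enat t'"
    by (auto intro: wellorder_InfI Inf_lower)
  then obtain N where N: "N \<in> ?S" "mixing_time G \<mu> \<epsilon> = enat N" "N \<le> t'"
    unfolding mixing_time_def by auto
  have "\<not> real N \<le> (1 - \<gamma>) * T"
  proof
    assume "real N \<le> (1 - \<gamma>) * T"
    then have "1 - \<epsilon>' \<le> tv_dist {1..n} (srw_pow G N 1) \<mu>" using sharp n by (auto simp: sharp_cutoff_def)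
    moreover have "tv_dist {1..n} (srw_pow G N 1) \<mu> < \<epsilon>" using N(1) n unfolding S by auto
    ultimately show False using \<epsilon>' by linarith
  qed
  then show ?thesis using that N t'(2) by force
qed

theorem theorem1p1:
  fixes din dout :: "nat \<Rightarrow> nat \<Rightarrow> nat"
    and \<eta> C K :: real
    and \<pi> :: "nat \<Rightarrow> (nat, nat \<times> nat) pre_digraph \<Rightarrow> nat \<Rightarrow> real"
  assumes "\<eta> > 0" and "C > 0" and "K \<ge> 2"
    and "\<And>n. n \<ge> 1 \<Longrightarrow> (\<Sum>v=1..n. dout n v) = (\<Sum>v=1..n. din n v)"
    and "\<And>n v. n \<ge> 1 \<Longrightarrow> v \<in> {1..n} \<Longrightarrow> 2 \<le> dout n v"
    and "\<And>n v. n \<ge> 1 \<Longrightarrow> v \<in> {1..n} \<Longrightarrow> real (dout n v) \<le> K"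
    and "\<And>n. n \<ge> 1 \<Longrightarrow> (\<Sum>v=1..n. real (din n v) powr (2 + \<eta>)) \<le> C * real n"
    and "\<And>n G. n \<ge> 1 \<Longrightarrow> G \<in> set_pmf (config_model n (din n) (dout n)) \<Longrightarrow> stationary G (\<pi> n G)"
  shows "(\<forall>\<rho>::real. \<rho> \<ge> 0 \<longrightarrow> \<rho> \<noteq> 1 \<longrightarrow>
            tendsto_in_prob (\<lambda>n. config_model n (din n) (dout n))
              (\<lambda>n G. ereal (Max ((\<lambda>x.
                 \<bar>tv_dist {1..n} (srw_pow G (nat \<lfloor>\<rho> * entropic_time n (din n) (dout n)\<rfloor>) x) (\<pi> n G)
                    - of_bool (\<rho> < 1)\<bar>) ` {1..n})))
              0)
       \<and> (\<forall>\<epsilon>::real. 0 < \<epsilon> \<longrightarrow> \<epsilon> < 1 \<longrightarrow>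
            tendsto_in_prob (\<lambda>n. config_model n (din n) (dout n))
              (\<lambda>n G. ereal_of_enat (mixing_time G (\<pi> n G) \<epsilon>)
                        / ereal (entropic_time n (din n) (dout n)))
              1)"
proof -
  define k where "k = nat \<lfloor>K\<rfloor>"
  \<comment> \<open>A single term of the moment sum gives
    \<open>d powr (2 + \<eta>) \<le> C * n\<close>, that is
    \<open>d \<le> (C * n) powr a\<close>.\<close>
  define a where "a = 1 / (2 + \<eta>)"
  define C' where "C' = C powr a"
  let ?cm = "\<lambda>n. config_model n (din n) (dout n)"
  let ?T = "\<lambda>n. entropic_time n (din n) (dout n)"
  have k2: "k \<ge> 2" using assms(3) unfolding k_def by linarith
  have a: "0 < a" "2 * a < 1" using assms(1) by (simp_all add: a_def field_simps)
  have C': "C' > 0" using assms(2) by (simp add: C'_def)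
  have dcm: "dcm n k (din n) (dout n) (1 + C) (C' * n powr a)" if n: "n \<ge> 1" for n
  proof
    show "n \<ge> 1" by fact
    show "(\<Sum>v=1..n. dout n v) = (\<Sum>v=1..n. din n v)" using assms(4) n .
    fix v assume v: "v \<in> {1..n}"
    show "2 \<le> dout n v" using assms(5) n v .
    show "dout n v \<le> k" using assms(6)[OF n v] unfolding k_def by linarith
    have "real (din n v) powr (2 + \<eta>) \<le> (\<Sum>v=1..n. real (din n v) powr (2 + \<eta>))"
      using v by (intro member_le_sum) auto
    also have "\<dots> \<le> C * n" using assms(7) n .
    finally have "(real (din n v) powr (2 + \<eta>)) powr a \<le> (C * n) powr a"
      using a by (intro powr_mono2) auto
    then show "real (din n v) \<le> C' * n powr a"
      using assms(1,2) unfolding C'_def by (simp add: powr_powr powr_mult a_def)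
  next
    have "(real d)\<^sup>2 \<le> 1 + real d powr (2 + \<eta>)" for d :: nat
    proof (cases "d = 0")
      case False
      then have "real d powr 2 \<le> real d powr (2 + \<eta>)" using assms(1) by (intro powr_mono) auto
      then show ?thesis using False by simp
    qed auto
    then have "(\<Sum>v=1..n. (real (din n v))\<^sup>2) \<le> (\<Sum>v=1..n. 1 + real (din n v) powr (2 + \<eta>))"
      by (intro sum_mono)
    then show "(\<Sum>v=1..n. (real (din n v))\<^sup>2) \<le> (1 + C) * n"
      using assms(7)[OF n] by (simp add: sum.distrib algebra_simps)
  qed
  \<comment> \<open>As \<open>Hr \<le> L\<close>, the entropic time tends to infinity; the rounding
    of times is then absorbed by any fixed relative margin.\<close>
  have T_large: "eventually (\<lambda>n. ?T n \<ge> c) sequentially" for c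
  proof -
    have "filterlim (\<lambda>n. ln (real n) / ln (real k)) at_top sequentially"
      using k2 by real_asymp
    then have "eventually (\<lambda>n. ln (real n) / ln (real k) \<ge> c) sequentially" by (simp add: filterlim_at_top)
    then show ?thesis using eventually_ge_at_top[of 1]
    proof eventually_elim
      case (elim n)
      interpret dcm n k "din n" "dout n" "1 + C" "C' * n powr a" using dcm elim by blast
      have "ln n / L \<le> ln n / Hr"
        using Hr_bounds ln2_ge_two_thirds elim by (intro divide_left_mono) (auto intro!: mult_pos_pos)
      then show ?case using elim by (simp add: entropic_time_def Hr_def)
    qed
  qed
  have whp: "eventually (\<lambda>n. measure_pmf.prob (?cm n) {G. \<not> sharp_cutoff n G (\<pi> n G) (?T n) \<gamma> \<epsilon>} \<le> \<epsilon>) sequentially"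
    if \<gamma>: "\<gamma> > 0" and \<epsilon>: "\<epsilon> > 0" for \<gamma> \<epsilon>
  proof -
    let ?q = "log 2 (real k)" and ?L = "ln (real k)"
    have qL: "?q \<ge> 1" "?L > 0" using k2 by (simp_all add: le_log_iff)
    \<comment> \<open>The three bounds serve, in turn, the asymptotic estimates, the lower edge and
      the upper edge of the window.\<close>
    define \<delta> where "\<delta> = min (1 / (96 * ?q)) (min (\<gamma> / 3) (\<gamma> * ln 2 / (8 * ?L)))"
    have \<delta>0: "\<delta> > 0" using qL \<gamma> by (simp add: \<delta>_def)
    have "\<delta> \<le> 1 / (96 * ?q)" "\<delta> \<le> \<gamma> / 3" "\<delta> \<le> \<gamma> * ln 2 / (8 * ?L)" unfolding \<delta>_def by linarith+
    then have \<delta>: "96 * \<delta> * ?q \<le> 1" "3 * \<delta> \<le> \<gamma>" "8 * \<delta> * ?L \<le> \<gamma> * ln 2" using qL by (simp_all add: field_simps)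
    have "eventually (large_enough k (1 + C) C' ?q ?L \<delta> (\<epsilon> / 42) \<gamma> a) at_top"
      using k2 assms(2) C' qL \<epsilon> \<gamma> \<delta>0 \<delta>(1) a by (intro eventually_large_enough) auto
    then have "eventually (\<lambda>n. large_enough k (1 + C) C' ?q ?L \<delta> (\<epsilon> / 42) \<gamma> a (real n)) sequentially"
      by (rule eventually_compose_filterlim[OF _ filterlim_real_sequentially])
    then show ?thesis using eventually_ge_at_top[of 1]
    proof eventually_elim
      case (elim n)
      interpret dcm n k "din n" "dout n" "1 + C" "C' * n powr a" using dcm elim by blast
      show ?case using assms(8) elim(2)
        by (intro sharp_cutoff_prob[OF _ elim(1) order.refl \<delta>0 \<delta> \<epsilon>])
    qed
  qed
  \<comment> \<open>An event that \<open>sharp_cutoff\<close> excludes once \<open>?T n\<close> is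
    large is eventually unlikely; both parts of the theorem reduce to this.\<close>
  have transfer: "eventually (\<lambda>n. measure_pmf.prob (?cm n) {G. Q n G} \<le> \<epsilon>) sequentially"
    if \<gamma>: "\<gamma> > 0" and \<epsilon>: "0 < \<epsilon>'" "\<epsilon>' \<le> \<epsilon>"
      and Q: "\<And>n G. n \<ge> 1 \<Longrightarrow> ?T n \<ge> c \<Longrightarrow> sharp_cutoff n G (\<pi> n G) (?T n) \<gamma> \<epsilon>' \<Longrightarrow> \<not> Q n G" for Q \<gamma> \<epsilon>' \<epsilon> c
    using whp[OF \<gamma> \<epsilon>(1)] T_large[of c] eventually_ge_at_top[of 1]
  proof eventually_elim
    case (elim n)
    have "measure_pmf.prob (?cm n) {G. Q n G} \<le> measure_pmf.prob (?cm n) {G. \<not> sharp_cutoff n G (\<pi> n G) (?T n) \<gamma> \<epsilon>'}"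
      by (rule measure_pmf.finite_measure_mono) (use Q elim in auto)
    then show ?case using elim \<epsilon>(2) by linarith
  qed
  show ?thesis
  proof (intro conjI allI impI tendsto_in_probI)
    fix \<rho> \<delta> \<epsilon> :: real
    assume \<rho>: "\<rho> \<ge> 0" "\<rho> \<noteq> 1" and \<delta>: "\<delta> > 0" and \<epsilon>: "\<epsilon> > 0"
    \<comment> \<open>Half of the distance from \<open>\<rho>\<close> to 1 is used as the window.
      For \<open>\<rho> > 1\<close> the other half, at least one time unit once
      \<open>?T n \<ge> 1 / \<gamma>\<close>, absorbs the floor.\<close>
    define \<gamma> where "\<gamma> = \<bar>\<rho> - 1\<bar> / 2"
    show "eventually (\<lambda>n. measure_pmf.prob (?cm n) {G. ereal \<delta> <
        \<bar>ereal (Max ((\<lambda>x. \<bar>tv_dist {1..n} (srw_pow G (nat \<lfloor>\<rho> * ?T n\<rfloor>) x) (\<pi> n G) - of_bool (\<rho> < 1)\<bar>) ` {1..n}))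
          - ereal 0\<bar>} \<le> \<epsilon>) sequentially"
    proof (rule transfer[of \<gamma> "min \<delta> \<epsilon>" \<epsilon> "1 / \<gamma>"])
      fix n G
      assume n: "n \<ge> 1" and T: "1 / \<gamma> \<le> ?T n" and sharp: "sharp_cutoff n G (\<pi> n G) (?T n) \<gamma> (min \<delta> \<epsilon>)"
      let ?t = "nat \<lfloor>\<rho> * ?T n\<rfloor>" and ?f = "\<lambda>x. tv_dist {1..n} (srw_pow G (nat \<lfloor>\<rho> * ?T n\<rfloor>) x) (\<pi> n G)"
      have \<gamma>: "\<gamma> > 0" using \<rho> by (simp add: \<gamma>_def)
      have "0 < 1 / \<gamma>" using \<gamma> by simp
      then have T0: "?T n > 0" using T by linarith
      have T1: "\<gamma> * ?T n \<ge> 1" using T \<gamma> by (simp add: field_simps)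
      have "\<rho> * ?T n \<ge> 0" using \<rho>(1) T0 by simp
      then have fl: "real ?t \<le> \<rho> * ?T n" "\<rho> * ?T n - 1 \<le> real ?t" by linarith+
      have "\<bar>?f x - of_bool (\<rho> < 1)\<bar> \<le> \<delta>" if x: "x \<in> {1..n}" for x
      proof (cases "\<rho> < 1")
        case True
        have "\<rho> * ?T n \<le> (1 - \<gamma>) * ?T n" using True T0 by (intro mult_right_mono) (auto simp: \<gamma>_def field_simps)
        then have "real ?t \<le> (1 - \<gamma>) * ?T n" using fl by linarith
        then have "1 - min \<delta> \<epsilon> \<le> ?f x" "?f x \<le> 1" using sharp x unfolding sharp_cutoff_def by blast+
        then show ?thesis using True by auto
      next
        case False
        have "(1 + \<gamma>) * ?T n = \<rho> * ?T n - \<gamma> * ?T n" using False by (simp add: \<gamma>_def field_simps)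
        then have "(1 + \<gamma>) * ?T n \<le> real ?t" using fl T1 by linarith
        then have "?f x \<le> min \<delta> \<epsilon>" using sharp x unfolding sharp_cutoff_def by blast
        moreover have "0 \<le> ?f x" by (rule tv_dist_nonneg) simp
        ultimately show ?thesis using False by auto
      qed
      then have "Max ((\<lambda>x. \<bar>?f x - of_bool (\<rho> < 1)\<bar>) ` {1..n}) \<le> \<delta>" using n by (subst Max_le_iff) auto
      moreover have "0 \<le> Max ((\<lambda>x. \<bar>?f x - of_bool (\<rho> < 1)\<bar>) ` {1..n})"
        using n by (subst Max_ge_iff) auto
      ultimately show "\<not> ereal \<delta> < \<bar>ereal (Max ((\<lambda>x. \<bar>?f x - of_bool (\<rho> < 1)\<bar>) ` {1..n})) - ereal 0\<bar>"
        by simp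
    qed (use \<rho> \<delta> \<epsilon> in \<open>auto simp: \<gamma>_def\<close>)
  next
    fix \<epsilon>0 \<delta> \<epsilon> :: real
    assume \<epsilon>0: "0 < \<epsilon>0" "\<epsilon>0 < 1" and \<delta>: "\<delta> > 0" and \<epsilon>: "\<epsilon> > 0"
    \<comment> \<open>Halving makes \<open>\<epsilon>'\<close> strictly smaller than both
      \<open>\<epsilon>0\<close> and \<open>1 - \<epsilon>0\<close>, as
      \<open>mixing_time_bounds\<close> requires.\<close>
    define \<epsilon>' where "\<epsilon>' = min \<epsilon> (min \<epsilon>0 (1 - \<epsilon>0) / 2)"
    show "eventually (\<lambda>n. measure_pmf.prob (?cm n) {G. ereal \<delta> <
        \<bar>ereal_of_enat (mixing_time G (\<pi> n G) \<epsilon>0) / ereal (?T n) - ereal 1\<bar>} \<le> \<epsilon>) sequentially"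
    proof (rule transfer[of "\<delta> / 2" \<epsilon>' \<epsilon> "2 / \<delta>"])
      fix n G
      assume n: "n \<ge> 1" and T: "2 / \<delta> \<le> ?T n" and sharp: "sharp_cutoff n G (\<pi> n G) (?T n) (\<delta> / 2) \<epsilon>'"
      have "0 < 2 / \<delta>" using \<delta> by simp
      then have T0: "?T n > 0" using T by linarith
      have T1: "\<delta> * ?T n \<ge> 2" using T \<delta> by (simp add: field_simps)
      have \<epsilon>': "\<epsilon>' < \<epsilon>0" "\<epsilon>' < 1 - \<epsilon>0" using \<epsilon>0 unfolding \<epsilon>'_def by (auto simp: min_def)
      obtain N where N: "mixing_time G (\<pi> n G) \<epsilon>0 = enat N" "(1 - \<delta> / 2) * ?T n \<le> N" "N \<le> (1 + \<delta> / 2) * ?T n + 1"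
        using mixing_time_bounds[OF sharp n \<epsilon>'] T0 \<delta> by auto
      have "(1 - \<delta>) * ?T n \<le> N" "N \<le> (1 + \<delta>) * ?T n"
        using N(2,3) T1 by (simp_all add: algebra_simps)
      then have "1 - \<delta> \<le> N / ?T n" "N / ?T n \<le> 1 + \<delta>" using T0 by (simp_all add: field_simps)
      then show "\<not> ereal \<delta> < \<bar>ereal_of_enat (mixing_time G (\<pi> n G) \<epsilon>0) / ereal (?T n) - ereal 1\<bar>"
        using T0 by (auto simp: N(1))
    qed (use \<epsilon>0 \<delta> \<epsilon> in \<open>auto simp: \<epsilon>'_def\<close>)
  qed
qed

end
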